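(* Let $\Omega$ be a bounded open interval of $\mathbb{R}$, let $R>0$, $\mu>0$, and let $u^{in}=(f^{in},g^{in})\in L_\infty(\Omega,\mathbb{R}^2)$ have non-negative components. Then there is a bounded weak solution $u=(f,g)$ to the thin film Muskat problem $$\partial_t f=\partial_x\big(f\,\partial_x[(1+R)f+Rg]\big),\qquad \partial_t g=\mu R\,\partial_x\big(g\,\partial_x(f+g)\big)\quad\text{in }(0,\infty)\times\Omega,$$ with homogeneous Neumann boundary conditions $\partial_x f=\partial_x g=0$ on $(0,\infty)\times\partial\Omega$ and initial condition $(f,g)(0)=(f^{in},g^{in})$, which satisfies: (p1) for each $T>0$, $$(f,g)\in L_{\infty,+}((0,T)\times\Omega,\mathbb{R}^2)\cap L_2((0,T),H^1(\Omega,\mathbb{R}^2))\cap W^1_2((0,T),H^1(\Omega,\mathbb{R}^2)');$$ (p2) for all $\varphi\in H^1(\Omega)$ and $t\ge0$, $$\int_\Omega(f(t,x)-f^{in}(x))\varphi(x)\,\mathrm{d}x+\int_0^t\int_\Omega f(s,x)\,\partial_x[(1+R)f+Rg](s,x)\,\partial_x\varphi(x)\,\mathrm{d}x\,\mathrm{d}s=0$$ and $$\int_\Omega(g(t,x)-g^{in}(x))\varphi(x)\,\mathrm{d}x+\mu R\int_0^t\int_\Omega g(s,x)\,\partial_x(f+g)(s,x)\,\partial_x\varphi(x)\,\mathrm{d}x\,\mathrm{d}s=0;$$ (p3) the following three properties hold: (l1) for all $t\ge0$, $$\int_\Omega\Phi_1(u(t,x))\,\mathrm{d}x+\int_0^t\int_\Omega\big[|\partial_xf|^2+R|\partial_x(f+g)|^2\big](s,x)\,\mathrm{d}x\,\mathrm{d}s\le\int_\Omega\Phi_1(u^{in}(x))\,\mathrm{d}x;$$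 (l2) for all integers $n\ge2$ and all $t\ge0$, $$\int_\Omega\Phi_n(u(t,x))\,\mathrm{d}x\le\int_\Omega\Phi_n(u^{in}(x))\,\mathrm{d}x,$$ where $\Phi_n$ is the homogeneous polynomial of degree $n$ defined in the context, whose coefficients are positive and which is convex on $[0,\infty)^2$; (l3) for all $t\ge0$, $$\|(f+g)(t)\|_\infty\le\frac{1+R}{R}\|f^{in}+g^{in}\|_\infty.$$
   Context: The subscript $+$ on a function space denotes its positive cone (functions with a.e. non-negative components); $H^1(\Omega,\mathbb{R}^2)=H^1(\Omega)\times H^1(\Omega)$ and $H^1(\Omega,\mathbb{R}^2)'$ is its dual space, in which $L_2(\Omega,\mathbb{R}^2)$ is embedded through the $L_2$ pairing; $\|\cdot\|_\infty$ is the norm of $L_\infty(\Omega)$. A function with the regularity in (p1) is identified with its time-continuous representative, so that its value at every $t\ge0$ is meaningful. "Bounded weak solution" means a pair with the regularity in (p1) and satisfying the identities in (p2). $L(r):=r\ln r-r+1$ for $r\ge0$ (with $L(0)=1$), and $\Phi_1(X):=L(X_1)+\frac1\mu L(X_2)$ for $X=(X_1,X_2)\in[0,\infty)^2$. For each integer $n\ge2$ set $\alpha_{k,n}:=R[k+\mu(n-k-1)]>0$ for $0\le k\le n-1$, $a_{0,n}:=1$, $$a_{j,n}:=\binom nj\prod_{k=0}^{j-1}\frac{k+\alpha_{k,n}}{\alpha_{k,n}},\quad1\le j\le n,\qquad\Phi_n(X):=\sum_{j=0}^na_{j,n}X_1^jX_2^{n-j},\quad X=(X_1,X_2)\in\mathbb{R}^2.$$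 *)

theory Defs
  imports "HOL-Analysis.Analysis" "HOL-Probability.Essential_Supremum"
begin

text \<open>Elements of Lebesgue, Sobolev and Bochner spaces are represented by functions rather than by
  equivalence classes, so the carriers below are closed under modification on null sets and
  the ``norms'' are seminorms whose kernel consists of the functions vanishing almost everywhere.\<close>

section \<open>Lebesgue spaces\<close>

definition Linf_norm :: "'x measure \<Rightarrow> ('x \<Rightarrow> 'a::euclidean_space) \<Rightarrow> ereal" where
  "Linf_norm M u = esssup M (\<lambda>x. ereal (norm (u x)))"

definition Linf :: "'x measure \<Rightarrow> ('x \<Rightarrow> 'a::euclidean_space) set" where
  "Linf M = {u. u \<in> borel_measurable M \<and> Linf_norm M u < \<infinity>}"

definition Linf_pos :: "'x measure \<Rightarrow> ('x \<Rightarrow> 'a::euclidean_space) set" where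
  "Linf_pos M = {u \<in> Linf M. AE x in M. \<forall>e\<in>Basis. 0 \<le> u x \<bullet> e}"

definition L2 :: "real set \<Rightarrow> (real \<Rightarrow> 'a::euclidean_space) set" where
  "L2 \<Omega> = {u. u \<in> borel_measurable (lebesgue_on \<Omega>) \<and> integrable (lebesgue_on \<Omega>) (\<lambda>x. (norm (u x))\<^sup>2)}"

definition L2_norm :: "real set \<Rightarrow> (real \<Rightarrow> 'a::euclidean_space) \<Rightarrow> real" where
  "L2_norm \<Omega> u = sqrt (LINT x|lebesgue_on \<Omega>. (norm (u x))\<^sup>2)"

section \<open>The Sobolev space of order one and its dual\<close>

definition test_function :: "real set \<Rightarrow> (real \<Rightarrow> real) \<Rightarrow> bool" where
  "test_function \<Omega> \<theta> \<longleftrightarrow>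
     (\<forall>n x. (deriv ^^ n) \<theta> field_differentiable (at x)) \<and>
     compact (closure {x. \<theta> x \<noteq> 0}) \<and> closure {x. \<theta> x \<noteq> 0} \<subseteq> \<Omega>"

definition locally_integrable :: "real set \<Rightarrow> (real \<Rightarrow> 'a::euclidean_space) \<Rightarrow> bool" where
  "locally_integrable \<Omega> u \<longleftrightarrow> (\<forall>K. compact K \<and> K \<subseteq> \<Omega> \<longrightarrow> u absolutely_integrable_on K)"

definition has_weak_deriv ::
  "real set \<Rightarrow> (real \<Rightarrow> 'a::euclidean_space) \<Rightarrow> (real \<Rightarrow> 'a) \<Rightarrow> bool" where
  "has_weak_deriv \<Omega> u v \<longleftrightarrow>
     locally_integrable \<Omega> u \<and> locally_integrable \<Omega> v \<and>
     (\<forall>\<theta>. test_function \<Omega> \<theta> \<longrightarrow>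
        (LINT x|lebesgue_on \<Omega>. deriv \<theta> x *\<^sub>R u x) = - (LINT x|lebesgue_on \<Omega>. \<theta> x *\<^sub>R v x))"

text \<open>For open \<open>\<Omega>\<close> the weak derivative is unique up to null sets; \<open>weak_deriv\<close> selects a
  representative (and is meaningless if there is no weak derivative).\<close>

definition weak_deriv :: "real set \<Rightarrow> (real \<Rightarrow> 'a::euclidean_space) \<Rightarrow> real \<Rightarrow> 'a" where
  "weak_deriv \<Omega> u = (SOME v. has_weak_deriv \<Omega> u v)"

text \<open>The type variable \<open>'a\<close> is \<open>real\<close> for \<open>H\<^sup>1(\<Omega>)\<close> and \<open>real \<times> real\<close> for \<open>H\<^sup>1(\<Omega>,\<real>\<^sup>2)\<close>.\<close>

definition H1 :: "real set \<Rightarrow> (real \<Rightarrow> 'a::euclidean_space) set" where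
  "H1 \<Omega> = {u \<in> L2 \<Omega>. \<exists>v \<in> L2 \<Omega>. has_weak_deriv \<Omega> u v}"

definition H1_norm :: "real set \<Rightarrow> (real \<Rightarrow> 'a::euclidean_space) \<Rightarrow> real" where
  "H1_norm \<Omega> u = sqrt ((L2_norm \<Omega> u)\<^sup>2 + (L2_norm \<Omega> (weak_deriv \<Omega> u))\<^sup>2)"

text \<open>Only the values of a functional on \<open>H1 \<Omega>\<close> matter; boundedness makes it independent of
  representatives.\<close>

definition H1_dual :: "real set \<Rightarrow> ((real \<Rightarrow> 'a::euclidean_space) \<Rightarrow> real) set" where
  "H1_dual \<Omega> = {l.
     (\<forall>\<phi>\<in>H1 \<Omega>. \<forall>\<psi>\<in>H1 \<Omega>. l (\<lambda>x. \<phi> x + \<psi> x) = l \<phi> + l \<psi>) \<and>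
     (\<forall>\<phi>\<in>H1 \<Omega>. \<forall>c. l (\<lambda>x. c *\<^sub>R \<phi> x) = c * l \<phi>) \<and>
     (\<exists>C. \<forall>\<phi>\<in>H1 \<Omega>. \<bar>l \<phi>\<bar> \<le> C * H1_norm \<Omega> \<phi>)}"

definition H1_dual_norm :: "real set \<Rightarrow> ((real \<Rightarrow> 'a::euclidean_space) \<Rightarrow> real) \<Rightarrow> real" where
  "H1_dual_norm \<Omega> l = (SUP \<phi>\<in>{\<phi> \<in> H1 \<Omega>. H1_norm \<Omega> \<phi> \<le> 1}. \<bar>l \<phi>\<bar>)"

definition L2_embed :: "real set \<Rightarrow> (real \<Rightarrow> 'a::euclidean_space) \<Rightarrow> (real \<Rightarrow> 'a) \<Rightarrow> real" where
  "L2_embed \<Omega> u = (\<lambda>\<phi>. LINT x|lebesgue_on \<Omega>. u x \<bullet> \<phi> x)"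

section \<open>Bochner spaces\<close>

text \<open>Here a (semi)normed space is given by a carrier \<open>X\<close> and a norm \<open>N\<close>; the difference of
  two elements is the pointwise difference of functions.\<close>

definition strongly_measurable ::
  "'t measure \<Rightarrow> ('y \<Rightarrow> 'b::ab_group_add) set \<Rightarrow> (('y \<Rightarrow> 'b) \<Rightarrow> real) \<Rightarrow> ('t \<Rightarrow> 'y \<Rightarrow> 'b) \<Rightarrow> bool" where
  "strongly_measurable M X N w \<longleftrightarrow>
     (\<exists>s :: nat \<Rightarrow> 't \<Rightarrow> 'y \<Rightarrow> 'b.
        (\<forall>k. simple_function M (s k) \<and> s k ` space M \<subseteq> X) \<and>
        (AE t in M. w t \<in> X \<and> (\<lambda>k. N (\<lambda>y. s k t y - w t y)) \<longlonglongrightarrow> 0))"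

definition L2_Bochner ::
  "real \<Rightarrow> ('y \<Rightarrow> 'b::ab_group_add) set \<Rightarrow> (('y \<Rightarrow> 'b) \<Rightarrow> real) \<Rightarrow> (real \<Rightarrow> 'y \<Rightarrow> 'b) set" where
  "L2_Bochner T X N = {w.
     strongly_measurable (lebesgue_on {0<..<T}) X N w \<and>
     integrable (lebesgue_on {0<..<T}) (\<lambda>t. (N (w t))\<^sup>2)}"

definition L2_H1 :: "real \<Rightarrow> real set \<Rightarrow> (real \<Rightarrow> real \<Rightarrow> 'a::euclidean_space) set" where
  "L2_H1 T \<Omega> = L2_Bochner T (H1 \<Omega>) (H1_norm \<Omega>)"

definition L2_H1_dual ::
  "real \<Rightarrow> real set \<Rightarrow> (real \<Rightarrow> (real \<Rightarrow> 'a::euclidean_space) \<Rightarrow> real) set" where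
  "L2_H1_dual T \<Omega> = L2_Bochner T (H1_dual \<Omega>) (H1_dual_norm \<Omega>)"

text \<open>The weak time derivative is characterised by
  \<open>\<integral> \<theta>'(t) w(t) dt = - \<integral> \<theta>(t) w'(t) dt\<close> as an identity of Bochner integrals in the dual space.
  These integrals are functionals, and evaluation at \<open>\<phi>\<close> commutes with the integral.\<close>

definition W12_H1_dual ::
  "real \<Rightarrow> real set \<Rightarrow> (real \<Rightarrow> (real \<Rightarrow> 'a::euclidean_space) \<Rightarrow> real) set" where
  "W12_H1_dual T \<Omega> = {w \<in> L2_H1_dual T \<Omega>. \<exists>w' \<in> L2_H1_dual T \<Omega>.
     \<forall>\<theta>. test_function {0<..<T} \<theta> \<longrightarrow> (\<forall>\<phi>\<in>H1 \<Omega>.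
       (LINT t|lebesgue_on {0<..<T}. deriv \<theta> t * w t \<phi>) =
       - (LINT t|lebesgue_on {0<..<T}. \<theta> t * w' t \<phi>))}"

text \<open>By the embedding of \<open>L\<^sub>2(0,T;H\<^sup>1) \<inter> W\<^sup>1\<^sub>2(0,T;(H\<^sup>1)')\<close> into \<open>C([0,T];L\<^sub>2)\<close>, the time-continuous
  representative is the one singled out by the following property for \<open>J = [0,\<infinity>)\<close>.\<close>

definition L2_continuous_on ::
  "real set \<Rightarrow> real set \<Rightarrow> (real \<Rightarrow> real \<Rightarrow> 'a::euclidean_space) \<Rightarrow> bool" where
  "L2_continuous_on J \<Omega> u \<longleftrightarrow>
     (\<forall>t\<in>J. u t \<in> L2 \<Omega> \<and> ((\<lambda>s. L2_norm \<Omega> (\<lambda>x. u s x - u t x)) \<longlongrightarrow> 0) (at t within J))"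

section \<open>The Liapunov functionals\<close>

text \<open>Since \<open>0 * ln 0 = 0\<close>, the formula gives the value \<open>1\<close> at \<open>r = 0\<close>.\<close>

definition L_fun :: "real \<Rightarrow> real" where
  "L_fun r = r * ln r - r + 1"

definition Phi1 :: "real \<Rightarrow> real \<times> real \<Rightarrow> real" where
  "Phi1 \<mu> X = L_fun (fst X) + 1 / \<mu> * L_fun (snd X)"

definition alpha :: "real \<Rightarrow> real \<Rightarrow> nat \<Rightarrow> nat \<Rightarrow> real" where
  "alpha R \<mu> k n = R * (real k + \<mu> * (real n - real k - 1))"

text \<open>For \<open>j = 0\<close> the product is empty and the coefficient is \<open>1\<close>.\<close>

definition acoef :: "real \<Rightarrow> real \<Rightarrow> nat \<Rightarrow> nat \<Rightarrow> real" where
  "acoef R \<mu> j n = real (n choose j) * (\<Prod>k<j. (real k + alpha R \<mu> k n) / alpha R \<mu> k n)"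

definition Phi :: "real \<Rightarrow> real \<Rightarrow> nat \<Rightarrow> real \<times> real \<Rightarrow> real" where
  "Phi R \<mu> n X = (\<Sum>j=0..n. acoef R \<mu> j n * fst X ^ j * snd X ^ (n - j))"

end

theory Submission
  imports Defs "HOL-Complex_Analysis.Great_Picard" "HOL-Real_Asymp.Real_Asymp" "HOL-Probability.Distributions"
begin

text \<open>The solution is a limit of an implicit Euler scheme. Each time step is solved by a Galerkin method in the entropy
  variables \<open>ln f\<close>, \<open>ln g\<close>, where a coercive algebraic system has a zero by Kuhn's combinatorial lemma; testing with
  these variables gives (l1). The product of the Hessian of \<open>\<Phi>\<^sub>n\<close> with the mobility matrix is positive semidefinite, so
  that \<open>\<integral>\<Phi>\<^sub>n\<close> decreases along the scheme, and \<open>n \<rightarrow> \<infinity>\<close> yields the uniform bound (l3). Weak compactness is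
  replaced by convex combinations of tails, which converge in \<open>L\<^sub>2\<close> and almost everywhere. The primitives in \<open>x\<close> of the
  approximations are equicontinuous in time and space, hence converge pointwise along a subsequence; an integration by
  parts against the bounded \<open>x\<close>-derivatives turns this into strong \<open>L\<^sub>2\<close> convergence, which identifies the fluxes.
  Continuity in time with values in \<open>L\<^sub>2\<close> follows from one-sided estimates at almost every time along a chain of times
  whose distance to the given one is halved in every step.\<close>

section \<open>Convex combinations in \<open>L\<^sub>2\<close>\<close>

text \<open>The fluxes are products of an unknown with a derivative, and the system is coupled and
  degenerates where \<open>f\<close> or \<open>g\<close> vanishes. Positivity therefore comes from
  the exponential in the Galerkin ansatz, and boundedness from the family \<open>Phi\<close>, whose
  coefficients are fixed by one symmetry requirement. In one space dimension the primitive in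
  \<open>x\<close> removes the outer derivative of each equation: the increment of the primitive of
  an unknown equals the time integral of its flux. The Neumann condition becomes the vanishing of
  the flux at both ends, that is, conservation of mass. Functions with equal primitives agree almost
  everywhere, and uniformly bounded functions converge weakly once their primitives converge
  pointwise; thus primitives take the place of weak topologies. Limits of primitives exist at every
  time, whereas derivatives are under control at almost every time only. Hence inequalities claimed
  at every single time, and continuity in L2, need arguments of their own.\<close>

abbreviation "BM == borel_measurable borel"
abbreviation "BM2 == borel_measurable (borel \<Otimes>\<^sub>M borel)"
abbreviation "un z == (%p. z (fst p) (snd p))"
notation (input) LIMSEQ ("((_)/ ---> (_))" [60, 60] 60)
lemmas Bochner_integrable_add = Bochner_Integration.integrable_add and Bochner_integrable_bound = Bochner_Integration.integrable_bound
 and Bochner_integrable_diff = Bochner_Integration.integrable_diff and Bochner_integrable_sum = Bochner_Integration.integrable_sum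
 and Bochner_integral_add = Bochner_Integration.integral_add and Bochner_integral_cong = Bochner_Integration.integral_cong
 and Bochner_integral_diff = Bochner_Integration.integral_diff and Bochner_integral_sum = Bochner_Integration.integral_sum

definition sq_int :: "'a measure => ('a => 'b::euclidean_space) => bool" where
 "sq_int M h \<longleftrightarrow> h : borel_measurable M & integrable M (%x. (norm (h x))^2)"

abbreviation sqn :: "'a measure => ('a => 'b::euclidean_space) => real" where
 "sqn M h \<equiv> (LINT x|M. (norm (h x))^2)"

lemma sq_intD [measurable_dest]: "sq_int M h ==> h : borel_measurable M"
 by (simp add: sq_int_def)

lemma sq_int_integrable: "sq_int M h ==> integrable M (%x. (norm (h x))^2)"
 by (simp add: sq_int_def)

lemma sqn_nonneg: "sqn M h >= 0" by simp

lemma norm_add_sq_le: "(norm (x + y :: 'b::real_normed_vector))^2 <= 2 * (norm x)^2 + 2 * (norm y)^2"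
proof -
 have "(norm (x + y))^2 <= (norm x + norm y)^2" by (intro power_mono norm_triangle_ineq) simp
 also have "... <= 2 * (norm x)^2 + 2 * (norm y)^2"
  using sum_squares_bound[of "norm x" "norm y"] by (simp add: power2_sum)
 finally show ?thesis .
qed

lemma sq_int_bound:
 assumes "k : borel_measurable M" "integrable M g" "!!x. x : space M ==> (norm (k x))^2 <= g x"
 shows "sq_int M k" unfolding sq_int_def using assms
 by (auto intro!: Bochner_integrable_bound[OF assms(2)] AE_I2 order_trans[OF _ abs_ge_self])

lemma sq_int_add: assumes "sq_int M h" "sq_int M k" shows "sq_int M (%x. h x + k x)"
 using assms by (intro sq_int_bound[where g="%x. 2 * (norm (h x))^2 + 2 * (norm (k x))^2"] norm_add_sq_le)
   (auto simp: sq_int_def)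

lemma sq_int_scaleR: assumes "sq_int M h" shows "sq_int M (%x. c *\<^sub>R h x)"
 using assms by (auto simp: sq_int_def power_mult_distrib)

lemma sq_int_mult: "sq_int M h ==> sq_int M (%x. c * h x :: real)"
 using sq_int_scaleR[of M h c] by simp

lemma sq_int_uminus: "sq_int M h ==> sq_int M (%x. - h x)"
 by (auto simp: sq_int_def)

lemma sq_int_diff: assumes "sq_int M h" "sq_int M k" shows "sq_int M (%x. h x - k x)"
 using sq_int_add[OF assms(1) sq_int_uminus[OF assms(2)]] by simp

lemma sq_int_zero [simp]: "sq_int M (%x. 0)" by (simp add: sq_int_def)

lemma sq_int_sum: assumes "!!i. i : A ==> sq_int M (h i)" shows "sq_int M (%x. \<Sum>i\<in>A. h i x)"
 using assms by (induct A rule: infinite_finite_induct) (auto intro: sq_int_add)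

lemma sq_int_norm_mult:
 assumes "sq_int M h" "sq_int M k" shows "integrable M (%x. norm (h x) * norm (k x))"
proof (rule Bochner_integrable_bound)
 show "integrable M (%x. (norm (h x))^2 + (norm (k x))^2)" using assms by (auto simp: sq_int_def)
 show "(%x. norm (h x) * norm (k x)) : borel_measurable M" using assms[THEN sq_intD] by measurable
 show "AE x in M. norm (norm (h x) * norm (k x)) <= norm ((norm (h x))^2 + (norm (k x))^2)"
 proof (intro AE_I2)
  fix x
  have "2 * (norm (h x) * norm (k x)) <= (norm (h x))^2 + (norm (k x))^2"
   using sum_squares_bound[of "norm (h x)" "norm (k x)"] by simp
  moreover have "0 <= norm (h x) * norm (k x)" by simp
  ultimately have "norm (h x) * norm (k x) <= (norm (h x))^2 + (norm (k x))^2" by linarith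
  thus "norm (norm (h x) * norm (k x)) <= norm ((norm (h x))^2 + (norm (k x))^2)" by simp
 qed
qed

lemma sq_int_inner:
 assumes "sq_int M h" "sq_int M k" shows "integrable M (%x. h x \<bullet> k x)"
proof (rule Bochner_integrable_bound[OF sq_int_norm_mult[OF assms]])
 show "(%x. h x \<bullet> k x) : borel_measurable M" using assms[THEN sq_intD] by measurable
qed (auto intro!: AE_I2 Cauchy_Schwarz_ineq2)

lemma sq_int_times:
 fixes h k :: "'a => real"
 assumes "sq_int M h" "sq_int M k" shows "integrable M (%x. h x * k x)" using sq_int_inner[OF assms] by simp

lemma sqn_add:
 assumes "sq_int M h" "sq_int M k"
 shows "sqn M (%x. h x + k x) = sqn M h + 2 * (LINT x|M. h x \<bullet> k x) + sqn M k"
proof -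
 have "sqn M (%x. h x + k x) = (LINT x|M. ((norm (h x))^2 + 2 * (h x \<bullet> k x)) + (norm (k x))^2)"
  by (simp add: power2_norm_eq_inner inner_add inner_commute algebra_simps)
 also have "... = sqn M h + 2 * (LINT x|M. h x \<bullet> k x) + sqn M k"
  using assms sq_int_inner[OF assms] by (subst Bochner_integral_add) (auto simp: sq_int_def)
 finally show ?thesis .
qed

lemma sqn_add_le:
 assumes "sq_int M h" "sq_int M k"
 shows "sqn M (%x. h x + k x) <= 2 * sqn M h + 2 * sqn M k"
proof -
 have "sqn M (%x. h x + k x) <= (LINT x|M. 2 * (norm (h x))^2 + 2 * (norm (k x))^2)"
  using assms sq_int_add[OF assms] by (intro integral_mono norm_add_sq_le) (auto simp: sq_int_def)
 also have "... = 2 * sqn M h + 2 * sqn M k" using assms by (auto simp: sq_int_def)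
 finally show ?thesis .
qed

lemma sqn_diff_le:
 assumes "sq_int M h" "sq_int M k"
 shows "sqn M (%x. h x - k x) <= 2 * sqn M h + 2 * sqn M k"
 using sqn_add_le[OF assms(1) sq_int_uminus[OF assms(2)]] by simp

lemma CS_norm:
 assumes "sq_int M h" "sq_int M k"
 shows "(LINT x|M. norm (h x) * norm (k x))^2 <= sqn M h * sqn M k"
proof -
 let ?B = "\<integral>x. norm (h x) * norm (k x) \<partial>M"
 have s: "sq_int M (%x. norm (h x))" "sq_int M (%x. norm (k x))" using assms by (auto simp: sq_int_def)
 have q: "0 <= c^2 * sqn M h + 2 * (c * d * ?B) + d^2 * sqn M k" for c d
 proof -
  have "0 <= sqn M (%x. c *\<^sub>R norm (h x) + d *\<^sub>R norm (k x))" by simp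
  also have "... = c^2 * sqn M h + 2 * (LINT x|M. (c * d) * (norm (h x) * norm (k x))) + d^2 * sqn M k"
   using sqn_add[OF sq_int_scaleR[OF s(1)] sq_int_scaleR[OF s(2)], of c d]
   by (simp add: power_mult_distrib mult_ac)
  finally show ?thesis by (simp only: integral_mult_right_zero)
 qed
 show ?thesis
 proof (cases "sqn M k = 0")
  case True
  have "?B = 0"
  proof (rule ccontr)
   assume "?B ~= 0"
   \<comment> \<open>When \<open>sqn M k\<close> vanishes, the quadratic form is affine in
     \<open>d\<close>; this \<open>d\<close> gives it the value -1.\<close>
   thus False using q[of 1 "- (sqn M h + 1) / (2 * ?B)"] True sqn_nonneg[of M h] by (simp add: field_simps)
  qed
  thus ?thesis using True by simp
 next
  case False
  hence p: "sqn M k > 0" using sqn_nonneg[of M k] by linarith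
  have "0 <= sqn M k * (sqn M k * sqn M h - ?B^2)"
   using q[of "sqn M k" "- ?B"] by (simp add: algebra_simps power2_eq_square)
  thus ?thesis using p by (simp add: zero_le_mult_iff mult.commute)
 qed
qed

lemma CS_sqrt:
 assumes "sq_int M h" "sq_int M k"
 shows "(LINT x|M. norm (h x) * norm (k x)) <= sqrt (sqn M h) * sqrt (sqn M k)"
 using CS_norm[OF assms] by (simp add: real_le_rsqrt flip: real_sqrt_mult)

lemma CS_inner:
 assumes "sq_int M h" "sq_int M k"
 shows "\<bar>\<integral>x. h x \<bullet> k x \<partial>M\<bar> <= sqrt (sqn M h) * sqrt (sqn M k)"
proof -
 have "\<bar>\<integral>x. h x \<bullet> k x \<partial>M\<bar> <= (LINT x|M. norm (h x \<bullet> k x))"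
  using integral_norm_bound[of M "%x. h x \<bullet> k x"] by simp
 also have "... <= (LINT x|M. norm (h x) * norm (k x))"
  using assms by (intro integral_mono integrable_norm sq_int_inner sq_int_norm_mult) (auto intro: Cauchy_Schwarz_ineq2)
 finally show ?thesis using CS_sqrt[OF assms] by simp
qed

lemma inner_tendsto:
 assumes "!!n. sq_int M (h n)" "sq_int M l" "sq_int M k" "(%n. sqn M (%x. h n x - l x)) ---> 0"
 shows "(%n. \<integral>x. h n x \<bullet> k x \<partial>M) ---> (LINT x|M. l x \<bullet> k x)"
proof (rule LIM_zero_cancel, rule Lim_null_comparison)
 show "\<forall>\<^sub>F n in sequentially. norm ((LINT x|M. h n x \<bullet> k x) - (LINT x|M. l x \<bullet> k x)) <= sqrt (sqn M (%x. h n x - l x)) * sqrt (sqn M k)"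
 proof (intro always_eventually allI)
  fix n
  have "(LINT x|M. h n x \<bullet> k x) - (LINT x|M. l x \<bullet> k x) = (LINT x|M. (h n x - l x) \<bullet> k x)"
   using assms by (simp add: inner_diff_left sq_int_inner)
  thus "norm ((LINT x|M. h n x \<bullet> k x) - (LINT x|M. l x \<bullet> k x)) <= sqrt (sqn M (%x. h n x - l x)) * sqrt (sqn M k)"
   using CS_inner[of M "%x. h n x - l x" k] assms by (simp add: sq_int_diff)
 qed
 show "(%n. sqrt (sqn M (%x. h n x - l x)) * sqrt (sqn M k)) ---> 0"
  using tendsto_mult[OF tendsto_real_sqrt[OF assms(4)] tendsto_const[of "sqrt (sqn M k)"]] by simp
qed

lemma sqn_tendsto:
 assumes "!!n. sq_int M (h n)" "sq_int M l" "(%n. sqn M (%x. h n x - l x)) ---> 0"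
 shows "(%n. sqn M (h n)) ---> sqn M l"
proof -
 have eq: "sqn M (h n) = sqn M (%x. h n x - l x) + 2 * (LINT x|M. h n x \<bullet> l x) - sqn M l" for n
 proof -
  have "sqn M (%x. h n x - l x) = sqn M (h n) + 2 * (LINT x|M. h n x \<bullet> (- l x)) + sqn M (%x. - l x)"
   using sqn_add[OF assms(1) sq_int_uminus[OF assms(2)], of n] by simp
  thus ?thesis by simp
 qed
 have "(%n. sqn M (%x. h n x - l x) + 2 * (LINT x|M. h n x \<bullet> l x) - sqn M l) ---> 0 + 2 * (LINT x|M. l x \<bullet> l x) - sqn M l"
  by (intro tendsto_intros assms inner_tendsto)
 thus ?thesis unfolding eq[symmetric] by (simp add: power2_norm_eq_inner)
qed

section \<open>Completeness of L2 and averages of tails\<close>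

lemma AE_summable_of_nn_integral:
 fixes f :: "nat => 'a => real"
 assumes [measurable]: "!!i. f i : borel_measurable M" and "!!i x. f i x >= 0"
  and "!!i. (\<integral>\<^sup>+x. ennreal (f i x) \<partial>M) <= ennreal (c i)" "summable c" "!!i. c i >= 0"
 shows "AE x in M. summable (%i. f i x)"
proof -
 have "(\<integral>\<^sup>+x. (\<Sum>i. ennreal (f i x)) \<partial>M) = (\<Sum>i. \<integral>\<^sup>+x. ennreal (f i x) \<partial>M)"
  by (rule nn_integral_suminf) measurable
 also have "... <= (\<Sum>i. ennreal (c i))" by (intro suminf_le assms) auto
 also have "... < \<infinity>" using assms(4,5) by (simp add: ennreal_suminf_neq_top less_top[symmetric])
 finally have "AE x in M. (\<Sum>i. ennreal (f i x)) ~= \<infinity>" by (intro nn_integral_PInf_AE) auto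
 thus ?thesis by eventually_elim (intro summable_suminf_not_top assms, auto)
qed

text \<open>Riesz-Fischer with both modes of convergence at once: almost everywhere along a fast
  subsequence, and in mean for the whole sequence by Fatou's lemma. The pointwise limit is what
  later identifies products.\<close>

lemma L2_complete:
 fixes h :: "nat => 'a => 'b::euclidean_space"
 assumes h: "!!n. sq_int M (h n)"
  and cauchy: "!!e. e > 0 ==> EX N. ALL m>=N. ALL n>=N. sqn M (%x. h m x - h n x) <= e"
 obtains r l where "strict_mono (r :: nat => nat)" "sq_int M l" "AE x in M. (%k. h (r k) x) ---> l x"
  "(%n. sqn M (%x. h n x - l x)) ---> 0"
proof -
 have [measurable]: "h n : borel_measurable M" for n using h by (rule sq_intD)
 have hd: "sq_int M (%x. h m x - h n x)" for m n using h by (intro sq_int_diff)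
 have "EX N. ALL m>=N. ALL n>=N. sqn M (%x. h m x - h n x) <= (1/8)^k" for k :: nat by (rule cauchy) simp
 then obtain N where N: "!!k m n. m >= N k ==> n >= N k ==> sqn M (%x. h m x - h n x) <= (1/8)^k" by metis
 define r where "r k = k + (SUM i<=k. N i)" for k
 have r: "strict_mono r" by (auto simp: strict_mono_Suc_iff r_def)
 have rN: "r k >= N k" for k using member_le_sum[of k "{..k}" N] by (auto simp: r_def intro: trans_le_add2)
 let ?d = "%k x. norm (h (r (Suc k)) x - h (r k) x)"
 have d: "sqn M (%x. h (r (Suc k)) x - h (r k) x) <= (1/8)^k" for k
  using rN[of k] strict_monoD[OF r, of k "Suc k"] by (intro N) auto
 \<comment> \<open>The weight 2^k is a compromise: against squared increments of order 8^-k it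
   leaves the summable 4^-k, and because d <= 2^-k + 2^k d^2 it still makes the increments
   themselves summable pointwise.\<close>
 have "AE x in M. summable (%k. 2^k * (?d k x)^2)"
 proof (rule AE_summable_of_nn_integral[where c="%k. (1/4)^k"])
  fix k
  have "(\<integral>\<^sup>+x. ennreal (2^k * (?d k x)^2) \<partial>M) = ennreal (LINT x|M. 2^k * (?d k x)^2)"
   using hd by (intro nn_integral_eq_integral) (auto simp: sq_int_def)
  also have "(LINT x|M. 2^k * (?d k x)^2) <= 2^k * (1/8)^k" using d[of k] by simp
  also have "2^k * (1/8)^k = (1/4::real)^k" by (simp flip: power_mult_distrib)
  finally show "(\<integral>\<^sup>+x. ennreal (2^k * (?d k x)^2) \<partial>M) <= ennreal ((1/4)^k)"
   by (simp add: ennreal_leI)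
 qed (auto intro!: summable_geometric)
 hence conv: "AE x in M. convergent (%k. h (r k) x)"
 proof eventually_elim
  case (elim x)
  have "summable (%k. ?d k x)"
  proof (rule summable_comparison_test'[of "%k. (1/2)^k + 2^k * (?d k x)^2" 0])
   show "summable (%k. (1/2)^k + 2^k * (?d k x)^2)" by (intro summable_add elim summable_geometric) auto
   fix k :: nat
   let ?D = "?d k x"
   have "0 <= (?D * 2^k - 1/2)^2" by simp
   also have "... = 2^k * (2^k * ?D^2) - 2^k * ?D + 1/4" by (simp add: power2_diff power_mult_distrib power2_eq_square algebra_simps)
   finally have "2^k * ?D <= 2^k * (2^k * ?D^2) + 2^k * (1/2)^k" by (simp flip: power_mult_distrib)
   hence "2^k * ?D <= 2^k * ((1/2)^k + 2^k * ?D^2)" by (simp add: algebra_simps)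
   thus "norm (?D) <= (1/2)^k + 2^k * ?D^2" by simp
  qed
  hence "summable (%k. h (r (Suc k)) x - h (r k) x)" by (rule summable_norm_cancel)
  hence "convergent (%n. h (r n) x - h (r 0) x)"
   unfolding summable_iff_convergent by (simp only: sum_lessThan_telescope[of "%k. h (r k) x"])
  thus ?case using convergent_add[OF _ convergent_const[of "h (r 0) x"]] by fastforce
 qed
 define l where "l x = lim (%k. h (r k) x)" for x
 have [measurable]: "l : borel_measurable M" unfolding l_def by measurable
 have lim: "AE x in M. (%k. h (r k) x) ---> l x"
  using conv by eventually_elim (simp add: l_def convergent_LIMSEQ_iff)
 \<comment> \<open>Fatou's lemma along the subsequence carries the Cauchy estimate over to the
   limit. It yields both the square integrability of \<open>l\<close> and convergence along all
   \<open>n\<close>.\<close>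
 have fatou: "(\<integral>\<^sup>+x. ennreal ((norm (h n x - l x))^2) \<partial>M) <= ennreal e"
  if e: "e >= 0" "ALL m>=N'. ALL n>=N'. sqn M (%x. h m x - h n x) <= e" "n >= N'" for n e N'
 proof -
  have "(\<integral>\<^sup>+x. ennreal ((norm (h n x - l x))^2) \<partial>M) = (\<integral>\<^sup>+x. liminf (%k. ennreal ((norm (h n x - h (r k) x))^2)) \<partial>M)"
  proof (rule nn_integral_cong_AE)
   show "AE x in M. ennreal ((norm (h n x - l x))^2) = liminf (%k. ennreal ((norm (h n x - h (r k) x))^2))"
    using lim
   proof eventually_elim
    case (elim x)
    have "(%k. ennreal ((norm (h n x - h (r k) x))^2)) ---> ennreal ((norm (h n x - l x))^2)"
     by (intro tendsto_ennrealI tendsto_intros elim)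
    thus ?case by (metis lim_imp_Liminf sequentially_bot)
   qed
  qed
  also have "... <= liminf (%k. \<integral>\<^sup>+x. ennreal ((norm (h n x - h (r k) x))^2) \<partial>M)"
   by (intro nn_integral_liminf) measurable
  also have "... <= ennreal e"
  proof (rule Liminf_le)
   have "\<forall>\<^sub>F k in sequentially. k >= N'" by (rule eventually_ge_at_top)
   thus "\<forall>\<^sub>F k in sequentially. (\<integral>\<^sup>+x. ennreal ((norm (h n x - h (r k) x))^2) \<partial>M) <= ennreal e"
   proof eventually_elim
    case (elim k)
    have "(\<integral>\<^sup>+x. ennreal ((norm (h n x - h (r k) x))^2) \<partial>M) = ennreal (sqn M (%x. h n x - h (r k) x))"
     using hd by (intro nn_integral_eq_integral) (auto simp: sq_int_def)
    also have "... <= ennreal e" using e elim seq_suble[OF r, of k] by (intro ennreal_leI) auto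
    finally show ?case .
   qed
  qed simp
  finally show ?thesis .
 qed
 obtain N1 where N1: "ALL m>=N1. ALL n>=N1. sqn M (%x. h m x - h n x) <= 1" using cauchy[of 1] by auto
 have "sq_int M (%x. h N1 x - l x)" unfolding sq_int_def
  using fatou[OF _ N1, of N1] by (auto intro!: integrableI_nonneg simp: le_less_trans)
 from sq_int_diff[OF h[of N1] this] have l: "sq_int M l" by simp
 have hl: "sq_int M (%x. h n x - l x)" for n using h l by (intro sq_int_diff)
 have "(%n. sqn M (%x. h n x - l x)) ---> 0"
 proof (rule LIMSEQ_I)
  fix e :: real assume "e > 0"
  obtain N' where N': "ALL m>=N'. ALL n>=N'. sqn M (%x. h m x - h n x) <= e/2" using cauchy[of "e/2"] \<open>e > 0\<close> by auto
  show "EX no. ALL n>=no. norm (sqn M (%x. h n x - l x) - 0) < e"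
  proof (intro exI allI impI)
   fix n assume n: "n >= N'"
   have "ennreal (sqn M (%x. h n x - l x)) = (\<integral>\<^sup>+x. ennreal ((norm (h n x - l x))^2) \<partial>M)"
    using hl by (intro nn_integral_eq_integral[symmetric]) (auto simp: sq_int_def)
   also have "... <= ennreal (e/2)" using fatou[OF _ N' n] \<open>e > 0\<close> by simp
   finally have "sqn M (%x. h n x - l x) <= e/2" using \<open>e > 0\<close> by simp
   thus "norm (sqn M (%x. h n x - l x) - 0) < e" using \<open>e > 0\<close> by simp
  qed
 qed
 thus ?thesis using that r l lim by blast
qed

text \<open>Row \<open>k\<close> averages over indices in [k, K k) only: using tails makes averaging
  preserve every limit that is already known, and the cutoff keeps all averages finite sums. The
  same weights are later applied to several sequences simultaneously.\<close>

definition conv_weights :: "(nat => nat => real) => (nat => nat) => bool" where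
 "conv_weights c K \<longleftrightarrow> (ALL k. (ALL n. c k n >= 0) & (ALL n. n < k \<or> K k <= n --> c k n = 0) & (SUM n<K k. c k n) = 1)"

lemma conv_weightsD:
 assumes "conv_weights c K"
 shows "c k n >= 0" "n < k ==> c k n = 0" "K k <= n ==> c k n = 0" "(SUM n<K k. c k n) = 1"
 using assms by (auto simp: conv_weights_def)

lemma conv_weights_subseq:
 assumes "conv_weights c K" "strict_mono (r :: nat => nat)"
 shows "conv_weights (%k. c (r k)) (%k. K (r k))" unfolding conv_weights_def
 using conv_weightsD[OF assms(1)] seq_suble[OF assms(2)] by (meson less_le_trans)

lemma conv_weights_bound:
 fixes a :: "nat => 'b::real_normed_vector"
 assumes c: "conv_weights c K" and "!!n. n >= k ==> norm (a n - l) <= e"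
 shows "norm ((SUM n<K k. c k n *\<^sub>R a n) - l) <= e"
proof -
 have "l = (SUM n<K k. c k n *\<^sub>R l)" using conv_weightsD(4)[OF c, of k] by (simp flip: scaleR_left.sum)
 hence "norm ((SUM n<K k. c k n *\<^sub>R a n) - l) = norm (SUM n<K k. c k n *\<^sub>R (a n - l))"
  by (simp add: scaleR_diff_right sum_subtractf)
 also have "... <= (SUM n<K k. c k n * e)"
 proof (rule sum_norm_le)
  fix n show "norm (c k n *\<^sub>R (a n - l)) <= c k n * e"
   using assms(2)[of n] conv_weightsD(1)[OF c, of k n] conv_weightsD(2)[OF c, of n k]
   by (cases "n < k") (auto intro: mult_left_mono)
 qed
 also have "... = e" using conv_weightsD(4)[OF c, of k] by (simp flip: sum_distrib_right)
 finally show ?thesis .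
qed

lemma conv_weights_tendsto:
 fixes a :: "nat => 'b::real_normed_vector"
 assumes c: "conv_weights c K" and a: "a ---> l"
 shows "(%k. SUM n<K k. c k n *\<^sub>R a n) ---> l"
proof (rule LIMSEQ_I)
 fix e :: real assume "e > 0"
 then obtain N where N: "!!n. n >= N ==> norm (a n - l) < e/2" using LIMSEQ_D[OF a, of "e/2"] by auto
 have "norm ((SUM n<K k. c k n *\<^sub>R a n) - l) < e" if "k >= N" for k
  using conv_weights_bound[OF c, of k a l "e/2"] N that \<open>e > 0\<close> by (force simp: less_imp_le)
 thus "EX no. ALL n>=no. norm ((SUM i<K n. c n i *\<^sub>R a i) - l) < e" by blast
qed

lemma conv_weights_le:
 fixes a :: "nat => real"
 assumes c: "conv_weights c K" and "!!n. n >= k ==> a n <= B"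
 shows "(SUM n<K k. c k n * a n) <= B"
proof -
 have "(SUM n<K k. c k n * a n) <= (SUM n<K k. c k n * B)"
 proof (rule sum_mono)
  fix n show "c k n * a n <= c k n * B"
   using assms(2)[of n] conv_weightsD(1)[OF c, of k n] conv_weightsD(2)[OF c, of n k]
   by (cases "n < k") (auto intro: mult_left_mono)
 qed
 also have "... = B" using conv_weightsD(4)[OF c, of k] by (simp flip: sum_distrib_right)
 finally show ?thesis .
qed

lemma conv_weights_ge:
 fixes a :: "nat => real"
 assumes c: "conv_weights c K" and "!!n. n >= k ==> B <= a n"
 shows "B <= (SUM n<K k. c k n * a n)"
 using conv_weights_le[OF c, of k "%n. - a n" "- B"] assms(2) by (simp add: sum_negf)

text \<open>Mazur's lemma without weak topologies: near-minimisers of the norm over the tail hulls form a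
 Cauchy sequence by the parallelogram identity.\<close>

theorem convex_combinations_converge:
 fixes h :: "nat => 'a => 'b::euclidean_space"
 assumes h: "!!n. sq_int M (h n)" and C: "!!n. sqn M (h n) <= C"
 obtains c K l where "conv_weights c K" "sq_int M l"
  "AE x in M. (%k. SUM n<K k. c k n *\<^sub>R h n x) ---> l x"
  "(%k. sqn M (%x. (SUM n<K k. c k n *\<^sub>R h n x) - l x)) ---> 0"
proof -
 define adm :: "nat => (nat => real) \<times> nat => bool" where
  "adm k w \<longleftrightarrow> (ALL n. fst w n >= 0) & (ALL n. n < k \<or> snd w <= n --> fst w n = 0) & (SUM n<snd w. fst w n) = 1" for k w
 define S where "S w x = (SUM n<snd w. fst w n *\<^sub>R h n x)" for w x
 have S: "sq_int M (S w)" for w unfolding S_def by (intro sq_int_sum sq_int_scaleR h)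
 have Sext: "S w x = (SUM n<N. fst w n *\<^sub>R h n x)" (is ?S) "(SUM n<N. fst w n) = 1" (is ?T) if "adm k w" "N >= snd w" for w x N k
 proof -
  show ?S unfolding S_def using that by (intro sum.mono_neutral_left) (auto simp: adm_def)
  have "(SUM n<snd w. fst w n) = (SUM n<N. fst w n)" using that by (intro sum.mono_neutral_left) (auto simp: adm_def)
  thus ?T using that by (simp add: adm_def)
 qed
 \<comment> \<open>The squared distance of the origin from the hull of the k-th tail. The hulls
   decrease, so \<open>d\<close> increases; the single terms \<open>e k\<close> bound it by
   \<open>C\<close>, whence \<open>d\<close> is a Cauchy sequence.\<close>
 define d where "d k = Inf ((%w. sqn M (S w)) ` {w. adm k w})" for k
 have bdd: "bdd_below ((%w. sqn M (S w)) ` {w. adm k w})" for k by (intro bdd_belowI[of _ 0]) auto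
 define e where "e k = ((%n. if n = k then 1 else 0 :: real), Suc k)" for k :: nat
 have e: "adm k (e k)" for k by (auto simp: adm_def e_def)
 have Se: "S (e k) = h k" for k by (auto simp: S_def e_def if_distrib[of "%a. a *\<^sub>R _"] cong: if_cong)
 have dle: "d k <= sqn M (S w)" if "adm k w" for k w unfolding d_def using that by (intro cInf_lower bdd) auto
 have dC: "d k <= C" for k using dle[OF e[of k]] C[of k] by (simp add: Se)
 have dmono: "d k <= d j" if "k <= j" for k j unfolding d_def
 proof (rule cInf_superset_mono[OF _ bdd])
  show "(%w. sqn M (S w)) ` {w. adm j w} ~= {}" using e[of j] by blast
  show "(%w. sqn M (S w)) ` {w. adm j w} <= (%w. sqn M (S w)) ` {w. adm k w}"
   using that by (auto simp: adm_def)
 qed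
 define io where "io k = 1 / real (Suc k)" for k
 have io: "io k > 0" "j >= k ==> io j <= io k" for j k by (auto simp: io_def field_simps)
 have "EX w. adm k w & sqn M (S w) < d k + io k" for k
 proof -
  have "EX y:(%w. sqn M (S w)) ` {w. adm k w}. y < d k + io k"
  proof (rule cInf_lessD)
   show "(%w. sqn M (S w)) ` {w. adm k w} ~= {}" using e[of k] by blast
  qed (simp add: d_def[symmetric] io)
  thus ?thesis by auto
 qed
 then obtain W where W: "!!k. adm k (W k)" "!!k. sqn M (S (W k)) < d k + io k" by metis
 have arith: "!!dk P Q a b dj i j. [|dk <= 1/4*P; P + Q = 2*a+2*b; a < dk+i; b < dj+j; j <= i|] ==> Q <= 2*(dj-dk)+4*(i::real)"
  by simp
 have key: "sqn M (%x. S (W k) x - S (W j) x) <= 2 * (d j - d k) + 4 * io k" if "k <= j" for k j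
 proof -
  define N where "N = max (snd (W k)) (snd (W j))"
  \<comment> \<open>The midpoint of elements of the k-th and the j-th hull lies in the k-th one, so
    its squared norm is at least \<open>d k\<close>; the parallelogram identity then bounds the
    difference of the two elements.\<close>
  define w where "w = ((%n. (fst (W k) n + fst (W j) n) / 2), N)"
  note 1 = Sext[OF W(1)[of k], of N] and 2 = Sext[OF W(1)[of j], of N]
  have "adm k w" using W(1)[of k] W(1)[of j] that 1(2) 2(2)
   by (auto simp: adm_def w_def N_def add_divide_distrib sum.distrib simp flip: sum_divide_distrib)
  have "S w x = (1/2) *\<^sub>R (S (W k) x + S (W j) x)" for x using 1(1)[of x] 2(1)[of x]
   unfolding S_def[of w] by (simp add: w_def N_def scaleR_sum_right add_divide_distrib scaleR_add_left sum.distrib scaleR_add_right)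
  hence "d k <= (1/4) * sqn M (%x. S (W k) x + S (W j) x)"
   using dle[OF \<open>adm k w\<close>] by (simp add: power_mult_distrib power_divide)
  moreover have "sqn M (%x. S (W k) x + S (W j) x) + sqn M (%x. S (W k) x - S (W j) x)
    = 2 * sqn M (S (W k)) + 2 * sqn M (S (W j))"
   using sqn_add[OF S[of "W k"] S[of "W j"]] sqn_add[OF S[of "W k"] sq_int_uminus[OF S[of "W j"]]] by simp
  ultimately show ?thesis
   using arith[where P="sqn M (%x. S (W k) x + S (W j) x)"] W(2)[of k] W(2)[of j] io(2)[OF that] by blast
 qed
 have "convergent d"
 proof (rule Bseq_monoseq_convergent)
  show "Bseq d" using dC dmono[of 0] by (intro BseqI'[of d "\<bar>d 0\<bar> + \<bar>C\<bar>"]) (smt (verit) le0 real_norm_def)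
  show "monoseq d" using dmono by (auto simp: monoseq_def)
 qed
 hence "Cauchy d" by (rule convergent_Cauchy)
 have cauchy: "EX N. ALL m>=N. ALL n>=N. sqn M (%x. S (W m) x - S (W n) x) <= eps" if "eps > 0" for eps
 proof -
  obtain N1 where N1: "!!m n. m >= N1 ==> n >= N1 ==> \<bar>d m - d n\<bar> < eps / 4"
   using \<open>Cauchy d\<close> \<open>eps > 0\<close> unfolding Cauchy_def dist_real_def by (meson divide_pos_pos zero_less_numeral)
  obtain N2 where N2: "io N2 < eps / 8"
   using reals_Archimedean[of "eps/8"] \<open>eps > 0\<close> by (auto simp: io_def inverse_eq_divide)
  have *: "sqn M (%x. S (W m) x - S (W n) x) <= eps" if "m >= max N1 N2" "n >= m" for m n
  proof -
   have "\<bar>d n - d m\<bar> < eps / 4" "io m < eps / 8" using that N1[of n m] io(2)[of N2 m] N2 by auto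
   moreover from this have "d n - d m < eps / 4" by linarith
   ultimately have "2 * (d n - d m) + 4 * io m <= eps" by simp
   with key[OF that(2)] show ?thesis by (rule order_trans)
  qed
  show ?thesis
  proof (intro exI[of _ "max N1 N2"] allI impI)
   fix m n assume "m >= max N1 N2" "n >= max N1 N2"
   thus "sqn M (%x. S (W m) x - S (W n) x) <= eps"
    using *[of m n] *[of n m] by (cases "m <= n") (auto simp: norm_minus_commute)
  qed
 qed
 obtain r l where rl: "strict_mono (r :: nat => nat)" "sq_int M l" "AE x in M. (%k. S (W (r k)) x) ---> l x"
  "(%n. sqn M (%x. S (W n) x - l x)) ---> 0" using L2_complete[OF S[of "W _"] cauchy] by blast
 have "conv_weights (%k. fst (W k)) (%k. snd (W k))" using W(1) by (auto simp: conv_weights_def adm_def)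
 hence cw: "conv_weights (%k. fst (W (r k))) (%k. snd (W (r k)))" by (rule conv_weights_subseq[OF _ rl(1)])
 show ?thesis using that[OF cw rl(2)] rl(3) LIMSEQ_subseq_LIMSEQ[OF rl(4) rl(1)] by (simp add: S_def o_def)
qed

lemma sqn_combination_le:
 fixes h :: "nat => 'a => 'b::euclidean_space"
 assumes c: "conv_weights c K" and h: "!!n. sq_int M (h n)" and "!!n. n >= k ==> sqn M (h n) <= B"
 shows "sqn M (%x. SUM n<K k. c k n *\<^sub>R h n x) <= B"
proof -
 have pt: "(norm (SUM n<K k. c k n *\<^sub>R h n x))^2 <= (SUM n<K k. c k n * (norm (h n x))^2)" for x
 proof -
  let ?s = "SUM n<K k. c k n *\<^sub>R h n x"
  \<comment> \<open>Jensen's inequality for the squared norm, read off from the non-negativity of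
    the weighted variance.\<close>
  have "0 <= (SUM n<K k. c k n * (norm (h n x - ?s))^2)"
   by (intro sum_nonneg mult_nonneg_nonneg conv_weightsD[OF c]) auto
  also have "... = (SUM n<K k. c k n * (norm (h n x))^2 - 2 * ((c k n *\<^sub>R h n x) \<bullet> ?s) + c k n * (norm ?s)^2)"
   by (intro sum.cong) (auto simp: power2_norm_eq_inner inner_diff_left inner_diff_right inner_commute algebra_simps)
  also have "... = (SUM n<K k. c k n * (norm (h n x))^2) - 2 * (?s \<bullet> ?s) + (norm ?s)^2"
   using conv_weightsD(4)[OF c, of k]
   by (simp only: sum.distrib sum_subtractf inner_sum_left sum_distrib_left[symmetric] sum_distrib_right[symmetric])
  finally show ?thesis by (simp add: power2_norm_eq_inner)
 qed
 have "sqn M (%x. SUM n<K k. c k n *\<^sub>R h n x) <= (LINT x|M. (SUM n<K k. c k n * (norm (h n x))^2))"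
  using h sq_int_sum[where A="{..<K k}", OF sq_int_scaleR[OF h, of "c k _"]]
  by (intro integral_mono pt Bochner_integrable_sum) (auto simp: sq_int_def)
 also have "... = (SUM n<K k. c k n * sqn M (h n))"
  using h by (subst Bochner_integral_sum) (auto simp: sq_int_def)
 also have "... <= B" by (rule conv_weights_le[OF c assms(3)])
 finally show ?thesis .
qed

text \<open>Half-lines form an intersection-stable generator of the Borel sets, so Dynkin's argument
  extends the vanishing of the integrals to all Borel sets, in particular to those on which
  \<open>h\<close> has a strict sign. Complements need the total integral, obtained by exhausting
  the line. This is how equality of primitives identifies functions.\<close>

lemma integral_interval_unique:
 assumes M: "finite_measure M" "sets M = sets (borel :: real measure)"
  and h: "integrable M (h :: real => real)" and 0: "!!x. (LINT y|M. indicator {..x} y * h y) = 0"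
 shows "AE x in M. h x = 0"
proof -
 interpret finite_measure M by fact
 have sp: "space M = UNIV" using sets_eq_imp_space_eq[OF M(2)] by simp
 have total: "(LINT y|M. h y) = 0"
 proof (rule LIMSEQ_unique)
  show "(%n. \<integral>y. indicator {..real n} y * h y \<partial>M) ---> (LINT y|M. h y)"
  proof (rule integral_dominated_convergence[where w="%y. \<bar>h y\<bar>"])
   show "AE y in M. (%n. indicator {..real n} y * h y) ---> h y"
   proof (intro AE_I2 tendsto_eventually)
    fix y :: real
    obtain N where "y <= real N" using real_arch_simple by blast
    thus "\<forall>\<^sub>F n in sequentially. indicator {..real n} y * h y = h y"
     by (intro eventually_sequentiallyI[of N]) auto
   qed
  qed (use h M in "auto simp: indicator_def")
 qed (simp add: 0)
 have set0: "(LINT y:A|M. h y) = 0" if A: "A : sets borel" for A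
 proof -
  have "Int_stable (range (%a::real. {..a}))" by (auto simp: Int_stable_def)
  moreover have "range (%a::real. {..a}) <= Pow UNIV" by simp
  moreover have "A : sigma_sets UNIV (range (%a::real. {..a}))" using A by (simp add: borel_eq_atMost)
  ultimately show ?thesis
  proof (induct rule: sigma_sets_induct_disjoint)
   case (basic A) thus ?case using 0 by (auto simp: set_lebesgue_integral_def)
  next
   case empty thus ?case by (simp add: set_lebesgue_integral_def)
  next
   case (compl A)
   hence "A : sets M" using M(2) by (simp add: borel_eq_atMost)
   hence "integrable M (%y. indicator A y * h y)" using integrable_mult_indicator[OF _ h] by fastforce
   hence "(LINT y|M. h y - indicator A y * h y) = 0"
    using h total compl by (simp add: set_lebesgue_integral_def)
   moreover have "h y - indicator A y * h y = indicator (UNIV - A) y * h y" for y by (auto simp: indicator_def)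
   ultimately show ?case by (simp add: set_lebesgue_integral_def)
  next
   case (union A)
   have [measurable]: "A i : sets M" for i using union(2) M(2) by (auto simp: borel_eq_atMost)
   have "(LINT y:(\<Union>i. A i)|M. h y) = (\<Sum>i. LINT y:A i|M. h y)"
    using union(1) h by (intro lebesgue_integral_countable_add)
     (auto simp: disjoint_family_on_def set_integrable_def simp del: real_scaleR_def intro!: integrable_mult_indicator)
   thus ?case using union by simp
  qed
 qed
 have [measurable]: "h : borel_measurable M" using h by auto
 have [measurable]: "{x. h x > 0} : sets M" "{x. h x < 0} : sets M"
  using sp by (auto simp: M(2)[symmetric] Collect_conj_eq intro!: borel_measurable_less[of "%_. 0" M h, simplified sp, simplified]
    borel_measurable_less[of h M "%_. 0", simplified sp, simplified])
 have ii: "integrable M (%y. indicator A y * h y)" if "A : sets M" for A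
  using integrable_mult_indicator[OF that h] by simp
 have "AE y in M. indicator {x. h x > 0} y * h y = 0"
 proof (subst integral_nonneg_eq_0_iff_AE[symmetric])
  show "(LINT y|M. indicator {x. h x > 0} y * h y) = 0"
   using set0[of "{x. h x > 0}"] by (simp add: set_lebesgue_integral_def M(2)[symmetric])
  show "AE y in M. 0 <= indicator {x. h x > 0} y * h y" by (intro AE_I2) (simp split: split_indicator)
 qed (rule ii, simp)
 moreover have "AE y in M. - (indicator {x. h x < 0} y * h y) = 0"
 proof (subst integral_nonneg_eq_0_iff_AE[symmetric])
  show "(LINT y|M. - (indicator {x. h x < 0} y * h y)) = 0"
   using set0[of "{x. h x < 0}"] by (simp add: set_lebesgue_integral_def M(2)[symmetric])
  show "AE y in M. 0 <= - (indicator {x. h x < 0} y * h y)" by (intro AE_I2) (simp split: split_indicator)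
 qed (rule integrable_minus, rule ii, simp)
 ultimately show ?thesis
 proof eventually_elim
  case (elim x) thus ?case by (cases "h x" "0::real" rule: linorder_cases) (auto simp: indicator_def)
 qed
qed

section \<open>Zeros of coercive vector fields\<close>

lemma choice2: "ALL p. EX q r. Z p q r ==> EX q r. ALL p. Z p (q p) (r p)"
 by metis

text \<open>Lattice points are labelled by the sign of each component of \<open>A\<close>. Kuhn's
  lemma finds, in ever smaller cells and for each coordinate, two points with different labels; in
  the limit \<open>A z i\<close> has both weak signs, unless \<open>z i\<close> lies on the face
  that forced the label. Hence every term \<open>z i * A z i\<close> is non-positive, the coercivity
  assumption excludes the boundary, and \<open>A\<close> vanishes at the interior point. Continuity
  is phrased with sequences of coordinates because points are functions of the index.\<close>

lemma zero_in_cube: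
 fixes A :: "(nat => real) => nat => real" and K :: real
 assumes K: "K > 0"
  and cont: "!!X x i. [|!!j. j < n ==> (%k. X k j) ---> x j; !!k j. j < n ==> \<bar>X k j\<bar> <= K; i < n|]
         ==> (%k::nat. A (X k) i) ---> A x i"
  and pos: "!!x. [|!!i. i < n ==> \<bar>x i\<bar> <= K; EX i<n. \<bar>x i\<bar> = K|] ==> (SUM i<n. x i * A x i) > 0"
 shows "EX x. (ALL i<n. \<bar>x i\<bar> <= K) & (ALL i<n. A x i = 0)"
proof -
 define pt :: "nat => (nat => nat) => nat => real" where
  "pt p q i = K * (2 * real (q i) / real (Suc p) - 1)" for p q i
 \<comment> \<open>The two outermost layers carry the labels that Kuhn's lemma prescribes there,
   whatever the sign of \<open>A\<close>; these exceptions reappear as the alternatives with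
   \<open>- K\<close> in the facts \<open>lab\<close> and \<open>side\<close>.\<close>
 define lab :: "nat => (nat => nat) => nat => nat" where
  "lab p q i = (if q i = 0 then 0 else if q i = Suc p then 1 else if A (pt p q) i <= 0 then 0 else 1)" for p q i
 have pt_bd: "\<bar>pt p q i\<bar> <= K" if "q i <= Suc p" for p q i
 proof -
  have "real (q i) / real (Suc p) <= 1" "real (q i) / real (Suc p) >= 0" using that by (auto simp: divide_simps)
  hence "\<bar>2 * real (q i) / real (Suc p) - 1\<bar> <= 1" by linarith
  thus ?thesis unfolding pt_def abs_mult using K by (simp add: mult_left_le)
 qed
 define s :: "bool => real" where "s c = (if c then 1 else -1)" for c
 have lab: "s c * A (pt p q) i <= 0 \<or> s c * pt p q i = - K" if "(lab p q i = 0) = c" for c p q i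
  using that by (auto simp: lab_def pt_def s_def simp del: of_nat_Suc split: if_splits)
 define ok where "ok p q r \<longleftrightarrow> (ALL i<n. q i < Suc p) &
  (ALL i c. i < n --> (ALL j<n. q j <= r i c j & r i c j <= q j + 1) & (lab p (r i c) i = 0) = c)" for p q r
 have "EX q r. ok p q r" for p
 proof -
  obtain q where q: "ALL i<n. q i < Suc p"
   and q2: "ALL i<n. EX r s. (ALL j<n. q j <= r j & r j <= q j + 1) & (ALL j<n. q j <= s j & s j <= q j + 1) & lab p r i ~= lab p s i"
   by (rule kuhn_lemma[of "Suc p" n "lab p"]) (auto simp: lab_def)
  have "EX r. i < n --> (ALL j<n. q j <= r j & r j <= q j + 1) & (lab p r i = 0) = c" for i c
  proof (cases "i < n")
   case True
   then obtain r s where rs: "ALL j<n. q j <= r j & r j <= q j + 1" "ALL j<n. q j <= s j & s j <= q j + 1" "lab p r i ~= lab p s i"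
    using q2 by blast
   from rs(3) have "(lab p r i = 0) ~= (lab p s i = 0)" by (auto simp: lab_def split: if_splits)
   thus ?thesis using rs(1,2) by (cases "(lab p r i = 0) = c") blast+
  qed simp
  hence "ALL i. EX r. ALL c. i < n --> (ALL j<n. q j <= r c j & r c j <= q j + 1) & (lab p (r c) i = 0) = c" by (intro allI choice)
  from choice[OF this] show ?thesis using q unfolding ok_def by blast
 qed
 hence "EX q r. ALL p. ok p (q p) (r p)" by (intro choice2 allI)
 then obtain q r where ok: "!!p. ok p (q p) (r p)" by blast
 have q: "q p i < Suc p" if "i < n" for p i using ok[of p] that by (simp add: ok_def)
 have r: "q p j <= r p i c j & r p i c j <= q p j + 1" if "i < n" "j < n" for p i c j
  using ok[of p] that by (simp add: ok_def)
 have labr: "(lab p (r p i c) i = 0) = c" if "i < n" for p i c using ok[of p] that unfolding ok_def by blast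
 obtain si where si: "strict_mono (si::nat=>nat)" "!!j. j : {..<n} ==> EX l. (%k. pt (si k) (q (si k)) j) ---> l"
 proof (rule function_convergent_subsequence[of "{..<n}" "%k j. pt k (q k) j" K])
  show "norm (pt k (q k) j) <= K" if "j : {..<n}" for k j using that pt_bd[of "q k" j k] q[of j k] by auto
 qed auto
 define z where "z j = lim (%k. pt (si k) (q (si k)) j)" for j
 have z: "(%k. pt (si k) (q (si k)) j) ---> z j" if "j < n" for j
  using si(2)[of j] that unfolding z_def by (metis lessThan_iff limI)
 have close: "(%k. pt (si k) (w k) j) ---> z j"
  if "j < n" "!!k. q (si k) j <= w k j & w k j <= q (si k) j + 1" for j w
 proof -
  have "(%k. pt (si k) (w k) j - pt (si k) (q (si k)) j) ---> 0"
  proof (rule Lim_null_comparison)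
   show "\<forall>\<^sub>F k in sequentially. norm (pt (si k) (w k) j - pt (si k) (q (si k)) j) <= 2 * K * inverse (real (Suc k))"
   proof (intro always_eventually allI)
    fix k
    have "pt (si k) (w k) j - pt (si k) (q (si k)) j = 2 * K * ((real (w k j) - real (q (si k) j)) / real (Suc (si k)))"
     by (simp add: pt_def diff_divide_distrib right_diff_distrib mult.assoc mult.left_commute del: of_nat_Suc)
    moreover have "\<bar>(real (w k j) - real (q (si k) j)) / real (Suc (si k))\<bar> <= 1 / real (Suc (si k))"
     using that(2)[of k] by (auto simp: divide_simps)
    moreover have "1 / real (Suc (si k)) <= inverse (real (Suc k))"
     using seq_suble[OF si(1), of k] by (auto simp: divide_simps)
    ultimately have "\<bar>(real (w k j) - real (q (si k) j)) / real (Suc (si k))\<bar> <= inverse (real (Suc k))"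
     and *: "norm (pt (si k) (w k) j - pt (si k) (q (si k)) j) = 2 * K * \<bar>(real (w k j) - real (q (si k) j)) / real (Suc (si k))\<bar>"
     using K by (simp_all only: real_norm_def abs_mult abs_of_pos abs_numeral)
    thus "norm (pt (si k) (w k) j - pt (si k) (q (si k)) j) <= 2 * K * inverse (real (Suc k))"
     unfolding * using K by (intro mult_left_mono) auto
   qed
   show "(%k. 2 * K * inverse (real (Suc k))) ---> 0"
    using tendsto_mult_right_zero[OF LIMSEQ_inverse_real_of_nat, of "2*K"] by simp
  qed
  from tendsto_add[OF this z[OF that(1)]] show ?thesis by simp
 qed
 have zK: "\<bar>z i\<bar> <= K" if "i < n" for i
 proof (rule tendsto_upperbound[OF tendsto_rabs[OF z[OF that]]])
  show "\<forall>\<^sub>F k in sequentially. \<bar>pt (si k) (q (si k)) i\<bar> <= K"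
   using pt_bd q that by (intro always_eventually allI) (auto simp: less_imp_le)
 qed auto
 have side: "s c * A z i <= 0 \<or> s c * z i = - K" if i: "i < n" for i c
 proof (rule ccontr)
  assume neg: "~ ?thesis"
  define y where "y k = pt (si k) (r (si k) i c)" for k
  have yz: "(%k. y k j) ---> z j" if "j < n" for j
   unfolding y_def using r[OF i that] by (intro close that) auto
  have "\<bar>y k j\<bar> <= K" if "j < n" for k j
   unfolding y_def using r[OF i that, of "si k" c] q[OF that, of "si k"] by (intro pt_bd) auto
  hence "(%k. A (y k) i) ---> A z i" by (intro cont yz i)
  from tendsto_mult_left[OF this, of "s c"] have "\<forall>\<^sub>F k in sequentially. s c * A (y k) i > 0"
   using neg by (intro order_tendstoD(1)) auto
  moreover have "s c * z i > - K" using neg zK[OF i] by (cases c) (auto simp: s_def)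
  hence "\<forall>\<^sub>F k in sequentially. s c * y k i > - K" by (rule order_tendstoD(1)[OF tendsto_mult_left[OF yz[OF i]]])
  ultimately have "\<forall>\<^sub>F k in sequentially. False"
  proof eventually_elim
   case (elim k)
   thus ?case using lab[OF labr[OF i, of "si k" c]] by (simp add: y_def)
  qed
  thus False by simp
 qed
 have upper: "A z i <= 0 \<or> z i = -K" and lower: "A z i >= 0 \<or> z i = K" if "i < n" for i
  using side[OF that, of True] side[OF that, of False] by (auto simp: s_def)
 have "z i * A z i <= 0" if "i < n" for i using upper[OF that] lower[OF that] K by (auto simp: mult_le_0_iff)
 hence "(SUM i<n. z i * A z i) <= 0" by (intro sum_nonpos) auto
 hence ne: "\<bar>z i\<bar> ~= K" if "i < n" for i using pos[of z] zK that by force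
 have "A z i = 0" if "i < n" for i using upper[OF that] lower[OF that] ne[OF that] K by auto
 thus ?thesis using zK by auto
qed

section \<open>The polynomials \<open>\<Phi>\<^sub>n\<close>\<close>

definition binform :: "(nat => real) => nat => real => real => real" where
 "binform c n x y = (SUM j<=n. c j * x ^ j * y ^ (n - j))"

lemma binform_nonneg:
 "(!!j. j <= n ==> c j >= 0) ==> x >= 0 ==> y >= 0 ==> binform c n x y >= 0"
 unfolding binform_def by (intro sum_nonneg mult_nonneg_nonneg) auto

lemma mult_x_binform:
 "x * binform c n x y = binform (%j. if j = 0 then 0 else c (j - 1)) (Suc n) x y"
 unfolding binform_def by (subst sum.atMost_Suc_shift) (simp add: sum_distrib_left mult_ac)

lemma mult_y_binform:
 "y * binform c n x y = binform (%j. if j <= n then c j else 0) (Suc n) x y"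
 unfolding binform_def by (simp add: sum_distrib_left mult_ac Suc_diff_le)

lemma binform_add: "binform c n x y + binform d n x y = binform (%j. c j + d j) n x y"
 by (simp add: binform_def sum.distrib algebra_simps)

lemma binform_cmult: "k * binform c n x y = binform (%j. k * c j) n x y"
 by (simp add: binform_def sum_distrib_left mult_ac)

lemma binform_cong: "(!!j. j <= n ==> c j = d j) ==> binform c n x y = binform d n x y"
 unfolding binform_def by (intro sum.cong) auto

lemma binform_deriv_decomp:
 "(SUM j<=Suc m. c j * (real j * p * x ^ (j - 1) * y ^ (Suc m - j) + x ^ j * (real (Suc m - j) * q * y ^ (Suc m - j - 1))))
  = binform (%j. c (Suc j) * real (Suc j)) m x y * p + binform (%j. c j * (real (Suc m) - real j)) m x y * q"
proof -
 have "(SUM j<=Suc m. c j * (real j * p * x ^ (j - 1) * y ^ (Suc m - j)))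
   = (SUM j<=m. c (Suc j) * (real (Suc j) * p * x ^ j * y ^ (m - j)))" by (subst sum.atMost_Suc_shift) simp
 moreover have "(SUM j<=Suc m. c j * (x ^ j * (real (Suc m - j) * q * y ^ (Suc m - j - 1))))
   = (SUM j<=m. c j * (x ^ j * ((real (Suc m) - real j) * q * y ^ (m - j))))"
  by (simp add: Suc_diff_le of_nat_diff)
 ultimately show ?thesis
  unfolding binform_def by (simp only: sum.distrib distrib_left sum_distrib_right) (simp add: mult_ac)
qed

lemma has_derivative_binform:
 assumes "(f has_real_derivative f') (at t)" "(g has_real_derivative g') (at t)"
 shows "((%t. binform c (Suc m) (f t) (g t)) has_real_derivative
  binform (%j. c (Suc j) * real (Suc j)) m (f t) (g t) * f' +
  binform (%j. c j * (real (Suc m) - real j)) m (f t) (g t) * g') (at t)"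
proof -
 have "((%t. binform c (Suc m) (f t) (g t)) has_real_derivative
  (SUM j<=Suc m. c j * (real j * f' * f t ^ (j - 1) * g t ^ (Suc m - j) + f t ^ j * (real (Suc m - j) * g' * g t ^ (Suc m - j - 1))))) (at t)"
  unfolding binform_def by (rule DERIV_sum) (rule derivative_eq_intros assms refl | simp add: algebra_simps)+
 thus ?thesis by (simp only: binform_deriv_decomp)
qed

lemma alpha_pos:
 assumes "R > 0" "mu > 0" "n >= 2" "k < n" shows "alpha R mu k n > 0"
proof -
 have "real k + mu * (real n - real k - 1) > 0"
 proof (cases "k = 0")
  case True thus ?thesis using assms by simp
 next
  case False
  have "mu * (real n - real k - 1) >= 0" using assms by (intro mult_nonneg_nonneg) auto
  thus ?thesis using False by simp
 qed
 thus ?thesis using assms by (simp add: alpha_def)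
qed

text \<open>The factors by which the coefficients of \<open>Phi\<close> exceed binomial ones: if all
  were 1, \<open>Phi\<close> would be the n-th power of X_1 + X_2. The bounds 1 and (1+R)/R enclose
  \<open>Phi\<close> between the n-th powers of X_1 + X_2 and of (1+R)/R times it; this is the
  origin of the constant in (l3).\<close>

definition rho :: "real => real => nat => nat => real" where
 "rho R mu n k = (real k + alpha R mu k n) / alpha R mu k n"

lemma rho_alt: "R > 0 ==> mu > 0 ==> n >= 2 ==> k < n ==> rho R mu n k = 1 + real k / alpha R mu k n"
 using alpha_pos[of R mu n k] by (simp add: rho_def field_simps)

lemma rho_bounds:
 assumes "R > 0" "mu > 0" "n >= 2" "k < n"
 shows "1 <= rho R mu n k" (is ?A) "rho R mu n k <= (1 + R) / R" (is ?B)
proof -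
 note al = alpha_pos[OF assms]
 show ?A using al by (simp add: rho_alt[OF assms])
 have "mu * (real n - real k - 1) >= 0" using assms by (intro mult_nonneg_nonneg) auto
 hence "R * real k <= alpha R mu k n" using assms by (simp add: alpha_def)
 hence "real k / alpha R mu k n <= 1 / R" using al assms by (simp add: field_simps)
 thus ?B using assms by (simp add: rho_alt[OF assms] field_simps)
qed

lemma rho_mono:
 assumes "R > 0" "mu > 0" "n >= 2" "Suc k < n"
 shows "rho R mu n k <= rho R mu n (Suc k)"
proof -
 have k: "k < n" using assms by simp
 have al: "alpha R mu k n > 0" "alpha R mu (Suc k) n > 0" using alpha_pos assms k by blast+
 have "real k * alpha R mu (Suc k) n <= real (Suc k) * alpha R mu k n"
 proof -
  have "real (Suc k) * alpha R mu k n - real k * alpha R mu (Suc k) n = R * mu * (real n - 1)"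
   by (simp add: alpha_def algebra_simps)
  moreover have "0 <= R * mu * (real n - 1)" using assms by (intro mult_nonneg_nonneg) auto
  ultimately show ?thesis by linarith
 qed
 hence "real k / alpha R mu k n <= real (Suc k) / alpha R mu (Suc k) n" using al by (simp add: divide_le_eq pos_le_divide_eq mult_ac del: of_nat_Suc)
 thus ?thesis using rho_alt[OF assms(1-3) k] rho_alt[OF assms] by simp
qed

lemma acoef_rho: "acoef R mu j n = real (n choose j) * (\<Prod>k<j. rho R mu n k)"
 by (simp add: acoef_def rho_def)

lemma acoef_pos:
 assumes "R > 0" "mu > 0" "n >= 2" "j <= n" shows "acoef R mu j n > 0" unfolding acoef_rho
proof (intro mult_pos_pos prod_pos)
 fix k assume "k : {..<j}"
 hence "1 <= rho R mu n k" using assms by (intro rho_bounds) auto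
 thus "0 < rho R mu n k" by simp
qed (use assms in auto)

lemma acoef_bounds:
 assumes "R > 0" "mu > 0" "n >= 2" "j <= n"
 shows "real (n choose j) <= acoef R mu j n" (is ?A) "acoef R mu j n <= real (n choose j) * ((1 + R) / R) ^ j" (is ?B)
proof -
 have "1 <= (\<Prod>k<j. rho R mu n k)" using assms by (intro prod_ge_1 rho_bounds) auto
 thus ?A unfolding acoef_rho by (simp add: mult_le_cancel_left1)
 have "(\<Prod>k<j. rho R mu n k) <= (\<Prod>k<j. (1 + R) / R)"
 proof (intro prod_mono conjI)
  fix k assume "k : {..<j}"
  hence "k < n" using assms by simp
  from rho_bounds[OF assms(1-3) this] show "0 <= rho R mu n k" "rho R mu n k <= (1 + R) / R" by auto
 qed
 thus ?B unfolding acoef_rho by (intro mult_left_mono) auto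
qed

lemma acoef_Suc:
 assumes "j < n" shows "acoef R mu (Suc j) n * real (Suc j) = rho R mu n j * acoef R mu j n * (real n - real j)"
proof -
 have "(n choose Suc j) * Suc j = (n choose j) * (n - j)"
  by (metis binomial_absorb_comp binomial_absorption mult.commute)
 hence "real (n choose Suc j) * real (Suc j) = real (n choose j) * (real n - real j)"
  using assms by (metis less_imp_le of_nat_diff of_nat_mult)
 thus ?thesis unfolding acoef_rho by (simp only: prod.lessThan_Suc) (simp only: mult.assoc mult.left_commute mult.commute[of "real (Suc j)"], simp add: mult_ac)
qed

lemma Phi_binform: "Phi R mu n X = binform (%j. acoef R mu j n) n (fst X) (snd X)"
 by (simp add: Phi_def binform_def atMost_atLeast0)

lemma Phi_lower:
 assumes "R > 0" "mu > 0" "n >= 2" "x >= 0" "y >= 0"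
 shows "(x + y) ^ n <= Phi R mu n (x, y)" unfolding Phi_binform binform_def binomial_ring using assms
 by (auto intro!: sum_mono mult_right_mono acoef_bounds)

lemma Phi_upper:
 assumes "R > 0" "mu > 0" "n >= 2" "x >= 0" "y >= 0"
 shows "Phi R mu n (x, y) <= ((1 + R) / R * (x + y)) ^ n"
proof -
 have q: "(1 + R) / R >= 1" using assms by simp
 have "Phi R mu n (x, y) <= (SUM j<=n. ((1 + R) / R) ^ n * (real (n choose j) * x ^ j * y ^ (n - j)))"
  unfolding Phi_binform binform_def
 proof (rule sum_mono)
  fix j assume j: "j : {..n}"
  have "acoef R mu j n <= real (n choose j) * ((1 + R) / R) ^ j" using assms j by (intro acoef_bounds) auto
  also have "... <= real (n choose j) * ((1 + R) / R) ^ n" using j q by (intro mult_left_mono power_increasing) auto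
  finally have "acoef R mu j n * (x ^ j * y ^ (n - j)) <= real (n choose j) * ((1 + R) / R) ^ n * (x ^ j * y ^ (n - j))"
   using assms by (intro mult_right_mono) auto
  thus "acoef R mu j n * fst (x, y) ^ j * snd (x, y) ^ (n - j) <= ((1 + R) / R) ^ n * (real (n choose j) * x ^ j * y ^ (n - j))"
   by (simp add: mult_ac)
 qed
 also have "... = ((1 + R) / R * (x + y)) ^ n"
  by (simp only: power_mult_distrib binomial_ring sum_distrib_left)
 finally show ?thesis .
qed

context
 fixes R mu :: real and m n :: nat
 assumes R: "R > 0" and mu: "mu > 0" and n: "n = Suc (Suc m)"
begin

lemma nfacts: "n >= 2" "real (Suc m) = real n - 1" "Suc m < n" "m < n" "j <= m ==> j < n" "j <= m ==> Suc j < n"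
 "j <= Suc m \<longleftrightarrow> j < n" "j <= m ==> real j + 2 <= real n" by (auto simp: n)

private abbreviation (input) "A j \<equiv> acoef R mu j n"
private abbreviation (input) "c2 j \<equiv> A j * (real n - real j) * (real n - 1 - real j)"

text \<open>Gradient and Hessian entries as forms of degree n - 1 and n - 2. Writing n = Suc (Suc m)
  avoids truncated subtraction in these degrees.\<close>

definition "Phi1d = binform (%j. A (Suc j) * real (Suc j)) (Suc m)"
definition "Phi2d = binform (%j. A j * (real n - real j)) (Suc m)"
definition "Phi11 = binform (%j. A (Suc (Suc j)) * real (Suc (Suc j)) * real (Suc j)) m"
definition "Phi12 = binform (%j. A (Suc j) * real (Suc j) * (real n - 1 - real j)) m"
definition "Phi22 = binform (%j. A j * (real n - real j) * (real n - 1 - real j)) m"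

lemma Phi_deriv:
 assumes "(f has_real_derivative f') (at t)" "(g has_real_derivative g') (at t)"
 shows "((%t. Phi R mu n (f t, g t)) has_real_derivative Phi1d (f t) (g t) * f' + Phi2d (f t) (g t) * g') (at t)" (is ?A)
  and "((%t. Phi1d (f t) (g t)) has_real_derivative Phi11 (f t) (g t) * f' + Phi12 (f t) (g t) * g') (at t)" (is ?B)
  and "((%t. Phi2d (f t) (g t)) has_real_derivative Phi12 (f t) (g t) * f' + Phi22 (f t) (g t) * g') (at t)" (is ?C)
proof -
 show ?A using has_derivative_binform[OF assms, of "%j. A j" "Suc m", folded n]
  unfolding Phi_binform Phi1d_def Phi2d_def fst_conv snd_conv .
 show ?B using has_derivative_binform[OF assms, of "%j. A (Suc j) * real (Suc j)" "m", unfolded nfacts(2)]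
  unfolding Phi1d_def Phi11_def Phi12_def .
 have e: "binform (%j. A (Suc j) * (real n - real (Suc j)) * real (Suc j)) m (f t) (g t) = Phi12 (f t) (g t)"
  unfolding Phi12_def by (intro binform_cong) simp
 show ?C using has_derivative_binform[OF assms, of "%j. A j * (real n - real j)" "m", unfolded nfacts(2) e]
  unfolding Phi2d_def Phi22_def .
qed

lemma Phi12_alt: "Phi12 = binform (%j. rho R mu n j * c2 j) m"
 unfolding Phi12_def by (intro ext binform_cong) (simp only: acoef_Suc[OF nfacts(5)] mult.assoc)

lemma Phi11_alt: "Phi11 = binform (%j. rho R mu n (Suc j) * rho R mu n j * c2 j) m"
 unfolding Phi11_def
proof (intro ext binform_cong)
 fix j assume j: "j <= m"
 have "A (Suc (Suc j)) * real (Suc (Suc j)) * real (Suc j) = rho R mu n (Suc j) * (A (Suc j) * real (Suc j)) * (real n - 1 - real j)"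
  by (subst acoef_Suc[OF nfacts(6)[OF j]]) simp
 thus "A (Suc (Suc j)) * real (Suc (Suc j)) * real (Suc j) = rho R mu n (Suc j) * rho R mu n j * c2 j"
  by (subst (asm) acoef_Suc[OF nfacts(5)[OF j]]) (simp add: mult_ac)
qed

lemma c2_nonneg: "j <= m ==> c2 j >= 0"
 using acoef_pos[OF R mu nfacts(1), of j] nfacts(5,8)[of j] by (intro mult_nonneg_nonneg) auto

lemma rho_ge1: "j <= Suc m ==> rho R mu n j >= 1"
 using R mu nfacts(1,7) by (intro rho_bounds) auto

lemma Phi_hess_nonneg:
 assumes "x >= 0" "y >= 0"
 shows "Phi11 x y >= 0" "Phi12 x y >= 0" "Phi22 x y >= 0"
proof -
 show "Phi11 x y >= 0" unfolding Phi11_alt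
 proof (intro binform_nonneg assms)
  fix j assume j: "j <= m"
  hence "0 <= rho R mu n (Suc j)" "0 <= rho R mu n j" using rho_ge1[of j] rho_ge1[of "Suc j"] by simp_all
  thus "0 <= rho R mu n (Suc j) * rho R mu n j * c2 j"
   using c2_nonneg[OF j] by (simp only: mult_nonneg_nonneg)
 qed
 show "Phi12 x y >= 0" unfolding Phi12_alt
 proof (intro binform_nonneg assms)
  fix j assume j: "j <= m"
  hence "0 <= rho R mu n j" using rho_ge1[of j] by simp
  thus "0 <= rho R mu n j * c2 j" using c2_nonneg[OF j] by (simp only: mult_nonneg_nonneg)
 qed
 show "Phi22 x y >= 0" unfolding Phi22_def using c2_nonneg by (intro binform_nonneg assms)
qed

text \<open>With \<open>c\<^sub>j\<close> the coefficients of \<open>\<partial>\<^sub>2\<^sub>2\<Phi>\<close>, those of \<open>\<partial>\<^sub>1\<^sub>2\<Phi>\<close> and \<open>\<partial>\<^sub>1\<^sub>1\<Phi>\<close> are \<open>\<rho>\<^sub>j c\<^sub>j\<close> and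
 \<open>\<rho>\<^sub>j \<rho>\<^sub>j\<^sub>+\<^sub>1 c\<^sub>j\<close> with \<open>\<rho>\<close> increasing, so that the Hessian determinant is controlled by Cauchy-Schwarz.\<close>

lemma Phi_hess_det:
 assumes "x >= 0" "y >= 0"
 shows "(Phi12 x y)^2 <= Phi11 x y * Phi22 x y"
proof -
 define w where "w j = c2 j * x ^ j * y ^ (m - j)" for j
 have w: "w j >= 0" if "j <= m" for j unfolding w_def using c2_nonneg[OF that] assms by auto
 have "(Phi12 x y)^2 = (SUM j<=m. (rho R mu n j * sqrt (w j)) * sqrt (w j))^2"
  unfolding Phi12_alt binform_def using w by (intro arg_cong[where f="%s. s^2"] sum.cong) (auto simp: w_def mult_ac)
 also have "... <= (SUM j<=m. (rho R mu n j * sqrt (w j))^2) * (SUM j<=m. (sqrt (w j))^2)"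
  by (rule Cauchy_Schwarz_ineq_sum)
 also have "(SUM j<=m. (sqrt (w j))^2) = Phi22 x y"
  unfolding Phi22_def binform_def using w by (intro sum.cong) (auto simp: w_def)
 also have "(SUM j<=m. (rho R mu n j * sqrt (w j))^2) <= Phi11 x y" unfolding Phi11_alt binform_def
 proof (rule sum_mono)
  fix j assume j: "j : {..m}"
  have "(rho R mu n j * sqrt (w j))^2 = (rho R mu n j * rho R mu n j) * w j" using w j by (simp add: power_mult_distrib power2_eq_square)
  also have "... <= (rho R mu n (Suc j) * rho R mu n j) * w j"
   using j R mu w rho_ge1[of j] nfacts(1,6) by (intro mult_right_mono rho_mono) auto
  finally show "(rho R mu n j * sqrt (w j))^2 <= rho R mu n (Suc j) * rho R mu n j * c2 j * x ^ j * y ^ (m - j)"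
   by (simp add: w_def mult_ac)
 qed
 finally show ?thesis using Phi_hess_nonneg(3)[OF assms] by (simp add: mult_right_mono)
qed

text \<open>The off-diagonal entries of Hessian times mobility matrix coincide, the mobility matrix
  having the rows X_1 (1+R, R) and mu R X_2 (1, 1). Comparing the coefficients of X_1^j X_2^(n-1-j)
  gives exactly a_(j+1) (j+1) alpha_j = (j + alpha_j) a_j (n - j): this requirement is where
  alpha_(k,n) and a_(j,n) come from.\<close>

lemma Phi_symmetry:
 "R * x * Phi11 x y + mu * R * y * Phi12 x y = (1 + R) * x * Phi12 x y + mu * R * y * Phi22 x y"
proof -
 let ?a = "%j. A (Suc j) * real (Suc j) * real j"
 have "x * Phi11 x y = binform (%j. A (Suc j) * real (Suc j) * real j) (Suc m) x y"
  unfolding Phi11_def mult_x_binform by (intro binform_cong) (auto simp: gr0_conv_Suc)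
 moreover have "y * Phi12 x y = binform (%j. A (Suc j) * real (Suc j) * (real n - 1 - real j)) (Suc m) x y"
  unfolding Phi12_def mult_y_binform by (intro binform_cong) (auto simp: nfacts(2)[symmetric] le_Suc_eq)
 moreover have "x * Phi12 x y = binform (%j. A j * real j * (real n - real j)) (Suc m) x y"
  unfolding Phi12_def mult_x_binform by (intro binform_cong) (auto simp: gr0_conv_Suc)
 moreover have "y * Phi22 x y = binform (%j. A j * (real n - real j) * (real n - 1 - real j)) (Suc m) x y"
  unfolding Phi22_def mult_y_binform by (intro binform_cong) (auto simp: nfacts(2)[symmetric] le_Suc_eq)
 moreover have "R * (A (Suc j) * real (Suc j) * real j) + mu * R * (A (Suc j) * real (Suc j) * (real n - 1 - real j))
   = (1 + R) * (A j * real j * (real n - real j)) + mu * R * (A j * (real n - real j) * (real n - 1 - real j))"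
  if "j <= Suc m" for j
 proof -
  have al: "alpha R mu j n > 0" using that nfacts(1,7) by (intro alpha_pos R mu) auto
  have r: "A (Suc j) * real (Suc j) = rho R mu n j * A j * (real n - real j)" using that nfacts(7) by (intro acoef_Suc) simp
  have "A (Suc j) * real (Suc j) * alpha R mu j n = (real j + alpha R mu j n) * A j * (real n - real j)"
   unfolding r using al by (simp add: rho_def)
  thus ?thesis by (simp add: alpha_def algebra_simps)
 qed
 ultimately show ?thesis
  by (simp only: mult.assoc binform_cmult binform_add) (intro binform_cong, simp only: mult.assoc)
qed

text \<open>The integrand that appears when the system is tested with the gradient of
  \<open>Phi\<close>. By \<open>Phi_symmetry\<close> it is a quadratic form with a symmetric matrix,
  so non-negative diagonal entries and determinant suffice; where the first diagonal entry vanishes,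
  so does the mixed one.\<close>

lemma Phi_dissipation:
 assumes "x >= 0" "y >= 0"
 shows "0 <= (Phi11 x y * ze + Phi12 x y * et) * (x * ((1 + R) * ze + R * et))
      + (Phi12 x y * ze + Phi22 x y * et) * (mu * R * (y * (ze + et)))"
proof -
 let ?a = "Phi11 x y" and ?b = "Phi12 x y" and ?c = "Phi22 x y"
 note nn = Phi_hess_nonneg[OF assms]
 define P where "P = (1 + R) * x * ?a + mu * R * y * ?b"
 define S where "S = R * x * ?a + mu * R * y * ?b"
 define Q where "Q = R * x * ?b + mu * R * y * ?c"
 have S': "S = (1 + R) * x * ?b + mu * R * y * ?c" unfolding S_def by (rule Phi_symmetry)
 have PQ: "P >= 0" "Q >= 0" unfolding P_def Q_def using nn assms R mu by auto
 \<comment> \<open>Multiplicativity of the determinant: the second factor is the determinant of the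
   mobility matrix.\<close>
 have "P * Q - S * S = (?a * ?c - ?b^2) * (mu * R * x * y)"
  unfolding P_def Q_def by (subst (2) S') (simp add: S_def algebra_simps power2_eq_square)
 moreover have "... >= 0" using Phi_hess_det[OF assms] assms R mu by (intro mult_nonneg_nonneg) auto
 ultimately have det: "S * S <= P * Q" by linarith
 have "0 <= P * ze^2 + 2 * S * ze * et + Q * et^2"
 proof (cases "P = 0")
  case True
  hence "S^2 <= 0" using det by (simp add: power2_eq_square)
  hence "S = 0" by simp
  thus ?thesis using True PQ by simp
 next
  case False
  have "P * (P * ze^2 + 2 * S * ze * et + Q * et^2) = (P * ze + S * et)^2 + (P * Q - S * S) * et^2"
   by (simp add: algebra_simps power2_eq_square)
  also have "... >= 0" using det by (intro add_nonneg_nonneg mult_nonneg_nonneg) auto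
  finally show ?thesis using False PQ by (simp add: zero_le_mult_iff)
 qed
 also have "P * ze^2 + 2 * S * ze * et + Q * et^2 = P * ze^2 + S * ze * et + S * ze * et + Q * et^2" by simp
 also have "... = (?a * ze + ?b * et) * (x * ((1 + R) * ze + R * et))
      + (?b * ze + ?c * et) * (mu * R * (y * (ze + et)))"
  by (subst (2) S') (simp add: P_def Q_def S_def algebra_simps power2_eq_square)
 finally show ?thesis .
qed

text \<open>Convexity in the form in which it is used, both for the implicit time step and for lower
  semicontinuity. The mean value theorem is applied twice along the segment, on which the Hessian is
  positive semidefinite since the segment stays in the quadrant.\<close>

lemma Phi_tangent:
 assumes "x1 >= 0" "x2 >= 0" "y1 >= 0" "y2 >= 0"
 shows "Phi R mu n (x1, x2) + Phi1d x1 x2 * (y1 - x1) + Phi2d x1 x2 * (y2 - x2) <= Phi R mu n (y1, y2)"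
proof -
 define f where "f t = x1 + t * (y1 - x1)" for t
 define g where "g t = x2 + t * (y2 - x2)" for t
 have f: "(f has_real_derivative (y1 - x1)) (at t)" for t unfolding f_def by (auto intro!: derivative_eq_intros)
 have g: "(g has_real_derivative (y2 - x2)) (at t)" for t unfolding g_def by (auto intro!: derivative_eq_intros)
 have pos: "f t >= 0" "g t >= 0" if "0 <= t" "t <= 1" for t
 proof -
  have "f t = (1 - t) * x1 + t * y1" "g t = (1 - t) * x2 + t * y2" by (auto simp: f_def g_def algebra_simps)
  thus "f t >= 0" "g t >= 0" using assms that by auto
 qed
 let ?h' = "%t. Phi1d (f t) (g t) * (y1 - x1) + Phi2d (f t) (g t) * (y2 - x2)"
 let ?h'' = "%t. (Phi11 (f t) (g t) * (y1 - x1) + Phi12 (f t) (g t) * (y2 - x2)) * (y1 - x1)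
   + (Phi12 (f t) (g t) * (y1 - x1) + Phi22 (f t) (g t) * (y2 - x2)) * (y2 - x2)"
 have d1: "((%t. Phi R mu n (f t, g t)) has_real_derivative ?h' t) (at t)" for t by (rule Phi_deriv[OF f g])
 have d2: "(?h' has_real_derivative ?h'' t) (at t)" for t by (intro DERIV_add DERIV_cmult_right Phi_deriv f g)
 have h'': "?h'' t >= 0" if "0 <= t" "t <= 1" for t
 proof -
  let ?a = "Phi11 (f t) (g t)" and ?b = "Phi12 (f t) (g t)" and ?c = "Phi22 (f t) (g t)"
  note nn = Phi_hess_nonneg[OF pos[OF that]] and det = Phi_hess_det[OF pos[OF that]]
  have "0 <= ?a * ze^2 + 2 * ?b * ze * et + ?c * et^2" for ze et
  proof (cases "?a = 0")
   case True hence "?b = 0" using det by simp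
   thus ?thesis using True nn by simp
  next
   case False
   have "?a * (?a * ze^2 + 2 * ?b * ze * et + ?c * et^2) = (?a * ze + ?b * et)^2 + (?a * ?c - ?b^2) * et^2"
    by (simp add: algebra_simps power2_eq_square)
   also have "... >= 0" using det by (intro add_nonneg_nonneg mult_nonneg_nonneg) auto
   finally show ?thesis using False nn by (simp add: zero_le_mult_iff)
  qed
  from this[of "y1 - x1" "y2 - x2"] show ?thesis by (simp add: algebra_simps power2_eq_square)
 qed
 obtain s where s: "0 < s" "s < 1" "Phi R mu n (f 1, g 1) - Phi R mu n (f 0, g 0) = (1 - 0) * ?h' s"
  using MVT2[of 0 1 "%t. Phi R mu n (f t, g t)" ?h'] d1 by auto
 obtain r where r: "0 < r" "r < s" "?h' s - ?h' 0 = (s - 0) * ?h'' r" using MVT2[of 0 s ?h' ?h''] d2 s by auto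
 have "(s - 0) * ?h'' r >= 0" using s r h''[of r] by (intro mult_nonneg_nonneg) auto
 hence "?h' 0 <= ?h' s" using r(3) by linarith
 thus ?thesis using s(3) by (simp add: f_def g_def)
qed

lemma Phi_convex: "convex_on {X. 0 <= fst X & 0 <= snd X} (Phi R mu n)"
proof (rule convex_onI)
 show "convex {X :: real * real. 0 <= fst X & 0 <= snd X}" by (rule convexI) auto
 fix t :: real and X Y :: "real * real"
 assume t: "0 < t" "t < 1" and X: "X : {X. 0 <= fst X & 0 <= snd X}" and Y: "Y : {X. 0 <= fst X & 0 <= snd X}"
 define z1 where "z1 = (1 - t) * fst X + t * fst Y"
 define z2 where "z2 = (1 - t) * snd X + t * snd Y"
 have z: "z1 >= 0" "z2 >= 0" using t X Y by (auto simp: z1_def z2_def)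
 have Z: "(1 - t) *\<^sub>R X + t *\<^sub>R Y = (z1, z2)" by (cases X, cases Y) (simp add: z1_def z2_def)
 define p q r where "p = Phi1d z1 z2" and "q = Phi2d z1 z2" and "r = Phi R mu n (z1, z2)"
 have "r + p * (fst X - z1) + q * (snd X - z2) <= Phi R mu n X"
  using Phi_tangent[OF z, of "fst X" "snd X"] X unfolding p_def q_def r_def by simp
 hence 1: "(1 - t) * (r + p * (fst X - z1) + q * (snd X - z2)) <= (1 - t) * Phi R mu n X"
  using t by (intro mult_left_mono) auto
 have "r + p * (fst Y - z1) + q * (snd Y - z2) <= Phi R mu n Y"
  using Phi_tangent[OF z, of "fst Y" "snd Y"] Y unfolding p_def q_def r_def by simp
 hence 2: "t * (r + p * (fst Y - z1) + q * (snd Y - z2)) <= t * Phi R mu n Y"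
  using t by (intro mult_left_mono) auto
 have "(1 - t) * (r + p * (fst X - z1) + q * (snd X - z2)) + t * (r + p * (fst Y - z1) + q * (snd Y - z2))
   = r + p * ((1 - t) * fst X + t * fst Y - z1) + q * ((1 - t) * snd X + t * snd Y - z2)"
  by (simp add: algebra_simps)
 also have "... = r" unfolding z1_def[symmetric] z2_def[symmetric] by simp
 finally show "Phi R mu n ((1 - t) *\<^sub>R X + t *\<^sub>R Y) <= (1 - t) * Phi R mu n X + t * Phi R mu n Y"
  using 1 2 unfolding Z r_def by linarith
qed

end

section \<open>Primitives and weak convergence\<close>

text \<open>Lebesgue measure on \<open>S\<close> as a density on the whole line: integrands remain
  Borel functions on all reals, and one notion of measurability serves all sets \<open>S\<close>.
  The transfer to \<open>lebesgue_on\<close> is made by \<open>lebesgue_on_mes\<close>.\<close>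

definition mes :: "real set => real measure" where
 "mes S = density lborel (%x. ennreal (indicator S x))"

lemma sets_mes [simp, measurable_cong]: "sets (mes S) = sets borel" by (simp add: mes_def)
lemma space_mes [simp]: "space (mes S) = UNIV" by (simp add: mes_def)
lemma measurable_mes [simp]: "measurable (mes S) N = measurable borel N"
 by (rule measurable_cong_sets) auto

lemma integral_mes:
 fixes f :: "real => 'b::euclidean_space"
 assumes [measurable]: "S : sets borel" "f : BM"
 shows "(LINT x|(mes S). f x) = (LINT x|lborel. indicator S x *\<^sub>R f x)"
 unfolding mes_def by (rule integral_density) auto

lemma integrable_mes:
 fixes f :: "real => 'b::euclidean_space"
 assumes [measurable]: "S : sets borel" "f : BM"
 shows "integrable (mes S) f \<longleftrightarrow> integrable lborel (%x. indicator S x *\<^sub>R f x)"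
 unfolding mes_def by (rule integrable_density) auto

lemma AE_mes: "S : sets borel ==> (AE x in mes S. P x) \<longleftrightarrow> (AE x in lborel. x : S --> P x)"
 unfolding mes_def by (subst AE_density) (auto simp: indicator_def)

lemma emeasure_mes:
 assumes [measurable]: "S : sets borel" "A : sets borel"
 shows "emeasure (mes S) A = emeasure lborel (S \<inter> A)"
proof -
 have "ennreal (indicator S x) * indicator A x = indicator (S \<inter> A) x" for x
  by (simp split: split_indicator)
 hence "emeasure (mes S) A = (\<integral>\<^sup>+x. indicator (S \<inter> A) x \<partial>lborel)"
  unfolding mes_def by (subst emeasure_density) auto
 thus ?thesis by simp
qed

lemma sigma_finite_mes: "S : sets borel ==> sigma_finite_measure (mes S)"
 unfolding mes_def by (subst sigma_finite_measure.sigma_finite_iff_density_finite[OF sigma_finite_lborel]) auto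

lemma finite_mes: "S : sets borel ==> emeasure lborel S < \<infinity> ==> finite_measure (mes S)"
 by (rule finite_measureI) (auto simp: emeasure_mes)

lemma emeasure_mes_singleton: "S : sets borel ==> emeasure (mes S) {x} = 0"
 by (cases "x : S") (auto simp: emeasure_mes)

lemma lebesgue_on_mes:
 fixes f :: "real => 'b::euclidean_space"
 assumes S: "S : sets borel" and f: "f : BM"
 shows "(LINT x|(lebesgue_on S). f x) = (LINT x|(mes S). f x)" (is ?A)
  and "integrable (lebesgue_on S) f \<longleftrightarrow> integrable (mes S) f" (is ?B)
  and "(AE x in lebesgue_on S. P x) \<longleftrightarrow> (AE x in mes S. P x)" (is ?C)
  and "f : borel_measurable (lebesgue_on S)" (is ?D)
proof -
 note [measurable] = S f
 have S': "S : sets lebesgue" using S by simp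
 show ?A using S' by (simp add: integral_restrict_space integral_mes integral_completion)
 show ?B using S' by (simp add: integrable_restrict_space integrable_mes integrable_completion)
 show ?C using S' by (simp add: AE_restrict_space_iff AE_mes AE_completion_iff)
 show ?D using measurable_completion[of f lborel borel] f by (auto intro!: measurable_restrict_space1)
qed

lemma lebesgue_on_AE_mes: "S : sets borel ==> (AE x in lebesgue_on S. P x) \<longleftrightarrow> (AE x in mes S. P x)"
 using lebesgue_on_mes(3)[of S "%_. 0::real" P] by simp

text \<open>The primitive of \<open>f\<close> from minus infinity. For Lebesgue measure on (a,b) it
  vanishes up to \<open>a\<close> and is constant from \<open>b\<close> on.\<close>

definition cum :: "real measure => (real => real) => real => real" where
 "cum M f x = (LINT y|M. indicator {..x} y * f y)"

text \<open>Without atoms the end point of a half-line is negligible; otherwise integration by parts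
  would carry a term from the diagonal.\<close>

locale diffuse = sigma_finite_measure M for M :: "real measure" +
 assumes sets_M [simp, measurable_cong]: "sets M = sets borel" and atomless: "!!x. emeasure M {x} = 0"
begin

lemma space_M [simp]: "space M = UNIV" using sets_eq_imp_space_eq[OF sets_M] by simp
lemma measurable_M [simp]: "measurable M N = measurable borel N" by (rule measurable_cong_sets) auto

lemma integrable_indicator_mult:
 fixes f :: "real => real"
 assumes "integrable M f" "A : sets borel" shows "integrable M (%y. indicator A y * f y)"
 using integrable_mult_indicator[of A M f] assms by simp

lemma AE_neq: "AE y in M. y ~= x"
 by (rule AE_I[of _ _ "{x}"]) (auto simp: atomless)

lemma borel_measurable_cum [measurable]:
 assumes [measurable]: "f : BM"
 shows "cum M f : BM"
proof -
 have "(%x. \<integral>y. indicator {..x} y * f y \<partial>M) : borel_measurable M"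
 proof (rule borel_measurable_lebesgue_integral)
  have "(%p. (if snd p <= fst p then f (snd p) else 0)) : borel_measurable (M \<Otimes>\<^sub>M M)" by measurable
  thus "(%(x, y). indicator {..x} y * f y) : borel_measurable (M \<Otimes>\<^sub>M M)"
   by (rule measurable_cong[THEN iffD1, rotated]) (auto simp: indicator_def)
 qed
 thus ?thesis by (simp add: cum_def[abs_def])
qed

lemma cum_bound: assumes "integrable M f" shows "\<bar>cum M f x\<bar> <= (LINT y|M. \<bar>f y\<bar>)"
proof -
 have "\<bar>cum M f x\<bar> <= (LINT y|M. \<bar>indicator {..x} y * f y\<bar>)"
  unfolding cum_def by (rule integral_abs_bound)
 also have "... <= (LINT y|M. \<bar>f y\<bar>)"
  using assms by (intro integral_mono integrable_abs integrable_indicator_mult) (auto simp: indicator_def)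
 finally show ?thesis .
qed

lemma cum_add: "integrable M f ==> integrable M g ==> cum M (%x. f x + g x) x = cum M f x + cum M g x"
 unfolding cum_def by (simp add: distrib_left integrable_indicator_mult)

lemma cum_diff: "integrable M f ==> integrable M g ==> cum M (%x. f x - g x) x = cum M f x - cum M g x"
 unfolding cum_def by (simp add: right_diff_distrib integrable_indicator_mult)

lemma cum_mult: "cum M (%x. c * f x) x = c * cum M f x"
proof -
 have "cum M (%x. c * f x) x = (LINT y|M. c * (indicator {..x} y * f y))" unfolding cum_def by (simp add: mult_ac)
 thus ?thesis by (simp add: cum_def)
qed

lemma cum_sum:
 "(!!i. i : I ==> integrable M (f i)) ==> cum M (%x. \<Sum>i\<in>I. f i x) x = (\<Sum>i\<in>I. cum M (f i) x)"
 unfolding cum_def by (simp add: sum_distrib_left integrable_indicator_mult)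

lemma integrable_prod:
 fixes w v :: "real => real"
 assumes w: "integrable M w" and v: "integrable M v"
 shows "integrable (M \<Otimes>\<^sub>M M) (%(x,y). w x * v y)"
proof -
 interpret P: pair_sigma_finite M M by unfold_locales
 have [measurable]: "w : BM" "v : BM" using w v borel_measurable_integrable by fastforce+
 show ?thesis by (rule P.Fubini_integrable) (use w v in "auto simp: abs_mult")
qed

text \<open>Fubini's theorem for w(x) v(y) on the triangle x <= y; seen from \<open>x\<close> the
  remaining half-line is the complement of \<open>{..x}\<close> up to one point.\<close>

lemma integration_by_parts:
 fixes w v :: "real => real"
 assumes w: "integrable M w" and v: "integrable M v"
 shows "(LINT x|M. w x * cum M v x) + (LINT x|M. v x * cum M w x) = (LINT x|M. w x) * (LINT x|M. v x)"
proof -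
 interpret P: pair_sigma_finite M M by unfold_locales
 have [measurable]: "w : BM" "v : BM" using w v borel_measurable_integrable by fastforce+
 have int: "integrable (M \<Otimes>\<^sub>M M) (%(x,y). (if x <= y then w x * v y else 0))"
 proof (rule Bochner_integrable_bound[OF integrable_prod[OF w v]])
  show "(%(x,y). (if x <= y then w x * v y else 0)) : borel_measurable (M \<Otimes>\<^sub>M M)" by measurable
 qed (auto intro!: AE_I2)
 have "(LINT y|M. v y * cum M w y) = (LINT y|M. (LINT x|M. (if x <= y then w x * v y else 0)))"
  unfolding cum_def by (intro Bochner_integral_cong refl)
   (auto simp: indicator_def if_distrib[of "%a. _ * a"] if_distrib[of "%a. a * _"] mult_ac
    simp flip: integral_mult_right_zero cong: if_cong intro!: Bochner_integral_cong)
 also have "... = (LINT x|M. (LINT y|M. (if x <= y then w x * v y else 0)))"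
  by (rule P.Fubini_integral[OF int])
 also have "... = (LINT x|M. w x * ((LINT y|M. v y) - cum M v x))"
 proof (intro Bochner_integral_cong refl)
  fix x
  have "(LINT y|M. (if x <= y then w x * v y else 0)) = (LINT y|M. w x * (v y - indicator {..x} y * v y))"
   by (intro integral_cong_AE) (use AE_neq[of x] in "auto elim!: eventually_mono simp: indicator_def")
  also have "... = w x * ((LINT y|M. v y) - cum M v x)"
   using v by (simp add: cum_def integrable_indicator_mult)
  finally show "(LINT y|M. (if x <= y then w x * v y else 0)) = w x * ((LINT y|M. v y) - cum M v x)" .
 qed
 also have "... = (LINT x|M. w x) * (LINT x|M. v x) - (LINT x|M. w x * cum M v x)"
 proof -
  have "integrable M (%x. w x * cum M v x)"
  proof (rule Bochner_integrable_bound[of M "%x. (LINT y|M. \<bar>v y\<bar>) * w x"])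
   show "AE x in M. norm (w x * cum M v x) <= norm ((LINT y|M. \<bar>v y\<bar>) * w x)"
    using cum_bound[OF v] by (intro AE_I2) (auto simp: abs_mult mult.commute intro!: mult_left_mono)
  qed (use w in auto)
  thus ?thesis using w by (simp add: right_diff_distrib)
 qed
 finally show ?thesis by simp
qed

text \<open>The product rule for primitives: integration by parts for both functions cut off at
  \<open>x\<close>. On the half-line itself the primitive of the truncated function is the original
  primitive.\<close>

lemma cum_times_cum:
 assumes w: "integrable M w" and v: "integrable M v"
 shows "cum M w x * cum M v x = cum M (%y. w y * cum M v y + v y * cum M w y) x"
proof -
 have [measurable]: "w : BM" "v : BM" using w v borel_measurable_integrable by fastforce+
 let ?w = "%y. indicator {..x} y * w y" and ?v = "%y. indicator {..x} y * v y"
 have i: "integrable M ?w" "integrable M ?v" using w v by (auto intro: integrable_indicator_mult)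
 have loc: "indicator {..x} y * cum M (%y. indicator {..x} y * f y) y = indicator {..x} y * cum M f y" for f y
  unfolding cum_def by (auto simp: indicator_def intro!: Bochner_integral_cong)
 have int: "integrable M (%y. indicator {..x} y * (f y * cum M g y))" if "integrable M f" "integrable M g" for f g
 proof (rule integrable_indicator_mult)
  have [measurable]: "f : BM" "g : BM" using that borel_measurable_integrable by fastforce+
  show "integrable M (%y. f y * cum M g y)"
  proof (rule Bochner_integrable_bound[of M "%x. (LINT y|M. \<bar>g y\<bar>) * f x"])
   show "AE x in M. norm (f x * cum M g x) <= norm ((LINT y|M. \<bar>g y\<bar>) * f x)"
    using cum_bound[OF that(2)] by (intro AE_I2) (auto simp: abs_mult mult.commute intro!: mult_left_mono)
  qed (use that in auto)
 qed simp
 have "cum M w x * cum M v x = (LINT y|M. ?w y * cum M ?v y) + (LINT y|M. ?v y * cum M ?w y)"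
  using integration_by_parts[OF i] by (simp add: cum_def)
 also have "(LINT y|M. ?w y * cum M ?v y) = (LINT y|M. indicator {..x} y * (w y * cum M v y))"
  using loc[of _ v] by (intro Bochner_integral_cong refl) (metis mult.assoc mult.commute)
 also have "(LINT y|M. ?v y * cum M ?w y) = (LINT y|M. indicator {..x} y * (v y * cum M w y))"
  using loc[of _ w] by (intro Bochner_integral_cong refl) (metis mult.assoc mult.commute)
 finally show ?thesis unfolding cum_def[of M "%y. w y * cum M v y + v y * cum M w y"]
  using int[OF w v] int[OF v w] by (simp add: distrib_left)
qed

end

lemma diffuse_mes: "S : sets borel ==> diffuse (mes S)"
 by (intro diffuse.intro sigma_finite_mes diffuse_axioms.intro) (auto simp: emeasure_mes_singleton)

text \<open>By Mazur's lemma, a subsequence violating the convergence would have convex combinations with a limit of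
 the same primitive as \<open>l\<close>.\<close>

lemma weak_conv_of_cum:
 fixes u :: "nat => real => real"
 assumes M: "finite_measure M" "sets M = sets (borel :: real measure)"
  and u: "!!n. u n : BM" "!!n x. \<bar>u n x\<bar> <= C"
  and l: "l : BM" "!!x. \<bar>l x\<bar> <= C"
  and conv: "!!x. (%n. cum M (u n) x) ---> cum M l x" and h: "integrable M (h :: real => real)"
 shows "(%n. \<integral>x. h x * u n x \<partial>M) ---> (LINT x|M. h x * l x)"
proof -
 interpret finite_measure M by fact
 have [simp]: "measurable M N = measurable borel N" for N :: "real measure" by (rule measurable_cong_sets) (auto simp: M)
 note [measurable] = u(1) l(1)
 have i: "integrable M (%x. g x * p x)"
  if g: "integrable M g" and p: "p : BM" "!!x. \<bar>p x\<bar> <= C" for g p :: "real => real"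
 proof (rule Bochner_integrable_bound[of M "%x. C * g x"])
  show "AE x in M. norm (g x * p x) <= norm (C * g x)"
   using order_trans[OF p(2) abs_ge_self] by (intro AE_I2) (auto simp: abs_mult mult.commute[of _ "\<bar>g _\<bar>"] intro!: mult_left_mono)
 qed (use p borel_measurable_integrable[OF g] g in simp_all)
 have below: "\<forall>\<^sub>F n in sequentially. (LINT x|M. h x * u n x) < (LINT x|M. h x * l x) + e"
  if h: "integrable M h" and e: "e > 0" for h :: "real => real" and e
 proof (rule ccontr)
  assume "~ ?thesis"
  hence "infinite {n. (LINT x|M. h x * l x) + e <= (LINT x|M. h x * u n x)}"
   by (simp add: not_eventually not_less frequently_cofinite flip: cofinite_eq_sequentially)
  from infinite_enumerate[OF this] obtain r :: "nat => nat"
   where r: "strict_mono r" "!!n. (LINT x|M. h x * l x) + e <= (LINT x|M. h x * u (r n) x)" by auto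
  have sq: "(norm (u n x))^2 <= C^2" for n x using power_mono[OF u(2)[of n x], of 2] by simp
  have s: "sq_int M (u n)" for n by (rule sq_int_bound[of _ _ "%_. C^2"]) (use sq in auto)
  have B: "sqn M (u n) <= (LINT x|M. C^2)" for n using sq s by (intro integral_mono) (auto simp: sq_int_def)
  obtain c K v where c: "conv_weights c K" and v: "sq_int M v"
   and ae: "AE x in M. (%k. SUM n<K k. c k n * u (r n) x) ---> v x"
   by (rule convex_combinations_converge[of M "%n. u (r n)", OF s B, unfolded real_scaleR_def])
  have [measurable]: "v : BM" using sq_intD[OF v] by simp
  define w where "w k x = (SUM n<K k. c k n * u (r n) x)" for k x
  have wb: "\<bar>w k x\<bar> <= C" for k x
   using conv_weights_le[OF c, of k "%n. u (r n) x" C] conv_weights_ge[OF c, of k "- C" "%n. u (r n) x"] u(2)[of _ x]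
   unfolding w_def by (simp add: abs_le_iff minus_le_iff)
  have w: "(%k. SUM n<K k. c k n * (LINT x|M. g x * u (r n) x)) ---> (LINT x|M. g x * v x)"
   if g: "integrable M g" for g :: "real => real"
  proof -
   have [measurable]: "g : BM" using borel_measurable_integrable[OF g] by simp
   have "(%k. \<integral>x. g x * w k x \<partial>M) ---> (LINT x|M. g x * v x)"
   proof (rule integral_dominated_convergence[where w="%x. C * \<bar>g x\<bar>"])
    show "AE x in M. (%k. g x * w k x) ---> g x * v x"
     using ae by eventually_elim (auto simp: w_def intro: tendsto_mult_left)
    show "AE x in M. norm (g x * w k x) <= C * \<bar>g x\<bar>" for k
     using wb by (intro AE_I2) (auto simp: abs_mult mult.commute[of C] intro!: mult_left_mono)
   qed (use g in "auto simp: w_def")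
   moreover have "(LINT x|M. g x * w k x) = (SUM n<K k. c k n * (LINT x|M. g x * u (r n) x))" for k
    using i[OF g u] by (simp add: w_def sum_distrib_left mult.left_commute[of "g _"])
   ultimately show ?thesis by simp
  qed
  have "AE x in M. v x - l x = 0"
  proof (rule integral_interval_unique[OF M])
   have iv: "integrable M v" using square_integrable_imp_integrable[of v] v by (simp add: sq_int_def)
   have il: "integrable M l" using i[of "%_. 1" l] l by simp
   show "integrable M (%x. v x - l x)" using iv il by simp
   have ind: "integrable M (%y. indicator {..x} y * p y)" if "integrable M p" for p :: "real => real" and x
    using integrable_mult_indicator[of "{..x}" M p] that M by simp
   fix x
   have "integrable M (indicator {..x} :: real => real)" using ind[of "%_. 1" x] by simp
   from LIMSEQ_unique[OF w[OF this]] conv_weights_tendsto[OF c LIMSEQ_subseq_LIMSEQ[OF conv[of x] r(1)]]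
   have "(LINT y|M. indicator {..x} y * v y) = cum M l x" by (simp add: cum_def o_def)
   thus "(LINT y|M. indicator {..x} y * (v y - l y)) = 0"
    using ind[OF iv] ind[OF il] by (simp add: cum_def right_diff_distrib)
  qed
  hence "(LINT x|M. h x * v x) = (LINT x|M. h x * l x)"
   using borel_measurable_integrable[OF h] by (intro integral_cong_AE) (auto elim: eventually_mono)
  with LIMSEQ_le_const[OF w[OF h], of "(LINT x|M. h x * l x) + e"] conv_weights_ge[OF c r(2)] e show False by auto
 qed
 show ?thesis
 proof (rule tendstoI)
  fix e :: real assume e: "e > 0"
  have m: "integrable M (%x. - h x)" using h by simp
  show "\<forall>\<^sub>F n in sequentially. dist (LINT x|M. h x * u n x) (LINT x|M. h x * l x) < e"
   using below[OF h e] below[OF m e] by eventually_elim (simp add: dist_real_def abs_less_iff)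
 qed
qed

section \<open>Absolutely continuous functions on an interval\<close>

locale interval = fixes a b :: real assumes ab: "a < b"
begin

definition mX :: "real measure" where "mX = mes {a<..<b}"

abbreviation integral_X (binder "LX " 10) where "integral_X f == integral\<^sup>L mX f"

lemma sets_mX [simp, measurable_cong]: "sets mX = sets borel" by (simp add: mX_def)
lemma space_mX [simp]: "space mX = UNIV" by (simp add: mX_def)

lemma finite_mX: "finite_measure mX" unfolding mX_def using ab by (intro finite_mes) auto

sublocale X: finite_measure mX by (rule finite_mX)
sublocale X: diffuse mX unfolding mX_def by (rule diffuse_mes) simp

lemma measure_mX: "measure mX UNIV = b - a"
 using ab by (simp add: mX_def measure_def emeasure_mes)

lemma AE_mX: "(AE x in mX. P x) \<longleftrightarrow> (AE x in lborel. a < x & x < b --> P x)"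
 unfolding mX_def by (subst AE_mes) auto

lemma AE_mXI: "(!!x. a < x ==> x < b ==> P x) ==> AE x in mX. P x"
 by (simp add: AE_mX)

lemma integrable_bounded:
 fixes f :: "real => real"
 assumes "f : BM" "!!x. a < x ==> x < b ==> \<bar>f x\<bar> <= B"
 shows "integrable mX f" using assms by (intro X.integrable_const_bound[where B=B] AE_mXI) auto

lemma sq_int_bounded:
 fixes f :: "real => real"
 assumes "f : BM" "!!x. a < x ==> x < b ==> \<bar>f x\<bar> <= B"
 shows "sq_int mX f" unfolding sq_int_def
proof
 show "integrable mX (%x. (norm (f x))^2)"
 proof (rule integrable_bounded[where B="B^2"])
  fix x assume "a < x" "x < b"
  thus "\<bar>(norm (f x))^2\<bar> <= B^2" using power_mono[OF assms(2), of x 2] by simp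
 qed (use assms(1) in measurable)
qed (use assms(1) in simp)

lemma sqn_bounded:
 fixes z :: "real => real"
 assumes "z : BM" "!!x. \<bar>z x\<bar> <= C" shows "sqn mX z <= C^2 * (b - a)"
proof -
 have "(norm (z x))^2 <= C^2" for x using power_mono[OF assms(2)[of x], of 2] by simp
 hence "sqn mX z <= (LX x. C^2)" using sq_int_integrable[OF sq_int_bounded[OF assms]] by (intro integral_mono) auto
 thus ?thesis by (simp add: measure_mX mult.commute)
qed

lemma sq_int_imp_integrable: assumes "sq_int mX (f :: real => real)" shows "integrable mX f"
 using sq_int_times[OF assms sq_int_bounded[of "%_. 1" 1]] by simp

lemma sq_int_bounded_mult:
 fixes f v :: "real => real"
 assumes "sq_int mX v" "f : BM" "!!x. a < x ==> x < b ==> \<bar>f x\<bar> <= B"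
 shows "sq_int mX (%x. f x * v x)" (is ?A) "sqn mX (%x. f x * v x) <= B^2 * sqn mX v" (is ?B)
proof -
 have [measurable]: "v : BM" using sq_intD[OF assms(1)] by simp
 have i: "integrable mX (%x. B^2 * (norm (v x))^2)" using assms(1) by (simp add: sq_int_def)
 have le: "AE x in mX. (norm (f x * v x))^2 <= B^2 * (norm (v x))^2"
 proof (rule AE_mXI)
  fix x assume "a < x" "x < b"
  thus "(norm (f x * v x))^2 <= B^2 * (norm (v x))^2"
   using power_mono[OF assms(3)[of x], of 2] by (simp add: power_mult_distrib mult_right_mono)
 qed
 have i2: "integrable mX (%x. (norm (f x * v x))^2)"
  by (rule Bochner_integrable_bound[OF i]) (use assms(2) le in auto)
 thus ?A using assms(2) by (simp add: sq_int_def)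
 show ?B using integral_mono_AE[OF i2 i le] by simp
qed

abbreviation "cumX \<equiv> cum mX"

lemma cumX_bounded:
 assumes "ph : BM" "!!x. \<bar>ph x\<bar> <= C" shows "\<bar>cumX ph x\<bar> <= C * (b - a)"
proof -
 have i: "integrable mX ph" using assms by (intro integrable_bounded)
 have "\<bar>cumX ph x\<bar> <= (LX y. \<bar>ph y\<bar>)" by (rule X.cum_bound[OF i])
 also have "... <= (LX y. C)" using i assms by (intro integral_mono) auto
 finally show ?thesis by (simp add: measure_mX mult.commute)
qed

lemma cumX_le_a: "x <= a ==> cumX f x = 0"
proof -
 assume "x <= a"
 hence "AE y in mX. indicator {..x} y * f y = 0" by (intro AE_mXI) auto
 thus ?thesis unfolding cum_def by (rule integral_eq_zero_AE)
qed

lemma cumX_ge_b: "x >= b ==> f : BM ==> cumX f x = (LX y. f y)"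
 unfolding cum_def by (intro integral_cong_AE AE_mXI) auto

lemma cumX_diff_eq:
 assumes "x <= y" "integrable mX f"
 shows "cumX f y - cumX f x = (LX z. indicator {x<..y} z * f z)"
proof -
 have "cumX f y - cumX f x = (LX z. indicator {..y} z * f z - indicator {..x} z * f z)"
  unfolding cum_def using assms by (simp add: X.integrable_indicator_mult)
 also have "... = (LX z. indicator {x<..y} z * f z)"
  using assms(1) by (intro Bochner_integral_cong) (auto simp: indicator_def)
 finally show ?thesis .
qed

lemma measure_Ioc_le: "x <= y ==> measure mX {x<..y} <= y - x"
proof -
 assume "x <= y"
 have "emeasure mX {x<..y} <= emeasure lborel {x<..y}"
  unfolding mX_def by (subst emeasure_mes) (auto intro!: emeasure_mono)
 thus ?thesis using \<open>x <= y\<close> by (simp add: measure_def enn2real_leI)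
qed

lemma cumX_holder:
 assumes v: "sq_int mX v"
 shows "(cumX v x - cumX v y)^2 <= \<bar>x - y\<bar> * sqn mX v"
proof -
 have *: "(cumX v y - cumX v x)^2 <= (y - x) * sqn mX v" if "x <= y" for x y
 proof -
  have s: "sq_int mX (indicator {x<..y} :: real => real)" by (rule sq_int_bounded[of _ 1]) auto
  have "sqn mX (indicator {x<..y} :: real => real) = (LX z. indicator {x<..y} z)"
   by (intro Bochner_integral_cong) (auto simp: indicator_def)
  hence 1: "sqn mX (indicator {x<..y} :: real => real) <= y - x" using measure_Ioc_le[OF that] by simp
  have "\<bar>cumX v y - cumX v x\<bar> <= sqrt (sqn mX (indicator {x<..y} :: real => real)) * sqrt (sqn mX v)"
   unfolding cumX_diff_eq[OF that sq_int_imp_integrable[OF v]] using CS_inner[OF s v] by simp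
  hence "\<bar>cumX v y - cumX v x\<bar>^2 <= (sqrt (sqn mX (indicator {x<..y} :: real => real)) * sqrt (sqn mX v))^2"
   by (intro power_mono) auto
  also have "... = sqn mX (indicator {x<..y} :: real => real) * sqn mX v" by (simp only: power_mult_distrib real_sqrt_pow2 sqn_nonneg)
  also have "... <= (y - x) * sqn mX v" using 1 by (intro mult_right_mono) auto
  finally show ?thesis by simp
 qed
 show ?thesis using *[of x y] *[of y x] by (cases "x <= y") (auto simp: power2_commute abs_if)
qed

lemma cumX_lipschitz:
 assumes "f : BM" "!!x. \<bar>f x\<bar> <= C"
 shows "\<bar>cumX f x - cumX f y\<bar> <= C * \<bar>x - y\<bar>"
proof -
 have i: "integrable mX f" using assms by (intro integrable_bounded)
 have *: "\<bar>cumX f y - cumX f x\<bar> <= C * (y - x)" if "x <= y" for x y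
 proof -
  have "\<bar>cumX f y - cumX f x\<bar> <= (LX z. \<bar>indicator {x<..y} z * f z\<bar>)"
   unfolding cumX_diff_eq[OF that i] by (rule integral_abs_bound)
  also have "... <= (LX z. C * indicator {x<..y} z)"
  proof (intro integral_mono integrable_abs X.integrable_indicator_mult i)
   show "integrable mX (%z. C * indicator {x<..y} z)"
    by (intro integrable_mult_right) (simp add: integrable_indicator_iff X.emeasure_eq_measure)
  qed (use assms(2) in "auto simp: indicator_def")
  also have "... <= C * (y - x)" using measure_Ioc_le[OF that] assms(2)[of 0] by (simp add: mult_left_mono)
  finally show ?thesis .
 qed
 show ?thesis using *[of x y] *[of y x] by (cases "x <= y") (auto simp: abs_minus_commute)
qed

text \<open>An H1 function in its continuous representative, extended constantly beyond both end
  points, together with a derivative. Carrying the derivative as a second argument turns product and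
  chain rules into statements about pairs and postpones weak derivatives to the very end.\<close>

definition ac :: "(real => real) => (real => real) => bool" where
 "ac ph v \<longleftrightarrow> sq_int mX v & (ALL x. ph x = ph a + cumX v x)"

lemma acD: "ac ph v ==> sq_int mX v" "ac ph v ==> ph x = ph a + cumX v x"
 unfolding ac_def by (blast, metis)

lemma acI: "sq_int mX v ==> (!!x. ph x = c + cumX v x) ==> ac ph v"
 by (auto simp: ac_def cumX_le_a)

lemma ac_integrable: "ac ph v ==> integrable mX v"
 by (intro sq_int_imp_integrable acD)

lemma ac_measurable_deriv: "ac ph v ==> v : BM"
 using sq_intD[OF acD(1)] by fastforce

lemma ac_measurable: assumes "ac ph v" shows "ph : BM"
proof -
 note [measurable] = ac_measurable_deriv[OF assms]
 have "(%x. ph a + cumX v x) : BM" by measurable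
 moreover have "(%x. ph a + cumX v x) = ph" by (intro ext) (rule acD(2)[OF assms, symmetric])
 ultimately show ?thesis by simp
qed

lemma ac_bounded: assumes "ac ph v" shows "\<bar>ph x\<bar> <= \<bar>ph a\<bar> + (LX y. \<bar>v y\<bar>)"
 using X.cum_bound[OF ac_integrable[OF assms], of x] acD(2)[OF assms, of x] by linarith

lemma ac_holder: assumes "ac ph v" shows "(ph x - ph y)^2 <= \<bar>x - y\<bar> * sqn mX v"
 using cumX_holder[OF acD(1)[OF assms], of x y] acD(2)[OF assms, of x] acD(2)[OF assms, of y] by simp

lemma ac_sq_int: assumes "ac ph v" shows "sq_int mX ph"
 by (rule sq_int_bounded[OF ac_measurable[OF assms] ac_bounded[OF assms]])

lemma ac_const: "ac (%_. c) (%_. 0)" by (auto simp: ac_def cum_def)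

lemma ac_add: assumes "ac ph v" "ac sh w" shows "ac (%x. ph x + sh x) (%x. v x + w x)"
proof (rule acI[where c="ph a + sh a"])
 show "ph x + sh x = ph a + sh a + cumX (%x. v x + w x) x" for x
  unfolding acD(2)[OF assms(1), of x] acD(2)[OF assms(2), of x] X.cum_add[OF assms[THEN ac_integrable]] by simp
qed (use assms in "auto intro: sq_int_add acD")

lemma ac_cmult: assumes "ac ph v" shows "ac (%x. c * ph x) (%x. c * v x)"
proof (rule acI[where c="c * ph a"])
 show "c * ph x = c * ph a + cumX (%x. c * v x) x" for x
  using acD(2)[OF assms, of x] by (simp add: X.cum_mult distrib_left)
qed (use assms in "auto intro: sq_int_mult acD")

lemma ac_diff: assumes "ac ph v" "ac sh w" shows "ac (%x. ph x - sh x) (%x. v x - w x)"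
 using ac_add[OF assms(1) ac_cmult[OF assms(2), of "-1"]] by simp

lemma ac_mult: assumes p: "ac ph v" and q: "ac sh w" shows "ac (%x. ph x * sh x) (%x. v x * sh x + ph x * w x)"
proof (rule acI[where c="ph a * sh a"])
 have s: "sq_int mX (%x. sh x * v x)" "sq_int mX (%x. ph x * w x)"
  using sq_int_bounded_mult(1)[OF acD(1)[OF p] ac_measurable[OF q] ac_bounded[OF q]]
   sq_int_bounded_mult(1)[OF acD(1)[OF q] ac_measurable[OF p] ac_bounded[OF p]] by auto
 thus "sq_int mX (%x. v x * sh x + ph x * w x)" by (auto intro!: sq_int_add simp: mult.commute)
 note [measurable] = p[THEN ac_measurable_deriv] q[THEN ac_measurable_deriv]
 note i = p[THEN ac_integrable] q[THEN ac_integrable]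
 fix x
 have sc: "integrable mX (%y. v y * cumX w y)" "integrable mX (%y. w y * cumX v y)"
  using sq_int_bounded_mult(1)[OF acD(1)[OF p] _ X.cum_bound[OF i(2)]]
   sq_int_bounded_mult(1)[OF acD(1)[OF q] _ X.cum_bound[OF i(1)]]
  by (auto intro!: sq_int_imp_integrable simp: mult.commute)
 have "cumX (%x. v x * sh x + ph x * w x) x
   = cumX (%y. (sh a * v y + ph a * w y) + (v y * cumX w y + w y * cumX v y)) x"
  unfolding cum_def by (intro Bochner_integral_cong refl)
   (subst acD(2)[OF p], subst acD(2)[OF q], simp add: algebra_simps cum_def)
 also have "... = sh a * cumX v x + ph a * cumX w x + cumX v x * cumX w x"
  using i sc by (subst X.cum_add) (auto simp: X.cum_add X.cum_mult X.cum_times_cum)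
 finally show "ph x * sh x = ph a * sh a + cumX (%x. v x * sh x + ph x * w x) x"
  by (subst acD(2)[OF p], subst acD(2)[OF q]) (simp add: algebra_simps)
qed

lemma ac_cong: "ac ph v ==> (!!x. ph x = ph' x) ==> (!!x. v x = v' x) ==> ac ph' v'"
 using ext[of ph ph'] ext[of v v'] by simp

lemma ac_power: assumes "ac ph v" shows "ac (%x. ph x ^ n) (%x. real n * ph x ^ (n - 1) * v x)"
proof (induct n)
 case 0 thus ?case using ac_const[of 1] by simp
next
 case (Suc n)
 show ?case by (rule ac_cong[OF ac_mult[OF assms Suc]]) (cases n; simp add: algebra_simps)+
qed

lemma ac_sum:
 assumes "!!i. i : I ==> ac (ph i) (v i)" shows "ac (%x. \<Sum>i\<in>I. ph i x) (%x. \<Sum>i\<in>I. v i x)"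
 using assms by (induct I rule: infinite_finite_induct) (auto intro: ac_add ac_const)

lemma ac_binform:
 assumes "ac f v" "ac g w"
 shows "ac (%x. binform c (Suc m) (f x) (g x))
  (%x. binform (%j. c (Suc j) * real (Suc j)) m (f x) (g x) * v x +
     binform (%j. c j * (real (Suc m) - real j)) m (f x) (g x) * w x)"
proof -
 have "ac (%x. SUM j<=Suc m. c j * (f x ^ j * g x ^ (Suc m - j)))
   (%x. SUM j<=Suc m. c j * ((real j * f x ^ (j - 1) * v x) * g x ^ (Suc m - j) + f x ^ j * (real (Suc m - j) * g x ^ (Suc m - j - 1) * w x)))"
  by (intro ac_sum ac_cmult ac_mult ac_power assms)
 thus ?thesis
  by (rule ac_cong) (simp add: binform_def mult.assoc, subst binform_deriv_decomp[symmetric], simp add: mult_ac)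
qed

text \<open>Since the primitive of \<open>w\<close> vanishes at \<open>a\<close>, the only boundary
  term sits at \<open>b\<close>, and it disappears when \<open>w\<close> has mean zero. Every use of
  an equation with a test function in \<open>x\<close> goes through this identity; conservation of
  mass provides the mean zero.\<close>

lemma ac_ibp:
 assumes "ac ph v" "integrable mX w"
 shows "(LX x. w x * ph x) = ph b * (LX x. w x) - (LX x. v x * cumX w x)"
proof -
 note [measurable] = ac_measurable_deriv[OF assms(1)] borel_measurable_integrable[OF assms(2), simplified]
 note v = ac_integrable[OF assms(1)]
 have i: "integrable mX (%x. w x * cumX v x)"
 proof (rule Bochner_integrable_bound[of _ "%x. (LX y. \<bar>v y\<bar>) * w x"])
  show "AE x in mX. norm (w x * cumX v x) <= norm ((LX y. \<bar>v y\<bar>) * w x)"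
   using X.cum_bound[OF v] by (intro AE_I2) (auto simp: abs_mult mult.commute intro!: mult_left_mono)
 qed (use assms in auto)
 have "(LX x. w x * ph x) = (LX x. ph a * w x + w x * cumX v x)"
  by (intro Bochner_integral_cong refl) (subst acD(2)[OF assms(1)], simp add: algebra_simps)
 also have "... = ph a * (LX x. w x) + (LX x. w x * cumX v x)" using i assms by simp
 also have "(LX x. w x * cumX v x) = (LX x. w x) * (LX x. v x) - (LX x. v x * cumX w x)"
  using X.integration_by_parts[OF assms(2) v] by simp
 also have "ph a * (LX x. w x) + ... = (ph a + (LX x. v x)) * (LX x. w x) - (LX x. v x * cumX w x)"
  by (simp add: algebra_simps)
 also have "ph a + (LX x. v x) = ph b" using acD(2)[OF assms(1), of b] by (simp add: cumX_ge_b)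
 finally show ?thesis .
qed

text \<open>Clamping the argument produces the constant extension that \<open>ac\<close> demands;
  the rest is the fundamental theorem of calculus.\<close>

lemma ac_of_deriv:
 assumes d: "!!x. a <= x ==> x <= b ==> (F has_real_derivative f x) (at x)"
  and c: "continuous_on {a..b} f" and [measurable]: "f : BM"
 shows "ac (%x. F (max a (min b x))) f"
proof (rule acI[where c="F a"])
 obtain B where B: "!!x. x : {a..b} ==> \<bar>f x\<bar> <= B"
  using compact_imp_bounded[OF compact_continuous_image[OF c compact_Icc]] unfolding bounded_iff by force
 show sq: "sq_int mX f" using B by (intro sq_int_bounded[of _ B]) auto
 have main: "F x = F a + cumX f x" if x: "a <= x" "x <= b" for x
 proof -
  have "((%y. f y) has_integral (F x - F a)) {a..x}"
  proof (rule fundamental_theorem_of_calculus[OF x(1)])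
   fix y assume "y : {a..x}"
   hence "(F has_real_derivative f y) (at y)" using x by (intro d) auto
   hence "(F has_real_derivative f y) (at y within {a..x})" by (rule has_field_derivative_at_within)
   thus "(F has_vector_derivative f y) (at y within {a..x})"
    by (simp only: has_real_derivative_iff_has_vector_derivative)
  qed
  hence I: "integral {a..x} f = F x - F a" by (rule integral_unique)
  have "set_integrable lborel {a..x} f"
   by (rule borel_integrable_atLeastAtMost', rule continuous_on_subset[OF c]) (use x in auto)
  from set_borel_integral_eq_integral(2)[OF this] have "(LINT y:{a..x}|lborel. f y) = F x - F a" unfolding I .
  moreover have "cumX f x = (LINT y:{a..x}|lborel. f y)"
  proof -
   have "cumX f x = (LINT y|lborel. indicator {a<..<b} y *\<^sub>R (indicator {..x} y * f y))"
    unfolding cum_def mX_def by (rule integral_mes) auto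
   also have "... = (LINT y|lborel. indicator {a..x} y *\<^sub>R f y)"
   proof (rule integral_cong_AE)
    have "AE y in lborel. y ~= a" "AE y in lborel. y ~= b" by (rule AE_lborel_singleton)+
    thus "AE y in lborel. indicator {a<..<b} y *\<^sub>R (indicator {..x} y * f y) = indicator {a..x} y *\<^sub>R f y"
     by eventually_elim (use x in "auto simp: indicator_def")
   qed auto
   finally show ?thesis by (simp add: set_lebesgue_integral_def)
  qed
  ultimately show ?thesis by simp
 qed
 fix x
 consider "x < a" | "a <= x" "x <= b" | "b < x" by linarith
 thus "F (max a (min b x)) = F a + cumX f x"
 proof cases
  case 1 thus ?thesis using ab by (simp add: cumX_le_a)
 next
  case 2 thus ?thesis using main[of x] by simp
 next
  case 3 thus ?thesis using main[of b] ab by (simp add: cumX_ge_b)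
 qed
qed

end

section \<open>A time step\<close>

lemma L_fun_tangent:
 assumes "r > 0" "s >= 0" shows "L_fun r + ln r * (s - r) <= L_fun s"
proof (cases "s = 0")
 case True thus ?thesis using assms by (simp add: L_fun_def)
next
 case False
 hence s: "s > 0" using assms by simp
 have "ln (r / s) <= r / s - 1" using assms s by (intro ln_le_minus_one) auto
 hence "s * (ln r - ln s) <= s * (r / s - 1)" using assms s by (intro mult_left_mono) (auto simp: ln_div)
 also have "... = r - s" using s by (simp add: field_simps)
 finally show ?thesis by (simp add: L_fun_def algebra_simps)
qed

lemma L_fun_nonneg: "r >= 0 ==> L_fun r >= 0"
 using L_fun_tangent[of 1 r] by (simp add: L_fun_def)

text \<open>The tangent at \<open>exp 1\<close>, where \<open>L_fun\<close> has the value and the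
  slope 1, with e <= 3. Through it the entropy controls the mass.\<close>

lemma L_fun_lower: assumes "r >= 0" shows "r - 2 <= L_fun r"
proof -
 have "L_fun (exp 1) + 1 * (r - exp 1) <= L_fun r" using L_fun_tangent[of "exp 1" r] assms by simp
 moreover have "exp 1 <= (3::real)" by (rule exp_le)
 ultimately show ?thesis by (simp add: L_fun_def)
qed

lemma L_fun_continuous: "continuous_on {0..} L_fun"
 unfolding continuous_on_def
proof
 fix r :: real assume "r : {0..}"
 then consider "r = 0" | "r > 0" by fastforce
 thus "(L_fun \<longlongrightarrow> L_fun r) (at r within {0..})"
 proof cases
  case 1
  have "((%x::real. x * ln x - x + 1) \<longlongrightarrow> 1) (at_right 0)" by real_asymp
  hence "(L_fun \<longlongrightarrow> L_fun 0) (at_right 0)" by (simp add: L_fun_def[abs_def])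
  thus ?thesis using 1 by (simp add: at_within_Ici_at_right)
 next
  case 2
  have "isCont L_fun r" unfolding L_fun_def[abs_def] using 2 by (intro continuous_intros) auto
  thus ?thesis using isCont_def tendsto_within_subset by blast
 qed
qed

lemma L_fun_measurable [measurable]: "L_fun : BM"
 unfolding L_fun_def[abs_def] by measurable

lemma L_fun_bounded: obtains B where "!!r. 0 <= r ==> r <= C ==> \<bar>L_fun r\<bar> <= B"
proof -
 have "compact (L_fun ` {0..C})" by (intro compact_continuous_image continuous_on_subset[OF L_fun_continuous]) auto
 from compact_imp_bounded[OF this] show ?thesis using that unfolding bounded_iff by force
qed

lemma Phi1_nonneg: "mu > 0 ==> x >= 0 ==> y >= 0 ==> Phi1 mu (x, y) >= 0"
 by (simp add: Phi1_def L_fun_nonneg)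

section \<open>Bounded pointwise convergence and the Galerkin problem\<close>

context interval
begin

text \<open>Pointwise convergence on the open interval with a uniform bound: closed under all
  operations that occur in the integrands, and sufficient for dominated convergence. The diagonal
  case \<open>bdm\<close> says bounded and measurable.\<close>

definition bconv :: "(nat => real => real) => (real => real) => bool" where
 "bconv u l \<longleftrightarrow> (ALL k. u k : BM) & l : BM &
   (EX M. ALL k x. a < x --> x < b --> \<bar>u k x\<bar> <= M) & (ALL x. a < x --> x < b --> (%k. u k x) ---> l x)"

abbreviation "bdm h \<equiv> bconv (%_. h) h"

lemma bconvI:
 assumes "!!k. u k : BM" "l : BM"
  "!!k x. a < x ==> x < b ==> \<bar>u k x\<bar> <= M" "!!x. a < x ==> x < b ==> (%k. u k x) ---> l x"
 shows "bconv u l" using assms unfolding bconv_def by blast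

lemma bconvE:
 assumes "bconv u l"
 obtains M where "!!k. u k : BM" "l : BM"
  "!!k x. a < x ==> x < b ==> \<bar>u k x\<bar> <= M" "!!x. a < x ==> x < b ==> (%k. u k x) ---> l x"
 using assms unfolding bconv_def by blast

lemma bdmI: "h : BM ==> (!!x. a < x ==> x < b ==> \<bar>h x\<bar> <= M) ==> bdm h"
 by (rule bconvI[where M=M]) auto

lemma bconv_const: "bconv (%_ _. c) (%_. c)" by (rule bconvI[where M="\<bar>c\<bar>"]) auto

lemma bconv_seq: assumes "X ---> c" shows "bconv (%k _. X k) (%_. c)"
proof -
 obtain M where "!!k. \<bar>X k\<bar> <= M" using convergent_imp_Bseq[of X] assms unfolding Bseq_def convergent_def by auto
 thus ?thesis using assms by (intro bconvI[where M=M]) auto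
qed

lemma bconv_add: assumes "bconv u l" "bconv u' l'" shows "bconv (%k x. u k x + u' k x) (%x. l x + l' x)"
proof -
 obtain M M' where M: "!!k x. a < x ==> x < b ==> \<bar>u k x\<bar> <= M" and M': "!!k x. a < x ==> x < b ==> \<bar>u' k x\<bar> <= M'"
  using assms unfolding bconv_def by blast
 have "\<bar>u k x + u' k x\<bar> <= M + M'" if "a < x" "x < b" for k x using M[OF that, of k] M'[OF that, of k] by linarith
 with assms show ?thesis by (intro bconvI[where M="M+M'"]) (auto simp: bconv_def intro!: tendsto_add borel_measurable_add)
qed

lemma bconv_mult: assumes "bconv u l" "bconv u' l'" shows "bconv (%k x. u k x * u' k x) (%x. l x * l' x)"
proof -
 obtain M M' where M: "!!k x. a < x ==> x < b ==> \<bar>u k x\<bar> <= M" and M': "!!k x. a < x ==> x < b ==> \<bar>u' k x\<bar> <= M'"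
  using assms unfolding bconv_def by blast
 have "\<bar>u k x * u' k x\<bar> <= M * M'" if "a < x" "x < b" for k x
  unfolding abs_mult using M[OF that, of k] M'[OF that, of k] by (intro mult_mono) auto
 with assms show ?thesis by (intro bconvI[where M="M*M'"]) (auto simp: bconv_def intro!: tendsto_mult borel_measurable_times)
qed

lemma bconv_cmult: "bconv u l ==> bconv (%k x. c * u k x) (%x. c * l x)"
 by (intro bconv_mult bconv_const)

lemma bconv_diff: assumes "bconv u l" "bconv u' l'" shows "bconv (%k x. u k x - u' k x) (%x. l x - l' x)"
 using bconv_add[OF assms(1) bconv_cmult[OF assms(2), of "-1"]] by simp

lemma bconv_sum: "(!!i. i : I ==> bconv (u i) (l i)) ==> bconv (%k x. \<Sum>i\<in>I. u i k x) (%x. \<Sum>i\<in>I. l i x)"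
 by (induct I rule: infinite_finite_induct) (auto intro: bconv_add bconv_const)

lemma bconv_exp: assumes "bconv u l" shows "bconv (%k x. exp (u k x)) (%x. exp (l x))"
proof -
 obtain M where M: "!!k x. a < x ==> x < b ==> \<bar>u k x\<bar> <= M" using assms unfolding bconv_def by blast
 have [measurable]: "u k : BM" "l : BM" for k using assms by (auto simp: bconv_def)
 have "\<bar>exp (u k x)\<bar> <= exp M" if "a < x" "x < b" for k x using M[OF that, of k] by simp
 thus ?thesis using assms by (intro bconvI[where M="exp M"] tendsto_exp) (auto simp: bconv_def)
qed

lemma bconv_integral:
 assumes "bconv u l" shows "(%k. LX x. u k x) ---> (LX x. l x)"
proof -
 obtain M where M: "!!k. u k : BM" "l : BM"
  "!!k x. a < x ==> x < b ==> \<bar>u k x\<bar> <= M" "!!x. a < x ==> x < b ==> (%k. u k x) ---> l x"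
  using bconvE[OF assms] by metis
 show ?thesis by (rule integral_dominated_convergence[where w="%_. M"]) (use M in "auto intro!: AE_mXI")
qed

lemma bdm_integrable: assumes "bdm h" shows "integrable mX h"
 using bconvE[OF assms] integrable_bounded by metis

lemma bdm_sq_int: assumes "bdm h" shows "sq_int mX h"
 using bconvE[OF assms] sq_int_bounded by metis

lemma bdm_L_fun: assumes "bdm f" "!!x. f x >= 0" shows "bdm (%x. L_fun (f x))"
proof -
 obtain M where M: "f : BM" "!!x. a < x ==> x < b ==> \<bar>f x\<bar> <= M" using bconvE[OF assms(1)] by metis
 obtain B where "!!r. 0 <= r ==> r <= M ==> \<bar>L_fun r\<bar> <= B" using L_fun_bounded[of M] by blast
 hence "\<bar>L_fun (f x)\<bar> <= B" if "a < x" "x < b" for x using M(2)[OF that] assms(2)[of x] by auto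
 thus ?thesis using M(1) by (intro bdmI) auto
qed

abbreviation "ent mu f g \<equiv> (LX x. Phi1 mu (f x, g x))"
abbreviation "diss R v w \<equiv> (LX x. (v x)^2 + R * (v x + w x)^2)"
text \<open>Both equations in one functional, the second divided by mu to match the weight in
  \<open>Phi1\<close>: for the test functions ln f and ln g, with derivatives v/f and w/g, the flux
  part becomes exactly the integrand of \<open>diss\<close>.\<close>

abbreviation "tested ta R mu F G f v g w p p' q q' \<equiv> (LX x. (f x - F x) * p x + 1 / mu * ((g x - G x) * q x)
 + ta * ((f x * ((1 + R) * v x + R * w x)) * p' x + R * ((g x * (v x + w x)) * q' x)))"

text \<open>Galerkin approximation in the entropy variables \<open>ln f\<close>, \<open>ln g\<close>: testing with them yields the
 entropy identity exactly, and the small multiple of the coefficients makes the problem coercive.\<close>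

lemma galerkin:
 fixes P Q P' Q' :: "nat => real => real"
 assumes P: "!!i. bdm (P i)" "!!i. bdm (P' i)" "!!i. bdm (Q i)" "!!i. bdm (Q' i)"
  and FG: "bdm F" "bdm G" "!!x. F x >= 0" "!!x. G x >= 0"
  and pos: "ta > 0" "R > 0" "mu > 0" "ep > 0"
 obtains ze w1 w1' w2 w2' where
  "w1 = (%x. SUM i<n. ze i * P i x)" "w1' = (%x. SUM i<n. ze i * P' i x)"
  "w2 = (%x. SUM i<n. ze i * Q i x)" "w2' = (%x. SUM i<n. ze i * Q' i x)"
  "!!i. i < n ==> tested ta R mu F G (%x. exp (w1 x)) (%x. exp (w1 x) * w1' x) (%x. exp (w2 x)) (%x. exp (w2 x) * w2' x)
    (P i) (P' i) (Q i) (Q' i) = - ep * ze i"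
  "ent mu (%x. exp (w1 x)) (%x. exp (w2 x)) + ta * diss R (%x. exp (w1 x) * w1' x) (%x. exp (w2 x) * w2' x)
   + ep * (SUM i<n. (ze i)^2) <= ent mu F G"
proof -
 define W1 W1' W2 W2' where "W1 ze x = (SUM i<n. ze i * P i x)" and "W1' ze x = (SUM i<n. ze i * P' i x)"
  and "W2 ze x = (SUM i<n. ze i * Q i x)" and "W2' ze x = (SUM i<n. ze i * Q' i x)" for ze x
 define I where "I ze i x = (exp (W1 ze x) - F x) * P i x + 1 / mu * ((exp (W2 ze x) - G x) * Q i x)
    + ta * ((exp (W1 ze x) * ((1 + R) * (exp (W1 ze x) * W1' ze x) + R * (exp (W2 ze x) * W2' ze x))) * P' i x
       + R * ((exp (W2 ze x) * (exp (W1 ze x) * W1' ze x + exp (W2 ze x) * W2' ze x)) * Q' i x))" for ze i x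
 define D where "D ze x = (exp (W1 ze x) * W1' ze x)^2 + R * (exp (W1 ze x) * W1' ze x + exp (W2 ze x) * W2' ze x)^2" for ze x
 have W: "bconv (%k. W1 (X k)) (W1 ze)" "bconv (%k. W1' (X k)) (W1' ze)" "bconv (%k. W2 (X k)) (W2 ze)" "bconv (%k. W2' (X k)) (W2' ze)"
  if "!!j. j < n ==> (%k. X k j) ---> ze j" for X ze
  unfolding W1_def W1'_def W2_def W2'_def using that by (auto intro!: bconv_sum bconv_mult bconv_seq P)
 have I: "bconv (%k. I (X k) i) (I ze i)" if "!!j. j < n ==> (%k. X k j) ---> ze j" for X ze i
  unfolding I_def by (intro bconv_add bconv_mult bconv_diff bconv_exp bconv_const P FG W that)
 have W0: "bdm (W1 ze)" "bdm (W1' ze)" "bdm (W2 ze)" "bdm (W2' ze)" for ze using W[of "%_. ze" ze] by auto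
 have I0: "bdm (I ze i)" for ze i using I[of "%_. ze" ze i] by simp
 have D0: "bdm (D ze)" for ze unfolding D_def power2_eq_square by (intro bconv_add bconv_mult bconv_exp bconv_const W0)
 have Phi0: "bdm (%x. Phi1 mu (u x, v x))" if "bdm u" "bdm v" "!!x. u x >= 0" "!!x. v x >= 0" for u v
  unfolding Phi1_def fst_conv snd_conv by (intro bconv_add bconv_mult bconv_const bdm_L_fun that)
 define C0 where "C0 = ent mu F G"
 have C0: "C0 >= 0" unfolding C0_def using FG pos by (intro integral_nonneg_AE AE_I2 Phi1_nonneg) auto
 \<comment> \<open>Testing with the entropy variables means weighting the i-th equation with the
   unknown coefficient \<open>ze i\<close>. The tangent inequality of \<open>L_fun\<close> at the
   new values bounds the time difference below by the increment of the entropy.\<close>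
 have energy: "ent mu (%x. exp (W1 ze x)) (%x. exp (W2 ze x)) - C0 + ta * (LX x. D ze x)
   <= (SUM i<n. ze i * (LX x. I ze i x))" for ze
 proof -
  have Phi: "bdm (%x. Phi1 mu (exp (W1 ze x), exp (W2 ze x)))" by (intro Phi0 bconv_exp W0) auto
  have "(SUM i<n. ze i * (LX x. I ze i x)) = (LX x. (SUM i<n. ze i * I ze i x))"
   using I0 by (subst Bochner_integral_sum) (auto intro!: bdm_integrable)
  also have "... >= (LX x. Phi1 mu (exp (W1 ze x), exp (W2 ze x)) - Phi1 mu (F x, G x) + ta * D ze x)"
  proof (rule integral_mono)
   show "integrable mX (%x. Phi1 mu (exp (W1 ze x), exp (W2 ze x)) - Phi1 mu (F x, G x) + ta * D ze x)"
    by (intro bdm_integrable bconv_add bconv_diff bconv_cmult D0 Phi Phi0 FG)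
   show "integrable mX (%x. SUM i<n. ze i * I ze i x)" by (intro bdm_integrable bconv_sum bconv_cmult I0)
   fix x
   let ?f = "exp (W1 ze x)" and ?g = "exp (W2 ze x)" and ?p = "W1' ze x" and ?q = "W2' ze x"
   have lin: "(SUM i<n. ze i * (A * P i x + 1 / mu * (B * Q i x) + ta * (c * P' i x + R * (d * Q' i x))))
     = A * W1 ze x + 1 / mu * (B * W2 ze x) + ta * (c * W1' ze x + R * (d * W2' ze x))" for A B c d
    unfolding W1_def W1'_def W2_def W2'_def
    by (simp only: distrib_left sum.distrib sum_distrib_left) (simp add: mult_ac)
   have "(SUM i<n. ze i * I ze i x) = (?f - F x) * W1 ze x + 1 / mu * ((?g - G x) * W2 ze x)
     + ta * ((?f * ((1 + R) * (?f * ?p) + R * (?g * ?q))) * ?p + R * ((?g * (?f * ?p + ?g * ?q)) * ?q))"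
    unfolding I_def lin ..
   also have "(?f * ((1 + R) * (?f * ?p) + R * (?g * ?q))) * ?p + R * ((?g * (?f * ?p + ?g * ?q)) * ?q) = D ze x"
    unfolding D_def by (simp add: algebra_simps power2_eq_square)
   also have "(?f - F x) * W1 ze x + 1 / mu * ((?g - G x) * W2 ze x) + ta * D ze x
     >= (L_fun ?f - L_fun (F x)) + 1 / mu * (L_fun ?g - L_fun (G x)) + ta * D ze x"
    using L_fun_tangent[of ?f "F x"] L_fun_tangent[of ?g "G x"] FG pos
    by (intro add_mono mult_left_mono order_refl) (auto simp: algebra_simps)
   also have "(L_fun ?f - L_fun (F x)) + 1 / mu * (L_fun ?g - L_fun (G x)) = Phi1 mu (?f, ?g) - Phi1 mu (F x, G x)"
    by (simp add: Phi1_def right_diff_distrib)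
   finally show "Phi1 mu (?f, ?g) - Phi1 mu (F x, G x) + ta * D ze x <= (SUM i<n. ze i * I ze i x)" .
  qed
  also have "(LX x. Phi1 mu (exp (W1 ze x), exp (W2 ze x)) - Phi1 mu (F x, G x) + ta * D ze x)
    = ent mu (%x. exp (W1 ze x)) (%x. exp (W2 ze x)) - C0 + ta * (LX x. D ze x)" unfolding C0_def
   using bdm_integrable[OF Phi] bdm_integrable[OF D0[of ze]] bdm_integrable[OF Phi0[OF FG]] by simp
  finally show ?thesis .
 qed
 \<comment> \<open>On the boundary of the cube the regularizing term is at least ep K^2; this
   half-width makes it exceed the entropy \<open>C0\<close> of the data, which is the coercivity
   that \<open>zero_in_cube\<close> asks for.\<close>
 define K where "K = C0 / ep + 1"
 have K: "K > 0" "ep * K^2 > C0" (is ?S)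
 proof -
  show "K > 0" using C0 pos by (simp add: K_def add_nonneg_pos)
  have K1: "K >= 1" using C0 pos by (simp add: K_def)
  have "C0 < ep * K" using pos by (simp add: K_def field_simps)
  also have "ep * K <= ep * K^2" using K1 pos by (intro mult_left_mono) (auto simp: power2_eq_square)
  finally show ?S .
 qed
 have nonneg: "ent mu (%x. exp (W1 ze x)) (%x. exp (W2 ze x)) >= 0" "(LX x. D ze x) >= 0" for ze
  using pos by (auto intro!: integral_nonneg_AE AE_I2 Phi1_nonneg simp: D_def)
 have "EX ze. (ALL i<n. \<bar>ze i\<bar> <= K) & (ALL i<n. (LX x. I ze i x) + ep * ze i = 0)"
 proof (rule zero_in_cube[OF K(1)])
  fix X :: "nat => nat => real" and x i assume X: "!!j. j < n ==> (%k. X k j) ---> x j" and i: "i < n"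
  show "(%k. (LX y. I (X k) i y) + ep * X k i) ---> (LX y. I x i y) + ep * x i"
   by (intro tendsto_intros bconv_integral I X i)
 next
  fix ze assume "EX i<n. \<bar>ze i\<bar> = K"
  then obtain j where j: "j < n" "\<bar>ze j\<bar> = K" by blast
  have "K^2 = (ze j)^2" using j(2) by (metis power2_abs)
  also have "... <= (SUM i<n. (ze i)^2)" using j(1) by (intro member_le_sum) auto
  finally have "C0 < ep * (SUM i<n. (ze i)^2)" using K(2) pos by (meson less_le_trans mult_left_mono less_imp_le)
  moreover have "(SUM i<n. ze i * ((LX x. I ze i x) + ep * ze i)) = (SUM i<n. ze i * (LX x. I ze i x)) + ep * (SUM i<n. (ze i)^2)"
   by (simp add: distrib_left sum.distrib sum_distrib_left power2_eq_square mult_ac)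
  moreover have "ta * (LX x. D ze x) >= 0" using nonneg[of ze] pos by simp
  ultimately show "(SUM i<n. ze i * ((LX x. I ze i x) + ep * ze i)) > 0"
   using energy[of ze] nonneg(1)[of ze] by linarith
 qed
 then obtain ze where ze: "!!i. i < n ==> (LX x. I ze i x) = - ep * ze i"
  by (metis add_eq_0_iff2 minus_mult_left)
 have "(SUM i<n. ze i * (LX x. I ze i x)) = - (ep * (SUM i<n. (ze i)^2))"
  using ze by (simp add: sum_distrib_left power2_eq_square mult_ac flip: sum_negf)
 hence "ent mu (%x. exp (W1 ze x)) (%x. exp (W2 ze x)) + ta * (LX x. D ze x) + ep * (SUM i<n. (ze i)^2) <= C0"
  using energy[of ze] by linarith
 thus ?thesis using that[of "W1 ze" ze "W1' ze" "W2 ze" "W2' ze"] ze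
  unfolding W1_def[abs_def] W1'_def[abs_def] W2_def[abs_def] W2'_def[abs_def] I_def D_def C0_def by blast
qed

end

lemma convergent_by_density:
 fixes u :: "nat => 'a => real"
 assumes "!!e. e > 0 ==> EX y:S. EX N. ALL n>=N. \<bar>u n x - u n y\<bar> <= e"
  and "!!y. y : S ==> convergent (%n. u n y)"
 shows "convergent (%n. u n x)"
proof (rule Cauchy_convergent, rule metric_CauchyI)
 fix e :: real assume e: "e > 0"
 obtain y N where y: "y : S" "!!n. n >= N ==> \<bar>u n x - u n y\<bar> <= e/4" using assms(1)[of "e/4"] e by auto
 have "Cauchy (%n. u n y)" using assms(2)[OF y(1)] by (rule convergent_Cauchy)
 then obtain N' where N': "!!m n. m >= N' ==> n >= N' ==> dist (u m y) (u n y) < e/4"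
  using metric_CauchyD[of "%n. u n y" "e/4"] e by auto
 show "EX M. ALL m>=M. ALL n>=M. dist (u m x) (u n x) < e"
 proof (intro exI[of _ "max N N'"] allI impI)
  fix m n assume "m >= max N N'" "n >= max N N'"
  thus "dist (u m x) (u n x) < e"
   using y(2)[of m] y(2)[of n] N'[of m n] e unfolding dist_real_def max.bounded_iff by linarith
 qed
qed

lemma sqn_diff_add_tendsto:
 assumes "!!k. sq_int M (u k)" "sq_int M u'" "!!k. sq_int M (z k)" "sq_int M z'"
  and "(%k. sqn M (%x. u k x - u' x)) ---> 0" "(%k. sqn M (%x. z k x - z' x)) ---> 0"
 shows "(%k. sqn M (%x. (u k x + z k x) - (u' x + z' x))) ---> 0"
proof (rule tendsto_sandwich[OF _ _ tendsto_const])
 show "\<forall>\<^sub>F k in sequentially. sqn M (%x. (u k x + z k x) - (u' x + z' x))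
   <= 2 * sqn M (%x. u k x - u' x) + 2 * sqn M (%x. z k x - z' x)"
 proof (intro always_eventually allI)
  fix k
  have "sqn M (%x. (u k x + z k x) - (u' x + z' x)) = sqn M (%x. (u k x - u' x) + (z k x - z' x))"
   by (simp add: algebra_simps)
  also have "... <= 2 * sqn M (%x. u k x - u' x) + 2 * sqn M (%x. z k x - z' x)"
   using assms by (intro sqn_add_le sq_int_diff) auto
  finally show "sqn M (%x. (u k x + z k x) - (u' x + z' x)) <= ..." .
 qed
 show "(%k. 2 * sqn M (%x. u k x - u' x) + 2 * sqn M (%x. z k x - z' x)) ---> 0"
  using assms(5,6) by (auto intro!: tendsto_eq_intros)
qed simp

lemma sqn_combination_le_sum:
 fixes h :: "nat => 'a => real"
 assumes c: "conv_weights c K" and h: "!!n. sq_int M (h n)"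
 shows "sqn M (%x. SUM n<K k. c k n * h n x) <= (SUM n<K k. c k n * sqn M (h n))"
proof -
 have pt: "(norm (SUM n<K k. c k n * h n x))^2 <= (SUM n<K k. c k n * (norm (h n x))^2)" for x
 proof -
  let ?s = "SUM n<K k. c k n * h n x"
  have "0 <= (SUM n<K k. c k n * (h n x - ?s)^2)"
   by (intro sum_nonneg mult_nonneg_nonneg conv_weightsD[OF c]) auto
  also have "... = (SUM n<K k. c k n * (h n x)^2 - 2 * ((c k n * h n x) * ?s) + c k n * ?s^2)"
   by (intro sum.cong) (auto simp: power2_eq_square algebra_simps)
  also have "... = (SUM n<K k. c k n * (h n x)^2) - 2 * (?s * ?s) + ?s^2" using conv_weightsD(4)[OF c, of k]
   by (simp only: sum.distrib sum_subtractf sum_distrib_left[symmetric] sum_distrib_right[symmetric])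
  finally show ?thesis by (simp add: power2_eq_square)
 qed
 have s: "sq_int M (%x. SUM n<K k. c k n * h n x)" by (intro sq_int_sum sq_int_mult h)
 have "sqn M (%x. SUM n<K k. c k n * h n x) <= (LINT x|M. (SUM n<K k. c k n * (norm (h n x))^2))"
  using h s by (intro integral_mono pt Bochner_integrable_sum) (auto simp: sq_int_def)
 also have "... = (SUM n<K k. c k n * sqn M (h n))"
  using h by (subst Bochner_integral_sum) (auto simp: sq_int_def)
 finally show ?thesis .
qed

definition mconv :: "'a measure => (nat => nat => real) => (nat => nat) => (nat => 'a => real) => ('a => real) => bool" where
 "mconv M c K h l \<longleftrightarrow> sq_int M l & (AE x in M. (%k. SUM n<K k. c k n * h n x) ---> l x)
  & (%k. sqn M (%x. (SUM n<K k. c k n * h n x) - l x)) ---> 0"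

lemma mconvD:
 assumes "mconv M c K h l"
 shows "sq_int M l" "AE x in M. (%k. SUM n<K k. c k n * h n x) ---> l x" "(%k. sqn M (%x. (SUM n<K k. c k n * h n x) - l x)) ---> 0"
 using assms by (simp_all add: mconv_def)

lemma mconv_subseq:
 assumes m: "mconv M c K h l" and r: "strict_mono r"
 shows "mconv M (%k. c (r k)) (%k. K (r k)) h l"
proof -
 have "AE x in M. (%k. SUM n<K (r k). c (r k) n * h n x) ---> l x" using mconvD(2)[OF m]
 proof eventually_elim
  case (elim x)
  from LIMSEQ_subseq_LIMSEQ[OF elim r] show ?case by (simp add: o_def)
 qed
 thus ?thesis using mconvD(1)[OF m] LIMSEQ_subseq_LIMSEQ[OF mconvD(3)[OF m] r] by (simp add: mconv_def o_def)
qed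

text \<open>The four sequences are packed into one with values in R^4, so that a single family of
  weights serves all of them: a flux and the derivatives that occur in it must be averaged
  identically for the product to be recognised in the limit.\<close>

lemma convex_combinations_converge4:
 fixes h1 h2 h3 h4 :: "nat => 'a => real"
 assumes s: "!!n. sq_int M (h1 n)" "!!n. sq_int M (h2 n)" "!!n. sq_int M (h3 n)" "!!n. sq_int M (h4 n)"
  and B: "!!n. sqn M (h1 n) <= B1" "!!n. sqn M (h2 n) <= B2" "!!n. sqn M (h3 n) <= B3" "!!n. sqn M (h4 n) <= B4"
 obtains c K l1 l2 l3 l4 where "conv_weights c K" "mconv M c K h1 l1" "mconv M c K h2 l2" "mconv M c K h3 l3" "mconv M c K h4 l4"
proof -
 define H where "H n x = (h1 n x, h2 n x, h3 n x, h4 n x)" for n x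
 have [measurable]: "h1 n : borel_measurable M" "h2 n : borel_measurable M" "h3 n : borel_measurable M" "h4 n : borel_measurable M" for n
  using s by (auto intro: sq_intD)
 have nH: "(norm (p, q, r, t))^2 = p^2 + q^2 + r^2 + t^2" for p q r t :: real by (simp add: norm_Pair)
 have i: "integrable M (%x. (h1 n x)^2)" "integrable M (%x. (h2 n x)^2)" "integrable M (%x. (h3 n x)^2)" "integrable M (%x. (h4 n x)^2)" for n
  using s[of n] by (auto simp: sq_int_def)
 have H: "sq_int M (H n)" for n unfolding sq_int_def H_def nH using i by (auto intro!: Bochner_integrable_add)
 have HB: "sqn M (H n) <= B1 + B2 + B3 + B4" for n unfolding H_def nH using i B[of n] by simp
 obtain c K l where l: "conv_weights c K" "sq_int M l"
  "AE x in M. (%k. SUM n<K k. c k n *\<^sub>R H n x) ---> l x"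
  "(%k. sqn M (%x. (SUM n<K k. c k n *\<^sub>R H n x) - l x)) ---> 0"
  by (rule convex_combinations_converge[OF H HB])
 define l1 l2 l3 l4 where "l1 x = fst (l x)" and "l2 x = fst (snd (l x))" and "l3 x = fst (snd (snd (l x)))"
  and "l4 x = snd (snd (snd (l x)))" for x
 have leq: "l x = (l1 x, l2 x, l3 x, l4 x)" for x by (simp add: l1_def l2_def l3_def l4_def)
 have Heq: "(SUM n<K k. c k n *\<^sub>R H n x) = (SUM n<K k. c k n * h1 n x, SUM n<K k. c k n * h2 n x, SUM n<K k. c k n * h3 n x, SUM n<K k. c k n * h4 n x)" for k x
  by (simp add: H_def sum_prod[symmetric])
 have [measurable]: "l : borel_measurable M" using l(2) by (rule sq_intD)
 have [measurable]: "l1 : borel_measurable M" "l2 : borel_measurable M" "l3 : borel_measurable M" "l4 : borel_measurable M"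
  unfolding l1_def[abs_def] l2_def[abs_def] l3_def[abs_def] l4_def[abs_def]
  by (auto intro!: borel_measurable_continuous_on[of _ l, OF _ \<open>l : borel_measurable M\<close>] continuous_intros)
 have il: "integrable M (%x. (l1 x)^2 + (l2 x)^2 + (l3 x)^2 + (l4 x)^2)"
  using sq_int_integrable[OF l(2)] by (simp add: leq nH)
 have sl: "sq_int M l1" "sq_int M l2" "sq_int M l3" "sq_int M l4" by (auto intro!: sq_int_bound[OF _ il])
 have conv: "mconv M c K h l'"
  if h: "!!n. sq_int M (h n)" "sq_int M l'" "!!k x. (norm ((SUM n<K k. c k n * h n x) - l' x))^2 <= (norm ((SUM n<K k. c k n *\<^sub>R H n x) - l x))^2"
   "AE x in M. (%k. SUM n<K k. c k n * h n x) ---> l' x" for h :: "nat => 'a => real" and l'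
 proof -
  have "(%k. sqn M (%x. (SUM n<K k. c k n * h n x) - l' x)) ---> 0"
  proof (rule tendsto_sandwich[OF _ _ tendsto_const l(4)])
   show "\<forall>\<^sub>F k in sequentially. sqn M (%x. (SUM n<K k. c k n * h n x) - l' x) <= sqn M (%x. (SUM n<K k. c k n *\<^sub>R H n x) - l x)"
    by (intro always_eventually allI integral_mono sq_int_integrable sq_int_diff sq_int_sum sq_int_mult sq_int_scaleR H l h)
  qed simp
  thus ?thesis using h(2,4) by (simp add: mconv_def)
 qed
 have "AE x in M. (%k. SUM n<K k. c k n * h1 n x) ---> l1 x & (%k. SUM n<K k. c k n * h2 n x) ---> l2 x
   & (%k. SUM n<K k. c k n * h3 n x) ---> l3 x & (%k. SUM n<K k. c k n * h4 n x) ---> l4 x" using l(3)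
 proof eventually_elim
  case (elim x)
  note 1 = elim[unfolded Heq leq]
  note 2 = tendsto_snd[OF 1, simplified] note 3 = tendsto_snd[OF 2, simplified]
  show ?case using tendsto_fst[OF 1] tendsto_fst[OF 2] tendsto_fst[OF 3] tendsto_snd[OF 3] by simp
 qed
 thus ?thesis
  by (intro that[OF l(1) conv[OF s(1) sl(1)] conv[OF s(2) sl(2)] conv[OF s(3) sl(3)] conv[OF s(4) sl(4)]])
    (auto simp: Heq leq nH elim: eventually_mono)
qed

text \<open>A product of a strongly and a weakly convergent factor: the limit is identified along the convex
 combinations, since the commutator \<open>(f\<^sub>n - f) p\<^sub>n\<close> tends to zero in \<open>L\<^sub>1\<close>.\<close>

lemma product_limit_AE:
 fixes f p :: "nat => 'a => real"
 assumes c: "conv_weights c K" and p: "!!n. sq_int M (p n)" "!!n. sqn M (p n) <= B"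
  and f: "!!n. sq_int M (%x. f n x - f' x)" "(%n. sqn M (%x. f n x - f' x)) ---> 0"
  and p': "AE x in M. (%k. SUM n<K k. c k n * p n x) ---> p' x"
  and J: "AE x in M. (%k. SUM n<K k. c k n * (f n x * p n x)) ---> J x"
 shows "AE x in M. J x = f' x * p' x"
proof -
 define e where "e k x = (SUM n<K k. c k n * ((f n x - f' x) * p n x))" for k x
 have i: "integrable M (%x. (f n x - f' x) * p n x)" for n by (intro sq_int_times f p)
 have ei: "integrable M (e k)" for k unfolding e_def[abs_def] by (intro Bochner_integrable_sum integrable_mult_right i)
 have B: "B >= 0" using p(2)[of 0] sqn_nonneg[of M "p 0"] by linarith
 define q where "q n = sqrt (sqn M (%x. f n x - f' x)) * sqrt B" for n
 have q: "q ---> 0"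
  using tendsto_mult[OF tendsto_real_sqrt[OF f(2)] tendsto_const[of "sqrt B"]] by (simp add: q_def[abs_def])
 have le: "(LINT x|M. norm (e k x)) <= (SUM n<K k. c k n *\<^sub>R q n)" for k
 proof -
  have "(LINT x|M. norm (e k x)) <= (LINT x|M. (SUM n<K k. c k n * (norm (f n x - f' x) * norm (p n x))))"
  proof (rule integral_mono)
   show "integrable M (%x. SUM n<K k. c k n * (norm (f n x - f' x) * norm (p n x)))"
    by (intro Bochner_integrable_sum integrable_mult_right sq_int_norm_mult f p)
   show "norm (e k x) <= (SUM n<K k. c k n * (norm (f n x - f' x) * norm (p n x)))" for x
    unfolding e_def using conv_weightsD(1)[OF c] by (intro sum_norm_le) (simp add: abs_mult)
  qed (use ei in simp)
  also have "... = (SUM n<K k. c k n * (LINT x|M. norm (f n x - f' x) * norm (p n x)))"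
   by (subst Bochner_integral_sum) (auto intro!: integrable_mult_right sq_int_norm_mult[OF f(1) p(1), simplified])
  also have "... <= (SUM n<K k. c k n * q n)"
  proof (intro sum_mono mult_left_mono conv_weightsD(1)[OF c])
   fix n
   show "(LINT x|M. norm (f n x - f' x) * norm (p n x)) <= q n"
    unfolding q_def by (rule order_trans[OF CS_sqrt[OF f(1) p(1)]]) (intro mult_left_mono real_sqrt_le_mono p(2), simp)
  qed
  finally show ?thesis by simp
 qed
 have "(%k. \<integral>x. norm (e k x) \<partial>M) ---> 0"
  by (rule tendsto_sandwich[OF _ _ tendsto_const conv_weights_tendsto[OF c q]]) (use le in auto)
 then obtain r where r: "strict_mono (r :: nat => nat)" "AE x in M. (%n. e (r n) x) ---> 0"
  using tendsto_L1_AE_subseq[of M e] ei by blast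
 from r(2) p' J show ?thesis
 proof eventually_elim
  case (elim x)
  have "e k x = (SUM n<K k. c k n * (f n x * p n x)) - f' x * (SUM n<K k. c k n * p n x)" for k
   unfolding e_def by (simp add: sum_distrib_left sum_subtractf algebra_simps)
  hence "(%k. e k x) ---> J x - f' x * p' x" using elim by (auto intro!: tendsto_intros)
  from LIMSEQ_subseq_LIMSEQ[OF this r(1)] have "(%k. e (r k) x) ---> J x - f' x * p' x" by (simp add: o_def)
  from LIMSEQ_unique[OF this elim(1)] show ?case by simp
 qed
qed

section \<open>From the Galerkin problems to one implicit time step\<close>

context interval
begin

lemma ac_clamp: assumes "ac ph v" shows "ph (max a (min b x)) = ph x"
proof -
 consider "x < a" | "a <= x" "x <= b" | "b < x" by linarith
 thus ?thesis
 proof cases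
  case 1 thus ?thesis using ab acD(2)[OF assms, of x] by (simp add: cumX_le_a)
 next
  case 3 thus ?thesis using ab acD(2)[OF assms, of x] acD(2)[OF assms, of b] ac_measurable_deriv[OF assms] by (simp add: cumX_ge_b)
 qed simp
qed

text \<open>The Hoelder estimate averaged over the second point. As the mass is controlled by the
  entropy, it turns the energy bound into a bound on the supremum.\<close>

lemma ac_sup_bound:
 assumes "ac ph v" shows "ph x <= (LX y. ph y) / (b - a) + sqrt ((b - a) * sqn mX v)"
proof -
 let ?x = "max a (min b x)"
 have x: "a <= ?x" "?x <= b" using ab by auto
 have "(LX y. ph ?x) <= (LX y. ph y + sqrt ((b - a) * sqn mX v))"
 proof (rule integral_mono_AE)
  show "AE y in mX. ph ?x <= ph y + sqrt ((b - a) * sqn mX v)"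
  proof (rule AE_mXI)
   fix y assume y: "a < y" "y < b"
   have "(ph ?x - ph y)^2 <= \<bar>?x - y\<bar> * sqn mX v" by (rule ac_holder[OF assms])
   also have "... <= (b - a) * sqn mX v" using x y by (intro mult_right_mono) auto
   finally have "ph ?x - ph y <= sqrt ((b - a) * sqn mX v)" by (rule real_le_rsqrt)
   thus "ph ?x <= ph y + sqrt ((b - a) * sqn mX v)" by simp
  qed
 qed (use sq_int_imp_integrable[OF ac_sq_int[OF assms]] in auto)
 also have "... = (LX y. ph y) + (b - a) * sqrt ((b - a) * sqn mX v)"
  using sq_int_imp_integrable[OF ac_sq_int[OF assms]] by (simp add: measure_mX)
 finally have "(b - a) * ph ?x <= (LX y. ph y) + (b - a) * sqrt ((b - a) * sqn mX v)"
  by (simp add: measure_mX)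
 thus ?thesis using ab ac_clamp[OF assms, of x] by (simp add: field_simps)
qed

lemma cumX_tendsto:
 assumes "!!k. sq_int mX (u k)" "sq_int mX l" "(%k. sqn mX (%x. u k x - l x)) ---> 0"
 shows "(%k. cumX (u k) x) ---> cumX l x"
proof -
 have s: "sq_int mX (indicator {..x} :: real => real)" by (rule sq_int_bounded[of _ 1]) auto
 show ?thesis using inner_tendsto[OF assms(1,2) s assms(3)] by (simp add: cum_def mult.commute)
qed

lemma ac_limit:
 assumes c: "conv_weights c K" and ac: "!!n. ac (f n) (v n)" and f: "!!x. (%n. f n x) ---> f' x"
  and v': "sq_int mX v'" "(%k. sqn mX (%x. (SUM n<K k. c k n * v n x) - v' x)) ---> 0"
 shows "ac f' v'"
proof (rule acI[OF v'(1)])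
 fix x
 have comb: "(%k. SUM n<K k. c k n * f n x) ---> f' x" for x using conv_weights_tendsto[OF c f[of x]] by simp
 have "(SUM n<K k. c k n * f n x) = (SUM n<K k. c k n * f n a) + cumX (%x. SUM n<K k. c k n * v n x) x" for k
  using ac_integrable[OF ac]
  by (subst acD(2)[OF ac]) (simp add: X.cum_sum X.cum_mult distrib_left sum.distrib)
 moreover have "(%k. (SUM n<K k. c k n * f n a) + cumX (%x. SUM n<K k. c k n * v n x) x) ---> f' a + cumX v' x"
  by (intro tendsto_add comb cumX_tendsto v' sq_int_sum sq_int_mult acD(1)[OF ac])
 ultimately show "f' x = f' a + cumX v' x" using LIMSEQ_unique[OF comb[of x]] by presburger
qed

lemma bconv_L_fun:
 assumes "bconv u l" "!!k x. u k x >= 0" "!!x. l x >= 0" shows "bconv (%k x. L_fun (u k x)) (%x. L_fun (l x))"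
proof -
 obtain M where M: "!!k. u k : BM" "l : BM"
  "!!k x. a < x ==> x < b ==> \<bar>u k x\<bar> <= M" "!!x. a < x ==> x < b ==> (%k. u k x) ---> l x"
  using bconvE[OF assms(1)] by metis
 obtain B where B: "!!r. 0 <= r ==> r <= M ==> \<bar>L_fun r\<bar> <= B" using L_fun_bounded[of M] by blast
 show ?thesis
 proof (rule bconvI[where M=B])
  fix k x assume x: "a < x" "x < b"
  show "\<bar>L_fun (u k x)\<bar> <= B" using M(3)[OF x, of k] assms(2) by (intro B) auto
 next
  fix x assume x: "a < x" "x < b"
  show "(%k. L_fun (u k x)) ---> L_fun (l x)"
   by (rule continuous_on_tendsto_compose[OF L_fun_continuous M(4)[OF x]]) (use assms in auto)
 qed (use M in measurable)
qed

lemma bconv_Phi1: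
 assumes "bconv u l" "bconv u' l'" "!!k x. u k x >= 0" "!!k x. u' k x >= 0" "!!x. l x >= 0" "!!x. l' x >= 0"
 shows "bconv (%k x. Phi1 mu (u k x, u' k x)) (%x. Phi1 mu (l x, l' x))"
 unfolding Phi1_def fst_conv snd_conv by (intro bconv_add bconv_mult bconv_const bconv_L_fun assms)

lemma bdm_continuous: assumes "continuous_on {a..b} h" "h : BM" shows "bdm h"
proof -
 obtain B where "!!x. x : {a..b} ==> \<bar>h x\<bar> <= B"
  using compact_imp_bounded[OF compact_continuous_image[OF assms(1) compact_Icc]] unfolding bounded_iff by force
 thus ?thesis using assms(2) by (intro bdmI[where M=B]) auto
qed

lemma ac_bdm: "ac ph v ==> bdm ph"
 by (rule bdmI[OF ac_measurable ac_bounded])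

lemma bconv_power: "bconv u l ==> bconv (%k x. u k x ^ n) (%x. l x ^ n)"
 by (induct n) (auto intro: bconv_const bconv_mult)

lemma bconv_binform: "bconv u l ==> bconv u' l' ==> bconv (%k x. binform c n (u k x) (u' k x)) (%x. binform c n (l x) (l' x))"
 unfolding binform_def by (intro bconv_sum bconv_mult bconv_const bconv_power)

lemma bconv_Phi: "bconv u l ==> bconv u' l' ==> bconv (%k x. Phi R mu n (u k x, u' k x)) (%x. Phi R mu n (l x, l' x))"
 unfolding Phi_binform fst_conv snd_conv by (rule bconv_binform)

text \<open>The chain rule from the exponential series: its partial sums are polynomials in
  \<open>ph\<close>, the derivative of each contains the preceding one, and all are bounded by
  \<open>exp M\<close>, so that dominated convergence passes to the limit.\<close>

lemma ac_exp: assumes "ac ph v" shows "ac (%x. exp (ph x)) (%x. exp (ph x) * v x)"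
proof (rule acI[where c="exp (ph a)"])
 note [measurable] = ac_measurable[OF assms] ac_measurable_deriv[OF assms]
 define M where "M = \<bar>ph a\<bar> + (LX y. \<bar>v y\<bar>)"
 have M: "\<bar>ph x\<bar> <= M" for x unfolding M_def by (rule ac_bounded[OF assms])
 have eM: "exp \<bar>ph x\<bar> <= exp M" "\<bar>exp (ph x)\<bar> <= exp M" for x using M[of x] by simp_all
 show "sq_int mX (%x. exp (ph x) * v x)" by (rule sq_int_bounded_mult(1)[OF acD(1)[OF assms] _ eM(2)]) measurable
 define S where "S n x = (SUM k<n. ph x ^ k / fact k)" for n x
 have S: "ac (S (Suc n)) (%x. S n x * v x)" for n
 proof (induct n)
  case 0 thus ?case using ac_const[of 1] by (simp add: S_def[abs_def])
 next
  case (Suc n)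
  show ?case
   by (rule ac_cong[OF ac_add[OF Suc ac_cmult[OF ac_power[OF assms, of "Suc n"], of "1 / fact (Suc n)"]]])
     (simp_all add: S_def distrib_right del: of_nat_Suc)
 qed
 have lim: "(%n. S n x) ---> exp (ph x)" for x
  using exp_converges[of "ph x"] by (simp add: sums_def S_def scaleR_conv_of_real divide_inverse mult.commute)
 have bd: "\<bar>S n x\<bar> <= exp M" for n x
 proof -
  have "\<bar>S n x\<bar> <= (SUM k<n. \<bar>ph x\<bar> ^ k /\<^sub>R fact k)"
   unfolding S_def by (rule order_trans[OF sum_abs]) (simp add: abs_mult power_abs divide_inverse mult.commute)
  also have "... <= exp \<bar>ph x\<bar>"
   unfolding sums_unique[OF exp_converges[of "\<bar>ph x\<bar>"]] by (intro sum_le_suminf sums_summable[OF exp_converges]) auto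
  finally show ?thesis using eM(1)[of x] by linarith
 qed
 fix x
 have "(%n. cumX (%y. S n y * v y) x) ---> cumX (%y. exp (ph y) * v y) x" unfolding cum_def
 proof (rule integral_dominated_convergence[where w="%y. exp M * \<bar>v y\<bar>"])
  show "AE y in mX. norm (indicator {..x} y * (S n y * v y)) <= exp M * \<bar>v y\<bar>" for n
   using bd by (intro AE_I2) (auto simp: indicator_def abs_mult intro!: mult_right_mono)
 qed (use lim ac_integrable[OF assms] in "auto simp: S_def intro!: tendsto_intros")
 from tendsto_add[OF LIMSEQ_Suc[OF lim[of a]] this]
 have "(%n. S (Suc n) x) ---> exp (ph a) + cumX (%y. exp (ph y) * v y) x"
  by (rule Lim_transform_eventually) (intro always_eventually allI acD(2)[OF S, symmetric])
 from LIMSEQ_unique[OF LIMSEQ_Suc[OF lim[of x]] this] show "exp (ph x) = exp (ph a) + cumX (%y. exp (ph y) * v y) x" .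
qed

lemma sq_int_indicator: "sq_int mX (indicator {..q} :: real => real)"
 by (rule sq_int_bounded[of _ 1]) auto

text \<open>The test functions have the indicators of rational half-lines as derivatives. After an
  integration by parts their equations say that \<open>J\<close> and the primitive of
  \<open>h\<close> have equal primitives at rational points, hence everywhere by continuity. A
  countable family thus recovers the equation, which is why the Galerkin scheme can use it.\<close>

lemma flux_from_moments:
 assumes h: "integrable mX h" and J: "sq_int mX J"
  and moments: "!!k. (LX x. h x * (1 + cumX (indicator {..from_nat_into \<rat> k}) x)) + (LX x. J x * indicator {..from_nat_into \<rat> k} x) = 0"
 shows "(LX x. h x) = 0" (is ?A) "AE x in mX. J x = cumX h x" (is ?B)
proof -
 have mom: "(LX x. h x * (1 + cumX (indicator {..q}) x)) + (LX x. J x * indicator {..q} x) = 0" if "q : \<rat>" for q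
  using moments[of "to_nat_on \<rat> q"] that by (simp add: countable_rat)
 have cumJ: "(LX x. J x * indicator {..q} x) = cumX J q" for q by (simp add: cum_def mult.commute)
 \<comment> \<open>For a rational left of the interval the test function is the constant 1 and the
   flux term vanishes: the equation states conservation of mass.\<close>
 obtain q where q: "q : \<rat>" "q < a" using Rats_dense_in_real[of "a - 1" a] by auto
 have "cumX (indicator {..q}) x = cumX (indicator {..x}) q" for x by (simp add: cum_def mult.commute)
 thus h0: ?A using mom[OF q(1)] q(2) by (simp add: cumJ cumX_le_a)
 have [measurable]: "h : BM" using h borel_measurable_integrable by fastforce
 define d where "d x = J x - cumX h x" for x
 have scum: "sq_int mX (cumX h)" by (rule sq_int_bounded[OF _ X.cum_bound[OF h]]) measurable
 have d: "sq_int mX d" unfolding d_def[abs_def] by (intro sq_int_diff J scum)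
 have zero: "cumX d q = 0" if "q : \<rat>" for q
 proof -
  have "ac (%x. 1 + cumX (indicator {..q}) x) (indicator {..q})" by (rule acI[OF sq_int_indicator refl])
  from ac_ibp[OF this h] have "(LX x. h x * (1 + cumX (indicator {..q}) x)) = - cumX (cumX h) q" by (simp add: h0 cum_def)
  thus ?thesis unfolding d_def[abs_def]
   using mom[OF that] X.cum_diff[OF sq_int_imp_integrable[OF J] sq_int_imp_integrable[OF scum]] by (simp add: cumJ)
 qed
 have "cumX d x = 0" for x
 proof -
  define B where "B = sqn mX d"
  have "(cumX d x)^2 <= 0 + e" if e: "e > 0" for e
  proof -
   have p: "e / (1 + B) > 0" using e sqn_nonneg[of mX d] by (simp add: B_def add_pos_nonneg)
   then obtain q where q: "q : \<rat>" "x < q" "q < x + e / (1 + B)" using Rats_dense_in_real[of x "x + e / (1 + B)"] by auto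
   have "(cumX d x)^2 <= \<bar>x - q\<bar> * B" using cumX_holder[OF d, of x q] zero[OF q(1)] by (simp add: B_def)
   also have "... <= e / (1 + B) * (1 + B)" using q p sqn_nonneg[of mX d] by (intro mult_mono) (auto simp: B_def)
   finally show ?thesis using sqn_nonneg[of mX d] by (simp add: B_def add_nonneg_eq_0_iff)
  qed
  from field_le_epsilon[OF this] show ?thesis by simp
 qed
 hence "AE x in mX. d x = 0"
  by (intro integral_interval_unique[OF finite_mX sets_mX sq_int_imp_integrable[OF d]]) (simp add: cum_def)
 thus ?B by eventually_elim (simp add: d_def)
qed

text \<open>The step is implicit, so the gradient of \<open>Phi\<close> is taken at the new values
  and its tangent inequality has the right direction. Mean zero removes the boundary terms of the
  integrations by parts, the primitives of the increments are the fluxes, and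
  \<open>Phi_dissipation\<close> gives the sign.\<close>

lemma Phi_step:
 assumes pos: "R > 0" "mu > 0" "ta > 0" and n: "n >= 2"
  and ac: "ac f v" "ac g w" and nn: "!!x. f x >= 0" "!!x. g x >= 0"
  and FG: "bdm F" "bdm G" "!!x. F x >= 0" "!!x. G x >= 0"
  and mass: "(LX x. f x - F x) = 0" "(LX x. g x - G x) = 0"
  and flux: "AE x in mX. cumX (%x. f x - F x) x = ta * (f x * ((1 + R) * v x + R * w x))"
   "AE x in mX. cumX (%x. g x - G x) x = ta * (mu * R * (g x * (v x + w x)))"
 shows "(LX x. Phi R mu n (f x, g x)) <= (LX x. Phi R mu n (F x, G x))"
proof -
 obtain m where m: "n = Suc (Suc m)" using n by (metis One_nat_def Suc_1 Suc_le_D Suc_le_mono)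
 note bf = ac_bdm[OF ac(1)] and bg = ac_bdm[OF ac(2)]
 let ?p = "%x. Phi1d R mu m n (f x) (g x)" and ?q = "%x. Phi2d R mu m n (f x) (g x)"
 let ?a = "%x. Phi11 R mu m n (f x) (g x)" and ?b = "%x. Phi12 R mu m n (f x) (g x)" and ?c = "%x. Phi22 R mu m n (f x) (g x)"
 have rm: "real (Suc m) = real n - 1" by (simp add: m)
 have p: "ac ?p (%x. ?a x * v x + ?b x * w x)"
  using ac_binform[OF ac, of "%j. acoef R mu (Suc j) n * real (Suc j)" m] unfolding rm
  by (simp only: Phi1d_def[OF pos(1,2) m] Phi11_def[OF pos(1,2) m] Phi12_def[OF pos(1,2) m])
 have e: "binform (%j. acoef R mu (Suc j) n * (real n - real (Suc j)) * real (Suc j)) m = Phi12 R mu m n"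
  unfolding Phi12_def[OF pos(1,2) m] by (intro ext binform_cong) simp
 have q: "ac ?q (%x. ?b x * v x + ?c x * w x)"
  using ac_binform[OF ac, of "%j. acoef R mu j n * (real n - real j)" m] unfolding rm e
  by (simp only: Phi2d_def[OF pos(1,2) m] Phi22_def[OF pos(1,2) m])
 have fF: "bdm (%x. f x - F x)" "bdm (%x. g x - G x)" by (intro bconv_diff bf bg FG)+
 let ?D = "%x. (?a x * v x + ?b x * w x) * (f x * ((1 + R) * v x + R * w x)) + (?b x * v x + ?c x * w x) * (mu * R * (g x * (v x + w x)))"
 have ibp: "(LX x. h x * P x) = - (LX x. D x * J x)"
  if h: "bdm h" "(LX x. h x) = 0" and P: "ac P D" and J: "AE x in mX. cumX h x = J x" "J : BM" for h P D J
 proof -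
  note [measurable] = ac_measurable_deriv[OF P] J(2) X.borel_measurable_cum[OF borel_measurable_integrable[OF bdm_integrable[OF h(1)], simplified]]
  have "(LX x. D x * cumX h x) = (LX x. D x * J x)" by (rule integral_cong_AE) (use J(1) in auto)
  thus ?thesis using ac_ibp[OF P bdm_integrable[OF h(1)]] h(2) by simp
 qed
 note [measurable] = ac_measurable_deriv[OF ac(1)] ac_measurable_deriv[OF ac(2)] ac_measurable[OF ac(1)] ac_measurable[OF ac(2)]
 have Jm: "(%x. ta * (f x * ((1 + R) * v x + R * w x))) : BM" "(%x. ta * (mu * R * (g x * (v x + w x)))) : BM" by measurable
 note p1 = ibp[OF fF(1) mass(1) p flux(1) Jm(1)] and q1 = ibp[OF fF(2) mass(2) q flux(2) Jm(2)]
 obtain Bf Bg where B: "!!x. \<bar>f x\<bar> <= Bf" "!!x. \<bar>g x\<bar> <= Bg" using ac_bounded[OF ac(1)] ac_bounded[OF ac(2)] by blast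
 have sJ: "sq_int mX (%x. f x * ((1 + R) * v x + R * w x))" "sq_int mX (%x. g x * (v x + w x))"
  using ac_measurable[OF ac(1)] ac_measurable[OF ac(2)] B acD(1)[OF ac(1)] acD(1)[OF ac(2)]
  by (auto intro!: sq_int_bounded_mult(1) sq_int_add sq_int_mult)
 have iD: "integrable mX (%x. (?a x * v x + ?b x * w x) * (f x * ((1 + R) * v x + R * w x)))"
  "integrable mX (%x. (?b x * v x + ?c x * w x) * (mu * R * (g x * (v x + w x))))"
  using acD(1)[OF p] acD(1)[OF q] by (intro sq_int_times sJ sq_int_mult; simp)+
 have "(LX x. (f x - F x) * ?p x) + (LX x. (g x - G x) * ?q x) = - (ta * (LX x. ?D x))"
  unfolding p1 q1 Bochner_integral_add[OF iD]
  by (simp only: mult.left_commute[of _ ta] integral_mult_right_zero) (simp add: distrib_left)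
 moreover have "(LX x. ?D x) >= 0"
  using Phi_dissipation[OF pos(1,2) m nn(1) nn(2)] by (intro integral_nonneg_AE AE_I2)
 ultimately have neg: "(LX x. (f x - F x) * ?p x) + (LX x. (g x - G x) * ?q x) <= 0" using pos by simp
 have i1: "integrable mX (%x. (f x - F x) * ?p x)" "integrable mX (%x. (g x - G x) * ?q x)"
  by (intro bdm_integrable bconv_mult fF ac_bdm[OF p] ac_bdm[OF q])+
 have i2: "integrable mX (%x. Phi R mu n (f x, g x))" "integrable mX (%x. Phi R mu n (F x, G x))"
  by (intro bdm_integrable bconv_Phi bf bg FG)+
 have "(LX x. Phi R mu n (f x, g x)) <= (LX x. Phi R mu n (F x, G x) + ((f x - F x) * ?p x + (g x - G x) * ?q x))"
 proof (rule integral_mono)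
  fix x
  show "Phi R mu n (f x, g x) <= Phi R mu n (F x, G x) + ((f x - F x) * ?p x + (g x - G x) * ?q x)"
   using Phi_tangent[OF pos(1,2) m nn(1)[of x] nn(2)[of x] FG(3)[of x] FG(4)[of x]] by (simp add: algebra_simps)
 qed (use i1 i2 in auto)
 also have "... = (LX x. Phi R mu n (F x, G x)) + ((LX x. (f x - F x) * ?p x) + (LX x. (g x - G x) * ?q x))"
  using i1 i2 by simp
 finally show ?thesis using neg by linarith
qed

text \<open>Chebyshev's inequality with the two n-th powers enclosing \<open>Phi\<close>: the
  measure of the set where f + g >= L + e is at most (b - a) (L / (L + e))^n, which tends to zero as
  n grows. The set is therefore null for every positive \<open>e\<close>.\<close>

lemma sup_bound_from_Phi:
 assumes pos: "R > 0" "mu > 0"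
  and m: "f : BM" "g : BM" "F : BM" "G : BM"
  and fg: "!!x. f x >= 0" "!!x. g x >= 0" "bdm f" "bdm g"
  and FG: "!!x. F x >= 0" "!!x. G x >= 0" "bdm F" "bdm G"
  and Phi: "!!n. n >= 2 ==> (LX x. Phi R mu n (f x, g x)) <= (LX x. Phi R mu n (F x, G x))"
  and K: "AE x in mX. F x + G x <= K" "K >= 0"
 shows "AE x in mX. f x + g x <= (1 + R) / R * K"
proof -
 note [measurable] = m
 define L where "L = (1 + R) / R * K"
 have L: "L >= 0" using pos K by (simp add: L_def)
 have key: "AE x in mX. f x + g x < L + e" if e: "e > 0" for e
 proof -
  let ?A = "{x. L + e <= f x + g x}"
  have [measurable]: "?A : sets borel" by measurable
  have le: "(L + e) ^ n * measure mX ?A <= L ^ n * (b - a)" if n: "n >= 2" for n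
  proof -
   have "(L + e) ^ n * measure mX ?A = (LX x. (L + e) ^ n * indicator ?A x)" by simp
   also have "... <= (LX x. Phi R mu n (f x, g x))"
   proof (rule integral_mono)
    show "integrable mX (%x. Phi R mu n (f x, g x))" by (intro bdm_integrable bconv_Phi fg)
    show "integrable mX (%x. (L + e) ^ n * indicator ?A x)"
     by (intro integrable_mult_right) (simp add: integrable_indicator_iff X.emeasure_eq_measure)
    fix x
    have "(L + e) ^ n * indicator ?A x <= (f x + g x) ^ n"
     using L e fg by (auto simp: indicator_def intro!: power_mono)
    also have "... <= Phi R mu n (f x, g x)" by (rule Phi_lower[OF pos n fg(1,2)])
    finally show "(L + e) ^ n * indicator ?A x <= Phi R mu n (f x, g x)" .
   qed
   also have "... <= (LX x. Phi R mu n (F x, G x))" by (rule Phi[OF n])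
   also have "... <= (LX x. L ^ n)"
   proof (rule integral_mono_AE)
    show "integrable mX (%x. Phi R mu n (F x, G x))" by (intro bdm_integrable bconv_Phi FG)
    show "AE x in mX. Phi R mu n (F x, G x) <= L ^ n" using K(1)
    proof eventually_elim
     case (elim x)
     have "Phi R mu n (F x, G x) <= ((1 + R) / R * (F x + G x)) ^ n" by (rule Phi_upper[OF pos n FG(1,2)])
     also have "... <= L ^ n" unfolding L_def using elim pos FG(1,2)[of x] by (intro power_mono mult_left_mono) auto
     finally show ?case .
    qed
   qed simp
   finally show ?thesis by (simp add: measure_mX mult.commute)
  qed
  have "measure mX ?A <= 0"
  proof (rule LIMSEQ_le_const)
   have r: "0 <= L / (L + e)" "L / (L + e) < 1" using L e by auto
   show "(%n. (L / (L + e)) ^ n * (b - a)) ---> 0"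
    using tendsto_mult[OF LIMSEQ_power_zero[of "L / (L + e)"] tendsto_const[of "b - a"]] r
    unfolding real_norm_def abs_of_nonneg[OF r(1)] by simp
   show "EX N. ALL n>=N. measure mX ?A <= (L / (L + e)) ^ n * (b - a)"
   proof (intro exI[of _ 2] allI impI)
    fix n :: nat assume "2 <= n"
    have p: "(L + e) ^ n > 0" using L e by simp
    show "measure mX ?A <= (L / (L + e)) ^ n * (b - a)"
     using le[OF \<open>2 <= n\<close>] p by (simp add: power_divide field_simps)
   qed
  qed
  hence "measure mX ?A = 0" using measure_nonneg[of mX ?A] by linarith
  hence "?A : null_sets mX" by (auto simp: null_sets_def X.emeasure_eq_measure)
  from AE_not_in[OF this] show ?thesis by eventually_elim auto
 qed
 have "AE x in mX. ALL j. f x + g x < L + 1 / real (Suc j)" by (subst AE_all_countable) (intro allI key, simp)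
 thus ?thesis
 proof eventually_elim
  case (elim x)
  have "f x + g x <= L"
  proof (rule field_le_epsilon)
   fix e :: real assume "e > 0"
   then obtain j where "inverse (real (Suc j)) < e" using reals_Archimedean by blast
   thus "f x + g x <= L + e" using elim[rule_format, of j] by (simp add: inverse_eq_divide)
  qed
  thus ?case by (simp add: L_def)
 qed
qed

lemma sq_meas: "sq_int mX v ==> v : BM"
 using sq_intD[of mX v] by simp

lemma bconv_imp_bdm: assumes "bconv u l" shows "bdm l"
proof -
 obtain M where M: "!!k. u k : BM" "l : BM"
  "!!k x. a < x ==> x < b ==> \<bar>u k x\<bar> <= M" "!!x. a < x ==> x < b ==> (%k. u k x) ---> l x"
  using bconvE[OF assms] by metis
 have "\<bar>l x\<bar> <= M" if "a < x" "x < b" for x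
  by (rule tendsto_upperbound[OF tendsto_rabs[OF M(4)[OF that]]]) (use M(3)[OF that] in auto)
 thus ?thesis using M(2) by (intro bdmI)
qed

lemma bconv_sqn: assumes "bconv u l" shows "(%k. sqn mX (%x. u k x - l x)) ---> 0"
proof -
 have d: "bconv (%k x. u k x - l x) (%x. l x - l x)" by (intro bconv_diff assms bconv_imp_bdm[OF assms])
 from bconv_integral[OF bconv_mult[OF d d]] show ?thesis by (simp add: power2_eq_square)
qed

lemma energy_bounds:
 assumes ac: "ac f v" "ac g w" and nn: "!!x. f x >= 0" "!!x. g x >= 0"
  and pos: "ta > 0" "R > 0" "mu > 0"
  and en: "ent mu f g + ta * diss R v w <= C0"
 shows "sqn mX v <= C0 / ta" (is ?A) "sqn mX w <= 2 * (C0 / ta) + 2 * (C0 / (ta * R))" (is ?B)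
  "(LX x. f x) <= C0 + 2 * (b - a)" (is ?C) "(LX x. g x) <= mu * C0 + 2 * (b - a)" (is ?D)
  "diss R v w = sqn mX v + R * sqn mX (%x. v x + w x)" (is ?E)
  "ent mu f g >= 0" (is ?F)
proof -
 note v = acD(1)[OF ac(1)] and w = acD(1)[OF ac(2)]
 note vw = sq_int_add[OF v w]
 have iv: "integrable mX (%x. (v x)^2)" "integrable mX (%x. (v x + w x)^2)"
  using sq_int_integrable[OF v] sq_int_integrable[OF vw] by simp_all
 show split: ?E using iv by simp
 have iL: "integrable mX (%x. L_fun (f x))" "integrable mX (%x. L_fun (g x))"
  using nn by (auto intro!: bdm_integrable bdm_L_fun ac_bdm[OF ac(1)] ac_bdm[OF ac(2)])
 have Ps: "ent mu f g = (LX x. L_fun (f x)) + 1 / mu * (LX x. L_fun (g x))"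
  using iL by (simp add: Phi1_def)
 have Ln: "(LX x. L_fun (f x)) >= 0" "1 / mu * (LX x. L_fun (g x)) >= 0"
  using nn pos by (auto intro!: integral_nonneg_AE AE_I2 L_fun_nonneg divide_nonneg_nonneg)
 show ?F using Ps Ln by simp
 have D: "ta * sqn mX v >= 0" "ta * (R * sqn mX (%x. v x + w x)) >= 0" using pos by (auto intro!: mult_nonneg_nonneg)
 have en': "(LX x. L_fun (f x)) + 1 / mu * (LX x. L_fun (g x)) + (ta * sqn mX v + ta * (R * sqn mX (%x. v x + w x))) <= C0"
  using en unfolding split Ps by (simp add: distrib_left)
 have 1: "ta * sqn mX v <= C0" and 2: "ta * (R * sqn mX (%x. v x + w x)) <= C0"
  and 3: "(LX x. L_fun (f x)) <= C0" and 4: "1 / mu * (LX x. L_fun (g x)) <= C0" using en' D Ln by linarith+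
 show v1: ?A using 1 pos by (simp add: field_simps)
 have v2: "sqn mX (%x. v x + w x) <= C0 / (ta * R)" using 2 pos by (simp add: field_simps)
 have "sqn mX w = sqn mX (%x. (v x + w x) - v x)" by simp
 also have "... <= 2 * sqn mX (%x. v x + w x) + 2 * sqn mX v" by (rule sqn_diff_le[OF vw v])
 finally show ?B using v1 v2 by linarith
 have low: "(LX x. u x) <= (LX x. L_fun (u x)) + 2 * (b - a)"
  if "bdm u" "!!x. u x >= 0" for u
 proof -
  have "(LX x. u x) <= (LX x. L_fun (u x) + 2)"
  proof (rule integral_mono)
   show "u x <= L_fun (u x) + 2" for x using L_fun_lower[OF that(2)[of x]] by simp
  qed (use that in "auto intro!: bdm_integrable bconv_add bdm_L_fun bconv_const")
  thus ?thesis using bdm_integrable[OF bdm_L_fun[OF that]] by (simp add: measure_mX mult.commute)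
 qed
 show ?C using low[OF ac_bdm[OF ac(1)] nn(1)] 3 by linarith
 have "(LX x. L_fun (g x)) <= mu * C0" using 4 pos by (simp add: field_simps)
 thus ?D using low[OF ac_bdm[OF ac(2)] nn(2)] by linarith
qed

lemma sq_int_comb:
 assumes v: "sq_int M v" "sqn M v <= B" and w: "sq_int M w" "sqn M w <= B"
 shows "sq_int M (%x. \<alpha> * v x + be * w x :: real)" "sqn M (%x. \<alpha> * v x + be * w x) <= (2 * \<alpha>^2 + 2 * be^2) * B" (is ?A)
proof -
 note s = sq_int_mult[OF v(1), of \<alpha>] sq_int_mult[OF w(1), of be]
 show "sq_int M (%x. \<alpha> * v x + be * w x)" by (rule sq_int_add[OF s])
 have "sqn M (%x. \<alpha> * v x + be * w x) <= 2 * (\<alpha>^2 * sqn M v) + 2 * (be^2 * sqn M w)"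
  using sqn_add_le[OF s] by (simp add: power_mult_distrib)
 also have "... <= 2 * (\<alpha>^2 * B) + 2 * (be^2 * B)" by (intro add_mono mult_left_mono v w) auto
 finally show ?A by (simp add: algebra_simps)
qed

text \<open>The entropy and the dissipation of one step bound the derivatives, and with the mass
  they bound the supremum. The functions are thus equi-Hoelder and converge pointwise along a
  subsequence; derivatives and fluxes converge only after averaging, and
  \<open>product_limit_AE\<close> recognises the averaged fluxes.\<close>

lemma elliptic_limit:
 fixes f g v w :: "nat => real => real"
 assumes ac: "!!n. ac (f n) (v n)" "!!n. ac (g n) (w n)" and nn: "!!n x. f n x >= 0" "!!n x. g n x >= 0"
  and pos: "ta > 0" "R > 0" "mu > 0"
  and en: "!!n. ent mu (f n) (g n) + ta * diss R (v n) (w n) <= C0"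
  and FG: "bdm F" "bdm G"
  and PQ: "!!i. bdm (P i)" "!!i. bdm (P' i)" "!!i. bdm (Q i)" "!!i. bdm (Q' i)"
  and eq: "!!i. (%n. tested ta R mu F G (f n) (v n) (g n) (w n) (P i) (P' i) (Q i) (Q' i)) ---> 0"
 obtains f' g' v' w' where "ac f' v'" "ac g' w'" "!!x. f' x >= 0" "!!x. g' x >= 0"
  "ent mu f' g' + ta * diss R v' w' <= C0"
  "!!i. (LX x. (f' x - F x) * P i x) + 1 / mu * (LX x. (g' x - G x) * Q i x)
    + ta * ((LX x. (f' x * ((1 + R) * v' x + R * w' x)) * P' i x) + R * (LX x. (g' x * (v' x + w' x)) * Q' i x)) = 0"
proof -
 note eb = energy_bounds[OF ac nn pos en]
 define B2 where "B2 = 2 * (C0 / ta) + 2 * (C0 / (ta * R))"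
 have C0: "C0 >= 0" using order_trans[OF sqn_nonneg eb(1)[of 0]] pos by (simp add: zero_le_divide_iff)
 have v: "sqn mX (v n) <= B2" (is ?S) "sqn mX (w n) <= B2" (is ?T) for n
 proof -
  have "0 <= C0 / ta" "0 <= C0 / (ta * R)" using C0 pos by auto
  hence "C0 / ta <= B2" unfolding B2_def by linarith
  thus ?S using eb(1)[of n] by linarith
  show ?T using eb(2)[of n] by (simp add: B2_def)
 qed
 have B2: "B2 >= 0" using v(1)[of 0] sqn_nonneg[of mX "v 0"] by linarith
 define M where "M = (C0 + mu * C0 + 2 * (b - a)) / (b - a) + sqrt ((b - a) * B2)"
 have sup: "u x <= M" if "ac u z" "sqn mX z <= B2" "(LX y. u y) <= C0 + mu * C0 + 2 * (b - a)" for u z x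
 proof -
  have "u x <= (LX y. u y) / (b - a) + sqrt ((b - a) * sqn mX z)" by (rule ac_sup_bound[OF that(1)])
  also have "... <= M" unfolding M_def using that ab
   by (intro add_mono divide_right_mono real_sqrt_le_mono mult_left_mono) auto
  finally show ?thesis .
 qed
 have fM: "\<bar>f n x\<bar> <= M" (is ?S) "\<bar>g n x\<bar> <= M" (is ?T) for n x
 proof -
  have "C0 + 2 * (b - a) <= C0 + mu * C0 + 2 * (b - a)" "mu * C0 + 2 * (b - a) <= C0 + mu * C0 + 2 * (b - a)"
   using C0 pos by auto
  hence "f n x <= M" "g n x <= M" using eb(3,4)[of n] by (auto intro!: sup[OF ac(1) v(1)] sup[OF ac(2) v(2)])
  thus ?S ?T using nn[of n x] by auto
 qed
 obtain k :: "nat => nat" where k: "strict_mono k" "!!y. y : (\<rat> :: real set) ==> EX l. (%n. (f (k n) y, g (k n) y)) ---> l"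
 proof (rule function_convergent_subsequence[of "\<rat> :: real set" "%n y. (f n y, g n y)" "M + M"])
  show "norm (f n y, g n y) <= M + M" for n y
   using norm_Pair_le[of "f n y" "g n y"] fM[of n y] unfolding real_norm_def by linarith
 qed (auto simp: countable_rat)
 have holder: "EX y:\<rat>. EX N::nat. ALL n>=N. \<bar>u n x - u n y\<bar> <= e"
  if "!!n. ac (u n) (z n)" "!!n. sqn mX (z n) <= B2" "e > 0" for u z e x
 proof -
  have "x < x + e^2 / (B2 + 1)" using that B2 by simp
  then obtain y where y: "y : \<rat>" "x < y" "y < x + e^2 / (B2 + 1)" using Rats_dense_in_real by blast
  have "\<bar>u n x - u n y\<bar> <= e" for n
  proof (rule power2_le_imp_le)
   have "\<bar>u n x - u n y\<bar>^2 <= \<bar>x - y\<bar> * sqn mX (z n)" using ac_holder[OF that(1)] by simp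
   also have "... <= (e^2 / (B2 + 1)) * B2" using y that(2) B2 by (intro mult_mono) auto
   also have "... <= e^2" using B2 by (simp add: field_simps)
   finally show "\<bar>u n x - u n y\<bar>^2 <= e^2" .
  qed (use that in auto)
  thus ?thesis using y(1) by blast
 qed
 have cf: "convergent (%n. f (k n) x)" (is ?S) "convergent (%n. g (k n) x)" (is ?T) for x
 proof -
  have q: "convergent (%n. f (k n) y) & convergent (%n. g (k n) y)" if yq: "y : \<rat>" for y
  proof -
   obtain l where l: "(%n. (f (k n) y, g (k n) y)) ---> l" using k(2)[OF yq] by blast
   from tendsto_fst[OF l] tendsto_snd[OF l] show ?thesis by (auto simp: convergent_def)
  qed
  show ?S by (rule convergent_by_density[OF holder[of "%n. f (k n)" "%n. v (k n)" _ x, OF ac(1) v(1)] q[THEN conjunct1]])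
  show ?T by (rule convergent_by_density[OF holder[of "%n. g (k n)" "%n. w (k n)" _ x, OF ac(2) v(2)] q[THEN conjunct2]])
 qed
 define f' g' where "f' x = lim (%n. f (k n) x)" and "g' x = lim (%n. g (k n) x)" for x
 have lf: "(%n. f (k n) x) ---> f' x" and lg: "(%n. g (k n) x) ---> g' x" for x
  using cf[of x] by (simp_all add: f'_def g'_def convergent_LIMSEQ_iff)
 have nn': "f' x >= 0" "g' x >= 0" for x
  using nn by (auto intro!: LIMSEQ_le_const[OF lf] LIMSEQ_le_const[OF lg])
 have mf: "f n : BM" "g n : BM" for n using ac by (auto intro: ac_measurable)
 have [measurable]: "f' : BM" "g' : BM"
  unfolding f'_def[abs_def] g'_def[abs_def] using mf by (auto intro!: borel_measurable_lim_metric)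
 have bf: "bconv (%n. f (k n)) f'" and bg: "bconv (%n. g (k n)) g'"
  by (rule bconvI[where M=M]; use fM lf lg mf in simp)+
 define p q J H where "p n x = (1 + R) * v n x + R * w n x" and "q n x = v n x + w n x"
  and "J n x = f n x * p n x" and "H n x = g n x * q n x" for n x
 have sv: "sq_int mX (v n)" "sq_int mX (w n)" for n using acD(1)[OF ac(1)] acD(1)[OF ac(2)] by auto
 have sp: "sq_int mX (p n)" "sqn mX (p n) <= (2 * (1 + R)^2 + 2 * R^2) * B2"
  and sq: "sq_int mX (q n)" "sqn mX (q n) <= 4 * B2" for n
  using sq_int_comb[OF sv(1)[of n] v(1)[of n] sv(2)[of n] v(2)[of n], where \<alpha>="1 + R" and be=R]
   sq_int_comb[OF sv(1)[of n] v(1)[of n] sv(2)[of n] v(2)[of n], where \<alpha>=1 and be=1]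
  by (simp_all add: p_def[abs_def] q_def[abs_def])
 have J: "sq_int mX (J n)" "sqn mX (J n) <= M^2 * ((2 * (1 + R)^2 + 2 * R^2) * B2)"
  and H: "sq_int mX (H n)" "sqn mX (H n) <= M^2 * (4 * B2)" for n
  using sq_int_bounded_mult[OF sp(1)[of n] mf(1)[of n] fM(1)[of n]] sq_int_bounded_mult[OF sq(1)[of n] mf(2)[of n] fM(2)[of n]]
   mult_left_mono[OF sp(2)[of n], of "M^2"] mult_left_mono[OF sq(2)[of n], of "M^2"]
  unfolding J_def[abs_def] H_def[abs_def] by auto
 obtain c K v' w' J' H' where c: "conv_weights c K"
  and m: "mconv mX c K (%n. v (k n)) v'" "mconv mX c K (%n. w (k n)) w'" "mconv mX c K (%n. J (k n)) J'" "mconv mX c K (%n. H (k n)) H'"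
  by (rule convex_combinations_converge4[of mX "%n. v (k n)" "%n. w (k n)" "%n. J (k n)" "%n. H (k n)", OF sv J(1) H(1) v J(2) H(2)])
 note s' = m[THEN mconvD(1)] and AE' = m[THEN mconvD(2)] and L2' = m[THEN mconvD(3)]
 have ac': "ac f' v'" "ac g' w'"
  by (rule ac_limit[OF c ac(1) lf s'(1) L2'(1)], rule ac_limit[OF c ac(2) lg s'(2) L2'(2)])
 have p': "AE x in mX. (%j. SUM n<K j. c j n * p (k n) x) ---> (1 + R) * v' x + R * w' x" using AE'(1,2)
 proof eventually_elim
  case (elim x)
  have "(SUM n<K j. c j n * p (k n) x) = (1 + R) * (SUM n<K j. c j n * v (k n) x) + R * (SUM n<K j. c j n * w (k n) x)" for j
   unfolding p_def by (simp only: sum_distrib_left sum.distrib[symmetric]) (simp add: algebra_simps)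
  thus ?case using elim by (auto intro!: tendsto_intros)
 qed
 have q': "AE x in mX. (%j. SUM n<K j. c j n * q (k n) x) ---> v' x + w' x" using AE'(1,2)
 proof eventually_elim
  case (elim x)
  thus ?case unfolding q_def distrib_left sum.distrib by (rule tendsto_add)
 qed
 have sdf: "sq_int mX (%x. f n x - f' x)" "sq_int mX (%x. g n x - g' x)" for n
  using ac_sq_int[OF ac(1)] ac_sq_int[OF ac(2)] ac_sq_int[OF ac'(1)] ac_sq_int[OF ac'(2)] by (auto intro: sq_int_diff)
 have J': "AE x in mX. J' x = f' x * ((1 + R) * v' x + R * w' x)"
  by (rule product_limit_AE[OF c sp sdf(1) bconv_sqn[OF bf] p' AE'(3)[unfolded J_def]])
 have H': "AE x in mX. H' x = g' x * (v' x + w' x)"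
  by (rule product_limit_AE[OF c sq sdf(2) bconv_sqn[OF bg] q' AE'(4)[unfolded H_def]])
 show ?thesis
 proof (rule that[OF ac' nn'])
  fix i
  define A where "A n = (LX x. (f n x - F x) * P i x) + 1 / mu * (LX x. (g n x - G x) * Q i x)" for n
  define D where "D n = ta * ((LX x. J n x * P' i x) + R * (LX x. H n x * Q' i x))" for n
  let ?A = "(LX x. (f' x - F x) * P i x) + 1 / mu * (LX x. (g' x - G x) * Q i x)"
  let ?D = "ta * ((LX x. J' x * P' i x) + R * (LX x. H' x * Q' i x))"
  note iP = bdm_sq_int[OF PQ(2)] bdm_sq_int[OF PQ(4)]
  note [measurable] = sq_meas[OF s'(1)] sq_meas[OF s'(2)] sq_meas[OF s'(3)] sq_meas[OF s'(4)]
   sq_meas[OF iP(1)] sq_meas[OF iP(2)]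
  have AD: "tested ta R mu F G (f n) (v n) (g n) (w n) (P i) (P' i) (Q i) (Q' i) = A n + D n" for n
  proof -
   have "integrable mX (%x. (f n x - F x) * P i x)" "integrable mX (%x. (g n x - G x) * Q i x)"
    by (intro bdm_integrable bconv_mult bconv_diff PQ FG ac_bdm[OF ac(1)] ac_bdm[OF ac(2)])+
   moreover have "integrable mX (%x. J n x * P' i x)" "integrable mX (%x. H n x * Q' i x)"
    using sq_int_times[OF J(1) iP(1)] sq_int_times[OF H(1) iP(2)] by auto
   ultimately show ?thesis by (simp add: A_def D_def J_def H_def p_def q_def)
  qed
  have Alim: "(%n. A (k n)) ---> ?A"
   unfolding A_def by (intro tendsto_intros bconv_integral bconv_mult bconv_diff bf bg FG PQ)
  have "(%n. A n + D n) ---> 0" using eq[of i] unfolding AD .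
  from LIMSEQ_subseq_LIMSEQ[OF this k(1)] have "(%n. A (k n) + D (k n)) ---> 0" by (simp add: o_def)
  from tendsto_diff[OF this Alim] have Dlim: "(%n. D (k n)) ---> - ?A" by simp
  \<comment> \<open>The sequence \<open>D (k n)\<close> itself converges, because the sum with
    \<open>A\<close> tends to zero and \<open>A\<close> converges; its averages keep this limit and
    can be compared with the averaged fluxes.\<close>
  have "(%j. SUM n<K j. c j n * D (k n)) ---> - ?A" using conv_weights_tendsto[OF c Dlim] by simp
  moreover have "(SUM n<K j. c j n * D (k n)) = ta * ((LX x. (SUM n<K j. c j n * J (k n) x) \<bullet> P' i x) + R * (LX x. (SUM n<K j. c j n * H (k n) x) \<bullet> Q' i x))" for j
  proof -
   have 1: "(LX x. (SUM n<K j. c j n * J (k n) x) \<bullet> P' i x) = (SUM n<K j. c j n * (LX x. J (k n) x * P' i x))"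
    using sq_int_times[OF J(1) iP(1)] by (simp add: sum_distrib_right mult.assoc)
   have 2: "(LX x. (SUM n<K j. c j n * H (k n) x) \<bullet> Q' i x) = (SUM n<K j. c j n * (LX x. H (k n) x * Q' i x))"
    using sq_int_times[OF H(1) iP(2)] by (simp add: sum_distrib_right mult.assoc)
   show ?thesis unfolding 1 2 D_def
    by (simp only: sum_distrib_left sum.distrib[symmetric]) (simp add: algebra_simps)
  qed
  moreover have "(%j. ta * ((LX x. (SUM n<K j. c j n * J (k n) x) \<bullet> P' i x) + R * (LX x. (SUM n<K j. c j n * H (k n) x) \<bullet> Q' i x)))
    ---> ta * ((LX x. J' x \<bullet> P' i x) + R * (LX x. H' x \<bullet> Q' i x))"
   by (intro tendsto_intros inner_tendsto s' iP L2' sq_int_sum sq_int_mult J(1) H(1))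
  ultimately have "?A + ?D = 0" using LIMSEQ_unique by fastforce
  moreover have "(LX x. J' x * P' i x) = (LX x. (f' x * ((1 + R) * v' x + R * w' x)) * P' i x)"
  proof (rule integral_cong_AE)
   show "AE x in mX. J' x * P' i x = f' x * ((1 + R) * v' x + R * w' x) * P' i x" using J' by eventually_elim simp
  qed measurable
  moreover have "(LX x. H' x * Q' i x) = (LX x. (g' x * (v' x + w' x)) * Q' i x)"
  proof (rule integral_cong_AE)
   show "AE x in mX. H' x * Q' i x = g' x * (v' x + w' x) * Q' i x" using H' by eventually_elim simp
  qed measurable
  ultimately show "?A + ta * ((LX x. (f' x * ((1 + R) * v' x + R * w' x)) * P' i x) + R * (LX x. (g' x * (v' x + w' x)) * Q' i x)) = 0"
   by simp
 next
  let ?E = "\<integral>x. Phi1 mu (f' x, g' x) \<partial>mX"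
  define E where "E n = ent mu (f n) (g n)" for n
  have Elim: "(%n. E (k n)) ---> ?E" unfolding E_def by (intro bconv_integral bconv_Phi1 bf bg nn nn')
  let ?V = "%j x. SUM n<K j. c j n * v (k n) x" and ?W = "%j x. SUM n<K j. c j n * w (k n) x"
  have sV: "sq_int mX (?V j)" "sq_int mX (?W j)" for j by (intro sq_int_sum sq_int_mult sv)+
  \<comment> \<open>By convexity the dissipation of the averaged derivatives is at most the average
    of the bounds C0 - E, and the entropies \<open>E\<close> converge without averaging.\<close>
  have "ta * (sqn mX (?V j) + R * sqn mX (%x. ?V j x + ?W j x)) <= (SUM n<K j. c j n * (C0 - E (k n)))" for j
  proof -
   have "sqn mX (?V j) <= (SUM n<K j. c j n * sqn mX (v (k n)))"
    by (rule sqn_combination_le_sum[OF c acD(1)[OF ac(1)]])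
   moreover have "sqn mX (%x. ?V j x + ?W j x) <= (SUM n<K j. c j n * sqn mX (%x. v (k n) x + w (k n) x))"
    using sqn_combination_le_sum[OF c sq_int_add[OF acD(1)[OF ac(1)] acD(1)[OF ac(2)]], of j k k]
    by (simp only: distrib_left sum.distrib)
   ultimately have "ta * (sqn mX (?V j) + R * sqn mX (%x. ?V j x + ?W j x))
     <= ta * ((SUM n<K j. c j n * sqn mX (v (k n))) + R * (SUM n<K j. c j n * sqn mX (%x. v (k n) x + w (k n) x)))"
    using pos by (intro mult_left_mono add_mono) auto
   also have "... = (SUM n<K j. c j n * (ta * (sqn mX (v (k n)) + R * sqn mX (%x. v (k n) x + w (k n) x))))"
    by (simp only: sum_distrib_left sum.distrib[symmetric]) (simp add: algebra_simps)
   also have "... <= (SUM n<K j. c j n * (C0 - E (k n)))"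
   proof (intro sum_mono mult_left_mono conv_weightsD(1)[OF c])
    fix n
    show "ta * (sqn mX (v (k n)) + R * sqn mX (%x. v (k n) x + w (k n) x)) <= C0 - E (k n)"
     using en[of "k n"] unfolding eb(5) E_def by linarith
   qed
   finally show ?thesis .
  qed
  moreover have "(%j. ta * (sqn mX (?V j) + R * sqn mX (%x. ?V j x + ?W j x))) ---> ta * (sqn mX v' + R * sqn mX (%x. v' x + w' x))"
   by (intro tendsto_intros sqn_tendsto s' L2' sV sq_int_add sqn_diff_add_tendsto)
  moreover have "(%j. SUM n<K j. c j n * (C0 - E (k n))) ---> C0 - ?E"
   using conv_weights_tendsto[OF c tendsto_diff[OF tendsto_const Elim], of C0] by simp
  ultimately have "ta * (sqn mX v' + R * sqn mX (%x. v' x + w' x)) <= C0 - ?E" by (intro LIMSEQ_le) auto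
  moreover have "diss R v' w' = sqn mX v' + R * sqn mX (%x. v' x + w' x)"
   using sq_int_integrable[OF s'(1)] sq_int_integrable[OF sq_int_add[OF s'(1,2)]] by simp
  ultimately show "?E + ta * diss R v' w' <= C0" by simp
 qed
qed

end

lemma choice4: "ALL p. EX q r s t. Z p q r s t ==> EX q r s t. ALL p. Z p (q p) (r p) (s p) (t p)"
 by metis

context interval
begin

lemma cumX_cong:
 assumes "v : BM" "v' : BM" "AE x in mX. v x = v' x"
 shows "cumX v = cumX v'" unfolding cum_def using assms by (intro ext integral_cong_AE) auto

text \<open>The Galerkin dimension n tends to infinity while the regularization is 1/(n+1). The
  basis consists of the test functions of \<open>flux_from_moments\<close>, so the limit of the
  tested equations yields the equations themselves in integrated form.\<close>

theorem elliptic_step: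
 assumes FG: "bdm F" "bdm G" "!!x. F x >= 0" "!!x. G x >= 0" and pos: "ta > 0" "R > 0" "mu > 0"
 obtains f g v w where "ac f v" "ac g w" "!!x. f x >= 0" "!!x. g x >= 0"
  "(LX x. f x - F x) = 0" "(LX x. g x - G x) = 0"
  "AE x in mX. cumX (%x. f x - F x) x = ta * (f x * ((1 + R) * v x + R * w x))"
  "AE x in mX. cumX (%x. g x - G x) x = ta * (mu * R * (g x * (v x + w x)))"
  "ent mu f g + ta * diss R v w <= ent mu F G"
proof -
 define e e' :: "nat => real => real"
  where "e k x = 1 + cumX (indicator {..from_nat_into \<rat> k}) x" and "e' k = indicator {..from_nat_into \<rat> k}" for k x
 have e: "ac (e k) (e' k)" for k unfolding e_def[abs_def] e'_def by (rule acI[OF sq_int_indicator refl])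
 \<comment> \<open>Even indices carry test functions for the first equation, odd indices for the
   second; the other component is zero.\<close>
 define P P' Q Q' where "P i = (if even i then e (i div 2) else (%_. 0))" and "P' i = (if even i then e' (i div 2) else (%_. 0))"
  and "Q i = (if odd i then e (i div 2) else (%_. 0))" and "Q' i = (if odd i then e' (i div 2) else (%_. 0))" for i
 have acP: "ac (P i) (P' i)" "ac (Q i) (Q' i)" for i by (simp_all add: P_def P'_def Q_def Q'_def e ac_const)
 have "bdm (P' i)" "bdm (Q' i)" for i by (rule bdmI[where M=1]; auto simp: P'_def Q'_def e'_def)+
 note PQ = ac_bdm[OF acP(1)] this(1) ac_bdm[OF acP(2)] this(2)
 define C0 where "C0 = ent mu F G"
 have "EX f v g w. ac f v & ac g w & (ALL x. f x >= 0) & (ALL x. g x >= 0) & ent mu f g + ta * diss R v w <= C0 &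
   (ALL i<n. \<bar>tested ta R mu F G f v g w (P i) (P' i) (Q i) (Q' i)\<bar> <= sqrt (C0 / real (Suc n)))" for n
 proof -
  have eps: "1 / real (Suc n) > 0" by simp
  obtain ze w1 w1' w2 w2' where w: "w1 = (%x. SUM i<n. ze i * P i x)" "w1' = (%x. SUM i<n. ze i * P' i x)"
   "w2 = (%x. SUM i<n. ze i * Q i x)" "w2' = (%x. SUM i<n. ze i * Q' i x)"
   and eq: "!!i. i < n ==> tested ta R mu F G (%x. exp (w1 x)) (%x. exp (w1 x) * w1' x) (%x. exp (w2 x)) (%x. exp (w2 x) * w2' x)
    (P i) (P' i) (Q i) (Q' i) = - (1 / real (Suc n)) * ze i"
   and en: "ent mu (%x. exp (w1 x)) (%x. exp (w2 x)) + ta * diss R (%x. exp (w1 x) * w1' x) (%x. exp (w2 x) * w2' x)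
    + 1 / real (Suc n) * (SUM i<n. (ze i)^2) <= ent mu F G"
   by (rule galerkin[of P P' Q Q' F G ta R mu "1 / real (Suc n)" n, OF PQ FG pos eps]) (rule that, assumption+)
  have ac1: "ac (%x. exp (w1 x)) (%x. exp (w1 x) * w1' x)" "ac (%x. exp (w2 x)) (%x. exp (w2 x) * w2' x)"
   unfolding w by (intro ac_exp ac_sum ac_cmult acP)+
  have s0: "ent mu (%x. exp (w1 x)) (%x. exp (w2 x)) >= 0"
   using pos by (intro integral_nonneg_AE AE_I2 Phi1_nonneg) auto
  have d0: "ta * diss R (%x. exp (w1 x) * w1' x) (%x. exp (w2 x) * w2' x) >= 0"
   using pos by (intro mult_nonneg_nonneg integral_nonneg_AE AE_I2 add_nonneg_nonneg) auto
  have xi0: "1 / real (Suc n) * (SUM i<n. (ze i)^2) >= 0" by (intro mult_nonneg_nonneg sum_nonneg) auto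
  have xiC: "1 / real (Suc n) * (SUM i<n. (ze i)^2) <= C0" using en s0 d0 unfolding C0_def by linarith
  \<comment> \<open>With ep = 1/(n+1) the energy estimate gives ep ze_i^2 <= C0, so the residual ep
    |ze_i| is at most the square root of ep C0: it vanishes even though the coefficients may
    grow.\<close>
  have bd: "\<bar>- (1 / real (Suc n)) * ze i\<bar> <= sqrt (C0 / real (Suc n))" if "i < n" for i
  proof (rule real_le_rsqrt)
   have "(ze i)^2 <= (SUM i<n. (ze i)^2)" using that by (intro member_le_sum) auto
   hence "1 / real (Suc n) * (ze i)^2 <= C0" using xiC by (meson eps less_imp_le mult_left_mono order_trans)
   hence "1 / real (Suc n) * (1 / real (Suc n) * (ze i)^2) <= 1 / real (Suc n) * C0" using eps by (intro mult_left_mono) auto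
   thus "\<bar>- (1 / real (Suc n)) * ze i\<bar>^2 <= C0 / real (Suc n)"
    by (simp add: power2_eq_square abs_mult del: of_nat_Suc)
  qed
  have r1: "ALL i<n. \<bar>tested ta R mu F G (%x. exp (w1 x)) (%x. exp (w1 x) * w1' x) (%x. exp (w2 x)) (%x. exp (w2 x) * w2' x)
   (P i) (P' i) (Q i) (Q' i)\<bar> <= sqrt (C0 / real (Suc n))" using eq bd by (intro allI impI) presburger
  have r2: "ent mu (%x. exp (w1 x)) (%x. exp (w2 x)) + ta * diss R (%x. exp (w1 x) * w1' x) (%x. exp (w2 x) * w2' x) <= C0"
   using en xi0 unfolding C0_def by linarith
  show ?thesis by (intro exI conjI, rule ac1(1), rule ac1(2)) (rule r1 r2 | simp)+
 qed
 hence "EX f v g w. ALL n. ac (f n) (v n) & ac (g n) (w n) & (ALL x. f n x >= 0) & (ALL x. g n x >= 0) &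
   ent mu (f n) (g n) + ta * diss R (v n) (w n) <= C0 &
   (ALL i<n. \<bar>tested ta R mu F G (f n) (v n) (g n) (w n) (P i) (P' i) (Q i) (Q' i)\<bar> <= sqrt (C0 / real (Suc n)))"
  by (intro choice4 allI)
 then obtain f v g w where seq: "ALL n. ac (f n) (v n) & ac (g n) (w n) & (ALL x. f n x >= 0) & (ALL x. g n x >= 0) &
   ent mu (f n) (g n) + ta * diss R (v n) (w n) <= C0 &
   (ALL i<n. \<bar>tested ta R mu F G (f n) (v n) (g n) (w n) (P i) (P' i) (Q i) (Q' i)\<bar> <= sqrt (C0 / real (Suc n)))"
  by (elim exE)
 have lim0: "(%n. tested ta R mu F G (f n) (v n) (g n) (w n) (P i) (P' i) (Q i) (Q' i)) ---> 0" for i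
 proof (rule Lim_null_comparison)
  show "\<forall>\<^sub>F n in sequentially. norm (tested ta R mu F G (f n) (v n) (g n) (w n) (P i) (P' i) (Q i) (Q' i)) <= sqrt (C0 / real (Suc n))"
   using seq by (intro eventually_sequentiallyI[of "Suc i"]) simp
  have "(%n. sqrt (C0 * inverse (real (Suc n)))) ---> sqrt (C0 * 0)"
   by (intro tendsto_intros LIMSEQ_inverse_real_of_nat)
  thus "(%n. sqrt (C0 / real (Suc n))) ---> 0" by (simp add: divide_inverse)
 qed
 have h: "!!n. ac (f n) (v n)" "!!n. ac (g n) (w n)" "!!n x. f n x >= 0" "!!n x. g n x >= 0"
  "!!n. ent mu (f n) (g n) + ta * diss R (v n) (w n) <= C0" using seq by auto
 obtain f' g' v' w' where lim: "ac f' v'" "ac g' w'" "!!x. f' x >= 0" "!!x. g' x >= 0" "ent mu f' g' + ta * diss R v' w' <= C0"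
  and eqs: "!!i. (LX x. (f' x - F x) * P i x) + 1 / mu * (LX x. (g' x - G x) * Q i x)
    + ta * ((LX x. (f' x * ((1 + R) * v' x + R * w' x)) * P' i x) + R * (LX x. (g' x * (v' x + w' x)) * Q' i x)) = 0"
  by (rule elliptic_limit[of f v g w ta R mu C0 F G P P' Q Q', OF h(1-4) pos h(5) FG(1,2) PQ lim0]) (rule that, assumption+)
 \<comment> \<open>Index 2k isolates the first equation, 2k + 1 the second, where the factor mu
   taken out in \<open>tested\<close> is restored.\<close>
 have e1: "(LX x. (f' x - F x) * e k x) + (LX x. (ta * (f' x * ((1 + R) * v' x + R * w' x))) * e' k x) = 0"
  and e2: "(LX x. (g' x - G x) * e k x) + (LX x. (ta * (mu * R * (g' x * (v' x + w' x)))) * e' k x) = 0" (is "?X + _ = 0") for k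
 proof -
  show "(LX x. (f' x - F x) * e k x) + (LX x. (ta * (f' x * ((1 + R) * v' x + R * w' x))) * e' k x) = 0"
   using eqs[of "2 * k"] by (simp add: P_def P'_def Q_def Q'_def mult.assoc)
  define Y where "Y = (LX x. g' x * (v' x + w' x) * e' k x)"
  have "1 / mu * ?X + ta * (R * Y) = 0" using eqs[of "2 * k + 1"] by (simp add: P_def P'_def Q_def Q'_def Y_def)
  hence "?X + ta * (mu * (R * Y)) = 0" using pos by (simp add: field_simps)
  thus "?X + (LX x. (ta * (mu * R * (g' x * (v' x + w' x)))) * e' k x) = 0" by (simp add: Y_def mult.assoc)
 qed
 obtain Bf Bg where B: "!!x. \<bar>f' x\<bar> <= Bf" "!!x. \<bar>g' x\<bar> <= Bg" using ac_bounded[OF lim(1)] ac_bounded[OF lim(2)] by blast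
 have sJ: "sq_int mX (%x. f' x * ((1 + R) * v' x + R * w' x))" "sq_int mX (%x. g' x * (v' x + w' x))"
  by (rule sq_int_bounded_mult(1)[OF sq_int_add[OF sq_int_mult[OF acD(1)[OF lim(1)]] sq_int_mult[OF acD(1)[OF lim(2)]]] ac_measurable[OF lim(1)] B(1)],
    rule sq_int_bounded_mult(1)[OF sq_int_add[OF acD(1)[OF lim(1)] acD(1)[OF lim(2)]] ac_measurable[OF lim(2)] B(2)])
 have ih: "integrable mX (%x. f' x - F x)" "integrable mX (%x. g' x - G x)"
  by (intro bdm_integrable bconv_diff ac_bdm[OF lim(1)] ac_bdm[OF lim(2)] FG)+
 note r1 = flux_from_moments[OF ih(1) sq_int_mult[OF sJ(1)] e1[unfolded e_def e'_def]]
 note r2 = flux_from_moments[OF ih(2) sq_int_mult[OF sq_int_mult[OF sJ(2)]] e2[unfolded e_def e'_def]]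
 show ?thesis
 proof (rule that[OF lim(1-4) r1(1) r2(1) _ _ lim(5)[unfolded C0_def]])
  show "AE x in mX. cumX (%x. f' x - F x) x = ta * (f' x * ((1 + R) * v' x + R * w' x))"
   using r1(2) by eventually_elim simp
  show "AE x in mX. cumX (%x. g' x - G x) x = ta * (mu * R * (g' x * (v' x + w' x)))"
   using r2(2) by eventually_elim simp
 qed
qed

end

section \<open>The implicit Euler scheme\<close>

context interval
begin

lemma ac_le_of_AE:
 assumes ac: "ac ph v" and le: "AE x in mX. ph x <= B" shows "ph x <= B"
proof (rule ccontr)
 assume neg: "~ ph x <= B"
 define y where "y = max a (min b x)"
 have y: "a <= y" "y <= b" "ph y > B" using neg ab ac_clamp[OF ac, of x] by (auto simp: y_def)
 define e where "e = ph y - B"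
 have e: "e > 0" using y by (simp add: e_def)
 define d where "d = e^2 / (sqn mX v + 1)"
 have d: "d > 0" using e sqn_nonneg[of mX v] by (simp add: d_def add_nonneg_pos)
 have near: "ph z > B" if "\<bar>z - y\<bar> < d" for z
 proof -
  have "(ph z - ph y)^2 <= \<bar>z - y\<bar> * sqn mX v" by (rule ac_holder[OF ac])
  also have "... <= d * sqn mX v" using that by (intro mult_right_mono) auto
  also have "... < e^2"
  proof -
   have "d * sqn mX v < d * (sqn mX v + 1)" using d by simp
   also have "... = e^2" using sqn_nonneg[of mX v] unfolding d_def
    by (intro nonzero_eq_divide_eq[THEN iffD1]) (linarith, simp)
   finally show ?thesis .
  qed
  finally have "\<bar>ph z - ph y\<bar>^2 < e^2" by simp
  hence "\<bar>ph z - ph y\<bar> < e" using e by (simp add: power2_less_imp_less)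
  thus ?thesis by (simp add: e_def)
 qed
 define l u where "l = max a (y - d)" and "u = min b (y + d)"
 have lu: "l < u" using y d ab by (auto simp: l_def u_def)
 have "AE z in lborel. z ~: {l<..<u}" using le unfolding AE_mX
 proof eventually_elim
  case (elim z)
  show ?case
  proof
   assume z: "z : {l<..<u}"
   hence "\<bar>z - y\<bar> < d" "a < z & z < b" by (auto simp: l_def u_def abs_less_iff)
   thus False using near[of z] elim by auto
  qed
 qed
 hence "{l<..<u} : null_sets lborel" by (subst AE_iff_null_sets) auto
 thus False using lu by (auto simp: null_sets_def)
qed

end

section \<open>The scheme for given data and fixed step size\<close>

locale muskat = interval +
 fixes R mu K0 :: real and F0 G0 :: "real => real"
 assumes R: "R > 0" and mu: "mu > 0"
  and F0m [measurable]: "F0 : BM" and G0m [measurable]: "G0 : BM"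
  and F0n: "!!x. F0 x >= 0" and G0n: "!!x. G0 x >= 0" and FG0: "!!x. F0 x + G0 x <= K0"
begin

definition stp :: "real => (real => real) => (real => real) => (real => real) => (real => real) => (real => real) => (real => real) => bool" where
 "stp ta F G f v g w \<longleftrightarrow> ac f v & ac g w & (ALL x. f x >= 0) & (ALL x. g x >= 0) &
   (LX x. f x - F x) = 0 & (LX x. g x - G x) = 0 &
   (AE x in mX. cumX (%x. f x - F x) x = ta * (f x * ((1 + R) * v x + R * w x))) &
   (AE x in mX. cumX (%x. g x - G x) x = ta * (mu * R * (g x * (v x + w x)))) &
   ent mu f g + ta * diss R v w <= ent mu F G"

text \<open>The quadruple is (f, v, g, w). The initial data need not have derivatives; the zeros at
  index 0 are a convention under which the interpolated derivatives and fluxes vanish for t <=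
  0.\<close>

primrec sol :: "real => nat => (real => real) \<times> (real => real) \<times> (real => real) \<times> (real => real)" where
 "sol ta 0 = (F0, (%_. 0), G0, (%_. 0))"
| "sol ta (Suc k) = (SOME s. stp ta (fst (sol ta k)) (fst (snd (snd (sol ta k)))) (fst s) (fst (snd s)) (fst (snd (snd s))) (snd (snd (snd s))))"

definition "fk ta k = fst (sol ta k)"
definition "vk ta k = fst (snd (sol ta k))"
definition "gk ta k = fst (snd (snd (sol ta k)))"
definition "wk ta k = snd (snd (snd (sol ta k)))"
definition "Jk ta k x = fk ta k x * ((1 + R) * vk ta k x + R * wk ta k x)"
definition "Hk ta k x = mu * R * (gk ta k x * (vk ta k x + wk ta k x))"
definition "Dk ta k = (LX x. (vk ta k x)^2 + R * (vk ta k x + wk ta k x)^2)"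
definition "Kb = (1 + R) / R * K0"
definition "C0 = ent mu F0 G0"

lemma F0_le: "F0 x <= K0" "G0 x <= K0" "K0 >= 0"
 using F0n[of x] G0n[of x] FG0[of x] by linarith+

lemma Kb: "Kb >= 0" "K0 <= Kb"
proof -
 have 1: "(1 + R) / R >= 1" using R by simp
 show "K0 <= Kb" unfolding Kb_def using mult_right_mono[OF 1 F0_le(3)] by simp
 thus "Kb >= 0" using F0_le(3) by linarith
qed

lemma bdm0: "bdm F0" "bdm G0"
 using F0n G0n F0_le by (auto intro!: bdmI[where M=K0])

lemma stp_ex: "bdm F ==> bdm G ==> (!!x. F x >= 0) ==> (!!x. G x >= 0) ==> ta > 0 ==> EX f v g w. stp ta F G f v g w"
 by (rule elliptic_step[of F G ta R mu]) (auto simp: R mu stp_def)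

lemma sol0 [simp]: "fk ta 0 = F0" "gk ta 0 = G0" "vk ta 0 = (%_. 0)" "wk ta 0 = (%_. 0)"
 by (simp_all add: fk_def gk_def vk_def wk_def)

lemma sol_props:
 assumes "ta > 0"
 shows "bdm (fk ta k) & bdm (gk ta k) & (ALL x. fk ta k x >= 0) & (ALL x. gk ta k x >= 0) &
  stp ta (fk ta k) (gk ta k) (fk ta (Suc k)) (vk ta (Suc k)) (gk ta (Suc k)) (wk ta (Suc k))"
proof (induct k)
 have step: "stp ta (fk ta k) (gk ta k) (fk ta (Suc k)) (vk ta (Suc k)) (gk ta (Suc k)) (wk ta (Suc k))"
  if h: "bdm (fk ta k)" "bdm (gk ta k)" "!!x. fk ta k x >= 0" "!!x. gk ta k x >= 0" for k
 proof -
  obtain f v g w where "stp ta (fk ta k) (gk ta k) f v g w" using stp_ex[OF h assms] by blast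
  hence "EX s. stp ta (fst (sol ta k)) (fst (snd (snd (sol ta k)))) (fst s) (fst (snd s)) (fst (snd (snd s))) (snd (snd (snd s)))"
   by (intro exI[of _ "(f, v, g, w)"]) (simp add: fk_def gk_def)
  from someI_ex[OF this] show ?thesis by (simp add: fk_def gk_def vk_def wk_def)
 qed
 {
  case 0
  show ?case using step[of 0] bdm0 F0n G0n by simp
 next
  case (Suc k)
  hence s: "stp ta (fk ta k) (gk ta k) (fk ta (Suc k)) (vk ta (Suc k)) (gk ta (Suc k)) (wk ta (Suc k))" by blast
  hence "bdm (fk ta (Suc k))" "bdm (gk ta (Suc k))" "!!x. fk ta (Suc k) x >= 0" "!!x. gk ta (Suc k) x >= 0"
   unfolding stp_def by (blast intro: ac_bdm)+
  thus ?case using step[of "Suc k"] by blast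
 }
qed

context
 fixes ta :: real assumes tau: "ta > 0"
begin

lemma k_bdm: "bdm (fk ta k)" "bdm (gk ta k)" and k_nonneg: "fk ta k x >= 0" "gk ta k x >= 0"
 using sol_props[OF tau, of k] by auto

lemma k_ac: "ac (fk ta (Suc k)) (vk ta (Suc k))" "ac (gk ta (Suc k)) (wk ta (Suc k))"
 using sol_props[OF tau, of k] by (auto simp: stp_def)

lemma k_sq: "sq_int mX (vk ta k)" "sq_int mX (wk ta k)"
 using acD(1)[OF k_ac(1)] acD(1)[OF k_ac(2)] by (cases k; simp)+

lemma k_int: "integrable mX (fk ta k)" "integrable mX (gk ta k)"
 by (intro bdm_integrable k_bdm)+

lemma k_mass: "(LX x. fk ta k x) = (LX x. F0 x)" "(LX x. gk ta k x) = (LX x. G0 x)"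
proof (induct k)
 case (Suc k)
 have "(LX x. fk ta (Suc k) x - fk ta k x) = 0" "(LX x. gk ta (Suc k) x - gk ta k x) = 0"
  using sol_props[OF tau, of k] by (auto simp: stp_def)
 hence "(LX x. fk ta (Suc k) x) = (LX x. fk ta k x)" "(LX x. gk ta (Suc k) x) = (LX x. gk ta k x)"
  using k_int by auto
 thus "(LX x. fk ta (Suc k) x) = (LX x. F0 x)" "(LX x. gk ta (Suc k) x) = (LX x. G0 x)"
  using Suc by auto
qed auto

lemma k_flux: "AE x in mX. cumX (fk ta (Suc k)) x - cumX (fk ta k) x = ta * Jk ta (Suc k) x"
 "AE x in mX. cumX (gk ta (Suc k)) x - cumX (gk ta k) x = ta * Hk ta (Suc k) x"
 using sol_props[OF tau, of k] by (auto simp: stp_def Jk_def Hk_def X.cum_diff[OF k_int(1) k_int(1)] X.cum_diff[OF k_int(2) k_int(2)])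

lemma k_Phi:
 assumes "n >= 2" shows "(LX x. Phi R mu n (fk ta k x, gk ta k x)) <= (LX x. Phi R mu n (F0 x, G0 x))"
proof (induct k)
 case (Suc k)
 have s: "stp ta (fk ta k) (gk ta k) (fk ta (Suc k)) (vk ta (Suc k)) (gk ta (Suc k)) (wk ta (Suc k))"
  using sol_props[OF tau, of k] by blast
 have "(LX x. Phi R mu n (fk ta (Suc k) x, gk ta (Suc k) x)) <= (LX x. Phi R mu n (fk ta k x, gk ta k x))"
  using s unfolding stp_def by (intro Phi_step[OF R mu tau assms k_ac k_nonneg k_bdm k_nonneg]) auto
 thus ?case using Suc by linarith
qed simp

text \<open>By \<open>k_Phi\<close> the integrals of \<open>Phi\<close> at step \<open>k\<close> are
  compared with those of the initial data directly, so the factor (1+R)/R is incurred once and does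
  not accumulate over the steps. Continuity turns the bound almost everywhere into one that holds
  everywhere.\<close>

lemma k_bound: "fk ta k x + gk ta k x <= Kb"
proof (cases k)
 case 0 thus ?thesis using FG0[of x] Kb by simp
next
 case (Suc j)
 have m: "fk ta k : BM" "gk ta k : BM" using k_bdm[of k] by (auto simp: bconv_def)
 have "AE x in mX. fk ta k x + gk ta k x <= Kb" unfolding Kb_def
  by (rule sup_bound_from_Phi[OF R mu m F0m G0m k_nonneg k_bdm F0n G0n bdm0 k_Phi])
    (use FG0 F0_le(3) in auto)
 from ac_le_of_AE[OF ac_add[OF k_ac(1)[of j] k_ac(2)[of j]] this[unfolded Suc]] show ?thesis unfolding Suc .
qed

lemma k_le: "fk ta k x <= Kb" "gk ta k x <= Kb"
 using k_bound[of k x] k_nonneg[of k x] by linarith+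

lemma Dk_split: "Dk ta k = sqn mX (vk ta k) + R * sqn mX (%x. vk ta k x + wk ta k x)"
 unfolding Dk_def using sq_int_integrable[OF k_sq(1)] sq_int_integrable[OF sq_int_add[OF k_sq]] by simp

lemma Dk_nonneg: "Dk ta k >= 0"
 unfolding Dk_split using R by (intro add_nonneg_nonneg mult_nonneg_nonneg) auto

lemma k_energy: "ent mu (fk ta k) (gk ta k) + ta * (SUM i<k. Dk ta (Suc i)) <= C0"
proof (induct k)
 case 0 show ?case by (simp add: C0_def)
next
 case (Suc k)
 have "ent mu (%x. fk ta (Suc k) x) (%x. gk ta (Suc k) x) + ta * Dk ta (Suc k) <= ent mu (fk ta k) (gk ta k)"
  using sol_props[OF tau, of k] by (auto simp: stp_def Dk_def)
 thus ?case using Suc by (simp add: distrib_left)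
qed

lemma k_diss: "ta * (SUM i<k. Dk ta (Suc i)) <= C0"
proof -
 have "ent mu (fk ta k) (gk ta k) >= 0" by (intro integral_nonneg_AE AE_I2 Phi1_nonneg mu k_nonneg)
 thus ?thesis using k_energy[of k] by linarith
qed

text \<open>One constant for four estimates. The factor 1 + 1/R passes from \<open>Dk\<close> to the
  squared norms of v and v + w; the summand 4 serves v and w, the next one the flux of f, the last
  one the flux of g.\<close>

definition "cD = (4 + Kb^2 * (2 + 2 * R^2) + (mu * R)^2 * Kb^2) * (1 + 1 / R)"

lemma cD: "cD >= 0" unfolding cD_def using R by (intro add_nonneg_nonneg mult_nonneg_nonneg) auto

lemma sq_JH: "sq_int mX (Jk ta k)" "sq_int mX (Hk ta k)"
 and sqn_le_Dk: "sqn mX (vk ta k) <= cD * Dk ta k" "sqn mX (wk ta k) <= cD * Dk ta k"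
  "sqn mX (Jk ta k) <= cD * Dk ta k" "sqn mX (Hk ta k) <= cD * Dk ta k"
proof -
 let ?v = "vk ta k" and ?w = "wk ta k" and ?q = "%x. vk ta k x + wk ta k x"
 have sq: "sq_int mX ?q" by (intro sq_int_add k_sq)
 define B where "B = (1 + 1 / R) * Dk ta k"
 have "B = sqn mX ?v + sqn mX ?q + (R * sqn mX ?q + sqn mX ?v / R)" using R unfolding B_def Dk_split by (simp add: field_simps)
 moreover have "0 <= R * sqn mX ?q + sqn mX ?v / R" "sqn mX ?v >= 0" "sqn mX ?q >= 0" using R by simp_all
 ultimately have V: "sqn mX ?v <= B" and Q: "sqn mX ?q <= B" and B: "B >= 0" by linarith+
 have b: "\<bar>fk ta k x\<bar> <= Kb" "\<bar>gk ta k x\<bar> <= Kb" for x using k_le[of k x] k_nonneg[of k x] by auto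
 have m: "fk ta k : BM" "gk ta k : BM" using k_bdm[of k] by (auto simp: bconv_def)
 have fin: "s <= cD * Dk ta k" if "s <= z * B" "z <= 4 + Kb^2 * (2 + 2 * R^2) + (mu * R)^2 * Kb^2" for s z
  using order_trans[OF that(1) mult_right_mono[OF that(2) B]] by (simp add: cD_def B_def mult.assoc)
 have z: "1 <= 4 + Kb^2 * (2 + 2 * R^2) + (mu * R)^2 * Kb^2" "4 <= 4 + Kb^2 * (2 + 2 * R^2) + (mu * R)^2 * Kb^2"
  "Kb^2 * (2 + 2 * R^2) <= 4 + Kb^2 * (2 + 2 * R^2) + (mu * R)^2 * Kb^2" "(mu * R)^2 * Kb^2 <= 4 + Kb^2 * (2 + 2 * R^2) + (mu * R)^2 * Kb^2"
  by (simp_all add: add_nonneg_nonneg add_increasing2 add_increasing)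
 show "sqn mX ?v <= cD * Dk ta k" by (rule fin[OF _ z(1)]) (use V in simp)
 show "sqn mX ?w <= cD * Dk ta k" using sq_int_comb(2)[OF sq Q k_sq(1) V, of 1 "-1"] by (intro fin[OF _ z(2)]) simp
 have p: "(1 + R) * ?v x + R * ?w x = 1 * ?v x + R * ?q x" for x by (simp add: algebra_simps)
 note c = sq_int_comb[OF k_sq(1) V sq Q, of 1 R, folded p]
 have "sqn mX (Jk ta k) <= Kb^2 * ((2 * 1^2 + 2 * R^2) * B)"
  unfolding Jk_def[abs_def] by (rule order_trans[OF sq_int_bounded_mult(2)[OF c(1) m(1) b(1)] mult_left_mono[OF c(2)]]) simp
 thus "sqn mX (Jk ta k) <= cD * Dk ta k" by (intro fin[OF _ z(3)]) (simp add: mult.assoc)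
 have g: "sq_int mX (%x. gk ta k x * ?q x)" by (rule sq_int_bounded_mult(1)[OF sq m(2) b(2)])
 show "sq_int mX (Jk ta k)" "sq_int mX (Hk ta k)"
  unfolding Jk_def[abs_def] Hk_def[abs_def] by (rule sq_int_bounded_mult(1)[OF c(1) m(1) b(1)], rule sq_int_mult[OF g])
 have "sqn mX (Hk ta k) = (mu * R)^2 * sqn mX (%x. gk ta k x * ?q x)"
  unfolding Hk_def[abs_def] by (simp add: power_mult_distrib)
 also have "... <= (mu * R)^2 * (Kb^2 * B)"
  by (intro mult_left_mono order_trans[OF sq_int_bounded_mult(2)[OF sq m(2) b(2)]] Q) auto
 finally show "sqn mX (Hk ta k) <= cD * Dk ta k" by (intro fin[OF _ z(4)]) (simp add: mult.assoc)
qed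

end

end

text \<open>Time carries the weight \<open>exp (- t)\<close>, which makes the measure of the whole half line finite; integration against
 \<open>wt T\<close> is integration over \<open>(0, T]\<close> with respect to Lebesgue measure.\<close>

definition mE :: "real measure" where "mE = density lborel (%t. ennreal (exponential_density 1 t))"

lemma sets_mE [simp, measurable_cong]: "sets mE = sets borel" by (simp add: mE_def)
lemma space_mE [simp]: "space mE = UNIV" by (simp add: mE_def)
lemma measurable_mE [simp]: "measurable mE N = measurable borel N" by (rule measurable_cong_sets) auto

lemma prob_mE: "prob_space mE" unfolding mE_def by (rule prob_space_exponential_density) simp

lemma AE_mE: "(AE t in mE. P t) \<longleftrightarrow> (AE t in lborel. t >= 0 --> P t)"
 unfolding mE_def by (subst AE_density) (auto simp: exponential_density_def)

lemma AE_mE_pos: "AE t in mE. t > 0"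
 unfolding AE_mE using AE_lborel_singleton[of "0::real"] by eventually_elim auto

lemma integral_mE:
 fixes f :: "real => real"
 assumes "f : BM"
 shows "(LINT t|mE. f t) = (LINT t|lborel. exponential_density 1 t * f t)"
 unfolding mE_def using assms by (subst integral_density) (auto simp: exponential_density_def)

lemma integrable_mE:
 fixes f :: "real => real"
 assumes "f : BM"
 shows "integrable mE f \<longleftrightarrow> integrable lborel (%t. exponential_density 1 t * f t)"
 unfolding mE_def using assms by (subst integrable_density) (auto simp: exponential_density_def)

lemma nn_integral_mE:
 fixes f :: "real => ennreal"
 assumes "f : BM"
 shows "(\<integral>\<^sup>+t. f t \<partial>mE) = (\<integral>\<^sup>+t. ennreal (exponential_density 1 t) * f t \<partial>lborel)"
 unfolding mE_def using assms by (subst nn_integral_density) auto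

definition wt :: "real => real => real" where "wt T t = exp t * indicator {0<..T} t"

lemma wt_nonneg: "wt T t >= 0" and wt_le: "wt T t <= exp T"
 by (auto simp: wt_def indicator_def)

lemma wt_measurable [measurable]: "wt T : BM"
 unfolding wt_def[abs_def] by measurable

lemma wt_dens: "exponential_density 1 t * (wt T t * y) = indicator {0<..T} t * y"
 by (auto simp: wt_def exponential_density_def indicator_def exp_minus_inverse simp flip: exp_add mult.assoc)

lemma integral_wt:
 assumes "f : BM"
 shows "(LINT t|mE. wt T t * f t) = (LINT t|lborel. indicator {0<..T} t * f t)"
 using assms by (subst integral_mE) (auto simp: wt_dens)

lemma nn_integral_wt:
 assumes "f : BM"
 shows "(\<integral>\<^sup>+t. ennreal (wt T t) * f t \<partial>mE) = (\<integral>\<^sup>+t. indicator {0<..T} t * f t \<partial>lborel)"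
proof -
 have "ennreal (exponential_density 1 t) * (ennreal (wt T t) * f t) = indicator {0<..T} t * f t" for t
  using wt_dens[of t T 1] by (simp add: mult.assoc[symmetric] exponential_density_def wt_nonneg flip: ennreal_mult)
   (simp add: indicator_def)
 thus ?thesis using assms by (subst nn_integral_mE) auto
qed

text \<open>Rounding up: the values of step k + 1 are used on the left-open interval from k tau to
  (k+1) tau, closed at its right end, and all t <= 0 get index 0 because \<open>nat\<close> cuts off
  negative integers. At positive times the interpolants therefore have derivatives even during the
  first step.\<close>

definition kk :: "nat => real => nat" where "kk N t = nat \<lceil>t * real (Suc N)\<rceil>"
definition tau :: "nat => real" where "tau N = 1 / real (Suc N)"

lemma tau_pos: "tau N > 0" by (simp add: tau_def)

lemma tau_tendsto: "tau ---> 0"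
 unfolding tau_def[abs_def] using LIMSEQ_inverse_real_of_nat by (simp add: inverse_eq_divide)

lemma kk_measurable [measurable]: "kk N : measurable borel (count_space UNIV)"
 unfolding kk_def[abs_def] by measurable

lemma kk_nonpos: "t <= 0 ==> kk N t = 0"
 by (auto simp: kk_def mult_nonpos_nonneg ceiling_le_zero)

lemma kk_Suc_iff: "kk N t = Suc k \<longleftrightarrow> t : {real k * tau N<..real (Suc k) * tau N}"
proof -
 have "kk N t = Suc k \<longleftrightarrow> \<lceil>t * real (Suc N)\<rceil> = int (Suc k)" unfolding kk_def by linarith
 also have "... \<longleftrightarrow> real k < t * real (Suc N) & t * real (Suc N) <= real (Suc k)"
  by (simp add: ceiling_eq_iff)
 also have "... \<longleftrightarrow> t : {real k * tau N<..real (Suc k) * tau N}"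
  by (auto simp: tau_def divide_less_eq pos_le_divide_eq)
 finally show ?thesis .
qed

lemma kk_mono: "s <= t ==> kk N s <= kk N t"
 unfolding kk_def by (intro nat_mono ceiling_mono mult_right_mono) auto

lemma kk_bounds: assumes "t >= 0" shows "t <= real (kk N t) * tau N" (is ?A) "real (kk N t) * tau N < t + tau N" (is ?B)
proof -
 have "t * real (Suc N) >= 0" using assms by simp
 hence c: "real (kk N t) = of_int \<lceil>t * real (Suc N)\<rceil>" unfolding kk_def by (simp add: of_nat_nat)
 have 1: "t * real (Suc N) <= real (kk N t)" and 2: "real (kk N t) < t * real (Suc N) + 1" unfolding c by linarith+
 have e: "t * real (Suc N) * tau N = t" by (simp add: tau_def)
 show ?A using mult_right_mono[OF 1, of "tau N"] tau_pos[of N] by (simp only: e less_imp_le)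
 show ?B using mult_strict_right_mono[OF 2 tau_pos[of N]] by (simp only: distrib_right e mult_1)
qed

lemma kk_pos: "t > 0 ==> kk N t > 0"
 using kk_bounds(1)[of t N] tau_pos[of N] by (cases "kk N t") auto

text \<open>The value at index 0 must vanish, since that index is taken on the whole half-line t <=
  0 of infinite measure.\<close>

lemma nn_integral_kk:
 fixes e :: "nat => ennreal"
 assumes "e 0 = 0"
 shows "(\<integral>\<^sup>+t. e (kk N t) \<partial>lborel) = (\<Sum>k. ennreal (tau N) * e (Suc k))"
proof -
 define I where "I k = {real k * tau N<..real (Suc k) * tau N}" for k
 have disj: "disjoint_family I"
  unfolding disjoint_family_on_def I_def by (metis (no_types, lifting) Int_emptyI kk_Suc_iff nat.inject)
 have "e (kk N t) = (\<Sum>k. e (Suc k) * indicator (I k) t)" for t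
 proof (cases "kk N t")
  case 0
  hence "t ~: I k" for k using kk_Suc_iff[of N t k] by (simp add: I_def)
  thus ?thesis using assms 0 by simp
 next
  case (Suc k)
  hence "t : I k" using kk_Suc_iff[of N t k] by (simp add: I_def)
  from suminf_cmult_indicator[OF disj this, of "%k. e (Suc k)"] show ?thesis using Suc by simp
 qed
 hence "(\<integral>\<^sup>+t. e (kk N t) \<partial>lborel) = (\<Sum>k. \<integral>\<^sup>+t. e (Suc k) * indicator (I k) t \<partial>lborel)"
  by (simp add: nn_integral_suminf I_def)
 also have "... = (\<Sum>k. ennreal (tau N) * e (Suc k))"
 proof (intro arg_cong[where f=suminf] ext)
  fix k
  have "real k * tau N <= real (Suc k) * tau N" using tau_pos[of N] by (intro mult_right_mono) auto
  hence "emeasure lborel (I k) = ennreal (real (Suc k) * tau N - real k * tau N)" unfolding I_def by simp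
  also have "real (Suc k) * tau N - real k * tau N = tau N" by (simp add: algebra_simps)
  finally show "(\<integral>\<^sup>+t. e (Suc k) * indicator (I k) t \<partial>lborel) = ennreal (tau N) * e (Suc k)"
   by (subst nn_integral_cmult_indicator) (auto simp: I_def mult.commute)
 qed
 finally show ?thesis .
qed

lemma integral_kk:
 fixes j :: "nat => real"
 shows "integrable lborel (%s. indicator {0<..real K * tau N} s * j (kk N s))"
  "(LINT s|lborel. indicator {0<..real K * tau N} s * j (kk N s)) = (SUM i<K. tau N * j (Suc i))"
proof (induct K)
 case (Suc K)
 let ?I = "{real K * tau N<..real (Suc K) * tau N}"
 have le: "real K * tau N <= real (Suc K) * tau N" using tau_pos[of N] by (intro mult_right_mono) auto
 have le0: "0 <= real K * tau N" using tau_pos[of N] by simp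
 have eq: "indicator {0<..real (Suc K) * tau N} s * j (kk N s) = indicator {0<..real K * tau N} s * j (kk N s) + indicator ?I s * j (Suc K)" for s
 proof (cases "s : ?I")
  case True thus ?thesis using kk_Suc_iff[of N s K] le0 by (auto simp: indicator_def)
 next
  case False thus ?thesis using le by (auto simp: indicator_def)
 qed
 have m: "emeasure lborel ?I = ennreal (tau N)" using le by (simp add: algebra_simps)
 have i: "integrable lborel (%s. indicator ?I s * j (Suc K))"
  by (intro integrable_mult_left) (use m in "simp add: integrable_indicator_iff")
 show "integrable lborel (%s. indicator {0<..real (Suc K) * tau N} s * j (kk N s))"
  unfolding eq using Suc(1) i by simp
 have "measure lborel ?I = tau N" using m tau_pos[of N] by (simp add: measure_def)
 thus "(LINT s|lborel. indicator {0<..real (Suc K) * tau N} s * j (kk N s)) = (SUM i<Suc K. tau N * j (Suc i))"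
  unfolding eq using Suc i by (subst Bochner_integral_add) auto
qed simp_all

section \<open>The space-time measure and norms of interpolants\<close>

context interval
begin

definition Q :: "(real * real) measure" where "Q = mE \<Otimes>\<^sub>M mX"

lemma sets_Q [simp, measurable_cong]: "sets Q = sets (borel \<Otimes>\<^sub>M borel)"
 unfolding Q_def by (rule sets_pair_measure_cong) auto

lemma space_Q [simp]: "space Q = UNIV" by (simp add: Q_def space_pair_measure)

lemma measurable_Q [simp]: "measurable Q N = measurable (borel \<Otimes>\<^sub>M borel) N" by (rule measurable_cong_sets) auto

sublocale E: prob_space mE by (rule prob_mE)
sublocale PQ: pair_sigma_finite mE mX ..
sublocale Q: finite_measure Q unfolding Q_def by (rule finite_measure_pair_measure) (unfold_locales)

lemma nn_integral_Q:
 "ph : BM2 ==> (\<integral>\<^sup>+p. ph p \<partial>Q) = (\<integral>\<^sup>+t. (\<integral>\<^sup>+x. ph (t, x) \<partial>mX) \<partial>mE)"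
 unfolding Q_def by (subst X.nn_integral_fst) (auto cong: measurable_cong_sets)

lemma integral_Q:
 fixes ph :: "real * real => real"
 shows "integrable Q ph ==> (LINT p|Q. ph p) = (LINT t|mE. (LX x. ph (t, x)))"
 unfolding Q_def by (rule PQ.integral_fst'[symmetric])

lemma AE_Q: assumes "AE p in Q. P p" shows "AE t in mE. AE x in mX. P (t, x)"
 using assms unfolding Q_def by (rule PQ.AE_pair)

lemma sq_int_Q_AE:
 assumes "sq_int Q ph" shows "AE t in mE. sq_int mX (%x. ph (t, x))"
proof -
 have [measurable]: "ph : BM2" using sq_intD[OF assms] by simp
 have "AE t in mE. integrable mX (%x. (norm (ph (t, x)))^2)"
  using sq_int_integrable[OF assms] unfolding Q_def by (rule PQ.AE_integrable_fst')
 thus ?thesis by eventually_elim (simp add: sq_int_def)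
qed

lemma sqn_Q: "sq_int Q ph ==> sqn Q ph = (LINT t|mE. sqn mX (%x. ph (t, x)))"
 using integral_Q[OF sq_int_integrable] .

lemma sq_int_Q_I:
 fixes ph :: "real * real => real"
 assumes [measurable]: "ph : BM2"
  and B: "(\<integral>\<^sup>+t. (\<integral>\<^sup>+x. ennreal ((ph (t, x))^2) \<partial>mX) \<partial>mE) <= ennreal B" "B >= 0"
 shows "sq_int Q ph" "sqn Q ph <= B" (is ?A)
proof -
 have nn: "(\<integral>\<^sup>+p. ennreal ((norm (ph p))^2) \<partial>Q) <= ennreal B"
  using B(1) by (subst nn_integral_Q) auto
 hence i: "integrable Q (%p. (norm (ph p))^2)" by (intro integrableI_nonneg) (auto simp: le_less_trans)
 thus "sq_int Q ph" by (simp add: sq_int_def)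
 show ?A using nn B(2) nn_integral_eq_integral[OF i] by simp
qed

lemma sq_int_Q_bounded:
 fixes ph :: "real * real => real"
 assumes "ph : BM2" "!!p. \<bar>ph p\<bar> <= B"
 shows "sq_int Q ph" unfolding sq_int_def
proof
 show "integrable Q (%p. (norm (ph p))^2)"
 proof (rule Q.integrable_const_bound[where B="B^2"])
  show "AE p in Q. norm ((norm (ph p))^2) <= B^2" using power_mono[OF assms(2), of _ 2] by (intro AE_I2) simp
 qed (use assms(1) in simp)
qed (use assms(1) in simp)

lemma sq_int_Q_bounded_mult:
 fixes ph z :: "real * real => real"
 assumes "sq_int Q ph" "z : BM2" "!!p. \<bar>z p\<bar> <= B"
 shows "sq_int Q (%p. z p * ph p)" (is ?A) "sqn Q (%p. z p * ph p) <= B^2 * sqn Q ph" (is ?B)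
proof -
 have le: "(norm (z p * ph p))^2 <= B^2 * (norm (ph p))^2" for p
  using power_mono[OF assms(3)[of p], of 2] by (simp add: power_mult_distrib mult_right_mono)
 have i: "integrable Q (%p. B^2 * (norm (ph p))^2)" using assms(1) by (simp add: sq_int_def)
 have m: "(%p. z p * ph p) : borel_measurable Q" using assms(2) sq_intD[OF assms(1)] by simp
 show s: ?A using sq_int_bound[OF m i] le by blast
 show ?B using integral_mono[OF sq_int_integrable[OF s] i le] by simp
qed

lemma step_measurable:
 fixes ph :: "nat => real => real"
 assumes "!!k. ph k : BM"
 shows "(%p. ph (kk N (fst p)) (snd p)) : BM2"
proof (rule measurable_compose_countable[where f="%k p. ph k (snd p)" and g="%p. kk N (fst p)"])
 show "(%p. ph k (snd p)) : BM2" for k using assms[of k] by measurable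
qed measurable

text \<open>The exponential density is at most 1, so the norm on \<open>Q\<close> is dominated by
  the Lebesgue integral over all steps; a bound on the partial sums that is uniform in their length
  suffices.\<close>

lemma step_sq_int:
 fixes ph :: "nat => real => real"
 assumes s: "!!k. sq_int mX (ph k)" and 0: "ph 0 = (%_. 0)" and B: "!!K. tau N * (SUM i<K. sqn mX (ph (Suc i))) <= B"
 shows "sq_int Q (%p. ph (kk N (fst p)) (snd p))" (is ?A) "sqn Q (%p. ph (kk N (fst p)) (snd p)) <= B" (is ?B)
proof -
 have B0: "B >= 0" using B[of 0] by simp
 define e where "e k = ennreal (sqn mX (ph k))" for k
 have e: "(\<integral>\<^sup>+x. ennreal ((ph k x)^2) \<partial>mX) = e k" for k
  using sq_int_integrable[OF s[of k]] unfolding e_def by (subst nn_integral_eq_integral) auto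
 have "(\<integral>\<^sup>+t. (\<integral>\<^sup>+x. ennreal ((ph (kk N t) x)^2) \<partial>mX) \<partial>mE) = (\<integral>\<^sup>+t. ennreal (exponential_density 1 t) * e (kk N t) \<partial>lborel)"
  unfolding e by (rule nn_integral_mE) measurable
 also have "... <= (\<integral>\<^sup>+t. e (kk N t) \<partial>lborel)"
 proof (intro nn_integral_mono)
  fix t
  have "ennreal (exponential_density 1 t) <= 1" by (auto simp: exponential_density_def)
  thus "ennreal (exponential_density 1 t) * e (kk N t) <= e (kk N t)" using mult_right_mono[of _ 1 "e (kk N t)"] by simp
 qed
 also have "... = (\<Sum>k. ennreal (tau N) * e (Suc k))" by (rule nn_integral_kk) (simp add: e_def 0)
 also have "... <= ennreal B"
 proof (rule suminf_le_const[OF summableI])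
  fix K
  have "(SUM k<K. ennreal (tau N) * e (Suc k)) = ennreal (tau N * (SUM i<K. sqn mX (ph (Suc i))))"
   using tau_pos[of N] by (simp add: e_def sum_distrib_left ennreal_mult[symmetric] sum_nonneg flip: sum_ennreal)
  also have "... <= ennreal B" by (intro ennreal_leI B)
  finally show "(SUM k<K. ennreal (tau N) * e (Suc k)) <= ennreal B" .
 qed
 finally have le: "(\<integral>\<^sup>+t. (\<integral>\<^sup>+x. ennreal ((ph (kk N t) x)^2) \<partial>mX) \<partial>mE) <= ennreal B" .
 have m: "ph k : BM" for k using sq_meas[OF s[of k]] .
 show ?A ?B using sq_int_Q_I[OF step_measurable[OF m] _ B0] le by auto
qed

text \<open>Interpolation: the derivative of the square of the primitive is 2 w times the primitive,
  and \<open>w\<close> is bounded. This converts the L2 estimate of an increment in time into a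
  pointwise one.\<close>

lemma cumX_sq_bound:
 assumes w: "w : BM" "!!x. \<bar>w x\<bar> <= C"
 shows "(cumX w x)^2 <= 2 * C * sqrt (b - a) * sqrt (sqn mX (cumX w))"
proof -
 have iw: "integrable mX w" using w by (intro integrable_bounded)
 have C: "C >= 0" using w(2)[of 0] by linarith
 have mc: "cumX w : BM" using w(1) by (rule X.borel_measurable_cum)
 have sc: "sq_int mX (cumX w)" by (rule sq_int_bounded[OF mc X.cum_bound[OF iw]])
 have ic: "integrable mX (cumX w)" by (rule sq_int_imp_integrable[OF sc])
 have s1: "sq_int mX (%_. 1 :: real)" by (rule sq_int_bounded[of _ 1]) auto
 have i: "integrable mX (%y. w y * cumX w y)"
  using sq_int_bounded_mult(1)[OF sc w(1) w(2)] by (rule sq_int_imp_integrable)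
 have "(cumX w x)^2 = cumX (%y. w y * cumX w y + w y * cumX w y) x"
  using X.cum_times_cum[OF iw iw] by (simp add: power2_eq_square)
 also have "... <= (LX y. \<bar>w y * cumX w y + w y * cumX w y\<bar>)"
  by (rule order_trans[OF abs_ge_self X.cum_bound[OF Bochner_integrable_add[OF i i]]])
 also have "... <= (LX y. 2 * C * \<bar>cumX w y\<bar>)"
 proof (rule integral_mono)
  fix y
  have "\<bar>w y * cumX w y + w y * cumX w y\<bar> = 2 * (\<bar>w y\<bar> * \<bar>cumX w y\<bar>)" by (simp add: abs_mult)
  also have "... <= 2 * (C * \<bar>cumX w y\<bar>)" using w(2)[of y] by (intro mult_left_mono mult_right_mono) auto
  finally show "\<bar>w y * cumX w y + w y * cumX w y\<bar> <= 2 * C * \<bar>cumX w y\<bar>" by simp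
 qed (use i ic in auto)
 also have "... = 2 * C * (LX y. norm (1::real) * norm (cumX w y))" by simp
 also have "... <= 2 * C * (sqrt (sqn mX (%_. 1::real)) * sqrt (sqn mX (cumX w)))"
  using C by (intro mult_left_mono CS_sqrt s1 sc) auto
 finally show ?thesis by (simp add: measure_mX mult.assoc)
qed

end

section \<open>Uniform estimates and equicontinuity of the interpolants\<close>

context muskat
begin

definition "uf N t = fk (tau N) (kk N t)"
definition "ug N t = gk (tau N) (kk N t)"
definition "uv N t = vk (tau N) (kk N t)"
definition "uw N t = wk (tau N) (kk N t)"
definition "uJ N t = Jk (tau N) (kk N t)"
definition "uH N t = Hk (tau N) (kk N t)"
definition "uD N T = (LINT p|Q. wt T (fst p) * ((uv N (fst p) (snd p))^2 + R * (uv N (fst p) (snd p) + uw N (fst p) (snd p))^2))"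

definition "BQ = cD * C0"

lemma C0_nonneg: "C0 >= 0"
 unfolding C0_def by (intro integral_nonneg_AE AE_I2 Phi1_nonneg mu F0n G0n)

lemma BQ_nonneg: "BQ >= 0" unfolding BQ_def by (intro mult_nonneg_nonneg C0_nonneg cD[OF tau_pos[of 0]])

lemma k_sum_bound:
 assumes "!!k. e k <= cD * Dk (tau N) k" shows "tau N * (SUM i<K. e (Suc i)) <= BQ"
proof -
 have "tau N * (SUM i<K. e (Suc i)) <= tau N * (SUM i<K. cD * Dk (tau N) (Suc i))"
  using tau_pos[of N] by (intro mult_left_mono sum_mono assms) auto
 also have "... = cD * (tau N * (SUM i<K. Dk (tau N) (Suc i)))" by (simp add: sum_distrib_left[symmetric])
 also have "... <= cD * C0" by (intro mult_left_mono k_diss tau_pos cD[OF tau_pos[of 0]])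
 finally show ?thesis by (simp add: BQ_def)
qed

lemma k_meas: "fk (tau N) k : BM" "gk (tau N) k : BM"
  "vk (tau N) k : BM" "wk (tau N) k : BM"
 using k_bdm[OF tau_pos, of N k] sq_meas[OF k_sq(1)[OF tau_pos]] sq_meas[OF k_sq(2)[OF tau_pos]] by (auto simp: bconv_def)

lemma u_meas:
 "(un (uf N)) : BM2"
 "(un (ug N)) : BM2"
 "(un (uv N)) : BM2"
 "(un (uw N)) : BM2" unfolding uf_def ug_def uv_def uw_def by (intro step_measurable k_meas)+

lemma u_bounds: "uf N t x >= 0" "ug N t x >= 0" "uf N t x + ug N t x <= Kb"
 unfolding uf_def ug_def by (intro k_nonneg k_bound tau_pos)+

lemma u_abs: "\<bar>uf N t x\<bar> <= Kb" "\<bar>ug N t x\<bar> <= Kb"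
 using u_bounds[of N t x] by auto

lemma u_ac: assumes "t > 0" shows "ac (uf N t) (uv N t)" (is ?A) "ac (ug N t) (uw N t)" (is ?B)
proof -
 obtain k where "kk N t = Suc k" using kk_pos[OF assms, of N] gr0_implies_Suc by blast
 thus ?A ?B using k_ac[OF tau_pos] by (simp_all add: uf_def uv_def ug_def uw_def)
qed

lemma u_mass: "(LX x. uf N t x) = (LX x. F0 x)" "(LX x. ug N t x) = (LX x. G0 x)"
 unfolding uf_def ug_def by (intro k_mass tau_pos)+

lemma u_sq:
 "sq_int Q (un (uv N))" "sqn Q (un (uv N)) <= BQ"
 "sq_int Q (un (uw N))" "sqn Q (un (uw N)) <= BQ"
 "sq_int Q (un (uJ N))" "sqn Q (un (uJ N)) <= BQ"
 "sq_int Q (un (uH N))" "sqn Q (un (uH N)) <= BQ" unfolding uv_def uw_def uJ_def uH_def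
 by (intro step_sq_int[where B=BQ] k_sq sq_JH tau_pos k_sum_bound sqn_le_Dk; simp add: Jk_def[abs_def] Hk_def[abs_def])+

lemma uJ_eq: "uJ N t x = uf N t x * ((1 + R) * uv N t x + R * uw N t x)"
 and uH_eq: "uH N t x = mu * R * (ug N t x * (uv N t x + uw N t x))"
 by (simp_all add: uJ_def uH_def Jk_def Hk_def uf_def ug_def uv_def uw_def)

lemma u_Phi: "n >= 2 ==> (LX x. Phi R mu n (uf N t x, ug N t x)) <= (LX x. Phi R mu n (F0 x, G0 x))"
 unfolding uf_def ug_def by (intro k_Phi tau_pos)

lemma u_diss_integrable: "integrable Q (%p. wt T (fst p) * ((uv N (fst p) (snd p))^2 + R * (uv N (fst p) (snd p) + uw N (fst p) (snd p))^2))"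
proof -
 note s = u_sq(1)[of N] u_sq(3)[of N]
 have i: "integrable Q (%p. exp T * ((uv N (fst p) (snd p))^2 + R * (uv N (fst p) (snd p) + uw N (fst p) (snd p))^2))"
  using sq_int_integrable[OF s(1)] sq_int_integrable[OF sq_int_add[OF s]] by simp
 note [measurable] = u_meas(3,4)[of N]
 show ?thesis
 proof (rule Bochner_integrable_bound[OF i])
  show "(%p. wt T (fst p) * ((uv N (fst p) (snd p))^2 + R * (uv N (fst p) (snd p) + uw N (fst p) (snd p))^2)) : borel_measurable Q"
   by measurable
  show "AE p in Q. norm (wt T (fst p) * ((uv N (fst p) (snd p))^2 + R * (uv N (fst p) (snd p) + uw N (fst p) (snd p))^2))
   <= norm (exp T * ((uv N (fst p) (snd p))^2 + R * (uv N (fst p) (snd p) + uw N (fst p) (snd p))^2))"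
   using R wt_nonneg wt_le by (intro AE_I2) (auto simp: abs_mult intro!: mult_right_mono)
 qed
qed

text \<open>The weighted integral covers the step containing \<open>T\<close> only partly, the sum
  covers it fully; the difference has the right sign since \<open>Dk\<close> is
  non-negative.\<close>

lemma uD_le:
 assumes "T >= 0" shows "uD N T <= tau N * (SUM i<kk N T. Dk (tau N) (Suc i))"
proof -
 let ?d = "%k x. (vk (tau N) k x)^2 + R * (vk (tau N) k x + wk (tau N) k x)^2"
 define e where "e k = (if k <= kk N T then ennreal (Dk (tau N) k) else 0)" for k
 note [measurable] = u_meas(3,4)[of N] k_meas[of N]
 have id: "integrable mX (?d k)" for k
  using sq_int_integrable[OF k_sq(1)[OF tau_pos]] sq_int_integrable[OF sq_int_add[OF k_sq(1)[OF tau_pos] k_sq(2)[OF tau_pos]]] by simp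
 have dk: "(\<integral>\<^sup>+x. ennreal (?d k x) \<partial>mX) = ennreal (Dk (tau N) k)" for k
  unfolding Dk_def using R by (intro nn_integral_eq_integral id AE_I2 add_nonneg_nonneg) auto
 have "ennreal (uD N T) = (\<integral>\<^sup>+p. ennreal (wt T (fst p) * ((uv N (fst p) (snd p))^2 + R * (uv N (fst p) (snd p) + uw N (fst p) (snd p))^2)) \<partial>Q)"
  unfolding uD_def using R wt_nonneg
  by (intro nn_integral_eq_integral[symmetric] u_diss_integrable AE_I2 mult_nonneg_nonneg add_nonneg_nonneg) auto
 also have "... = (\<integral>\<^sup>+t. (\<integral>\<^sup>+x. ennreal (wt T t * ?d (kk N t) x) \<partial>mX) \<partial>mE)"
  by (subst nn_integral_Q) (auto simp: uv_def uw_def)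
 also have "... = (\<integral>\<^sup>+t. ennreal (wt T t) * ennreal (Dk (tau N) (kk N t)) \<partial>mE)"
 proof (intro nn_integral_cong)
  fix t
  have 1: "ennreal (wt T t * ?d (kk N t) x) = ennreal (wt T t) * ennreal (?d (kk N t) x)" for x
   using R wt_nonneg by (intro ennreal_mult) auto
  have 2: "(%x. ennreal (?d (kk N t) x)) : borel_measurable mX" by measurable
  show "(\<integral>\<^sup>+x. ennreal (wt T t * ?d (kk N t) x) \<partial>mX) = ennreal (wt T t) * ennreal (Dk (tau N) (kk N t))"
   unfolding 1 nn_integral_cmult[OF 2] dk ..
 qed
 also have "... = (\<integral>\<^sup>+t. indicator {0<..T} t * ennreal (Dk (tau N) (kk N t)) \<partial>lborel)"
  by (rule nn_integral_wt) measurable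
 also have "... <= (\<integral>\<^sup>+t. e (kk N t) \<partial>lborel)"
  by (intro nn_integral_mono) (auto simp: e_def indicator_def kk_mono)
 also have "... = (\<Sum>k. ennreal (tau N) * e (Suc k))" by (rule nn_integral_kk) (simp add: e_def Dk_def)
 also have "... = (SUM k<kk N T. ennreal (tau N) * e (Suc k))" by (rule suminf_finite) (auto simp: e_def)
 also have "... = ennreal (tau N * (SUM i<kk N T. Dk (tau N) (Suc i)))"
  using tau_pos[of N] Dk_nonneg[OF tau_pos, of N] by (simp add: e_def sum_distrib_left ennreal_mult[symmetric] flip: sum_ennreal)
 finally show ?thesis
  using tau_pos[of N] Dk_nonneg[OF tau_pos, of N] by (subst (asm) ennreal_le_iff) (auto intro!: mult_nonneg_nonneg sum_nonneg)
qed

lemma u_energy: "T >= 0 ==> ent mu (uf N T) (ug N T) + uD N T <= C0"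
 using uD_le[of T N] k_energy[OF tau_pos, of N "kk N T"] by (simp add: uf_def ug_def)

lemma W_sum: "AE x in mX. cumX (fk (tau N) (k + m)) x - cumX (fk (tau N) k) x = (SUM i<m. tau N * Jk (tau N) (Suc (k + i)) x)"
 "AE x in mX. cumX (gk (tau N) (k + m)) x - cumX (gk (tau N) k) x = (SUM i<m. tau N * Hk (tau N) (Suc (k + i)) x)"
proof -
 show "AE x in mX. cumX (fk (tau N) (k + m)) x - cumX (fk (tau N) k) x = (SUM i<m. tau N * Jk (tau N) (Suc (k + i)) x)"
 proof (induct m)
  case (Suc m)
  from Suc k_flux(1)[OF tau_pos[of N], of "k + m"] show ?case by eventually_elim simp
 qed simp
 show "AE x in mX. cumX (gk (tau N) (k + m)) x - cumX (gk (tau N) k) x = (SUM i<m. tau N * Hk (tau N) (Suc (k + i)) x)"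
 proof (induct m)
  case (Suc m)
  from Suc k_flux(2)[OF tau_pos[of N], of "k + m"] show ?case by eventually_elim simp
 qed simp
qed

text \<open>Cauchy-Schwarz over the \<open>m\<close> steps against the total flux budget
  \<open>BQ\<close>: increments of the primitives are Hoelder continuous in time with exponent 1/2,
  as functions with values in L2.\<close>

lemma W_bound:
 fixes J :: "nat => real => real"
 assumes W: "AE x in mX. W x = (SUM i<m. tau N * J (Suc (k + i)) x)" "W : BM"
  and J: "!!k. sq_int mX (J k)" "!!K. tau N * (SUM i<K. sqn mX (J (Suc i))) <= BQ"
 shows "sqn mX W <= real m * tau N * BQ"
proof -
 note Jm = sq_meas[OF J(1)]
 have t: "tau N >= 0" using tau_pos[of N] by simp
 have iJ: "integrable mX (%x. (J k x)^2)" for k using sq_int_integrable[OF J(1)] by simp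
 have "sqn mX W = (LX x. (SUM i<m. tau N * J (Suc (k + i)) x)^2)"
  by (rule integral_cong_AE) (use W Jm in auto)
 also have "... <= (LX x. real m * tau N * (SUM i<m. tau N * (J (Suc (k + i)) x)^2))"
 proof (rule integral_mono)
  show "integrable mX (%x. (SUM i<m. tau N * J (Suc (k + i)) x)^2)"
   using sq_int_integrable[OF sq_int_sum[where A="{..<m}" and h="%i x. tau N * J (Suc (k + i)) x", OF sq_int_mult[OF J(1)]]] by simp
  show "integrable mX (%x. real m * tau N * (SUM i<m. tau N * (J (Suc (k + i)) x)^2))"
   using iJ by (intro integrable_mult_right Bochner_integrable_sum)
  fix x
  have "(SUM i<m. tau N * J (Suc (k + i)) x)^2 = (SUM i<m. sqrt (tau N) * (sqrt (tau N) * J (Suc (k + i)) x))^2"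
   using t by (simp flip: mult.assoc)
  also have "... <= (SUM i<m. (sqrt (tau N))^2) * (SUM i<m. (sqrt (tau N) * J (Suc (k + i)) x)^2)"
   by (rule Cauchy_Schwarz_ineq_sum)
  finally show "(SUM i<m. tau N * J (Suc (k + i)) x)^2 <= real m * tau N * (SUM i<m. tau N * (J (Suc (k + i)) x)^2)"
   using t by (simp add: power_mult_distrib)
 qed
 also have "... = real m * tau N * (SUM i<m. tau N * sqn mX (J (Suc (k + i))))"
  using iJ by (simp add: Bochner_integral_sum)
 also have "... <= real m * tau N * BQ"
 proof (intro mult_left_mono)
  have "(SUM i<m. tau N * sqn mX (J (Suc (k + i)))) <= (SUM i<k + m. tau N * sqn mX (J (Suc i)))"
  proof -
   have "(SUM i<m. tau N * sqn mX (J (Suc (k + i)))) = (\<Sum>i\<in>{k..<k + m}. tau N * sqn mX (J (Suc i)))"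
    by (rule sum.reindex_bij_witness[of _ "%i. i - k" "%i. k + i"]) auto
   also have "... <= (SUM i<k + m. tau N * sqn mX (J (Suc i)))" using t by (intro sum_mono2) auto
   finally show ?thesis .
  qed
  also have "... <= BQ" using J(2)[of "k + m"] by (simp add: sum_distrib_left)
  finally show "(SUM i<m. tau N * sqn mX (J (Suc (k + i)))) <= BQ" .
 qed (use t in auto)
 finally show ?thesis .
qed

lemma J_sum: "tau N * (SUM i<K. sqn mX (Jk (tau N) (Suc i))) <= BQ" "tau N * (SUM i<K. sqn mX (Hk (tau N) (Suc i))) <= BQ"
 by (intro k_sum_bound sqn_le_Dk tau_pos)+

definition "cT = 2 * Kb * sqrt (b - a)"

lemma cT: "cT >= 0" unfolding cT_def using Kb ab by simp

text \<open>\<open>W_bound\<close> combined with \<open>cumX_sq_bound\<close> gives a pointwise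
  modulus with exponent 1/4. The extra step size comes from rounding both times to the grid and
  disappears in the limit.\<close>

lemma u_time_aux:
 assumes st: "0 <= s" "s <= t"
 shows "(cumX (uf N t) x - cumX (uf N s) x)^2 <= cT * sqrt ((t - s + tau N) * BQ)" (is ?A)
  "(cumX (ug N t) x - cumX (ug N s) x)^2 <= cT * sqrt ((t - s + tau N) * BQ)" (is ?B)
proof -
 let ?k = "kk N s"
 define m where "m = kk N t - ?k"
 have m: "kk N t = ?k + m" using kk_mono[OF st(2), of N] by (simp add: m_def)
 have "real (?k + m) * tau N < t + tau N" "s <= real ?k * tau N" using kk_bounds(2)[of t N] kk_bounds(1)[of s N] st m by auto
 hence mt: "real m * tau N <= t - s + tau N" by (simp add: algebra_simps)
 have gen: "(cumX (ph (?k + m)) x - cumX (ph ?k) x)^2 <= cT * sqrt ((t - s + tau N) * BQ)"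
  if ph: "!!k. ph k : BM" "!!k x. 0 <= ph k x" "!!k x. ph k x <= Kb"
   and W: "AE x in mX. cumX (ph (?k + m)) x - cumX (ph ?k) x = (SUM i<m. tau N * J (Suc (?k + i)) x)"
   and J: "!!k. sq_int mX (J k)" "!!K. tau N * (SUM i<K. sqn mX (J (Suc i))) <= BQ" for ph J
 proof -
  have i: "integrable mX (ph k)" for k using ph by (intro integrable_bounded[where B=Kb]) (auto simp: abs_of_nonneg)
  define w where "w x = ph (?k + m) x - ph ?k x" for x
  have cw: "cumX w x = cumX (ph (?k + m)) x - cumX (ph ?k) x" for x unfolding w_def[abs_def] by (rule X.cum_diff[OF i i])
  have wm: "w : BM" unfolding w_def[abs_def] using ph(1) by simp
  have wb: "\<bar>w x\<bar> <= Kb" for x using ph(2,3)[of "?k + m" x] ph(2,3)[of ?k x] unfolding w_def by linarith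
  have "sqn mX (cumX w) <= real m * tau N * BQ"
   using W by (intro W_bound[OF _ X.borel_measurable_cum[OF wm] J]) (simp add: cw)
  also have "... <= (t - s + tau N) * BQ" by (intro mult_right_mono mt BQ_nonneg)
  finally have n: "sqn mX (cumX w) <= (t - s + tau N) * BQ" .
  have "(cumX w x)^2 <= cT * sqrt (sqn mX (cumX w))" unfolding cT_def by (rule cumX_sq_bound[OF wm wb])
  also have "... <= cT * sqrt ((t - s + tau N) * BQ)" by (intro mult_left_mono real_sqrt_le_mono n cT)
  finally show ?thesis by (simp add: cw)
 qed
 show ?A
  unfolding uf_def m by (rule gen[OF k_meas(1) k_nonneg(1)[OF tau_pos] k_le(1)[OF tau_pos] W_sum(1) sq_JH(1)[OF tau_pos] J_sum(1)])
 show ?B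
  unfolding ug_def m by (rule gen[OF k_meas(2) k_nonneg(2)[OF tau_pos] k_le(2)[OF tau_pos] W_sum(2) sq_JH(2)[OF tau_pos] J_sum(2)])
qed

lemma u_time:
 assumes st: "0 <= s" "0 <= t"
 shows "(cumX (uf N t) x - cumX (uf N s) x)^2 <= cT * sqrt ((\<bar>t - s\<bar> + tau N) * BQ)"
  "(cumX (ug N t) x - cumX (ug N s) x)^2 <= cT * sqrt ((\<bar>t - s\<bar> + tau N) * BQ)"
 using u_time_aux[of s t N x] u_time_aux[of t s N x] st by (cases "s <= t"; simp add: power2_commute abs_if)+

lemma u_space: "\<bar>cumX (uf N t) x - cumX (uf N t) y\<bar> <= Kb * \<bar>x - y\<bar>" "\<bar>cumX (ug N t) x - cumX (ug N t) y\<bar> <= Kb * \<bar>x - y\<bar>"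
 by (intro cumX_lipschitz u_abs; simp add: uf_def ug_def k_meas)+

end

context interval
begin

lemma sq_int_Q_snd: assumes "sq_int mX (h :: real => real)" shows "sq_int Q (%p. h (snd p))"
proof (rule sq_int_Q_I)
 note [measurable] = sq_meas[OF assms]
 show "(%p. h (snd p)) : BM2" by measurable
 have "(\<integral>\<^sup>+x. ennreal ((h x)^2) \<partial>mX) = ennreal (sqn mX h)"
  using sq_int_integrable[OF assms] by (subst nn_integral_eq_integral) auto
 thus "(\<integral>\<^sup>+t. (\<integral>\<^sup>+x. ennreal ((h (snd (t, x)))^2) \<partial>mX) \<partial>mE) <= ennreal (sqn mX h)"
  by (simp add: E.emeasure_space_1[simplified])
qed simp

lemma sq_int_Q_wt_snd:
 assumes "sq_int mX (h :: real => real)" shows "sq_int Q (%p. wt T (fst p) * h (snd p))"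
 by (rule sq_int_Q_bounded_mult(1)[OF sq_int_Q_snd[OF assms], of "%p. wt T (fst p)" "exp T"])
   (use wt_nonneg wt_le in "auto simp: abs_of_nonneg")

end

context muskat
begin

text \<open>The sum over steps runs to the end of the step containing \<open>T\<close>, the integral
  stops at \<open>T\<close>. The overshoot is shorter than one step, and the error is of order sqrt
  tau rather than tau because the flux of a single step is controlled only through tau times its
  squared norm.\<close>

lemma flux_identity_aux:
 fixes J :: "nat => real => real"
 assumes T: "T >= 0" and h: "sq_int mX h"
  and W: "AE x in mX. W x = (SUM i<kk N T. tau N * J (Suc i) x)" "W : BM"
  and J: "!!k. sq_int mX (J k)" "!!K. tau N * (SUM i<K. sqn mX (J (Suc i))) <= BQ"
  and JQ: "sq_int Q (%p. J (kk N (fst p)) (snd p))"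
 shows "\<bar>(LX x. W x * h x) - (LINT p|Q. wt T (fst p) * h (snd p) * J (kk N (fst p)) (snd p))\<bar> <= sqrt (tau N) * (sqrt BQ * sqrt (sqn mX h))"
proof -
 let ?k = "kk N T"
 note [measurable] = sq_meas[OF J(1)] sq_meas[OF h] W(2)
 have t0: "tau N > 0" by (rule tau_pos)
 define j where "j k = (LX x. J k x * h x)" for k
 have ij: "integrable mX (%x. J k x * h x)" for k using sq_int_times[OF J(1) h] .
 have 1: "(LX x. W x * h x) = (SUM i<?k. tau N * j (Suc i))"
 proof -
  have "(LX x. W x * h x) = (LX x. (SUM i<?k. tau N * (J (Suc i) x * h x)))"
   by (rule integral_cong_AE) (use W(1) in "auto simp: sum_distrib_right mult.assoc elim: eventually_mono")
  also have "... = (SUM i<?k. tau N * j (Suc i))" unfolding j_def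
   by (subst Bochner_integral_sum) (auto intro: ij)
  finally show ?thesis .
 qed
 have 2: "(LINT p|Q. wt T (fst p) * h (snd p) * J (kk N (fst p)) (snd p)) = (LINT t|lborel. indicator {0<..T} t * j (kk N t))"
 proof -
  have "(LINT p|Q. wt T (fst p) * h (snd p) * J (kk N (fst p)) (snd p)) = (LINT t|mE. (LX x. wt T t * h x * J (kk N t) x))"
   using integral_Q[OF sq_int_times[OF sq_int_Q_wt_snd[OF h] JQ]] by simp
  also have "... = (LINT t|mE. wt T t * j (kk N t))" unfolding j_def
   by (intro Bochner_integral_cong refl) (simp add: mult_ac flip: integral_mult_right_zero)
  also have "... = (LINT t|lborel. indicator {0<..T} t * j (kk N t))" by (rule integral_wt) measurable
  finally show ?thesis .
 qed
 let ?I = "{T<..real ?k * tau N}"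
 note kb = kk_bounds[OF T, of N]
 have eq: "indicator {0<..T} t * j (kk N t) = indicator {0<..real ?k * tau N} t * j (kk N t) - indicator ?I t * j ?k" for t
 proof (cases "t : ?I")
  case True
  hence "?k ~= 0" using T by (intro notI) simp
  then obtain k' where k': "?k = Suc k'" by (cases ?k) auto
  have "real k' * tau N < T" using kb(2) unfolding k' by (simp add: algebra_simps)
  hence "kk N t = Suc k'" using True by (subst kk_Suc_iff) (auto simp: k')
  thus ?thesis using True T k' by (auto simp: indicator_def)
 next
  case False thus ?thesis using kb(1) by (auto simp: indicator_def)
 qed
 have m: "emeasure lborel ?I = ennreal (real ?k * tau N - T)" using kb by simp
 have i: "integrable lborel (%t. indicator ?I t * j ?k)"
  by (intro integrable_mult_left) (use m in "simp add: integrable_indicator_iff")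
 have "measure lborel ?I = real ?k * tau N - T" using m kb by (simp add: measure_def)
 hence 3: "(LINT t|lborel. indicator {0<..T} t * j (kk N t)) = (SUM i<?k. tau N * j (Suc i)) - (real ?k * tau N - T) * j ?k"
  unfolding eq using integral_kk[of ?k N j] i by (subst Bochner_integral_diff) auto
 have "\<bar>(real ?k * tau N - T) * j ?k\<bar> <= sqrt (tau N) * (sqrt BQ * sqrt (sqn mX h))"
 proof (cases ?k)
  case 0 thus ?thesis using kb T t0 BQ_nonneg by (simp add: mult_nonneg_nonneg)
 next
  case (Suc k')
  \<comment> \<open>A single summand of the flux budget: one factor sqrt tau of the interval length
    is spent on the norm of the last flux.\<close>
  have "tau N * sqn mX (J ?k) <= (SUM i<?k. tau N * sqn mX (J (Suc i)))"
   unfolding Suc using t0 by (intro member_le_sum[of k' "{..<Suc k'}" "%i. tau N * sqn mX (J (Suc i))"]) auto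
  also have "... <= BQ" using J(2)[of ?k] by (simp add: sum_distrib_left)
  finally have JB: "tau N * sqn mX (J ?k) <= BQ" .
  have "\<bar>(real ?k * tau N - T) * j ?k\<bar> <= tau N * \<bar>j ?k\<bar>"
   unfolding abs_mult using kb by (intro mult_right_mono) auto
  also have "... <= tau N * (sqrt (sqn mX (J ?k)) * sqrt (sqn mX h))"
   unfolding j_def using CS_inner[OF J(1) h, of ?k] t0 by (intro mult_left_mono) auto
  also have "... = sqrt (tau N) * (sqrt (tau N * sqn mX (J ?k)) * sqrt (sqn mX h))"
   using t0 by (simp add: real_sqrt_mult)
  also have "... <= sqrt (tau N) * (sqrt BQ * sqrt (sqn mX h))"
   using JB t0 by (intro mult_left_mono mult_right_mono real_sqrt_le_mono) auto
  finally show ?thesis .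
 qed
 thus ?thesis unfolding 1 2 3 by simp
qed

lemma flux_identity:
 assumes T: "T >= 0" and h: "sq_int mX h"
 shows "\<bar>(LX x. (cumX (uf N T) x - cumX F0 x) * h x) - (LINT p|Q. wt T (fst p) * h (snd p) * uJ N (fst p) (snd p))\<bar> <= sqrt (tau N) * (sqrt BQ * sqrt (sqn mX h))" (is ?A)
  "\<bar>(LX x. (cumX (ug N T) x - cumX G0 x) * h x) - (LINT p|Q. wt T (fst p) * h (snd p) * uH N (fst p) (snd p))\<bar> <= sqrt (tau N) * (sqrt BQ * sqrt (sqn mX h))" (is ?B)
proof -
 note [measurable] = k_meas[of N]
 show ?A unfolding uJ_def using W_sum(1)[of N 0 "kk N T"] u_sq(5)[of N]
  by (intro flux_identity_aux T h sq_JH tau_pos J_sum) (auto simp: uf_def uJ_def)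
 show ?B unfolding uH_def using W_sum(2)[of N 0 "kk N T"] u_sq(7)[of N]
  by (intro flux_identity_aux T h sq_JH tau_pos J_sum) (auto simp: ug_def uH_def)
qed

definition "CU = Kb * (b - a)"

lemma u_cum_bound: "\<bar>cumX (uf N t) x\<bar> <= CU" "\<bar>cumX (ug N t) x\<bar> <= CU"
 unfolding CU_def by (intro cumX_bounded u_abs; simp add: uf_def ug_def k_meas)+

text \<open>Ascoli's theorem in space and time: a diagonal subsequence converges at rational points,
  and asymptotic equicontinuity extends this to every point. Convergence at every time, and not
  merely almost every time, is what makes the values at each \<open>t\<close> meaningful.\<close>

lemma subsequence_exists:
 "EX r::nat => nat. strict_mono r & (ALL t>=0. ALL x. convergent (%n. cumX (uf (r n) t) x) & convergent (%n. cumX (ug (r n) t) x))"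
proof -
 define S :: "(real * real) set" where "S = ({0..} \<inter> \<rat>) \<times> \<rat>"
 define z where "z n p = (cumX (uf n (fst p)) (snd p), cumX (ug n (fst p)) (snd p))" for n and p :: "real * real"
 obtain r :: "nat => nat" where r: "strict_mono r" "!!p. p : S ==> EX l. (%n. z (r n) p) ---> l"
 proof (rule function_convergent_subsequence[of S z "CU + CU"])
  show "countable S" unfolding S_def by (intro countable_SIGMA countable_Int2 countable_rat)
  fix n p
  show "norm (z n p) <= CU + CU"
   unfolding z_def using u_cum_bound[of n "fst p" "snd p"] by (intro order_trans[OF norm_Pair_le] add_mono) auto
 qed blast
 have cS: "convergent (%n. cumX (uf (r n) (fst p)) (snd p)) & convergent (%n. cumX (ug (r n) (fst p)) (snd p))" if p: "p : S" for p
 proof -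
  obtain l where l: "(%n. z (r n) p) ---> l" using r(2)[OF p] by blast
  from tendsto_fst[OF l] tendsto_snd[OF l] show ?thesis unfolding z_def fst_conv snd_conv convergent_def by blast
 qed
 have dens: "EX y:S. EX N. ALL n>=N. \<bar>cumX (u (r n) t) x - cumX (u (r n) (fst y)) (snd y)\<bar> <= e"
  if t: "t >= 0" and e: "e > 0"
   and time: "!!N s t x. 0 <= s ==> 0 <= t ==> (cumX (u N t) x - cumX (u N s) x)^2 <= cT * sqrt ((\<bar>t - s\<bar> + tau N) * BQ)"
   and space: "!!N t x y. \<bar>cumX (u N t) x - cumX (u N t) y\<bar> <= Kb * \<bar>x - y\<bar>" for u :: "nat => real => real => real" and t x e
 proof -
  \<comment> \<open>One length \<open>d\<close> bounds both the distance of the times and the step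
    size, hence the sum of two equal terms.\<close>
  have "(%m. cT * sqrt ((inverse (real (Suc m)) + inverse (real (Suc m))) * BQ)) ---> cT * sqrt ((0 + 0) * BQ)"
   by (intro tendsto_intros LIMSEQ_inverse_real_of_nat)
  from order_tendstoD(2)[OF this, of "(e / 2)^2"] e
  obtain m where m: "cT * sqrt ((inverse (real (Suc m)) + inverse (real (Suc m))) * BQ) < (e / 2)^2" by (auto simp: eventually_sequentially)
  define d where "d = inverse (real (Suc m))"
  have d: "d > 0" by (simp add: d_def)
  obtain s where s: "s : \<rat>" "t < s" "s < t + d" using Rats_dense_in_real[of t "t + d"] d by auto
  define d' where "d' = e / (2 * (Kb + 1))"
  have d': "d' > 0" using e Kb by (simp add: d'_def)
  obtain y where y: "y : \<rat>" "x < y" "y < x + d'" using Rats_dense_in_real[of x "x + d'"] d' by auto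
  obtain N where N: "!!n. n >= N ==> tau n < d" using order_tendstoD(2)[OF tau_tendsto d] by (auto simp: eventually_sequentially)
  have "\<bar>cumX (u (r n) t) x - cumX (u (r n) s) y\<bar> <= e" if "n >= N" for n
  proof -
   have tn: "tau (r n) < d" using seq_suble[OF r(1), of n] that by (intro N) linarith
   have "Kb * \<bar>x - y\<bar> <= (Kb + 1) * d'" using y Kb by (intro mult_mono) auto
   also have "... = e / 2" using Kb unfolding d'_def by (simp add: field_simps)
   finally have 1: "\<bar>cumX (u (r n) t) x - cumX (u (r n) t) y\<bar> <= e / 2" using space[of "r n" t x y] by linarith
   have "\<bar>cumX (u (r n) t) y - cumX (u (r n) s) y\<bar>^2 <= cT * sqrt ((\<bar>t - s\<bar> + tau (r n)) * BQ)"
    using time[of s t "r n" y] t s by simp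
   also have "... <= cT * sqrt ((d + d) * BQ)"
    using s tn by (intro mult_left_mono real_sqrt_le_mono mult_right_mono BQ_nonneg cT) auto
   also have "... <= (e / 2)^2" using m by (simp add: d_def)
   finally have 2: "\<bar>cumX (u (r n) t) y - cumX (u (r n) s) y\<bar> <= e / 2" by (rule power2_le_imp_le) (use e in simp)
   show ?thesis using 1 2 by linarith
  qed
  moreover have "(s, y) : S" using s y t by (simp add: S_def)
  ultimately show ?thesis by (intro bexI[of _ "(s, y)"]) auto
 qed
 have "convergent (%n. cumX (uf (r n) t) x) & convergent (%n. cumX (ug (r n) t) x)" if t: "t >= 0" for t x
  using convergent_by_density[of S "%n p. cumX (uf (r n) (fst p)) (snd p)" "(t, x)"] dens[OF t _ u_time(1) u_space(1)]
   convergent_by_density[of S "%n p. cumX (ug (r n) (fst p)) (snd p)" "(t, x)"] dens[OF t _ u_time(2) u_space(2)] cS by auto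
 thus ?thesis using r(1) by blast
qed

definition "rr = (SOME r::nat => nat. strict_mono r &
 (ALL t>=0. ALL x. convergent (%n. cumX (uf (r n) t) x) & convergent (%n. cumX (ug (r n) t) x)))"

lemma rr_props: "strict_mono rr" "t >= 0 ==> convergent (%n. cumX (uf (rr n) t) x)" "t >= 0 ==> convergent (%n. cumX (ug (rr n) t) x)"
 using someI_ex[OF subsequence_exists] unfolding rr_def[symmetric] by auto

definition "Uf t x = lim (%n. cumX (uf (rr n) t) x)"
definition "Ug t x = lim (%n. cumX (ug (rr n) t) x)"

lemma u_nonpos: "t <= 0 ==> uf N t = F0" "t <= 0 ==> ug N t = G0"
 by (simp_all add: uf_def ug_def kk_nonpos)

lemma U_lim: "(%n. cumX (uf (rr n) t) x) ---> Uf t x" "(%n. cumX (ug (rr n) t) x) ---> Ug t x"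
proof -
 have "convergent (%n. cumX (uf (rr n) t) x)" "convergent (%n. cumX (ug (rr n) t) x)"
  using rr_props(2,3)[of t x] u_nonpos[of t] by (cases "t >= 0"; simp add: convergent_const)+
 thus "(%n. cumX (uf (rr n) t) x) ---> Uf t x" "(%n. cumX (ug (rr n) t) x) ---> Ug t x"
  by (simp_all add: Uf_def Ug_def convergent_LIMSEQ_iff)
qed

lemma tau_rr: "(%n. tau (rr n)) ---> 0"
 using LIMSEQ_subseq_LIMSEQ[OF tau_tendsto rr_props(1)] by (simp add: o_def)

lemma U_time:
 assumes "0 <= s" "0 <= t"
 shows "(Uf t x - Uf s x)^2 <= cT * sqrt (\<bar>t - s\<bar> * BQ)" (is ?A) "(Ug t x - Ug s x)^2 <= cT * sqrt (\<bar>t - s\<bar> * BQ)" (is ?B)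
proof -
 have r: "(%n. cT * sqrt ((\<bar>t - s\<bar> + tau (rr n)) * BQ)) ---> cT * sqrt ((\<bar>t - s\<bar> + 0) * BQ)"
  by (intro tendsto_intros tau_rr)
 show ?A
  using LIMSEQ_le[OF tendsto_power[OF tendsto_diff[OF U_lim(1) U_lim(1)], of t x s x 2] r] u_time(1)[OF assms] by simp
 show ?B
  using LIMSEQ_le[OF tendsto_power[OF tendsto_diff[OF U_lim(2) U_lim(2)], of t x s x 2] r] u_time(2)[OF assms] by simp
qed

lemma U_time_continuous:
 assumes "0 <= t" shows "((%s. Uf s x) \<longlongrightarrow> Uf t x) (at t within {0..})" (is ?A) "((%s. Ug s x) \<longlongrightarrow> Ug t x) (at t within {0..})" (is ?B)
proof -
 have gen: "((%s. U s x) \<longlongrightarrow> U t x) (at t within {0..})"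
  if "!!s. 0 <= s ==> (U s x - U t x)^2 <= cT * sqrt (\<bar>s - t\<bar> * BQ)" for U :: "real => real => real"
 proof -
  have "((%s. cT * sqrt (\<bar>s - t\<bar> * BQ)) \<longlongrightarrow> cT * sqrt (\<bar>t - t\<bar> * BQ)) (at t within {0..})"
   by (intro tendsto_intros)
  hence lim: "((%s. cT * sqrt (\<bar>s - t\<bar> * BQ)) \<longlongrightarrow> 0) (at t within {0..})" by simp
  have "((%s. (U s x - U t x)^2) \<longlongrightarrow> 0) (at t within {0..})"
  proof (rule tendsto_sandwich[OF _ _ tendsto_const lim])
   show "\<forall>\<^sub>F s in at t within {0..}. 0 <= (U s x - U t x)^2" by simp
   show "\<forall>\<^sub>F s in at t within {0..}. (U s x - U t x)^2 <= cT * sqrt (\<bar>s - t\<bar> * BQ)"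
    unfolding eventually_at_filter by (rule always_eventually) (use that in simp)
  qed
  from tendsto_real_sqrt[OF this] have "((%s. \<bar>U s x - U t x\<bar>) \<longlongrightarrow> 0) (at t within {0..})" by simp
  thus ?thesis by (simp add: tendsto_rabs_zero_iff LIM_zero_iff)
 qed
 show ?A by (rule gen) (use U_time(1)[OF assms] in auto)
 show ?B by (rule gen) (use U_time(2)[OF assms] in auto)
qed

end

section \<open>Passage to the limit\<close>

context interval
begin

lemma cumX_measurable2:
 assumes [measurable]: "V : BM2"
 shows "(%p. cumX (%x. V (fst p, x)) (snd p)) : BM2"
proof -
 have "(%p. LX y. (if y <= snd p then V (fst p, y) else 0)) : BM2"
  by (rule X.borel_measurable_lebesgue_integral) measurable
 also have "(%p. LX y. (if y <= snd p then V (fst p, y) else 0)) = (%p. cumX (%x. V (fst p, x)) (snd p))"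
  unfolding cum_def by (intro ext Bochner_integral_cong) (auto simp: indicator_def)
 finally show ?thesis .
qed

lemma section_measurable:
 "(un z) : BM2 ==> z t : BM" for z :: "real => real => real"
 using measurable_compose[OF measurable_Pair1'[of t borel borel], of "%p. z (fst p) (snd p)" borel] by simp

text \<open>If \<open>\<phi>\<close> has mean zero, then \<open>\<integral>\<phi>\<^sup>2 = - \<integral>\<phi>' \<Phi>\<close> for the primitive \<open>\<Phi>\<close> of \<open>\<phi>\<close>: pointwise convergence of the primitives
 and boundedness of the derivatives thus give strong convergence.\<close>

lemma strong_limit:
 fixes u w :: "nat => real => real => real"
 assumes um: "!!n. (un (u n)) : BM2" and ub: "!!n t x. \<bar>u n t x\<bar> <= C"
  and ac: "!!n t. t > 0 ==> ac (u n t) (w n t)" and mass: "!!n t. (LX x. u n t x) = m"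
  and w: "!!n. sq_int Q (un (w n))" "!!n. sqn Q (un (w n)) <= B"
  and U: "!!t x. (%n. cumX (u n t) x) ---> U t x"
 shows "EX l. sq_int Q l & (%n. sqn Q (%p. u n (fst p) (snd p) - l p)) ---> 0"
proof -
 define c where "c n p = cumX (u n (fst p)) (snd p)" for n p
 define UU where "UU p = U (fst p) (snd p)" for p
 define D where "D = C * (b - a)"
 have B0: "B >= 0" using w(2)[of 0] sqn_nonneg[of Q "%p. w 0 (fst p) (snd p)"] by linarith
 have u1: "u n t : BM" for n t using um by (rule section_measurable)
 have cm [measurable]: "c n : BM2" for n using cumX_measurable2[OF um[of n]] unfolding c_def[abs_def] by simp
 have cb: "\<bar>c n p\<bar> <= D" for n p unfolding c_def D_def by (rule cumX_bounded[OF u1 ub])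
 have lim: "(%n. c n p) ---> UU p" for p unfolding c_def UU_def by (rule U)
 have Um [measurable]: "UU : BM2" by (rule borel_measurable_LIMSEQ_real[OF lim cm])
 have Ub: "\<bar>UU p\<bar> <= D" for p by (rule tendsto_upperbound[OF tendsto_rabs[OF lim]]) (use cb in auto)
 have sc: "sq_int Q (c n)" for n using cm cb by (rule sq_int_Q_bounded)
 have sU: "sq_int Q UU" using Um Ub by (rule sq_int_Q_bounded)
 have su: "sq_int Q (un (u n))" for n using um ub by (intro sq_int_Q_bounded)
 have conv: "(%n. sqn Q (%p. c n p - UU p)) ---> 0"
 proof -
  have "(%n. sqn Q (%p. c n p - UU p)) ---> (LINT p|Q. 0)"
  proof (rule integral_dominated_convergence[where w="%_. (2 * D)^2"])
   show "AE p in Q. (%n. (norm (c n p - UU p))^2) ---> 0"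
   proof (rule AE_I2)
    fix p show "(%n. (norm (c n p - UU p))^2) ---> 0"
     using tendsto_power[OF tendsto_norm[OF tendsto_diff[OF lim[of p] tendsto_const[of "UU p"]]], of 2] by simp
   qed
   show "AE p in Q. norm ((norm (c n p - UU p))^2) <= (2 * D)^2" for n
   proof (rule AE_I2)
    fix p have "\<bar>c n p - UU p\<bar> <= 2 * D" using cb[of n p] Ub[of p] by linarith
    from power_mono[OF this, of 2] show "norm ((norm (c n p - UU p))^2) <= (2 * D)^2" by simp
   qed
  qed auto
  thus ?thesis by simp
 qed
 have key: "sqn Q (%p. u n (fst p) (snd p) - u k (fst p) (snd p)) <= sqrt (sqn Q (%p. c n p - c k p)) * sqrt (4 * B)" for n k
 proof -
  define ph where "ph t x = u n t x - u k t x" for t x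
  define om where "om t x = w n t x - w k t x" for t x
  have som: "sq_int Q (un om)" unfolding om_def by (intro sq_int_diff w)
  have sph: "sq_int Q (un ph)" unfolding ph_def by (intro sq_int_diff su)
  have sl: "sqn mX (ph t) = - (LX x. om t x * (c n (t, x) - c k (t, x)))" if t: "t > 0" for t
  proof -
   have ac1: "ac (ph t) (om t)" unfolding ph_def[abs_def] om_def[abs_def] by (intro ac_diff ac t)
   have i: "integrable mX (u n t)" for n using u1 ub by (rule integrable_bounded)
   have "(LX x. ph t x) = 0" unfolding ph_def using mass i by simp
   moreover have "cumX (ph t) x = c n (t, x) - c k (t, x)" for x
    unfolding ph_def[abs_def] c_def by (simp add: X.cum_diff i)
   moreover have "integrable mX (ph t)" unfolding ph_def[abs_def] using i by simp
   ultimately show ?thesis using ac_ibp[OF ac1, of "ph t"] by (simp add: power2_eq_square)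
  qed
  have "sqn Q (un ph) = (LINT t|mE. sqn mX (ph t))" by (subst sqn_Q[OF sph]) simp
  also have "... = (LINT t|mE. - (LX x. om t x * (c n (t, x) - c k (t, x))))"
  proof (rule integral_cong_AE)
   note [measurable] = sph som sq_intD[OF sph, simplified] sq_intD[OF som, simplified]
   have [measurable]: "(%(t, x). ph t x) : borel_measurable (borel \<Otimes>\<^sub>M mX)" "(%(t, x). om t x) : borel_measurable (borel \<Otimes>\<^sub>M mX)"
    using sq_intD[OF sph] sq_intD[OF som] by (simp_all add: case_prod_beta' cong: measurable_cong_sets)
   show "(%t. sqn mX (ph t)) : borel_measurable mE" by simp
   show "(%t. - (LX x. om t x * (c n (t, x) - c k (t, x)))) : borel_measurable mE" by simp
   show "AE t in mE. sqn mX (ph t) = - (LX x. om t x * (c n (t, x) - c k (t, x)))"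
    using AE_mE_pos by eventually_elim (rule sl)
  qed
  also have "... = - (LINT p|Q. om (fst p) (snd p) * (c n p - c k p))"
   using integral_Q[OF sq_int_times[OF som sq_int_diff[OF sc[of n] sc[of k]]]] by simp
  also have "... <= sqrt (sqn Q (un om)) * sqrt (sqn Q (%p. c n p - c k p))"
   using CS_inner[OF som sq_int_diff[OF sc[of n] sc[of k]]] by simp
  also have "... <= sqrt (4 * B) * sqrt (sqn Q (%p. c n p - c k p))"
  proof (intro mult_right_mono real_sqrt_le_mono)
   show "sqn Q (un om) <= 4 * B"
    unfolding om_def using sqn_diff_le[OF w(1)[of n] w(1)[of k]] w(2)[of n] w(2)[of k] by linarith
  qed simp
  finally show ?thesis unfolding ph_def by (simp add: mult.commute)
 qed
 show ?thesis
 proof (rule L2_complete[of Q "%n p. u n (fst p) (snd p)"])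
  show "sq_int Q (un (u n))" for n by (rule su)
  fix e :: real assume e: "e > 0"
  define Z where "Z = 4 * B + 1"
  have Z: "Z > 0" "4 * B <= Z" using B0 by (simp_all add: Z_def)
  define d where "d = e^2 / (4 * Z)"
  have d: "d > 0" using e Z by (simp add: d_def)
  obtain N where N: "!!n. n >= N ==> sqn Q (%p. c n p - UU p) < d"
   using order_tendstoD(2)[OF conv d] by (auto simp: eventually_sequentially)
  have "sqn Q (%p. u n (fst p) (snd p) - u k (fst p) (snd p)) <= e" if "n >= N" "k >= N" for n k
  proof -
   have "sqn Q (%p. c n p - c k p) = sqn Q (%p. (c n p - UU p) - (c k p - UU p))" by simp
   also have "... <= 2 * sqn Q (%p. c n p - UU p) + 2 * sqn Q (%p. c k p - UU p)"
    by (intro sqn_diff_le sq_int_diff sc sU)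
   also have "... <= 4 * d" using N[OF that(1)] N[OF that(2)] by linarith
   finally have "sqn Q (%p. c n p - c k p) <= 4 * d" .
   hence "sqrt (sqn Q (%p. c n p - c k p)) * sqrt (4 * B) <= sqrt (4 * d) * sqrt Z"
    using Z d B0 by (intro mult_mono) auto
   also have "... = sqrt (e^2)" unfolding real_sqrt_mult[symmetric] d_def using Z by simp
   finally show ?thesis using key[of n k] e by simp
  qed
  thus "EX N. ALL m>=N. ALL n>=N. sqn Q (%p. u m (fst p) (snd p) - u n (fst p) (snd p)) <= e" by blast
 qed blast
qed

lemma AE_Q_fst: assumes "AE t in mE. P t" shows "AE p in Q. P (fst p)"
proof -
 obtain N where N: "{t : space mE. ~ P t} <= N" "emeasure mE N = 0" "N : sets mE" using assms by (rule AE_E)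
 have "emeasure (mE \<Otimes>\<^sub>M mX) (N \<times> UNIV) = 0"
  using N by (subst X.emeasure_pair_measure_Times) auto
 hence "N \<times> UNIV : null_sets Q" unfolding Q_def using N by (intro null_setsI) auto
 thus ?thesis by (rule AE_I') (use N in auto)
qed

text \<open>The averaged derivatives determine the limit up to an additive constant, and the
  conserved mass \<open>m\<close> determines the constant: this explains the formula for
  \<open>ph\<close>. Pointwise convergence of the averages and the identification of the primitive
  follow.\<close>

lemma slice_limit:
 assumes c: "conv_weights c K" and ac: "!!n. ac (u n) (w n)" and mass: "!!n. (LX x. u n x) = m"
  and ub: "!!n x. \<bar>u n x\<bar> <= C" and U: "!!x. (%n. cumX (u n) x) ---> U x"
  and V: "sq_int mX V" "(%k. sqn mX (%x. (SUM n<K k. c k n * w n x) - V x)) ---> 0"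
  and ph: "!!x. ph x = (m - (LX y. cumX V y)) / (b - a) + cumX V x"
 shows "ac ph V" "(%k. SUM n<K k. c k n * u n x) ---> ph x" (is ?A) "cumX ph x = U x" "(LX x. ph x) = m" (is ?B)
proof -
 show acph: "ac ph V" using ph by (intro acI V)
 define p where "p k x = (SUM n<K k. c k n * u n x)" for k x
 define q where "q k x = (SUM n<K k. c k n * w n x)" for k x
 have acp: "ac (p k) (q k)" for k unfolding p_def[abs_def] q_def[abs_def] by (intro ac_sum ac_cmult ac)
 have um: "u n : BM" for n using ac by (rule ac_measurable)
 have iu: "integrable mX (u n)" for n by (rule integrable_bounded[OF um ub])
 have pm: "(LX x. p k x) = m" for k
  unfolding p_def using iu conv_weightsD(4)[OF c, of k] by (simp add: Bochner_integral_sum mass flip: sum_distrib_right)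
 have sq: "sq_int mX (q k)" for k using acp by (rule acD(1))
 have ccV: "bdm (cumX V)" and ccq: "bdm (cumX (q k))" for k
  using ac_bdm[of "cumX V" V] ac_bdm[of "cumX (q k)" "q k"] acI[OF V(1), of "cumX V" 0] acI[OF sq, of "cumX (q k)" 0 k] by auto
 note icV = bdm_integrable[OF ccV] and icq = bdm_integrable[OF ccq]
 have cb: "\<bar>cumX (q k) x - cumX V x\<bar> <= sqrt ((b - a) * sqn mX (%x. q k x - V x))" for k x
 proof -
  define y where "y = max a (min b x)"
  have cl: "cumX z x = cumX z y" if z: "sq_int mX z" for z :: "real => real"
   using ac_clamp[OF acI[OF z, of "cumX z" 0], of x] by (simp add: y_def)
  have d: "sq_int mX (%x. q k x - V x)" by (intro sq_int_diff sq V)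
  have "(cumX (%x. q k x - V x) y - cumX (%x. q k x - V x) a)^2 <= \<bar>y - a\<bar> * sqn mX (%x. q k x - V x)"
   by (rule cumX_holder[OF d])
  also have "... <= (b - a) * sqn mX (%x. q k x - V x)" using ab by (intro mult_right_mono) (auto simp: y_def)
  finally have "\<bar>cumX (%x. q k x - V x) y\<bar> <= sqrt ((b - a) * sqn mX (%x. q k x - V x))"
   by (intro real_le_rsqrt) (simp add: cumX_le_a)
  thus ?thesis by (simp add: cl sq V X.cum_diff sq_int_imp_integrable)
 qed
 have "(%k. sqrt ((b - a) * sqn mX (%x. q k x - V x))) ---> sqrt ((b - a) * 0)"
  by (intro tendsto_intros V(2)[folded q_def])
 hence c0: "(%k. sqrt ((b - a) * sqn mX (%x. q k x - V x))) ---> 0" by simp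
 have cl: "(%k. cumX (q k) x) ---> cumX V x" for x
  by (rule LIM_zero_cancel, rule Lim_null_comparison[OF _ c0]) (use cb in auto)
 have z0: "(%k. LX x. cumX (q k) x - cumX V x) ---> 0"
 proof (rule Lim_null_comparison)
  show "\<forall>\<^sub>F k in sequentially. norm (LX x. cumX (q k) x - cumX V x) <= sqrt ((b - a) * sqn mX (%x. q k x - V x)) * (b - a)"
  proof (rule always_eventually, rule allI)
   fix k
   have i: "integrable mX (%x. cumX (q k) x - cumX V x)" using ccV ccq by (intro Bochner_integrable_diff bdm_integrable)
   have "norm (LX x. cumX (q k) x - cumX V x) <= (LX x. \<bar>cumX (q k) x - cumX V x\<bar>)"
    using integral_norm_bound[of mX "%x. cumX (q k) x - cumX V x"] by simp
   also have "... <= (LX x. sqrt ((b - a) * sqn mX (%x. q k x - V x)))"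
    using i by (intro integral_mono cb) auto
   finally show "norm (LX x. cumX (q k) x - cumX V x) <= sqrt ((b - a) * sqn mX (%x. q k x - V x)) * (b - a)"
    by (simp add: measure_mX mult.commute)
  qed
  show "(%k. sqrt ((b - a) * sqn mX (%x. q k x - V x)) * (b - a)) ---> 0" using tendsto_mult_right[OF c0, of "b - a"] by simp
 qed
 have ci: "(%k. LX x. cumX (q k) x) ---> (LX x. cumX V x)"
  by (rule LIM_zero_cancel) (use z0 in "simp add: icV icq")
 have pa: "p k a = (m - (LX x. cumX (q k) x)) / (b - a)" for k
 proof -
  have "(LX x. p k x) = (LX x. p k a + cumX (q k) x)" by (intro Bochner_integral_cong refl acD(2)[OF acp])
  also have "... = p k a * (b - a) + (LX x. cumX (q k) x)" by (simp add: icq measure_mX)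
  finally show ?thesis using ab by (simp add: pm field_simps)
 qed
 have pl: "(%k. p k x) ---> ph x" for x
 proof -
  have "(%k. (m - (LX x. cumX (q k) x)) / (b - a) + cumX (q k) x) ---> ph x"
   unfolding ph by (intro tendsto_intros ci cl) (use ab in auto)
  moreover have "p k x = (m - (LX x. cumX (q k) x)) / (b - a) + cumX (q k) x" for k
   using acD(2)[OF acp, of k x] pa[of k] by simp
  ultimately show ?thesis by simp
 qed
 thus ?A unfolding p_def .
 have pb: "\<bar>p k x\<bar> <= C" for k x
  using conv_weights_bound[OF c, of k "%n. u n x" 0 C] ub by (simp add: p_def)
 have bc: "bconv p ph" using ac_measurable[OF acp] ac_measurable[OF acph] pb pl by (intro bconvI)
 show ?B using bconv_integral[OF bc] by (simp add: pm LIMSEQ_const_iff)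
 have "bconv (%k y. indicator {..x} y * p k y) (%y. indicator {..x} y * ph y)"
  by (intro bconv_mult bc bdmI[where M=1]) auto
 from bconv_integral[OF this] have "(%k. cumX (p k) x) ---> cumX ph x" unfolding cum_def .
 moreover have "cumX (p k) x = (SUM n<K k. c k n * cumX (u n) x)" for k
  unfolding p_def[abs_def] using iu by (simp add: X.cum_sum X.cum_mult)
 moreover have "(%k. SUM n<K k. c k n * cumX (u n) x) ---> U x" using conv_weights_tendsto[OF c U[of x]] by simp
 ultimately show "cumX ph x = U x" by (simp add: LIMSEQ_unique)
qed

end

section \<open>Limits of derivatives and fluxes along averages\<close>

context muskat
begin

abbreviation "sconv c K z Z t == (%k. sqn mX (%x. (SUM n<K k. c k n * z (rr n) t x) - Z (t, x))) ---> 0"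

text \<open>The last conjunct is convergence in L2 of the slices at almost every time. It follows
  from the space-time convergence only after a further subsequence of the rows of weights, so all
  these properties are recorded for one common family.\<close>

definition limit_data where
 "limit_data c K V W J H \<longleftrightarrow> conv_weights c K & mconv Q c K (%n. un (uv (rr n))) V & mconv Q c K (%n. un (uw (rr n))) W
  & mconv Q c K (%n. un (uJ (rr n))) J & mconv Q c K (%n. un (uH (rr n))) H
  & (AE t in mE. sconv c K uv V t & sconv c K uw W t & sconv c K uJ J t & sconv c K uH H t)"

lemma limit_data_exists: "EX c K V W J H. limit_data c K V W J H"
proof -
 note s = u_sq
 obtain c K V W J H where c: "conv_weights c K" and m: "mconv Q c K (%n. un (uv (rr n))) V" "mconv Q c K (%n. un (uw (rr n))) W"
  "mconv Q c K (%n. un (uJ (rr n))) J" "mconv Q c K (%n. un (uH (rr n))) H"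
  by (rule convex_combinations_converge4[of Q "%n. un (uv (rr n))" "%n. un (uw (rr n))" "%n. un (uJ (rr n))" "%n. un (uH (rr n))",
   OF s(1,3,5,7) s(2,4,6,8)])
 note sq = m[THEN mconvD(1)] and l = m[THEN mconvD(3)]
 define e where "e k t = sqn mX (%x. (SUM n<K k. c k n * uv (rr n) t x) - V (t, x)) + sqn mX (%x. (SUM n<K k. c k n * uw (rr n) t x) - W (t, x))
  + sqn mX (%x. (SUM n<K k. c k n * uJ (rr n) t x) - J (t, x)) + sqn mX (%x. (SUM n<K k. c k n * uH (rr n) t x) - H (t, x))" for k t
 have int: "integrable mE (%t. sqn mX (%x. (SUM n<K k. c k n * z n t x) - Z (t, x)))" (is ?S)
  "(LINT t|mE. sqn mX (%x. (SUM n<K k. c k n * z n t x) - Z (t, x))) = sqn Q (%p. (SUM n<K k. c k n * z n (fst p) (snd p)) - Z p)" (is ?T)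
  if z: "!!n. sq_int Q (un (z n))" "sq_int Q Z" for z Z k
 proof -
  have d: "sq_int Q (%p. (SUM n<K k. c k n * z n (fst p) (snd p)) - Z p)" by (intro sq_int_diff sq_int_sum sq_int_mult z)
  show ?S using PQ.integrable_fst'[OF sq_int_integrable[OF d, unfolded Q_def]] by simp
  show ?T using sqn_Q[OF d] by simp
 qed
 note i = int(1)[OF s(1) sq(1)] int(1)[OF s(3) sq(2)] int(1)[OF s(5) sq(3)] int(1)[OF s(7) sq(4)]
 have ei: "integrable mE (e k)" for k unfolding e_def by (intro Bochner_integrable_add i)
 have e0: "e k t >= 0" for k t unfolding e_def by (intro add_nonneg_nonneg sqn_nonneg)
 have ie: "(LINT t|mE. e k t) = sqn Q (%p. (SUM n<K k. c k n * uv (rr n) (fst p) (snd p)) - V p)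
   + sqn Q (%p. (SUM n<K k. c k n * uw (rr n) (fst p) (snd p)) - W p)
   + sqn Q (%p. (SUM n<K k. c k n * uJ (rr n) (fst p) (snd p)) - J p) + sqn Q (%p. (SUM n<K k. c k n * uH (rr n) (fst p) (snd p)) - H p)" for k
  unfolding e_def int(2)[OF s(1) sq(1), symmetric] int(2)[OF s(3) sq(2), symmetric] int(2)[OF s(5) sq(3), symmetric] int(2)[OF s(7) sq(4), symmetric]
  by (simp only: Bochner_integral_add Bochner_integrable_add i)
 have "(%k. \<integral>t. e k t \<partial>mE) ---> 0 + 0 + 0 + 0" unfolding ie by (intro tendsto_add l)
 hence "(%k. \<integral>t. norm (e k t) \<partial>mE) ---> 0" using e0 by simp
 from tendsto_L1_AE_subseq[OF ei this] obtain r where r: "strict_mono r" "AE t in mE. (%k. e (r k) t) ---> 0" by blast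
 have g1: "norm A <= A + B + C + D" and g2: "norm B <= A + B + C + D" and g3: "norm C <= A + B + C + D" and g4: "norm D <= A + B + C + D"
  if "A >= 0" "B >= 0" "C >= 0" "D >= 0" for A B C D :: real using that by auto
 have "AE t in mE. sconv (%k. c (r k)) (%k. K (r k)) uv V t & sconv (%k. c (r k)) (%k. K (r k)) uw W t
   & sconv (%k. c (r k)) (%k. K (r k)) uJ J t & sconv (%k. c (r k)) (%k. K (r k)) uH H t" using r(2)
 proof eventually_elim
  case (elim t)
  have "norm (sqn mX (%x. (SUM n<K k. c k n * uv (rr n) t x) - V (t, x))) <= e k t"
   "norm (sqn mX (%x. (SUM n<K k. c k n * uw (rr n) t x) - W (t, x))) <= e k t"
   "norm (sqn mX (%x. (SUM n<K k. c k n * uJ (rr n) t x) - J (t, x))) <= e k t"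
   "norm (sqn mX (%x. (SUM n<K k. c k n * uH (rr n) t x) - H (t, x))) <= e k t" for k
   unfolding e_def by (rule g1, (rule sqn_nonneg)+) (rule g2, (rule sqn_nonneg)+, rule g3, (rule sqn_nonneg)+, rule g4, (rule sqn_nonneg)+)
  thus ?case by (intro conjI; intro Lim_null_comparison[OF always_eventually elim] allI)
 qed
 with m[THEN mconv_subseq, OF r(1)] conv_weights_subseq[OF c r(1)] show ?thesis
  unfolding limit_data_def by (intro exI[of _ "%k. c (r k)"] exI[of _ "%k. K (r k)"] exI[of _ V] exI[of _ W] exI[of _ J] exI[of _ H] conjI)
qed

end

context interval
begin

text \<open>Averages of a strongly convergent sequence keep its limit; therefore the pointwise limit
  of the averages, which is known explicitly, is the strong limit.\<close>

lemma strong_limit_unique: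
 fixes u :: "nat => real * real => real"
 assumes c: "conv_weights c K" and u: "!!n. sq_int Q (u n)" and l: "sq_int Q l" "(%n. sqn Q (%p. u n p - l p)) ---> 0"
  and ae: "AE p in Q. (%k. SUM n<K k. c k n * u n p) ---> ph p"
 shows "AE p in Q. l p = ph p"
proof -
 define e where "e k p = (SUM n<K k. c k n * u n p) - l p" for k p
 have e_eq: "e k p = (SUM n<K k. c k n *\<^sub>R (u n p - l p))" for k p
  using conv_weightsD(4)[OF c, of k] by (simp add: e_def right_diff_distrib sum_subtractf flip: sum_distrib_right)
 have se: "sq_int Q (e k)" for k unfolding e_def[abs_def] by (intro sq_int_diff sq_int_sum sq_int_mult u l)
 have "(%k. sqn Q (e k)) ---> 0"
 proof (rule LIMSEQ_I)
  fix r :: real assume r: "0 < r"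
  then obtain N where N: "!!n. n >= N ==> sqn Q (%p. u n p - l p) < r / 2"
   using order_tendstoD(2)[OF l(2), of "r / 2"] by (auto simp: eventually_sequentially)
  have "sqn Q (e k) <= r / 2" if k: "k >= N" for k
   unfolding e_eq[abs_def] by (rule sqn_combination_le[OF c sq_int_diff[OF u l(1)]]) (use N k in "force intro: less_imp_le")
  hence "sqn Q (e k) < r" if "k >= N" for k using that r by force
  thus "EX no. ALL n>=no. norm (sqn Q (e n) - 0) < r" by (intro exI[of _ N]) (simp add: abs_of_nonneg)
 qed
 hence "(%k. \<integral>p. norm ((norm (e k p))^2) \<partial>Q) ---> 0" by simp
 from tendsto_L1_AE_subseq[OF sq_int_integrable[OF se] this]
 obtain r where r: "strict_mono r" "AE p in Q. (%k. (norm (e (r k) p))^2) ---> 0" by blast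
 from r(2) ae show ?thesis
 proof eventually_elim
  case (elim p)
  have 1: "(%k. e (r k) p) ---> 0" using elim(1) by (simp add: tendsto_norm_zero_iff)
  have "(%k. e (r k) p) ---> ph p - l p"
   using LIMSEQ_subseq_LIMSEQ[OF tendsto_diff[OF elim(2) tendsto_const[of "l p"]] r(1)] by (simp add: e_def o_def)
  from LIMSEQ_unique[OF this 1] show ?case by simp
 qed
qed

end

locale muskat_limit = muskat +
 fixes c :: "nat => nat => real" and K :: "nat => nat" and V W J H :: "real * real => real"
 assumes ld: "limit_data c K V W J H"
begin

lemma cw: "conv_weights c K" and mconvs: "mconv Q c K (%n. un (uv (rr n))) V" "mconv Q c K (%n. un (uw (rr n))) W"
  "mconv Q c K (%n. un (uJ (rr n))) J" "mconv Q c K (%n. un (uH (rr n))) H"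
 and slices: "AE t in mE. sconv c K uv V t & sconv c K uw W t & sconv c K uJ J t & sconv c K uH H t"
 using ld unfolding limit_data_def by - (elim conjE, assumption)+

lemmas sV = mconvs(1)[THEN mconvD(1)] and sW = mconvs(2)[THEN mconvD(1)] and sJ = mconvs(3)[THEN mconvD(1)] and sH = mconvs(4)[THEN mconvD(1)]
lemmas V_AE = mconvs(1)[THEN mconvD(2)] and W_AE = mconvs(2)[THEN mconvD(2)] and J_AE = mconvs(3)[THEN mconvD(2)] and H_AE = mconvs(4)[THEN mconvD(2)]
lemmas V_L2 = mconvs(1)[THEN mconvD(3)] and W_L2 = mconvs(2)[THEN mconvD(3)] and J_L2 = mconvs(3)[THEN mconvD(3)] and H_L2 = mconvs(4)[THEN mconvD(3)]

text \<open>The formula of \<open>slice_limit\<close>, imposed at all times: being built from the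
  jointly measurable \<open>V\<close>, it is jointly measurable in (t, x), while it agrees with the
  limit of the averages at good times.\<close>

definition "fl t x = ((LX x. F0 x) - (LX y. cumX (%x. V (t, x)) y)) / (b - a) + cumX (%x. V (t, x)) x"
definition "gl t x = ((LX x. G0 x) - (LX y. cumX (%x. W (t, x)) y)) / (b - a) + cumX (%x. W (t, x)) x"

definition "good t \<longleftrightarrow> t > 0 & sq_int mX (%x. V (t, x)) & sq_int mX (%x. W (t, x)) &
 sconv c K uv V t &
 sconv c K uw W t"

lemma good_AE: "AE t in mE. good t"
 using slices AE_mE_pos sq_int_Q_AE[OF sV] sq_int_Q_AE[OF sW] by eventually_elim (simp add: good_def)

lemma l_measurable: "(un fl) : BM2"
  "(un gl) : BM2"
proof -
 have gen: "(%p. (m - (LX y. cumX (%x. V (fst p, x)) y)) / (b - a) + cumX (%x. V (fst p, x)) (snd p)) : BM2"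
  if s: "sq_int Q V" for V and m :: real
 proof -
  have V: "V : BM2" using sq_intD[OF s] by simp
  note 1 [measurable] = cumX_measurable2[OF V]
  have "(%q. cumX (%x. V (fst (fst q, snd q), x)) (snd (fst q, snd q))) : borel_measurable (borel \<Otimes>\<^sub>M mX)" using 1 by simp
  hence "(%t. LX y. cumX (%x. V (t, x)) y) : BM"
   by (intro X.borel_measurable_lebesgue_integral) (simp add: case_prod_beta')
  from measurable_compose[OF measurable_fst this] have [measurable]: "(%p. LX y. cumX (%x. V (fst p, x)) y) : BM2" .
  show ?thesis by measurable
 qed
 show "(un fl) : BM2"
  "(un gl) : BM2" unfolding fl_def gl_def by (intro gen sV sW)+
qed

lemma good_limits:
 assumes "good t"
 shows "ac (fl t) (%x. V (t, x))" (is ?A) "(%k. SUM n<K k. c k n * uf (rr n) t x) ---> fl t x" (is ?B) "cumX (fl t) x = Uf t x" (is ?C)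
  "ac (gl t) (%x. W (t, x))" (is ?D) "(%k. SUM n<K k. c k n * ug (rr n) t x) ---> gl t x" (is ?E) "cumX (gl t) x = Ug t x" (is ?F)
proof -
 have t: "t > 0" and s: "sq_int mX (%x. V (t, x))" "sq_int mX (%x. W (t, x))"
  and l: "sconv c K uv V t"
  "sconv c K uw W t"
  using assms by (auto simp: good_def)
 show ?A ?B ?C by (rule slice_limit[OF cw u_ac(1)[OF t] u_mass(1) u_abs(1) U_lim(1) s(1) l(1) fl_def])+
 show ?D ?E ?F by (rule slice_limit[OF cw u_ac(2)[OF t] u_mass(2) u_abs(2) U_lim(2) s(2) l(2) gl_def])+
qed

text \<open>The only strong convergence available is that of the unknowns themselves, from
  \<open>strong_limit\<close>; its limit is recognised as \<open>fl\<close> or \<open>gl\<close>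
  through the averages. With the averaged derivatives, \<open>product_limit_AE\<close> then
  identifies the averaged fluxes.\<close>

lemma flux_limit: "AE t in mE. AE x in mX. J (t, x) = fl t x * ((1 + R) * V (t, x) + R * W (t, x))"
  "AE t in mE. AE x in mX. H (t, x) = mu * R * (gl t x * (V (t, x) + W (t, x)))"
proof -
 have l1: "AE p in Q. (%k. SUM n<K k. c k n * uf (rr n) (fst p) (snd p)) ---> fl (fst p) (snd p)"
  using AE_Q_fst[OF good_AE] by eventually_elim (rule good_limits)
 have l2: "AE p in Q. (%k. SUM n<K k. c k n * ug (rr n) (fst p) (snd p)) ---> gl (fst p) (snd p)"
  using AE_Q_fst[OF good_AE] by eventually_elim (rule good_limits)
 have su: "sq_int Q (un (uf n))" "sq_int Q (un (ug n))" for n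
  by (rule sq_int_Q_bounded[OF u_meas(1) u_abs(1)], rule sq_int_Q_bounded[OF u_meas(2) u_abs(2)])
 obtain lf where lf: "sq_int Q lf" "(%n. sqn Q (%p. uf (rr n) (fst p) (snd p) - lf p)) ---> 0"
  using strong_limit[of "%n. uf (rr n)", OF u_meas(1) u_abs(1) u_ac(1) u_mass(1) u_sq(1,2) U_lim(1)] by blast
 obtain lg where lg: "sq_int Q lg" "(%n. sqn Q (%p. ug (rr n) (fst p) (snd p) - lg p)) ---> 0"
  using strong_limit[of "%n. ug (rr n)", OF u_meas(2) u_abs(2) u_ac(2) u_mass(2) u_sq(3,4) U_lim(2)] by blast
 have ef: "AE p in Q. lf p = fl (fst p) (snd p)" by (rule strong_limit_unique[OF cw su(1) lf l1])
 have eg: "AE p in Q. lg p = gl (fst p) (snd p)" by (rule strong_limit_unique[OF cw su(2) lg l2])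
 have sump: "AE p in Q. (%k. SUM n<K k. c k n * (\<alpha> * uv (rr n) (fst p) (snd p) + be * uw (rr n) (fst p) (snd p))) ---> \<alpha> * V p + be * W p" for \<alpha> be
  using V_AE W_AE
 proof eventually_elim
  case (elim p)
  have "(SUM n<K k. c k n * (\<alpha> * uv (rr n) (fst p) (snd p) + be * uw (rr n) (fst p) (snd p)))
   = \<alpha> * (SUM n<K k. c k n * uv (rr n) (fst p) (snd p)) + be * (SUM n<K k. c k n * uw (rr n) (fst p) (snd p))" for k
   by (simp add: sum_distrib_left distrib_left sum.distrib mult_ac)
  thus ?case using elim by (simp add: tendsto_intros)
 qed
 note sp = sq_int_comb[OF u_sq(1-4)]
 have "AE p in Q. J p = lf p * ((1 + R) * V p + R * W p)"
  by (rule product_limit_AE[OF cw sp sq_int_diff[OF su(1) lf(1)] lf(2) sump]) (use J_AE in "simp add: uJ_eq")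
 with ef have "AE p in Q. J p = fl (fst p) (snd p) * ((1 + R) * V p + R * W p)" by eventually_elim simp
 from AE_Q[OF this] show "AE t in mE. AE x in mX. J (t, x) = fl t x * ((1 + R) * V (t, x) + R * W (t, x))" by simp
 have uHe: "uH n t x = ug n t x * (mu * R * uv n t x + mu * R * uw n t x)" for n t x by (simp add: uH_eq algebra_simps)
 have "AE p in Q. H p = lg p * (mu * R * V p + mu * R * W p)"
  by (rule product_limit_AE[OF cw sp sq_int_diff[OF su(2) lg(1)] lg(2) sump]) (use H_AE in "simp add: uHe")
 with eg have "AE p in Q. H p = mu * R * (gl (fst p) (snd p) * (V p + W p))" by eventually_elim (simp add: algebra_simps)
 from AE_Q[OF this] show "AE t in mE. AE x in mX. H (t, x) = mu * R * (gl t x * (V (t, x) + W (t, x)))" by simp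
qed

end

section \<open>Values at every time and lower semicontinuity\<close>

context muskat
begin

text \<open>A primitive determines its integrand up to a null set, so this describes the
  representatives of the weak limits at time \<open>t\<close>, with the bounds required at every
  point. It makes sense at times where no derivative is available.\<close>

definition "admissible t ph sh \<longleftrightarrow> ph : BM & sh : BM &
  (ALL x. 0 <= ph x & 0 <= sh x & ph x + sh x <= Kb) & cumX ph = Uf t & cumX sh = Ug t"

lemma admissibleD:
 assumes "admissible t ph sh"
 shows "ph : BM" (is ?A) "sh : BM" (is ?B) "0 <= ph x" "0 <= sh x" "ph x + sh x <= Kb"
  "cumX ph = Uf t" "cumX sh = Ug t" "bdm ph" "bdm sh" "\<bar>ph x\<bar> <= Kb" "\<bar>sh x\<bar> <= Kb"
proof -
 show p: ?A ?B "0 <= ph x" "0 <= sh x" "ph x + sh x <= Kb"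
  "cumX ph = Uf t" "cumX sh = Ug t" for x using assms by (auto simp: admissible_def)
 have b: "\<bar>ph x\<bar> <= Kb" "\<bar>sh x\<bar> <= Kb" for x using p(3-5)[of x] by auto
 thus "\<bar>ph x\<bar> <= Kb" "\<bar>sh x\<bar> <= Kb" .
 show "bdm ph" "bdm sh" by (rule bdmI[OF p(1) b(1)], rule bdmI[OF p(2) b(2)])
qed

lemma U_b: "Uf t b = (LX x. F0 x)" "Ug t b = (LX x. G0 x)"
proof -
 have "cumX (uf N t) b = (LX x. F0 x)" "cumX (ug N t) b = (LX x. G0 x)" for N
  using u_mass[of N t] cumX_ge_b[OF order_refl, of "uf N t"] cumX_ge_b[OF order_refl, of "ug N t"] k_meas
  by (simp_all add: uf_def ug_def)
 thus "Uf t b = (LX x. F0 x)" "Ug t b = (LX x. G0 x)" by (simp_all add: Uf_def Ug_def)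
qed

lemma admissible_mass:
 assumes "admissible t ph sh"
 shows "(LX x. ph x) = (LX x. F0 x)" "(LX x. sh x) = (LX x. G0 x)"
 using cumX_ge_b[OF order_refl admissibleD(1)[OF assms]] cumX_ge_b[OF order_refl admissibleD(2)[OF assms]]
  admissibleD(6,7)[OF assms] U_b[of t] by simp_all

lemma u_meas1: "uf N t : BM" "ug N t : BM"
 by (simp_all add: uf_def ug_def k_meas)

text \<open>At a fixed time only the uniform bounds are at hand; averages of the values converge
  almost everywhere, and convergence of the primitives identifies the limits. Each sequence enters
  twice to fit the statement for four sequences.\<close>

lemma admissible_exists: "EX ph sh. admissible t ph sh"
proof -
 have sq: "sq_int mX (uf n t)" "sq_int mX (ug n t)" for n
  by (rule sq_int_bounded[OF u_meas1(1) u_abs(1)], rule sq_int_bounded[OF u_meas1(2) u_abs(2)])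
 have B: "sqn mX (uf n t) <= Kb^2 * (b - a)" "sqn mX (ug n t) <= Kb^2 * (b - a)" for n
  by (rule sqn_bounded[OF u_meas1(1) u_abs(1)], rule sqn_bounded[OF u_meas1(2) u_abs(2)])
 obtain c K l1 l2 l3 l4 where c: "conv_weights c K" and m: "mconv mX c K (%n. uf (rr n) t) l1" "mconv mX c K (%n. ug (rr n) t) l2"
   "mconv mX c K (%n. uf (rr n) t) l3" "mconv mX c K (%n. ug (rr n) t) l4"
  by (rule convex_combinations_converge4[of mX "%n. uf (rr n) t" "%n. ug (rr n) t" "%n. uf (rr n) t" "%n. ug (rr n) t", OF sq sq B B])
 note l = m[THEN mconvD(1)] and ae = m[THEN mconvD(2)] and L = m[THEN mconvD(3)]
 \<comment> \<open>Truncation changes the limits on a null set only and makes the bounds hold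
   everywhere; the second function is cut at the height the first one leaves below
   \<open>Kb\<close>.\<close>
 define ph where "ph x = max 0 (min (l1 x) Kb)" for x
 define sh where "sh x = max 0 (min (l2 x) (Kb - ph x))" for x
 note lm [measurable] = sq_meas[OF l(1)] sq_meas[OF l(2)]
 have bm: "ph : BM" "sh : BM" unfolding sh_def[abs_def] ph_def[abs_def] by measurable
 have "AE x in mX. ph x = l1 x & sh x = l2 x" using ae(1,2)
 proof eventually_elim
  case (elim x)
  have p: "(SUM n<K k. c k n * uf (rr n) t x) >= 0" "(SUM n<K k. c k n * ug (rr n) t x) >= 0"
   "(SUM n<K k. c k n * uf (rr n) t x) + (SUM n<K k. c k n * ug (rr n) t x) <= Kb" for k
   using conv_weights_ge[OF c, of k 0 "%n. uf (rr n) t x"] conv_weights_ge[OF c, of k 0 "%n. ug (rr n) t x"]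
    conv_weights_le[OF c, of k "%n. uf (rr n) t x + ug (rr n) t x" Kb] u_bounds by (auto simp: distrib_left sum.distrib)
  have "l1 x >= 0" "l2 x >= 0" by (rule LIMSEQ_le_const[OF elim(1)], use p in blast) (rule LIMSEQ_le_const[OF elim(2)], use p in blast)
  moreover have "l1 x + l2 x <= Kb" by (rule LIMSEQ_le_const2[OF tendsto_add[OF elim]]) (use p in blast)
  ultimately show ?case by (simp add: ph_def sh_def)
 qed
 hence "cumX ph = cumX l1" "cumX sh = cumX l2" using bm lm by (auto intro!: cumX_cong elim: eventually_mono)
 moreover have "cumX z = U"
  if z: "!!n. sq_int mX (u n)" "!!x. (%n. cumX (u n) x) ---> U x" "sq_int mX z" "(%k. sqn mX (%x. (SUM n<K k. c k n * u n x) - z x)) ---> 0" for z u U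
 proof
  fix x
  have "(%k. cumX (%x. SUM n<K k. c k n * u n x) x) ---> cumX z x"
   by (rule cumX_tendsto) (intro sq_int_sum sq_int_mult z)+
  moreover have "cumX (%x. SUM n<K k. c k n * u n x) x = (SUM n<K k. c k n * cumX (u n) x)" for k
   using z(1) by (simp add: X.cum_sum X.cum_mult sq_int_imp_integrable)
  ultimately show "cumX z x = U x" using conv_weights_tendsto[OF c z(2)[of x]] by (simp add: LIMSEQ_unique)
 qed
 note this[OF sq(1) U_lim(1) l(1) L(1)] this[OF sq(2) U_lim(2) l(2) L(2)]
 moreover have "0 <= ph x & 0 <= sh x & ph x + sh x <= Kb" for x using Kb(1) by (auto simp: ph_def sh_def)
 ultimately show ?thesis unfolding admissible_def using bm by (intro exI[of _ ph] exI[of _ sh]) auto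
qed

lemma weak_limit:
 assumes "admissible t ph sh" "integrable mX h"
 shows "(%n. LX x. h x * uf (rr n) t x) ---> (LX x. h x * ph x)" (is ?A)
  "(%n. LX x. h x * ug (rr n) t x) ---> (LX x. h x * sh x)" (is ?B)
proof -
 note a = admissibleD[OF assms(1)]
 show ?A
  by (rule weak_conv_of_cum[OF finite_mX sets_mX u_meas1(1) u_abs(1) a(1) a(10) _ assms(2)]) (use U_lim(1) a(6) in simp)
 show ?B
  by (rule weak_conv_of_cum[OF finite_mX sets_mX u_meas1(2) u_abs(2) a(2) a(11) _ assms(2)]) (use U_lim(2) a(7) in simp)
qed

lemma u_bdm: "bdm (uf N t)" "bdm (ug N t)"
 unfolding uf_def ug_def by (intro k_bdm tau_pos)+

text \<open>Lower semicontinuity by convexity: the tangent of \<open>Phi\<close> at the limit has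
  bounded coefficients, so its linear part passes to the weak limit and vanishes there.\<close>

lemma admissible_Phi:
 assumes adm: "admissible t ph sh" and n: "n >= 2"
 shows "(LX x. Phi R mu n (ph x, sh x)) <= (LX x. Phi R mu n (F0 x, G0 x))"
proof -
 obtain m where m: "n = Suc (Suc m)" using n by (metis Suc_le_D numeral_2_eq_2 Suc_le_mono)
 note a = admissibleD[OF adm]
 define p q where "p x = Phi1d R mu m n (ph x) (sh x)" and "q x = Phi2d R mu m n (ph x) (sh x)" for x
 have pq: "bdm p" "bdm q"
  unfolding p_def[abs_def] q_def[abs_def] Phi1d_def[OF R mu m] Phi2d_def[OF R mu m] by (intro bconv_binform a)+
 have i: "integrable mX (%x. p x * uf N t x)" "integrable mX (%x. q x * ug N t x)" "integrable mX (%x. p x * ph x)" "integrable mX (%x. q x * sh x)"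
  "integrable mX (%x. Phi R mu n (ph x, sh x))" "integrable mX (%x. Phi R mu n (uf N t x, ug N t x))" for N
  by (intro bdm_integrable bconv_mult bconv_Phi pq a u_bdm)+
 define I where "I N = (LX x. Phi R mu n (ph x, sh x)) + ((LX x. p x * uf N t x) - (LX x. p x * ph x)) + ((LX x. q x * ug N t x) - (LX x. q x * sh x))" for N
 have "I N <= (LX x. Phi R mu n (F0 x, G0 x))" for N
 proof -
  have "I N = (LX x. Phi R mu n (ph x, sh x) + (p x * uf N t x - p x * ph x) + (q x * ug N t x - q x * sh x))"
   unfolding I_def by (simp add: i)
  also have "... <= (LX x. Phi R mu n (uf N t x, ug N t x))"
  proof (rule integral_mono)
   show "integrable mX (%x. Phi R mu n (ph x, sh x) + (p x * uf N t x - p x * ph x) + (q x * ug N t x - q x * sh x))"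
    by (intro Bochner_integrable_add Bochner_integrable_diff i)
   fix x show "Phi R mu n (ph x, sh x) + (p x * uf N t x - p x * ph x) + (q x * ug N t x - q x * sh x) <= Phi R mu n (uf N t x, ug N t x)"
    using Phi_tangent[OF R mu m a(3)[of x] a(4)[of x] u_bounds(1)[of N t x] u_bounds(2)[of N t x]]
    unfolding p_def q_def by (simp add: right_diff_distrib)
  qed (rule i)
  also have "... <= (LX x. Phi R mu n (F0 x, G0 x))" by (rule u_Phi[OF n])
  finally show ?thesis .
 qed
 moreover have "(%k. I (rr k)) ---> (LX x. Phi R mu n (ph x, sh x)) + ((LX x. p x * ph x) - (LX x. p x * ph x)) + ((LX x. q x * sh x) - (LX x. q x * sh x))"
  unfolding I_def by (intro tendsto_intros weak_limit[OF adm] bdm_integrable pq)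
 ultimately show ?thesis by (intro LIMSEQ_le_const2) auto
qed

text \<open>The tangent functional of \<open>\<integral>\<Phi>\<^sub>1\<close> at the strictly positive pair \<open>(ph + e, sh + e)\<close>.\<close>

definition "tan1 ph e s = (LX x. L_fun (ph x + e) + ln (ph x + e) * (s x - (ph x + e)))"

lemma ln_bdm:
 assumes "ph : BM" "!!x. 0 <= ph x" "!!x. ph x <= Kb" "e > 0"
 shows "bdm (%x. ln (ph x + e))"
proof (rule bdmI)
 show "(%x. ln (ph x + e)) : BM" using assms(1) by measurable
 fix x
 have "ln e <= ln (ph x + e)" "ln (ph x + e) <= ln (Kb + e)" using assms(2,3)[of x] assms(4) Kb(1) by simp_all
 thus "\<bar>ln (ph x + e)\<bar> <= \<bar>ln e\<bar> + \<bar>ln (Kb + e)\<bar>" by linarith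
qed

lemma tan1_le:
 assumes ph: "bdm ph" "!!x. 0 <= ph x" "!!x. ph x <= Kb" and e: "e > 0" and s: "bdm s" "!!x. 0 <= s x"
 shows "tan1 ph e s <= (LX x. L_fun (s x))" unfolding tan1_def
proof (rule integral_mono)
 have m: "ph : BM" using ph(1) by (auto simp: bconv_def)
 have b: "bdm (%x. ph x + e)" by (intro bconv_add ph bconv_const)
 show "integrable mX (%x. L_fun (ph x + e) + ln (ph x + e) * (s x - (ph x + e)))"
  using e ph(2) by (intro bdm_integrable bconv_add bconv_mult bconv_diff bdm_L_fun b ln_bdm s m ph bconv_const) (auto intro: add_nonneg_nonneg less_imp_le)
 show "integrable mX (%x. L_fun (s x))" by (intro bdm_integrable bdm_L_fun s)
 fix x show "L_fun (ph x + e) + ln (ph x + e) * (s x - (ph x + e)) <= L_fun (s x)"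
  using ph(2)[of x] e s(2)[of x] by (intro L_fun_tangent) auto
qed

lemma tan1_expand:
 assumes ph: "bdm ph" "!!x. 0 <= ph x" "!!x. ph x <= Kb" and e: "e > 0" and s: "bdm s"
 shows "tan1 ph e s = (LX x. L_fun (ph x + e)) + (LX x. ln (ph x + e) * s x) - (LX x. ln (ph x + e) * (ph x + e))"
proof -
 have m: "ph : BM" using ph(1) by (auto simp: bconv_def)
 have b: "bdm (%x. ph x + e)" by (intro bconv_add ph bconv_const)
 have i: "integrable mX (%x. L_fun (ph x + e))" "integrable mX (%x. ln (ph x + e) * s x)" "integrable mX (%x. ln (ph x + e) * (ph x + e))"
  using e ph(2) by (intro bdm_integrable bconv_mult bdm_L_fun b ln_bdm s m ph; auto intro: add_nonneg_nonneg less_imp_le)+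
 have "L_fun (ph x + e) + ln (ph x + e) * (s x - (ph x + e)) = L_fun (ph x + e) + ln (ph x + e) * s x - ln (ph x + e) * (ph x + e)" for x
  by (simp add: algebra_simps)
 thus ?thesis unfolding tan1_def using i by simp
qed

text \<open>At \<open>s = ph\<close> the linear term is - e ln(ph + e). The logarithm is bounded
  above by Kb + e, although not uniformly from below, and hence the shift costs only an error of
  order \<open>e\<close>.\<close>

lemma tan1_lower:
 assumes ph: "bdm ph" "!!x. 0 <= ph x" "!!x. ph x <= Kb" and e: "e > 0"
 shows "(LX x. L_fun (ph x + e)) - e * ((Kb + e) * (b - a)) <= tan1 ph e ph"
proof -
 have m: "ph : BM" using ph(1) by (auto simp: bconv_def)
 have b: "bdm (%x. ph x + e)" by (intro bconv_add ph bconv_const)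
 have i: "integrable mX (%x. L_fun (ph x + e))" using e ph(2) by (intro bdm_integrable bdm_L_fun b) (auto intro: add_nonneg_nonneg less_imp_le)
 have "(LX x. L_fun (ph x + e)) - e * ((Kb + e) * (b - a)) = (LX x. L_fun (ph x + e) - e * (Kb + e))"
  using i by (simp add: measure_mX mult_ac)
 also have "... <= tan1 ph e ph" unfolding tan1_def
 proof (rule integral_mono)
  show "integrable mX (%x. L_fun (ph x + e) - e * (Kb + e))" using i by simp
  show "integrable mX (%x. L_fun (ph x + e) + ln (ph x + e) * (ph x - (ph x + e)))"
   by (intro Bochner_integrable_add i bdm_integrable bconv_mult bconv_diff b ln_bdm m ph e)
  fix x
  have "ln (ph x + e) <= ph x + e - 1" using ph(2)[of x] e by (intro ln_le_minus_one) simp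
  hence "ln (ph x + e) <= Kb + e" using ph(3)[of x] by simp
  hence "e * ln (ph x + e) <= e * (Kb + e)" using e by simp
  thus "L_fun (ph x + e) - e * (Kb + e) <= L_fun (ph x + e) + ln (ph x + e) * (ph x - (ph x + e))" by (simp add: mult.commute)
 qed
 finally show ?thesis .
qed

end

context muskat_limit
begin

lemma comb_inner:
 assumes z: "!!n. sq_int Q (z n)" "sq_int Q Z" "(%k. sqn Q (%p. (SUM n<K k. c k n * z n p) - Z p)) ---> 0"
  and h: "sq_int Q (h :: real * real => real)"
 shows "(%k. SUM n<K k. c k n * (LINT p|Q. z n p * h p)) ---> (LINT p|Q. Z p * h p)"
proof -
 have "(%k. \<integral>p. (SUM n<K k. c k n * z n p) \<bullet> h p \<partial>Q) ---> (LINT p|Q. Z p \<bullet> h p)"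
  by (rule inner_tendsto[OF sq_int_sum[OF sq_int_mult[OF z(1)]] z(2) h z(3)])
 moreover have "(LINT p|Q. (SUM n<K k. c k n * z n p) * h p) = (SUM n<K k. c k n * (LINT p|Q. z n p * h p))" for k
 proof -
  have "(LINT p|Q. (SUM n<K k. c k n * z n p) * h p) = (LINT p|Q. (SUM n<K k. c k n * (z n p * h p)))"
   by (simp add: sum_distrib_right mult.assoc)
  also have "... = (SUM n<K k. c k n * (LINT p|Q. z n p * h p))"
   by (subst Bochner_integral_sum) (auto intro: sq_int_times z h)
  finally show ?thesis .
 qed
 ultimately show ?thesis by simp
qed

definition "Dl t = (LINT p|Q. wt t (fst p) * ((V p)^2 + R * (V p + W p)^2))"

text \<open>Entropy and dissipation are both bounded below by tangents at their limits. The entropy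
  converges weakly at the fixed time, the derivatives only after averaging over space-time;
  averaging the sum of the two tangents treats both together. The shift \<open>e\<close> keeps ln
  bounded and is removed at the end.\<close>

lemma admissible_energy:
 assumes adm: "admissible t ph sh" and t: "t >= 0"
 shows "ent mu ph sh + Dl t <= C0"
proof -
 note ad = admissibleD[OF adm]
 have le: "ph x <= Kb" "sh x <= Kb" for x using ad(3,4,5)[of x] by linarith+
 \<comment> \<open>\<open>hV\<close> and \<open>hW\<close> are half the gradient of the quadratic
   dissipation at (V, W). Hence \<open>Dl\<close> is the pairing of the limit with them, and 2 B -
   Dl is the tangent lying below \<open>uD\<close>.\<close>
 define hW where "hW p = wt t (fst p) * (R * (V p + W p))" for p
 define hV where "hV p = wt t (fst p) * (V p + R * (V p + W p))" for p
 have wtm: "(%p. wt t (fst p)) : BM2" by measurable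
 have wtb: "\<bar>wt t (fst p)\<bar> <= exp t" for p :: "real * real" using wt_nonneg wt_le by (simp add: abs_of_nonneg)
 have sh: "sq_int Q hV" "sq_int Q hW"
  unfolding hV_def hW_def by (intro sq_int_Q_bounded_mult(1)[OF _ wtm wtb] sq_int_add sq_int_mult sV sW)+
 define B where "B n = (LINT p|Q. uv (rr n) (fst p) (snd p) * hV p) + (LINT p|Q. uw (rr n) (fst p) (snd p) * hW p)" for n
 have DV: "Dl t = (LINT p|Q. V p * hV p) + (LINT p|Q. W p * hW p)"
 proof -
  have "Dl t = (LINT p|Q. V p * hV p + W p * hW p)"
   unfolding Dl_def hV_def hW_def by (intro Bochner_integral_cong refl) (simp add: power2_eq_square algebra_simps)
  also have "... = (LINT p|Q. V p * hV p) + (LINT p|Q. W p * hW p)"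
   by (intro Bochner_integral_add sq_int_times sV sW sh)
  finally show ?thesis .
 qed
 have Dint: "integrable Q (%p. V p * hV p + W p * hW p)" by (intro Bochner_integrable_add sq_int_times sV sW sh)
 have Bint: "integrable Q (%p. uv (rr n) (fst p) (snd p) * hV p + uw (rr n) (fst p) (snd p) * hW p)" for n
  by (intro Bochner_integrable_add sq_int_times u_sq sh)
 have uDB: "2 * B n - Dl t <= uD (rr n) t" for n
 proof -
  have "2 * B n - Dl t = (LINT p|Q. 2 * (uv (rr n) (fst p) (snd p) * hV p + uw (rr n) (fst p) (snd p) * hW p) - (V p * hV p + W p * hW p))"
   unfolding B_def DV using Dint Bint[of n] u_sq(1,3)[of "rr n"] by (simp add: sq_int_times sV sW sh)
  also have "... <= uD (rr n) t" unfolding uD_def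
  proof (rule integral_mono[OF _ u_diss_integrable])
   show "integrable Q (%p. 2 * (uv (rr n) (fst p) (snd p) * hV p + uw (rr n) (fst p) (snd p) * hW p) - (V p * hV p + W p * hW p))"
    by (intro Bochner_integrable_diff integrable_mult_right Dint Bint)
   fix p
   have alg: "2 * (v * (om * (x + R * (x + y))) + w * (om * (R * (x + y)))) - (x * (om * (x + R * (x + y))) + y * (om * (R * (x + y))))
    = om * (v^2 + R * (v + w)^2) - om * ((v - x)^2 + R * ((v + w) - (x + y))^2)" for v w x y om :: real
    by (simp add: power2_eq_square algebra_simps)
   have "0 <= wt t (fst p) * ((uv (rr n) (fst p) (snd p) - V p)^2 + R * ((uv (rr n) (fst p) (snd p) + uw (rr n) (fst p) (snd p)) - (V p + W p))^2)"
    using wt_nonneg R by (intro mult_nonneg_nonneg add_nonneg_nonneg) auto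
   thus "2 * (uv (rr n) (fst p) (snd p) * hV p + uw (rr n) (fst p) (snd p) * hW p) - (V p * hV p + W p * hW p)
     <= wt t (fst p) * ((uv (rr n) (fst p) (snd p))^2 + R * (uv (rr n) (fst p) (snd p) + uw (rr n) (fst p) (snd p))^2)"
    unfolding hV_def hW_def alg by simp
  qed
  finally show ?thesis .
 qed
 have Blim: "(%k. SUM n<K k. c k n * B n) ---> Dl t"
  unfolding DV B_def distrib_left sum.distrib by (intro tendsto_add comb_inner u_sq sV sW V_L2 W_L2 sh)
 have step: "tan1 ph e ph + 1 / mu * tan1 sh e sh + Dl t <= C0" if e: "e > 0" for e
 proof -
  define T where "T n = tan1 ph e (uf (rr n) t) + 1 / mu * tan1 sh e (ug (rr n) t)" for n
  have "T n + (2 * B n - Dl t) <= C0" for n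
  proof -
   have bL: "bdm (%x. L_fun (uf (rr n) t x))" "bdm (%x. L_fun (ug (rr n) t x))" by (intro bdm_L_fun u_bdm u_bounds)+
   have "1 / mu * tan1 sh e (ug (rr n) t) <= 1 / mu * (LX x. L_fun (ug (rr n) t x))"
    using mu by (intro mult_left_mono tan1_le ad le e u_bdm u_bounds) auto
   hence "T n <= (LX x. L_fun (uf (rr n) t x)) + 1 / mu * (LX x. L_fun (ug (rr n) t x))"
    unfolding T_def by (intro add_mono tan1_le ad le e u_bdm u_bounds)
   also have "... = ent mu (%x. uf (rr n) t x) (%x. ug (rr n) t x)"
    unfolding Phi1_def using bdm_integrable[OF bL(1)] bdm_integrable[OF bL(2)] by simp
   finally show ?thesis using u_energy[OF t, of "rr n"] uDB[of n] by linarith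
  qed
  hence le0: "(SUM n<K k. c k n * (T n + (2 * B n - Dl t))) <= C0" for k by (intro conv_weights_le[OF cw])
  have mm: "ph : BM" "sh : BM" by (rule ad)+
  have "T ---> tan1 ph e ph + 1 / mu * tan1 sh e sh"
   unfolding T_def tan1_expand[OF ad(8) ad(3) le(1) e u_bdm(1)] tan1_expand[OF ad(9) ad(4) le(2) e u_bdm(2)]
    tan1_expand[OF ad(8) ad(3) le(1) e ad(8)] tan1_expand[OF ad(9) ad(4) le(2) e ad(9)]
   by (intro tendsto_intros weak_limit[OF adm] bdm_integrable ln_bdm mm ad le e)
  from conv_weights_tendsto[OF cw this]
  have "(%k. (SUM n<K k. c k n * T n) + (2 * (SUM n<K k. c k n * B n) - Dl t)) ---> (tan1 ph e ph + 1 / mu * tan1 sh e sh) + (2 * Dl t - Dl t)"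
   by (intro tendsto_intros Blim) simp
  moreover have "(SUM n<K k. c k n * (T n + (2 * B n - Dl t))) = (SUM n<K k. c k n * T n) + (2 * (SUM n<K k. c k n * B n) - Dl t)" for k
  proof -
   have "(SUM n<K k. c k n * (T n + (2 * B n - Dl t))) = (SUM n<K k. c k n * T n) + (2 * (SUM n<K k. c k n * B n) - (SUM n<K k. c k n) * Dl t)"
    by (simp add: distrib_left right_diff_distrib sum.distrib sum_subtractf sum_distrib_left sum_distrib_right mult_ac)
   thus ?thesis using conv_weightsD(4)[OF cw, of k] by simp
  qed
  ultimately have "(tan1 ph e ph + 1 / mu * tan1 sh e sh) + (2 * Dl t - Dl t) <= C0"
   using le0 by (intro LIMSEQ_le_const2) auto
  thus ?thesis by simp
 qed
 define e where "e k = 1 / real (Suc k)" for k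
 have e: "e k > 0" for k by (simp add: e_def)
 have e0: "e ---> 0" unfolding e_def by (rule LIMSEQ_Suc[OF lim_1_over_n])
 define E where "E th k = (LX x. L_fun (th x + e k)) - e k * ((Kb + e k) * (b - a))" for th k
 have Elim: "E th ---> (LX x. L_fun (th x))" if th: "bdm th" "!!x. 0 <= th x" for th
 proof -
  have "bconv (%k x. th x + e k) (%x. th x + 0)" by (intro bconv_add bconv_seq e0 th)
  from bconv_L_fun[OF this] have "bconv (%k x. L_fun (th x + e k)) (%x. L_fun (th x))" using th(2) e by (simp add: add_nonneg_nonneg less_imp_le)
  from bconv_integral[OF this] have 1: "(%k. LX x. L_fun (th x + e k)) ---> (LX x. L_fun (th x))" .
  have "E th ---> (LX x. L_fun (th x)) - 0 * ((Kb + 0) * (b - a))" unfolding E_def by (intro tendsto_intros 1 e0)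
  thus ?thesis by simp
 qed
 have lo: "E ph k + 1 / mu * E sh k + Dl t <= C0" for k
 proof -
  have "1 / mu * E sh k <= 1 / mu * tan1 sh (e k) sh" unfolding E_def using mu by (intro mult_left_mono tan1_lower ad le e) auto
  moreover have "E ph k <= tan1 ph (e k) ph" unfolding E_def by (intro tan1_lower ad le e)
  ultimately show ?thesis using step[OF e[of k]] by linarith
 qed
 have "(%k. E ph k + 1 / mu * E sh k + Dl t) ---> (LX x. L_fun (ph x)) + 1 / mu * (LX x. L_fun (sh x)) + Dl t"
  by (intro tendsto_intros Elim ad)
 hence "(LX x. L_fun (ph x)) + 1 / mu * (LX x. L_fun (sh x)) + Dl t <= C0"
  using lo by (intro LIMSEQ_le_const2) auto
 moreover have "ent mu ph sh = (LX x. L_fun (ph x)) + 1 / mu * (LX x. L_fun (sh x))"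
  unfolding Phi1_def using bdm_integrable[OF bdm_L_fun[OF ad(8) ad(3)]] bdm_integrable[OF bdm_L_fun[OF ad(9) ad(4)]] by simp
 ultimately show ?thesis by simp
qed

text \<open>The primitives converge pointwise along the whole sequence, the fluxes only in averages;
  averaging the approximate identity of each step leaves its vanishing error intact.\<close>

lemma U_flux_aux:
 assumes h: "sq_int mX h" and z: "!!n. sq_int Q (un (z n))" "sq_int Q Z" "(%k. sqn Q (%p. (SUM n<K k. c k n * z n (fst p) (snd p)) - Z p)) ---> 0"
  and u: "!!n. u n : BM" "!!n x. \<bar>u n x\<bar> <= C" "!!x. (%n. cumX (u n) x) ---> U x" "u0 : BM"
  and i0: "integrable mX u0"
  and e: "!!n. \<bar>(LX x. (cumX (u n) x - cumX u0 x) * h x) - (LINT p|Q. wt T (fst p) * h (snd p) * z n (fst p) (snd p))\<bar> <= e n" "e ---> 0"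
 shows "(LX x. (U x - cumX u0 x) * h x) = (LINT p|Q. wt T (fst p) * h (snd p) * Z p)"
proof -
 define A where "A n = (LX x. (cumX (u n) x - cumX u0 x) * h x)" for n
 define B where "B n = (LINT p|Q. wt T (fst p) * h (snd p) * z n (fst p) (snd p))" for n
 note [measurable] = sq_meas[OF h] u(1,4)
 have Um [measurable]: "U : BM" by (rule borel_measurable_LIMSEQ_real[OF u(3)]) measurable
 define M where "M = C * (b - a) + (LX y. \<bar>u0 y\<bar>)"
 have "A ---> (LX x. (U x - cumX u0 x) * h x)" unfolding A_def
 proof (rule integral_dominated_convergence[where w="%x. M * \<bar>h x\<bar>"])
  show "integrable mX (%x. M * \<bar>h x\<bar>)" using sq_int_imp_integrable[OF h] by simp
  show "AE x in mX. (%n. (cumX (u n) x - cumX u0 x) * h x) ---> (U x - cumX u0 x) * h x"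
   by (intro AE_I2 tendsto_intros u)
  show "AE x in mX. norm ((cumX (u n) x - cumX u0 x) * h x) <= M * \<bar>h x\<bar>" for n
  proof (rule AE_I2)
   fix x
   have "\<bar>cumX (u n) x - cumX u0 x\<bar> <= M" using cumX_bounded[OF u(1,2), of n x] X.cum_bound[OF i0, of x] unfolding M_def by linarith
   thus "norm ((cumX (u n) x - cumX u0 x) * h x) <= M * \<bar>h x\<bar>" by (simp add: abs_mult mult_right_mono)
  qed
 qed auto
 from conv_weights_tendsto[OF cw this] have 1: "(%k. SUM n<K k. c k n * A n) ---> (LX x. (U x - cumX u0 x) * h x)" by simp
 have 2: "(%k. SUM n<K k. c k n * B n) ---> (LINT p|Q. wt T (fst p) * h (snd p) * Z p)"
  using comb_inner[OF z sq_int_Q_wt_snd[OF h]] unfolding B_def by (simp only: mult.commute[of "z _ _ _"] mult.commute[of "Z _"])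
 have "(%n. A n - B n) ---> 0" by (rule Lim_null_comparison[OF _ e(2)]) (use e(1) in "auto simp: A_def B_def")
 from conv_weights_tendsto[OF cw this] have "(%k. (SUM n<K k. c k n * A n) - (SUM n<K k. c k n * B n)) ---> 0"
  by (simp add: right_diff_distrib sum_subtractf)
 with tendsto_diff[OF 1 2] have "(LX x. (U x - cumX u0 x) * h x) - (LINT p|Q. wt T (fst p) * h (snd p) * Z p) = 0" by (rule LIMSEQ_unique)
 thus ?thesis by simp
qed

lemma U_flux:
 assumes T: "T >= 0" and h: "sq_int mX h"
 shows "(LX x. (Uf T x - cumX F0 x) * h x) = (LINT p|Q. wt T (fst p) * h (snd p) * J p)" (is ?A)
  "(LX x. (Ug T x - cumX G0 x) * h x) = (LINT p|Q. wt T (fst p) * h (snd p) * H p)" (is ?B)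
proof -
 have "(%n. sqrt (tau (rr n)) * (sqrt BQ * sqrt (sqn mX h))) ---> sqrt 0 * (sqrt BQ * sqrt (sqn mX h))" by (intro tendsto_intros tau_rr)
 hence e: "(%n. sqrt (tau (rr n)) * (sqrt BQ * sqrt (sqn mX h))) ---> 0" by simp
 show ?A
  by (rule U_flux_aux[OF h u_sq(5) sJ J_L2 u_meas1(1) u_abs(1) U_lim(1) F0m bdm_integrable[OF bdm0(1)] flux_identity(1)[OF T h] e])
 show ?B
  by (rule U_flux_aux[OF h u_sq(7) sH H_L2 u_meas1(2) u_abs(2) U_lim(2) G0m bdm_integrable[OF bdm0(2)] flux_identity(2)[OF T h] e])
qed

text \<open>At good times the explicit, jointly measurable limit; at the remaining times any
  admissible pair. The first choice gives the function spaces, the second makes the inequalities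
  hold at every time.\<close>

definition "fg t = (if good t then (fl t, gl t) else SOME p. admissible t (fst p) (snd p))"
definition "f t = fst (fg t)"
definition "g t = snd (fg t)"

lemma good_fg: "good t ==> f t = fl t" "good t ==> g t = gl t"
 by (simp_all add: f_def g_def fg_def)

lemma fg_admissible: "admissible t (f t) (g t)"
proof (cases "good t")
 case True
 note l = good_limits[OF True]
 have p: "(SUM n<K k. c k n * uf (rr n) t x) >= 0" "(SUM n<K k. c k n * ug (rr n) t x) >= 0"
   "(SUM n<K k. c k n * uf (rr n) t x) + (SUM n<K k. c k n * ug (rr n) t x) <= Kb" for k x
  using conv_weights_ge[OF cw, of k 0 "%n. uf (rr n) t x"] conv_weights_ge[OF cw, of k 0 "%n. ug (rr n) t x"]
   conv_weights_le[OF cw, of k "%n. uf (rr n) t x + ug (rr n) t x" Kb] u_bounds by (auto simp: distrib_left sum.distrib)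
 have "fl t x >= 0" "gl t x >= 0" for x by (rule LIMSEQ_le_const[OF l(2)], use p in blast) (rule LIMSEQ_le_const[OF l(5)], use p in blast)
 moreover have "fl t x + gl t x <= Kb" for x by (rule LIMSEQ_le_const2[OF tendsto_add[OF l(2,5)]]) (use p in blast)
 ultimately show ?thesis
  unfolding admissible_def good_fg[OF True] using ac_measurable[OF l(1)] ac_measurable[OF l(4)] l(3,6) by auto
next
 case False
 have "EX p. admissible t (fst p) (snd p)" using admissible_exists[of t] by simp
 from someI_ex[OF this] False show ?thesis by (simp add: f_def g_def fg_def)
qed

end

section \<open>Strong continuity in time\<close>

text \<open>\<open>N\<close> stands for the squared norm, \<open>D\<close> for the squared distance,
  \<open>F\<close> for the accumulated energy with density \<open>e\<close>, and \<open>G\<close>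
  for the good times. The estimate (i) needs its first time in \<open>G\<close>, so it bounds
  \<open>D r 0\<close> by N 0 - N r and energy terms, but cannot bound N 0 from above directly. A
  chain of good times tending to 0 does so: its norms grow by a telescoping amount, and lower
  semicontinuity (iii) passes to 0.\<close>

lemma halving_chain:
 fixes N F e :: "real => real" and D :: "real => real => real"
 assumes i: "!!r q. r : G ==> 0 <= r ==> r <= 1 ==> 0 <= q ==> q <= 1 ==> N r - N q + D r q <= \<bar>F r - F q\<bar> + \<bar>r - q\<bar> * e r"
  and ii: "!!u v. 0 <= u ==> u < v ==> v <= 1 ==> EX r:G. u < r & r < v & e r * (v - u) <= F v - F u"
  and iii: "!!rh B. rh ---> 0 ==> (!!k. 0 <= rh k & rh k <= 1 & N (rh k) <= B) ==> N 0 <= B"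
  and mono: "!!r q. 0 <= r ==> r <= q ==> q <= 1 ==> F r <= F q"
  and D: "!!r q. D r q >= 0" and e: "!!r. e r >= 0"
 shows "EX r:G. 0 < r & r < 1 & e r <= 2 * (F 1 - F 0) & D r 0 <= 11 * (F 1 - F 0)"
proof -
 define h where "h k = (1 / 2 :: real) ^ k" for k
 have h: "0 < h k" "h k <= 1" "h (Suc k) = h k / 2" for k by (simp_all add: h_def power_le_one)
 \<comment> \<open>In each dyadic interval a good time is chosen at which the energy density is at
   most its average.\<close>
 have "EX r:G. h (Suc k) < r & r < h k & e r * h (Suc k) <= F (h k) - F (h (Suc k))" for k
 proof -
  have "0 <= h (Suc k)" "h (Suc k) < h k" "h k <= 1" "h k - h (Suc k) = h (Suc k)" using h(1,2)[of k] h(3)[of k] by simp_all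
  thus ?thesis using ii[of "h (Suc k)" "h k"] by metis
 qed
 then obtain rh where rh: "!!k. rh k : G" "!!k. h (Suc k) < rh k" "!!k. rh k < h k" "!!k. e (rh k) * h (Suc k) <= F (h k) - F (h (Suc k))"
  by metis
 have r01: "0 <= rh k" "rh k <= 1" for k using rh(2,3)[of k] h[of k] by linarith+
 \<comment> \<open>The increment of \<open>F\<close> counts once. Neighbouring chain times differ by
   at most 3 h(k+2), so the density at the smaller one contributes at most three further
   increments.\<close>
 have step: "N (rh (Suc k)) - N (rh k) <= 4 * F (h k) - 4 * F (h (Suc (Suc k)))" for k
 proof -
  have "D (rh (Suc k)) (rh k) >= 0" by (rule D)
  hence "N (rh (Suc k)) - N (rh k) <= \<bar>F (rh (Suc k)) - F (rh k)\<bar> + \<bar>rh (Suc k) - rh k\<bar> * e (rh (Suc k))"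
   using i[OF rh(1) r01 r01, of "Suc k" k] by linarith
  moreover have "\<bar>F (rh (Suc k)) - F (rh k)\<bar> <= F (h k) - F (h (Suc (Suc k)))"
  proof -
   have "F (rh (Suc k)) <= F (rh k)" using rh(2)[of k] rh(3)[of "Suc k"] r01 by (intro mono) auto
   moreover have "F (h (Suc (Suc k))) <= F (rh (Suc k))" by (intro mono less_imp_le[OF h(1)] less_imp_le[OF rh(2)] r01)
   moreover have "F (rh k) <= F (h k)" by (intro mono less_imp_le[OF rh(3)] h r01)
   ultimately show ?thesis by linarith
  qed
  moreover have "\<bar>rh (Suc k) - rh k\<bar> * e (rh (Suc k)) <= (3 * h (Suc (Suc k))) * e (rh (Suc k))"
   using rh(2,3)[of k] rh(2,3)[of "Suc k"] h[of k] h[of "Suc k"] by (intro mult_right_mono e) auto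
  moreover have "e (rh (Suc k)) * h (Suc (Suc k)) <= F (h (Suc k)) - F (h (Suc (Suc k)))" by (rule rh)
  moreover have "F (h (Suc k)) <= F (h k)" using h[of k] h[of "Suc k"] by (intro mono) auto
  ultimately show ?thesis by (simp add: mult.commute)
 qed
 \<comment> \<open>Differences over two scales telescope to two terms at either end; each pair costs
   at most F 1 - F 0, which gives 8 in total.\<close>
 have "N (rh k) <= N (rh 0) + 4 * (F 1 + F (1/2)) - 4 * (F (h k) + F (h (Suc k)))" for k
 proof (induct k)
  case 0 show ?case by (simp add: h_def)
 next
  case (Suc k) thus ?case using step[of k] by simp
 qed
 moreover have "F (1/2) <= F 1" "F 0 <= F (h k)" for k using h(1,2)[of k] by (auto intro!: mono)
 ultimately have bound: "N (rh k) <= N (rh 0) + 8 * (F 1 - F 0)" for k by (smt (verit))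
 have "h ---> 0" unfolding h_def by (rule LIMSEQ_realpow_zero) auto
 hence "rh ---> 0" by (rule tendsto_sandwich[OF _ _ tendsto_const, rotated 2]) (use r01 rh(3) in "auto intro!: always_eventually less_imp_le")
 hence N0: "N 0 <= N (rh 0) + 8 * (F 1 - F 0)" using iii[of rh] r01 bound by blast
 have e0: "e (rh 0) <= 2 * (F 1 - F 0)" using rh(4)[of 0] mono[of 0 "1/2"] by (simp add: h_def)
 have p: "0 < rh 0" "rh 0 < 1" using rh(2,3)[of 0] by (auto simp: h_def)
 have "rh 0 * e (rh 0) <= 1 * e (rh 0)" using p by (intro mult_right_mono e) auto
 \<comment> \<open>11 = 8 + 1 + 2: growth of the norm along the chain, the increment of
   \<open>F\<close>, and the density at the first chain time.\<close>
 hence "D (rh 0) 0 <= 11 * (F 1 - F 0)"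
  using i[OF rh(1), of 0 0] N0 e0 p mono[of 0 "rh 0"] mono[of "rh 0" 1] by simp
 thus ?thesis using rh(1)[of 0] p e0 by blast
qed

text \<open>\<open>halving_chain\<close> is applied on the segment from \<open>s\<close> to
  \<open>p\<close> and on the reversed one; it links each end point with a good time. Between the
  two good times the one-sided estimate in both orders bounds the distance directly, the norms
  cancelling.\<close>

lemma modulus_of_one_sided:
 fixes N E e :: "real => real" and D :: "real => real => real"
 assumes i: "!!r q. r : G ==> 0 <= r ==> 0 <= q ==> N r - N q + D r q <= \<bar>E r - E q\<bar> + \<bar>r - q\<bar> * e r"
  and ii: "!!u v. 0 <= u ==> u < v ==> EX r:G. u < r & r < v & e r * (v - u) <= E v - E u"
  and iii: "!!rh s B. 0 <= s ==> rh ---> s ==> (!!k. 0 <= rh k & N (rh k) <= B) ==> N s <= B"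
  and mono: "!!r q. 0 <= r ==> r <= q ==> E r <= E q"
  and D: "!!r q. D r q >= 0" "!!r q. D r q = D q r" "!!r q s. D r s <= 2 * D r q + 2 * D q s" "!!r. D r r = 0" and e: "!!r. e r >= 0"
  and sp: "0 <= s" "0 <= p"
 shows "D s p <= 78 * \<bar>E p - E s\<bar>"
proof (cases "s = p")
 case True
 thus ?thesis by (simp add: D(4))
next
 case False
 have near: "EX r:G. 0 <= r & min s p < r & r < max s p & e r * \<bar>p - s\<bar> <= 2 * \<bar>E p - E s\<bar> & D r s <= 11 * \<bar>E p - E s\<bar>"
  if sp: "0 <= s" "0 <= p" "s ~= p" for s p
 proof -
  define z where "z r = s + (p - s) * r" for r
  have z0: "0 <= z r" if "0 <= r" "r <= 1" for r
  proof -
   have "z r = (1 - r) * s + r * p" by (simp add: z_def algebra_simps)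
   thus ?thesis using that sp by simp
  qed
  have zz: "z r - z q = (p - s) * (r - q)" for r q by (simp add: z_def algebra_simps)
  \<comment> \<open>When the segment is run backwards in time, the sign keeps \<open>F\<close>
    nondecreasing in the parameter.\<close>
  define F where "F r = sgn (p - s) * (E (z r) - E s)" for r
  have F1: "F 1 - F 0 = \<bar>E p - E s\<bar>"
   using mono[of s p] mono[of p s] sp by (cases "s < p") (auto simp: F_def z_def)
  have "EX r:{r. z r : G}. 0 < r & r < 1 & e (z r) * \<bar>p - s\<bar> <= 2 * (F 1 - F 0) & D (z r) (z 0) <= 11 * (F 1 - F 0)"
  proof (rule halving_chain[where N="%r. N (z r)" and D="%r q. D (z r) (z q)" and e="%r. e (z r) * \<bar>p - s\<bar>"])
   fix r q :: real assume r: "r : {r. z r : G}" "0 <= r" "r <= 1" and q: "0 <= q" "q <= 1"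
   have "\<bar>F r - F q\<bar> = \<bar>E (z r) - E (z q)\<bar>" using sp(3) by (simp add: F_def abs_mult flip: right_diff_distrib)
   moreover have "\<bar>z r - z q\<bar> * e (z r) = \<bar>r - q\<bar> * (e (z r) * \<bar>p - s\<bar>)" unfolding zz abs_mult by (simp only: mult_ac)
   ultimately show "N (z r) - N (z q) + D (z r) (z q) <= \<bar>F r - F q\<bar> + \<bar>r - q\<bar> * (e (z r) * \<bar>p - s\<bar>)"
    using i[of "z r" "z q", OF _ z0[OF r(2,3)] z0[OF q]] r(1) unfolding mem_Collect_eq by linarith
  next
   fix u v :: real assume uv: "0 <= u" "u < v" "v <= 1"
   have inv: "z ((x - s) / (p - s)) = x" for x using sp(3) by (simp add: z_def)
   show "EX r:{r. z r : G}. u < r & r < v & e (z r) * \<bar>p - s\<bar> * (v - u) <= F v - F u"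
   proof (cases "s < p")
    case True
    have "z u < z v" using uv True by (simp add: z_def)
    then obtain x where x: "x : G" "z u < x" "x < z v" "e x * (z v - z u) <= E (z v) - E (z u)" using ii[of "z u" "z v"] z0 uv by auto
    have "u < (x - s) / (p - s)" "(x - s) / (p - s) < v" using x True by (simp_all add: z_def field_simps)
    thus ?thesis using x True uv by (intro bexI[of _ "(x - s) / (p - s)"]) (auto simp: inv zz F_def mult.assoc)
   next
    case False
    hence ps: "p < s" using sp by simp
    have "z v < z u" using uv ps by (simp add: z_def mult_less_cancel_left)
    then obtain x where x: "x : G" "z v < x" "x < z u" "e x * (z u - z v) <= E (z u) - E (z v)" using ii[of "z v" "z u"] z0 uv by auto
    have "u < (x - s) / (p - s)" "(x - s) / (p - s) < v" using x ps by (simp_all add: z_def field_simps)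
    moreover have "(p - s) * (u - v) = (s - p) * (v - u)" by (simp add: algebra_simps)
    ultimately show ?thesis using x ps uv by (intro bexI[of _ "(x - s) / (p - s)"]) (auto simp: inv zz F_def mult.assoc)
   qed
  next
   fix rh :: "nat => real" and B assume rh: "rh ---> 0" "!!k. 0 <= rh k & rh k <= 1 & N (z (rh k)) <= B"
   have "(%k. z (rh k)) ---> s + (p - s) * 0" unfolding z_def by (intro tendsto_intros rh)
   hence "N s <= B" using rh(2) z0 sp by (intro iii[of s "%k. z (rh k)"]) auto
   thus "N (z 0) <= B" by (simp add: z_def)
  next
   fix r q :: real assume rq: "0 <= r" "r <= q" "q <= 1"
   show "F r <= F q"
   proof (cases "s < p")
    case True
    hence "z r <= z q" using rq by (simp add: z_def mult_left_mono)
    thus ?thesis using mono[of "z r" "z q"] z0 rq True by (simp add: F_def)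
   next
    case False
    hence "z q <= z r" using rq sp by (simp add: z_def mult_left_mono_neg)
    thus ?thesis using mono[of "z q" "z r"] z0 rq False sp by (simp add: F_def)
   qed
  qed (auto intro: D(1) e mult_nonneg_nonneg)
  then obtain r where r: "z r : G" "0 < r" "r < 1" "e (z r) * \<bar>p - s\<bar> <= 2 * (F 1 - F 0)" "D (z r) (z 0) <= 11 * (F 1 - F 0)" by blast
  have zs: "z r - s = (p - s) * r" "p - z r = (p - s) * (1 - r)" by (simp_all add: z_def algebra_simps)
  have "min s p < z r & z r < max s p"
  proof (cases "s < p")
   case True
   hence "0 < (p - s) * r" "0 < (p - s) * (1 - r)" using r by simp_all
   hence "s < z r" "z r < p" unfolding zs[symmetric] by simp_all
   thus ?thesis using True by simp
  next
   case False
   hence "(p - s) * r < 0" "(p - s) * (1 - r) < 0" using r sp by (simp_all add: mult_less_0_iff)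
   hence "z r < s" "p < z r" unfolding zs[symmetric] by simp_all
   thus ?thesis using False by simp
  qed
  thus ?thesis using r z0[of r] F1 by (intro bexI[of _ "z r"]) (auto simp: z_def)
 qed
 obtain r where r: "r : G" "0 <= r" "min s p < r" "r < max s p" "e r * \<bar>p - s\<bar> <= 2 * \<bar>E p - E s\<bar>" "D r s <= 11 * \<bar>E p - E s\<bar>"
  using near[OF sp False] by blast
 obtain q where q: "q : G" "0 <= q" "min s p < q" "q < max s p" "e q * \<bar>p - s\<bar> <= 2 * \<bar>E p - E s\<bar>" "D q p <= 11 * \<bar>E p - E s\<bar>"
  using near[OF sp(2,1)] False by (metis abs_minus_commute min.commute max.commute)
 have d: "\<bar>r - q\<bar> <= \<bar>p - s\<bar>" using r(3,4) q(3,4) by linarith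
 have Ed: "\<bar>E r - E q\<bar> <= \<bar>E p - E s\<bar>"
 proof -
  have m: "min s p >= 0" using sp by simp
  have "E r <= E (max s p)" "E q <= E (max s p)" "E (min s p) <= E r" "E (min s p) <= E q"
   using r(2-4) q(2-4) m by (auto intro!: mono)
  hence "\<bar>E r - E q\<bar> <= E (max s p) - E (min s p)" by linarith
  also have "... <= \<bar>E p - E s\<bar>" unfolding min_def max_def by (cases "s <= p") auto
  finally show ?thesis .
 qed
 have "\<bar>r - q\<bar> * e r <= \<bar>p - s\<bar> * e r" "\<bar>q - r\<bar> * e q <= \<bar>p - s\<bar> * e q" using d by (auto intro!: mult_right_mono e)
 hence "\<bar>r - q\<bar> * e r <= 2 * \<bar>E p - E s\<bar>" "\<bar>q - r\<bar> * e q <= 2 * \<bar>E p - E s\<bar>" using r(5) q(5) by (simp_all add: mult.commute)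
 hence "D r q <= 3 * \<bar>E p - E s\<bar>"
  using i[OF r(1,2) q(2)] i[OF q(1,2) r(2)] D(2)[of r q] Ed abs_minus_commute[of "E r" "E q"] by linarith
 \<comment> \<open>Two weak triangle inequalities: 2 * 11 + 2 * (2 * 3 + 2 * 11) = 78.\<close>
 thus ?thesis using D(3)[of s p r] D(3)[of r p q] D(2)[of s r] r(6) q(6) by linarith
qed

section \<open>The one-sided estimate in L2 and its modulus\<close>

context interval
begin

lemma sqn_diff_commute: "sqn M (%x. u x - v x) = sqn M (%x. v x - u x :: real)"
 by (simp add: power2_commute)

lemma sqn_triangle:
 fixes u v w :: "'x => real"
 assumes "sq_int M u" "sq_int M v" "sq_int M w"
 shows "sqn M (%x. u x - w x) <= 2 * sqn M (%x. u x - v x) + 2 * sqn M (%x. v x - w x)"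
 using sqn_add_le[OF sq_int_diff[OF assms(1,2)] sq_int_diff[OF assms(2,3)]] by simp

text \<open>The energy against which continuity is measured. The flux enters through Young's
  inequality; the derivative is included because the estimate at a good time \<open>r\<close> costs
  the squared norm of V(r, .), which has to be controlled by an average in time.\<close>

definition "acc V J T = (LINT p|Q. wt T (fst p) * ((J p)^2 + (V p)^2))" for V J :: "real * real => real"

lemma integrable_wt_Q:
 assumes "integrable Q (h :: real * real => real)" shows "integrable Q (%p. wt T (fst p) * h p)"
proof (rule Bochner_integrable_bound[OF integrable_mult_right[OF assms, of "exp T"]])
 have [measurable]: "h : BM2" using borel_measurable_integrable[OF assms] by simp
 show "(%p. wt T (fst p) * h p) : borel_measurable Q" by simp
 show "AE p in Q. norm (wt T (fst p) * h p) <= norm (exp T * h p)"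
  using wt_nonneg wt_le by (intro AE_I2) (auto simp: abs_mult intro!: mult_right_mono)
qed

lemma wt_mono: "S <= T ==> wt S t <= wt T t"
 by (auto simp: wt_def indicator_def)

lemma integrable_wt: "integrable mE (wt T)" "T >= 0 ==> (LINT t|mE. wt T t) = T"
proof -
 show "integrable mE (wt T)" by (rule E.integrable_const_bound[where B="exp T"]) (use wt_nonneg wt_le in "auto simp: abs_of_nonneg")
 show "(LINT t|mE. wt T t) = T" if "T >= 0" using integral_wt[of "%_. 1" T] that by simp
qed

lemma integral_wt_snd:
 assumes h: "sq_int mX (h :: real => real)" and T: "T >= 0"
 shows "integrable Q (%p. wt T (fst p) * (h (snd p))^2)" (is ?A) "(LINT p|Q. wt T (fst p) * (h (snd p))^2) = T * sqn mX h" (is ?B)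
proof -
 show i: ?A using integrable_wt_Q[OF sq_int_integrable[OF sq_int_Q_snd[OF h]]] by simp
 show ?B using integral_Q[OF i] integrable_wt[of T] T by simp
qed

text \<open>A density cannot exceed its mean almost everywhere on an interval of positive length;
  the time found can be taken in any set of full measure.\<close>

lemma acc_slice:
 assumes V: "sq_int Q V" and J: "sq_int Q J" and uv: "0 <= u" "u < v" and G: "AE t in mE. t : G"
 shows "EX r:G. u < r & r < v & (sqn mX (%x. V (r, x)) + sqn mX (%x. J (r, x))) * (v - u) <= acc V J v - acc V J u"
proof (rule ccontr)
 assume neg: "~ ?thesis"
 define e where "e t = sqn mX (%x. V (t, x)) + sqn mX (%x. J (t, x))" for t
 define M where "M = acc V J v - acc V J u"
 have Vm [measurable]: "V : borel_measurable (borel \<Otimes>\<^sub>M mX)" "J : borel_measurable (borel \<Otimes>\<^sub>M mX)"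
  using sq_intD[OF V] sq_intD[OF J] by simp_all
 have em [measurable]: "e : BM" unfolding e_def by measurable
 have iVJ: "integrable Q (%p. (J p)^2 + (V p)^2)" using sq_int_integrable[OF V] sq_int_integrable[OF J] by simp
 have slice: "AE t in mE. (LX x. (J (t, x))^2 + (V (t, x))^2) = e t"
  using sq_int_Q_AE[OF V] sq_int_Q_AE[OF J]
 proof eventually_elim
  case (elim t)
  show ?case unfolding e_def using sq_int_integrable[OF elim(1)] sq_int_integrable[OF elim(2)] by simp
 qed
 have ie: "integrable mE (%t. wt T t * e t)" (is ?S) and acc: "acc V J T = (LINT t|mE. wt T t * e t)" (is ?T) for T
 proof -
  note i = integrable_wt_Q[OF iVJ, of T]
  have ae: "AE t in mE. (LX x. wt T t * ((J (t, x))^2 + (V (t, x))^2)) = wt T t * e t"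
   using slice by eventually_elim simp
  have 1: "(%t. LX x. wt T t * ((J (t, x))^2 + (V (t, x))^2)) : BM" by measurable
  show ?S
   using PQ.integrable_fst'[OF i[unfolded Q_def]] by (rule integrable_cong_AE_imp) (use ae 1 in "auto elim: eventually_mono")
  show ?T unfolding acc_def integral_Q[OF i] fst_conv by (rule integral_cong_AE) (use ae 1 in auto)
 qed
 have lbi: "integrable lborel (%t. indicator {u<..v} t * e t)" (is ?S) and lb: "M = (LINT t|lborel. indicator {u<..v} t * e t)" (is ?T)
 proof -
  have i: "integrable lborel (%t. indicator {0<..T} t * e t)" for T
   using ie[of T] integrable_mE[of "%t. wt T t * e t"] by (simp add: wt_dens)
  have eq: "indicator {u<..v} t * e t = indicator {0<..v} t * e t - indicator {0<..u} t * e t" for t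
   using uv by (auto simp: indicator_def)
  show ?S unfolding eq by (intro Bochner_integrable_diff i)
  show ?T unfolding M_def acc eq using i integral_wt[OF em] by simp
 qed
 define k where "k t = indicator {u<..v} t * (e t - M / (v - u))" for t
 have ki: "integrable lborel k"
 proof -
  have "k = (%t. indicator {u<..v} t * e t - indicator {u<..v} t * (M / (v - u)))" by (auto simp: k_def fun_eq_iff right_diff_distrib)
  thus ?thesis using lbi uv by (simp add: integrable_mult_left)
 qed
 have "(LINT t|lborel. k t) = M - (LINT t|lborel. indicator {u<..v} t * (M / (v - u)))"
  unfolding k_def lb right_diff_distrib using lbi uv by (subst Bochner_integral_diff) auto
 also have "... = 0" using uv by simp
 finally have k0: "(LINT t|lborel. k t) = 0" .
 have "AE t in lborel. t ~= v" by (rule AE_lborel_singleton)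
 moreover have "AE t in lborel. t >= 0 --> t : G" using G by (simp add: AE_mE)
 ultimately have pos: "AE t in lborel. t : {u<..v} --> k t > 0"
 proof eventually_elim
  case (elim t)
  show ?case
  proof
   assume t: "t : {u<..v}"
   hence "t : G" "u < t" "t < v" using elim uv by auto
   hence "~ e t * (v - u) <= M" using neg by (auto simp: e_def M_def)
   hence "M / (v - u) < e t" using uv by (simp add: field_simps)
   thus "k t > 0" using t by (simp add: k_def)
  qed
 qed
 hence "AE t in lborel. 0 <= k t" by eventually_elim (auto simp: k_def indicator_def split: if_splits)
 from integral_nonneg_eq_0_iff_AE[OF ki this] k0 have "AE t in lborel. k t = 0" by simp
 with pos have "AE t in lborel. t ~: {u<..v}" by eventually_elim auto
 hence "{u<..v} : null_sets lborel" by (subst AE_iff_null_sets) auto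
 thus False using uv by (auto simp: null_sets_def)
qed

lemma integrable_acc:
 assumes V: "sq_int Q V" and J: "sq_int Q J" shows "integrable Q (%p. wt T (fst p) * ((J p)^2 + (V p)^2))"
 using sq_int_integrable[OF V] sq_int_integrable[OF J] by (intro integrable_wt_Q) simp

lemma acc_mono:
 assumes V: "sq_int Q V" and J: "sq_int Q J" and "s <= t" shows "acc V J s <= acc V J t"
 unfolding acc_def by (intro integral_mono integrable_acc V J mult_right_mono wt_mono assms) auto

lemma acc_continuous:
 assumes V: "sq_int Q V" and J: "sq_int Q J" shows "(acc V J \<longlongrightarrow> acc V J t) (at t within {0..})"
 unfolding tendsto_at_iff_sequentially o_def
proof (intro allI impI)
 fix X :: "nat => real" assume X: "X ---> t"
 have "\<forall>\<^sub>F n in sequentially. X n < t + 1" using order_tendstoD(2)[OF X, of "t + 1"] by simp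
 then obtain N where N: "!!n. n >= N ==> X n < t + 1" by (auto simp: eventually_sequentially)
 have "(%n. acc V J (X (n + N))) ---> acc V J t" unfolding acc_def
 proof (rule integral_dominated_convergence[where w="%p. exp (t + 1) * ((J p)^2 + (V p)^2)"])
  show "integrable Q (%p. exp (t + 1) * ((J p)^2 + (V p)^2))"
   using sq_int_integrable[OF V] sq_int_integrable[OF J] by simp
  show "(%p. wt t (fst p) * ((J p)^2 + (V p)^2)) : borel_measurable Q" "(%p. wt (X (n + N)) (fst p) * ((J p)^2 + (V p)^2)) : borel_measurable Q" for n
   by (rule borel_measurable_integrable[OF integrable_acc[OF V J]])+
  have "AE s in lborel. s ~= t" by (rule AE_lborel_singleton)
  hence "AE s in mE. s ~= t" unfolding AE_mE by eventually_elim simp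
  from AE_Q_fst[OF this] show "AE p in Q. (%n. wt (X (n + N)) (fst p) * ((J p)^2 + (V p)^2)) ---> wt t (fst p) * ((J p)^2 + (V p)^2)"
  proof eventually_elim
   case (elim p)
   have "\<forall>\<^sub>F n in sequentially. wt (X (n + N)) (fst p) = wt t (fst p)"
   proof (cases "fst p < t")
    case True
    from order_tendstoD(1)[OF LIMSEQ_ignore_initial_segment[OF X, of N] this] show ?thesis
     by eventually_elim (use True in "auto simp: wt_def indicator_def")
   next
    case False
    hence f: "t < fst p" using elim by simp
    from order_tendstoD(2)[OF LIMSEQ_ignore_initial_segment[OF X, of N] this] show ?thesis
     by eventually_elim (use f in "auto simp: wt_def indicator_def")
   qed
   hence "(%n. wt (X (n + N)) (fst p)) ---> wt t (fst p)" by (rule tendsto_eventually)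
   thus ?case by (intro tendsto_intros)
  qed
  show "AE p in Q. norm (wt (X (n + N)) (fst p) * ((J p)^2 + (V p)^2)) <= exp (t + 1) * ((J p)^2 + (V p)^2)" for n
  proof (rule AE_I2)
   fix p :: "real * real"
   have "wt (X (n + N)) (fst p) <= exp (t + 1)" using wt_le[of "X (n + N)" "fst p"] N[of "n + N"] by (smt (verit) exp_le_cancel_iff le_add2)
   thus "norm (wt (X (n + N)) (fst p) * ((J p)^2 + (V p)^2)) <= exp (t + 1) * ((J p)^2 + (V p)^2)"
    using wt_nonneg by (auto simp: abs_mult intro!: mult_right_mono)
  qed
 qed
 thus "(%n. acc V J (X n)) ---> acc V J t" by (rule LIMSEQ_offset)
qed

text \<open>At a good time \<open>r\<close> the function \<open>ph r\<close> has a derivative and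
  may serve as test function for the difference of the values at \<open>r\<close> and any other time
  \<open>q\<close>. The flux identity turns this into a space-time integral of V(r, .) against the
  flux between the two times.\<close>

lemma L2_modulus:
 fixes ph :: "real => real => real"
 assumes m: "!!t. ph t : BM" and bd: "!!t x. \<bar>ph t x\<bar> <= C" and mass: "!!t. (LX x. ph t x) = M"
  and Uc: "!!t x. t >= 0 ==> ((%s. cumX (ph s) x) \<longlongrightarrow> cumX (ph t) x) (at t within {0..})"
  and V: "sq_int Q V" and J: "sq_int Q J" and G: "AE t in mE. t : G" and ac: "!!t. t : G ==> ac (ph t) (%x. V (t, x))"
  and u0: "u0 : BM" "!!x. \<bar>u0 x\<bar> <= C0"
  and flux: "!!t h. t >= 0 ==> sq_int mX h ==> (LX x. (cumX (ph t) x - u0 x) * h x) = (LINT p|Q. wt t (fst p) * h (snd p) * J p)"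
  and sp: "0 <= s" "0 <= p"
 shows "sqn mX (%x. ph s x - ph p x) <= 78 * \<bar>acc V J p - acc V J s\<bar>"
proof -
 have sq: "sq_int mX (ph t)" for t by (rule sq_int_bounded[OF m bd])
 have i: "integrable mX (ph t)" for t by (rule integrable_bounded[OF m bd])
 have su: "sq_int mX (%x. cumX (ph t) x - u0 x)" for t
  by (intro sq_int_diff sq_int_bounded[OF X.borel_measurable_cum[OF m] cumX_bounded[OF m bd]] sq_int_bounded[OF u0])
 show ?thesis
 proof (rule modulus_of_one_sided[where G=G and N="%t. sqn mX (ph t)" and E="acc V J" and D="%t q. sqn mX (%x. ph t x - ph q x)"
    and e="%t. sqn mX (%x. V (t, x)) + sqn mX (%x. J (t, x))", OF _ _ _ _ _ _ _ _ _ sp])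
  fix r q :: real assume r: "r : G" "0 <= r" and q: "0 <= q"
  let ?h = "%x. V (r, x)"
  have h: "sq_int mX ?h" using acD(1)[OF ac[OF r(1)]] .
  define w where "w x = ph r x - ph q x" for x
  have iw: "integrable mX w" unfolding w_def[abs_def] using i by simp
  have sw: "sq_int mX w" unfolding w_def[abs_def] by (intro sq_int_diff sq)
  have cw: "cumX w x = (cumX (ph r) x - u0 x) - (cumX (ph q) x - u0 x)" for x unfolding w_def[abs_def] using i by (simp add: X.cum_diff)
  have w0: "(LX x. w x) = 0" unfolding w_def[abs_def] using i mass by simp
  have "sqn mX (ph r) - sqn mX (ph q) + sqn mX w = (LX x. (norm (ph r x))^2 - (norm (ph q x))^2 + (norm (w x))^2)"
   using sq_int_integrable[OF sq] sq_int_integrable[OF sw] by simp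
  \<comment> \<open>|p|^2 - |q|^2 + |p - q|^2 = 2 (p - q) p: only the value at \<open>r\<close> is
    used as a test function, so regularity is required at one of the two times.\<close>
  also have "... = (LX x. 2 * (w x * ph r x))"
   by (intro Bochner_integral_cong refl) (simp add: w_def power2_eq_square algebra_simps)
  also have "... = - 2 * (LX x. ?h x * cumX w x)" using ac_ibp[OF ac[OF r(1)] iw] w0 by simp
  also have "(LX x. ?h x * cumX w x) = (LX x. (cumX (ph r) x - u0 x) * ?h x - (cumX (ph q) x - u0 x) * ?h x)"
   unfolding cw by (intro Bochner_integral_cong refl) (simp add: algebra_simps)
  also have "... = (LINT p|Q. wt r (fst p) * ?h (snd p) * J p) - (LINT p|Q. wt q (fst p) * ?h (snd p) * J p)"
   by (subst Bochner_integral_diff[OF sq_int_times[OF su h] sq_int_times[OF su h]]) (simp add: flux r q h)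
  also have "... = (LINT p|Q. wt r (fst p) * ?h (snd p) * J p - wt q (fst p) * ?h (snd p) * J p)"
   by (rule Bochner_integral_diff[symmetric]; intro sq_int_times sq_int_Q_wt_snd h J)
  also have "- 2 * ... = (LINT p|Q. - 2 * (wt r (fst p) * ?h (snd p) * J p - wt q (fst p) * ?h (snd p) * J p))" by (rule integral_mult_right_zero[symmetric])
  also have "... <= (LINT p|Q. (wt (max r q) (fst p) * (?h (snd p))^2 - wt (min r q) (fst p) * (?h (snd p))^2)
    + (wt (max r q) (fst p) * ((J p)^2 + (V p)^2) - wt (min r q) (fst p) * ((J p)^2 + (V p)^2)))"
  proof (rule integral_mono)
   show "integrable Q (%p. - 2 * (wt r (fst p) * ?h (snd p) * J p - wt q (fst p) * ?h (snd p) * J p))"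
    by (intro integrable_mult_right Bochner_integrable_diff sq_int_times sq_int_Q_wt_snd h J)
   show "integrable Q (%p. (wt (max r q) (fst p) * (?h (snd p))^2 - wt (min r q) (fst p) * (?h (snd p))^2)
    + (wt (max r q) (fst p) * ((J p)^2 + (V p)^2) - wt (min r q) (fst p) * ((J p)^2 + (V p)^2)))"
    by (intro Bochner_integrable_add Bochner_integrable_diff integrable_acc V J integral_wt_snd(1) h) (use r q in auto)
   fix p :: "real * real"
   \<comment> \<open>\<open>om\<close> is the weight of the time interval between \<open>r\<close>
     and \<open>q\<close>, and \<open>d\<close> equals it up to sign, which covers both orders of
     the times. Young's inequality is then the non-negativity of a square.\<close>
   define om where "om = wt (max r q) (fst p) - wt (min r q) (fst p)"
   define d where "d = wt r (fst p) - wt q (fst p)"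
   have om: "om >= 0" unfolding om_def using wt_mono[of "min r q" "max r q" "fst p"] by simp
   have d: "d = om \<or> d = - om" unfolding d_def om_def by (cases "r <= q") auto
   have alg: "(A * x - B * x) + (A * y - B * y) = (A - B) * (x + y)" for A B x y :: real by (simp add: algebra_simps)
   have alg2: "- 2 * (A * x * y - B * x * y) = - 2 * ((A - B) * (x * y))" for A B x y :: real by (simp add: algebra_simps)
   have "0 <= om * ((?h (snd p) + J p)^2 + (V p)^2)" "0 <= om * ((?h (snd p) - J p)^2 + (V p)^2)" using om by simp_all
   with d show "- 2 * (wt r (fst p) * ?h (snd p) * J p - wt q (fst p) * ?h (snd p) * J p)
    <= (wt (max r q) (fst p) * (?h (snd p))^2 - wt (min r q) (fst p) * (?h (snd p))^2)
    + (wt (max r q) (fst p) * ((J p)^2 + (V p)^2) - wt (min r q) (fst p) * ((J p)^2 + (V p)^2))"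
    unfolding alg alg2 d_def[symmetric] om_def[symmetric] by (auto simp: power2_sum power2_diff algebra_simps)
  qed
  also have "... = (max r q - min r q) * sqn mX ?h + (acc V J (max r q) - acc V J (min r q))"
  proof -
   have mm: "0 <= max r q" "0 <= min r q" using r q by auto
   note i = integral_wt_snd[OF h mm(1)] integral_wt_snd[OF h mm(2)] integrable_acc[OF V J]
   show ?thesis unfolding acc_def by (subst Bochner_integral_add; (intro Bochner_integrable_diff i)?)
     (simp only: Bochner_integral_diff i left_diff_distrib)
  qed
  also have "... <= \<bar>acc V J r - acc V J q\<bar> + \<bar>r - q\<bar> * (sqn mX (%x. V (r, x)) + sqn mX (%x. J (r, x)))"
  proof -
   have e: "max r q - min r q = \<bar>r - q\<bar>" by (cases "r <= q") simp_all
   have "acc V J (max r q) - acc V J (min r q) <= \<bar>acc V J r - acc V J q\<bar>" by (cases "r <= q") simp_all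
   moreover have "0 <= \<bar>r - q\<bar> * sqn mX (%x. J (r, x))" by simp
   ultimately show ?thesis unfolding e distrib_left by linarith
  qed
  finally show "sqn mX (ph r) - sqn mX (ph q) + sqn mX (%x. ph r x - ph q x)
   <= \<bar>acc V J r - acc V J q\<bar> + \<bar>r - q\<bar> * (sqn mX (%x. V (r, x)) + sqn mX (%x. J (r, x)))" unfolding w_def .
 next
  fix u v :: real assume "0 <= u" "u < v"
  from acc_slice[OF V J this G] show "EX r:G. u < r & r < v & (sqn mX (%x. V (r, x)) + sqn mX (%x. J (r, x))) * (v - u) <= acc V J v - acc V J u" .
 next
  fix rh :: "nat => real" and s B assume s: "0 <= s" and rh: "rh ---> s" "!!k. 0 <= rh k & sqn mX (ph (rh k)) <= B"
  \<comment> \<open>Lower semicontinuity of the norm: continuity of the primitives in time gives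
    weak convergence, and |y|^2 >= 2 x y - |x|^2.\<close>
  have "(%k. LX x. ph s x * ph (rh k) x) ---> (LX x. ph s x * ph s x)"
  proof (rule weak_conv_of_cum[OF finite_mX sets_mX m bd m bd _ i])
   fix x
   show "(%k. cumX (ph (rh k)) x) ---> cumX (ph s) x"
    using continuous_within_sequentiallyI Uc[OF s, of x] rh s
    by (intro continuous_within_tendsto_compose'[of s "{0..}" "%t. cumX (ph t) x"]) (auto simp: continuous_within)
  qed
  hence "(%k. 2 * (LX x. ph s x * ph (rh k) x) - sqn mX (ph s)) ---> 2 * (LX x. ph s x * ph s x) - sqn mX (ph s)"
   by (intro tendsto_intros)
  moreover have "2 * (LX x. ph s x * ph (rh k) x) - sqn mX (ph s) <= B" for k
  proof -
   have "0 <= sqn mX (%x. ph s x - ph (rh k) x)" by simp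
   also have "... = (LX x. (norm (ph s x))^2 - 2 * (ph s x * ph (rh k) x) + (norm (ph (rh k) x))^2)"
    by (intro Bochner_integral_cong refl) (simp add: power2_eq_square algebra_simps)
   also have "... = sqn mX (ph s) - 2 * (LX x. ph s x * ph (rh k) x) + sqn mX (ph (rh k))"
    using sq_int_integrable[OF sq] sq_int_times[OF sq sq] by simp
   finally show ?thesis using rh(2)[of k] by linarith
  qed
  ultimately show "sqn mX (ph s) <= B" by (intro LIMSEQ_le_const2[where X="%k. 2 * (LX x. ph s x * ph (rh k) x) - sqn mX (ph s)"]) (auto simp: power2_eq_square)
 qed (use sqn_triangle[OF sq sq sq] sqn_diff_commute acc_mono[OF V J] in auto)
qed

end

section \<open>Test functions and weak derivatives\<close>

text \<open>The classical bump exp(- l / ((x - c)(d - x))) multiplied by a polynomial and a negative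
  power of the denominator: this enlarged family is closed under differentiation, so smoothness
  needs a single derivative computation.\<close>

definition bump :: "real => real => real => real poly => nat => real => real" where
 "bump c d l p m x = (if c < x & x < d then poly p x * (1 / ((x - c) * (d - x))) ^ m * exp (- l * (1 / ((x - c) * (d - x)))) else 0)"

lemma DERIV_zero_of_quadratic_bound:
 fixes f :: "real => real"
 assumes "!!y. \<bar>f y - f x\<bar> <= C * \<bar>y - x\<bar>^2"
 shows "(f has_real_derivative 0) (at x)" unfolding has_field_derivative_iff
proof (rule Lim_null_comparison)
 have b: "norm ((f y - f x) / (y - x)) <= C * \<bar>y - x\<bar>" if "y ~= x" for y
 proof -
  have "\<bar>f y - f x\<bar> <= (C * \<bar>y - x\<bar>) * \<bar>y - x\<bar>" using assms[of y] by (simp only: power2_eq_square mult.assoc)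
  thus ?thesis using that by (simp add: pos_divide_le_eq)
 qed
 show "\<forall>\<^sub>F y in at x. norm ((f y - f x) / (y - x)) <= C * \<bar>y - x\<bar>"
  unfolding eventually_at_filter by (rule always_eventually) (use b in blast)
 have "((%y. C * \<bar>y - x\<bar>) \<longlongrightarrow> C * \<bar>x - x\<bar>) (at x)" by (intro tendsto_intros)
 thus "((%y. C * \<bar>y - x\<bar>) \<longlongrightarrow> 0) (at x)" by simp
qed

text \<open>One term of the exponential series. The exponent m + 2 leaves a factor 1/u^2, hence
  vanishing of second order at the end points of the support.\<close>

lemma exp_neg_power_bound:
 fixes u l :: real assumes "u > 0" "l > 0"
 shows "u ^ m * exp (- l * u) <= fact (m + 2) / l ^ (m + 2) * (1 / u)^2"
proof -
 have "(l * u) ^ (m + 2) / fact (m + 2) <= exp (l * u)"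
 proof -
  have "(\<Sum>n\<in>{m + 2}. (l * u) ^ n /\<^sub>R fact n) <= (\<Sum>n. (l * u) ^ n /\<^sub>R fact n)"
   using assms by (intro sum_le_suminf summable_exp_generic) auto
  thus ?thesis by (simp add: exp_def divide_inverse mult.commute)
 qed
 hence "(l ^ (m + 2) * u ^ (m + 2)) <= fact (m + 2) * exp (l * u)" by (simp add: power_mult_distrib field_simps del: fact_Suc power_Suc)
 hence "u ^ m * u^2 * l ^ (m + 2) <= fact (m + 2) * exp (l * u)" by (simp only: power_add mult_ac)
 thus ?thesis using assms by (simp add: exp_minus field_simps del: fact_Suc power_Suc)
qed

text \<open>Inside the support this is calculus; at all other points the quadratic bound makes the
  difference quotient vanish, which settles the end points without one-sided derivatives.\<close>

lemma bump_deriv: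
 assumes cd: "c < d" and l: "l > 0"
 shows "EX p'. ALL x. (bump c d l p m has_real_derivative bump c d l p' (m + 2) x) (at x)"
proof -
 define q where "q = [:- c, 1:] * [:d, - 1 :: real:]"
 define r where "r = pderiv q"
 have q: "poly q x = (x - c) * (d - x)" for x by (simp add: q_def algebra_simps)
 \<comment> \<open>The numerator after all three terms of the derivative are written with the common
   power m + 2 of 1/q.\<close>
 define p' where "p' = pderiv p * q^2 - smult (real m) (p * r * q) + smult l (p * r)"
 have "(bump c d l p m has_real_derivative bump c d l p' (m + 2) x) (at x)" for x
 proof (cases "c < x & x < d")
  case True
  have y: "poly q x > 0" unfolding q using True by simp
  define u where "u = 1 / poly q x"
  have u: "poly q x * u = 1" "u ~= 0" using y by (simp_all add: u_def)
  have du: "((%x. 1 / poly q x) has_real_derivative - poly r x * u^2) (at x)"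
   using y unfolding r_def by (auto intro!: derivative_eq_intros poly_DERIV simp: u_def power2_eq_square)
  have 1: "((%x. poly p x * (1 / poly q x) ^ m * exp (- l * (1 / poly q x))) has_real_derivative
   (poly (pderiv p) x * u ^ m + poly p x * (real m * u ^ (m - 1) * (- poly r x * u^2))) * exp (- l * u)
    + poly p x * u ^ m * (exp (- l * u) * (- l * (- poly r x * u^2)))) (at x)"
   by (rule derivative_eq_intros du poly_DERIV refl | simp add: u_def)+
  have 2: "(poly (pderiv p) x * u ^ m + poly p x * (real m * u ^ (m - 1) * (- poly r x * u^2))) * exp (- l * u)
    + poly p x * u ^ m * (exp (- l * u) * (- l * (- poly r x * u^2)))
   = (poly (pderiv p) x * u ^ m - real m * (poly p x * poly r x) * u ^ (m + 1) + l * (poly p x * poly r x) * u ^ (m + 2)) * exp (- l * u)"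
   by (cases m) (simp_all add: algebra_simps power2_eq_square)
  have pw: "(poly q x)^2 * u ^ (m + 2) = u ^ m" (is ?S) "poly q x * u ^ (m + 2) = u ^ (m + 1)" (is ?T)
  proof -
   have "(poly q x)^2 * u ^ (m + 2) = (poly q x * u)^2 * u ^ m" "poly q x * u ^ (m + 2) = (poly q x * u) * u ^ (m + 1)"
    by (simp_all add: power_mult_distrib power_add power2_eq_square)
   thus ?S ?T using u by simp_all
  qed
  have 3: "A * u ^ m - B * u ^ (m + 1) + C * u ^ (m + 2) = (A * (poly q x)^2 - B * poly q x + C) * u ^ (m + 2)" for A B C
   unfolding left_diff_distrib distrib_right mult.assoc pw ..
  have "((%x. poly p x * (1 / poly q x) ^ m * exp (- l * (1 / poly q x))) has_real_derivative
    poly p' x * u ^ (m + 2) * exp (- l * u)) (at x)" using 1 unfolding 2 3 by (simp add: p'_def algebra_simps)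
  hence "((%x. poly p x * (1 / poly q x) ^ m * exp (- l * (1 / poly q x))) has_real_derivative bump c d l p' (m + 2) x) (at x)"
   using True by (simp add: bump_def u_def q)
  thus ?thesis
   by (rule has_field_derivative_transform_within_open[where S="{c<..<d}"]) (use True in "auto simp: bump_def q")
 next
  case False
  have "bounded (poly p ` {c..d})" by (intro compact_imp_bounded compact_continuous_image continuous_intros) auto
  then obtain B where B1: "!!z. z : poly p ` {c..d} ==> norm z <= B" unfolding bounded_iff by blast
  have B: "\<bar>poly p y\<bar> <= B" if "c <= y" "y <= d" for y using B1[of "poly p y"] that by auto
  have B0: "B >= 0" using B[of c] cd by linarith
  define C where "C = B * (fact (m + 2) / l ^ (m + 2)) * (d - c)^2"
  have "\<bar>bump c d l p m y - bump c d l p m x\<bar> <= C * \<bar>y - x\<bar>^2" for y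
  proof (cases "c < y & y < d")
   case True
   define u where "u = 1 / ((y - c) * (d - y))"
   have u: "u > 0" using True by (simp add: u_def)
   have iu: "1 / u = (y - c) * (d - y)" by (simp add: u_def)
   have "(y - c) * (d - y) <= (d - c) * \<bar>y - x\<bar>"
   proof (cases "x <= c")
    case True
    have "(y - c) * (d - y) <= \<bar>y - x\<bar> * (d - c)" using True \<open>c < y & y < d\<close> by (intro mult_mono) auto
    thus ?thesis by (simp add: mult.commute)
   next
    case f: False
    thus ?thesis using False \<open>c < y & y < d\<close> by (intro mult_mono) auto
   qed
   hence iu2: "(1 / u)^2 <= (d - c)^2 * \<bar>y - x\<bar>^2" using True unfolding iu power_mult_distrib[symmetric] by (intro power_mono) auto
   have "\<bar>bump c d l p m y - bump c d l p m x\<bar> = \<bar>poly p y\<bar> * (u ^ m * exp (- l * u))"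
    using True False u by (auto simp: bump_def u_def[symmetric] abs_mult)
   also have "... <= B * (fact (m + 2) / l ^ (m + 2) * (1 / u)^2)"
    using True u l B0 by (intro mult_mono B exp_neg_power_bound) auto
   also have "... <= B * (fact (m + 2) / l ^ (m + 2) * ((d - c)^2 * \<bar>y - x\<bar>^2))"
    using B0 l by (intro mult_left_mono iu2) auto
   also have "... = C * \<bar>y - x\<bar>^2" by (simp only: C_def mult_ac)
   finally show ?thesis .
  next
   case f: False
   thus ?thesis using False B0 l by (auto simp: bump_def C_def)
  qed
  hence "(bump c d l p m has_real_derivative 0) (at x)" by (rule DERIV_zero_of_quadratic_bound)
  thus ?thesis using False by (auto simp: bump_def)
 qed
 thus ?thesis by blast
qed

lemma iterated_deriv_in_family:
 fixes \<F> :: "(real => real) set"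
 assumes "!!f. f : \<F> ==> EX f':\<F>. ALL x. (f has_real_derivative f' x) (at x)" "f : \<F>"
 shows "(deriv ^^ n) f : \<F>"
proof (induct n)
 case (Suc n)
 obtain f' where f': "f' : \<F>" "!!x. ((deriv ^^ n) f has_real_derivative f' x) (at x)" using assms(1)[OF Suc] by blast
 have "deriv ((deriv ^^ n) f) = f'" using DERIV_imp_deriv[OF f'(2)] by blast
 thus ?case using f'(1) by simp
qed (simp add: assms)

lemma smooth_of_family:
 fixes \<F> :: "(real => real) set"
 assumes "!!f. f : \<F> ==> EX f':\<F>. ALL x. (f has_real_derivative f' x) (at x)" "f : \<F>"
 shows "(deriv ^^ n) f field_differentiable (at x)"
 using assms(1)[OF iterated_deriv_in_family[OF assms, of n]] by (meson field_differentiable_def)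

text \<open>As \<open>k\<close> grows the exponent tends to zero, so the bells tend boundedly to the
  indicator of the open interval; this replaces mollification.\<close>

definition bell :: "real => real => nat => real => real" where "bell c d k = bump c d (1 / real (Suc k)) [:1:] 0"

lemma bell_bounds: assumes "c < d" shows "0 <= bell c d k x" "bell c d k x <= 1" "x ~: {c<..<d} ==> bell c d k x = 0" "c < x ==> x < d ==> 0 < bell c d k x"
 by (auto simp: bell_def bump_def)

lemma bell_tendsto: "(%k. bell c d k x) ---> indicator {c<..<d} x"
proof (cases "c < x & x < d")
 case True
 have "(%k. exp (- (1 / real (Suc k)) * (1 / ((x - c) * (d - x))))) ---> exp (- 0 * (1 / ((x - c) * (d - x))))"
  by (intro tendsto_intros LIMSEQ_Suc[OF lim_1_over_n])
 thus ?thesis using True by (simp add: bell_def bump_def)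
qed (auto simp: bell_def bump_def)

text \<open>Combinations of two bumps, because a second bell is subtracted to make an integral
  vanish before a compactly supported primitive is taken.\<close>

definition bells :: "(real => real) set" where
 "bells = {%x. \<alpha> * bump c d l p m x + be * bump c' d' l' p' m' x | \<alpha> c d l p m be c' d' l' p' m'. c < d & l > 0 & c' < d' & l' > 0}"

lemma bells_deriv: assumes "f : bells" shows "EX f':bells. ALL x. (f has_real_derivative f' x) (at x)"
proof -
 obtain \<alpha> c d l p m be c' d' l' p' m' where f: "f = (%x. \<alpha> * bump c d l p m x + be * bump c' d' l' p' m' x)"
  and pos: "c < d" "l > 0" "c' < d'" "l' > 0" using assms unfolding bells_def by blast
 obtain r r' where r: "!!x. (bump c d l p m has_real_derivative bump c d l r (m + 2) x) (at x)"
  "!!x. (bump c' d' l' p' m' has_real_derivative bump c' d' l' r' (m' + 2) x) (at x)"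
  using bump_deriv[OF pos(1,2)] bump_deriv[OF pos(3,4)] by metis
 have "(f has_real_derivative (\<alpha> * bump c d l r (m + 2) x + be * bump c' d' l' r' (m' + 2) x)) (at x)" for x
  unfolding f by (intro DERIV_add DERIV_cmult r)
 moreover have "(%x. \<alpha> * bump c d l r (m + 2) x + be * bump c' d' l' r' (m' + 2) x) : bells"
  unfolding bells_def using pos by blast
 ultimately show ?thesis by (intro bexI[where x="%x. \<alpha> * bump c d l r (m + 2) x + be * bump c' d' l' r' (m' + 2) x"] allI)
qed

lemma bell_in_bells: "c < d ==> c' < d' ==> (%x. \<alpha> * bell c d k x + be * bell c' d' k' x) : bells"
 unfolding bells_def bell_def by (auto intro!: exI)

lemma test_functionI:
 assumes "!!n x. (deriv ^^ n) th field_differentiable (at x)" "!!x. x ~: {c..d} ==> th x = 0" "a < c" "d < b"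
 shows "test_function {a<..<b} th"
proof -
 have "x : {c..d}" if "th x ~= 0" for x using assms(2)[of x] that by blast
 hence cl: "closure {x. th x ~= 0} <= {c..d}" by (intro closure_minimal) auto
 moreover have "{c..d} <= {a<..<b}" using assms by auto
 moreover have "compact (closure {x. th x ~= 0})"
  using cl by (meson bounded_closed_interval bounded_subset closed_closure compact_eq_bounded_closed)
 ultimately show ?thesis using assms(1) unfolding test_function_def by blast
qed

lemma test_bell:
 assumes "a < c" "c < d" "d < b" shows "test_function {a<..<b} (bell c d k)"
proof (rule test_functionI[where c=c and d=d])
 have "(%x. 1 * bell c d k x + 0 * bell c d k x) : bells" by (intro bell_in_bells assms)
 hence "bell c d k : bells" by simp
 thus "(deriv ^^ n) (bell c d k) field_differentiable (at x)" for n x by (intro smooth_of_family[OF bells_deriv])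
qed (use assms bell_bounds in auto)

lemma test_primitive:
 assumes sh: "sh : bells" and d: "!!x. (th has_real_derivative sh x) (at x)"
  and 0: "!!x. x ~: {c..d} ==> th x = 0" "a < c" "d < b"
 shows "test_function {a<..<b} th" (is ?A) "deriv th = sh" (is ?B)
proof -
 show ?A
  \<comment> \<open>The primitive itself need not be such a combination, but the family stays closed
    under differentiation when it is added.\<close>
  by (rule test_functionI[OF smooth_of_family[of "insert th bells"] 0]) (use bells_deriv sh d in blast)+
 show ?B using DERIV_imp_deriv[OF d] by blast
qed

lemma test_functionD:
 assumes "test_function {a<..<b} th" "a < b"
 shows "(th has_real_derivative deriv th x) (at x)" (is ?A) "continuous_on UNIV th" (is ?B) "continuous_on UNIV (deriv th)" (is ?C)
  "EX c d. a < c & c < d & d < b & (ALL x. x ~: {c..d} --> th x = 0 & deriv th x = 0)" (is ?D)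
proof -
 have sm: "(deriv ^^ n) th field_differentiable (at x)" for n x using assms(1) by (simp add: test_function_def)
 have d0: "(th has_real_derivative deriv th x) (at x)" for x
  using sm[of 0 x] by (simp add: field_differentiable_derivI)
 thus ?A .
 show ?B using d0 by (meson DERIV_isCont continuous_at_imp_continuous_on)
 show ?C
  using sm[of 1] by (auto intro!: continuous_at_imp_continuous_on field_differentiable_imp_continuous_at)
 define S where "S = closure {x. th x ~= 0}"
 have S: "compact S" "S <= {a<..<b}" using assms(1) by (auto simp: test_function_def S_def)
 have z: "th x = 0 & deriv th x = 0" if "x ~: S" for x
 proof
  have cl: "th y = 0" if "y ~: S" for y using that closure_subset[of "{x. th x ~= 0}"] by (auto simp: S_def)
  thus "th x = 0" using that by blast
  have op: "open (- S)" using S(1) by (simp add: compact_imp_closed open_Compl)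
  have eq: "0 = th y" if "y : - S" for y using cl[of y] that by simp
  have "(th has_real_derivative 0) (at x)"
   by (rule has_field_derivative_transform_within_open[OF DERIV_const op _ eq]) (use that in simp)
  thus "deriv th x = 0" by (rule DERIV_imp_deriv)
 qed
 show ?D
 proof (cases "S = {}")
  case True
  obtain c where "a < c" "c < b" using dense[OF assms(2)] by blast
  moreover obtain d where "c < d" "d < b" using dense[OF calculation(2)] by blast
  ultimately show ?thesis using z True by blast
 next
  case False
  obtain s where s: "s : S" "!!y. y : S ==> s <= y" using compact_attains_inf[OF S(1) False] by blast
  obtain t where t: "t : S" "!!y. y : S ==> y <= t" using compact_attains_sup[OF S(1) False] by blast
  have "t < b" using t(1) S(2) by auto
  then obtain d where d: "t < d" "d < b" using dense by blast
  have "a < s" "s < d" using s(1) S(2) t(2)[of s] d by auto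
  moreover have "x ~: S" if "x ~: {s..d}" for x using that s(2)[of x] t(2)[of x] d by auto
  ultimately show ?thesis using z d by blast
 qed
qed

lemma borel_measurable_lebesgue_AE:
 fixes f g :: "'a::euclidean_space => 'b::topological_space"
 assumes g: "g : borel_measurable lebesgue" and ae: "AE x in lebesgue. f x = g x"
 shows "f : borel_measurable lebesgue"
proof (rule measurableI)
 obtain N where N: "{x : space lebesgue. f x ~= g x} <= N" "emeasure lebesgue N = 0" "N : sets lebesgue" using ae by (rule AE_E)
 fix B :: "'b set" assume B: "B : sets borel"
 have 1: "f -` B \<inter> N : sets lebesgue"
  using null_sets_completion_subset[of "f -` B \<inter> N" N lborel] N(2,3) by (auto simp: null_sets_def)
 have 2: "g -` B : sets lebesgue" using measurable_sets[OF g B] by simp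
 have eq: "f -` B = (g -` B - N) \<union> (f -` B \<inter> N)" using N(1) by auto
 show "f -` B \<inter> space lebesgue : sets lebesgue"
  using sets.Un[OF sets.Diff[OF 2 N(3)] 1] unfolding eq[symmetric] by simp
qed simp

lemma borel_measurable_lebesgue_on_AE:
 fixes f g :: "'a::euclidean_space => 'b::topological_space"
 assumes S: "S : sets lebesgue" and g: "g : borel_measurable lebesgue" and ae: "AE x in lebesgue_on S. f x = g x"
 shows "f : borel_measurable (lebesgue_on S)"
proof -
 have "AE x in lebesgue. x : S --> f x = g x" using ae S by (simp add: AE_restrict_space_iff)
 hence "AE x in lebesgue. (if x : S then f x else g x) = g x" by eventually_elim auto
 hence "(%x. if x : S then f x else g x) : borel_measurable lebesgue" by (rule borel_measurable_lebesgue_AE[OF g])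
 hence "(%x. if x : S then f x else g x) : borel_measurable (lebesgue_on S)" by (rule measurable_restrict_space1)
 thus ?thesis by (rule measurable_cong[THEN iffD1, rotated]) simp
qed

section \<open>Weak derivatives and absolutely continuous representatives\<close>

context interval
begin

abbreviation "Om \<equiv> {a<..<b}"

lemma AE_Om: "(AE x in lebesgue_on Om. P x) \<longleftrightarrow> (AE x in mX. P x)"
 unfolding mX_def by (rule lebesgue_on_AE_mes) simp

text \<open>The bridge between the statement, which integrates completion-measurable functions over
  \<open>lebesgue_on\<close>, and the proof, which works with Borel functions and \<open>mX\<close>:
  completeness makes agreement almost everywhere sufficient.\<close>

lemma lebesgue_rep:
 fixes f g :: "real => 'b::euclidean_space"
 assumes g: "g : BM" and ae: "AE x in mX. f x = g x"
 shows "f : borel_measurable (lebesgue_on Om)" (is ?A) "integrable (lebesgue_on Om) f \<longleftrightarrow> integrable mX g" (is ?B)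
  "(LINT x|lebesgue_on Om. f x) = (LX x. g x)" (is ?C)
proof -
 have ae': "AE x in lebesgue_on Om. f x = g x" using ae by (simp add: AE_Om)
 note l = lebesgue_on_mes[of Om g, OF _ g, folded mX_def]
 show m: ?A
  by (rule borel_measurable_lebesgue_on_AE[OF _ _ ae']) (use g in "auto intro: measurable_completion")
 have gm: "g : borel_measurable (lebesgue_on Om)" using l(4) by simp
 show ?B using integrable_cong_AE[OF m gm ae'] l(2) by simp
 show ?C using integral_cong_AE[OF m gm ae'] l(1) by simp
qed

lemma lebesgue_rep_exists:
 fixes f :: "real => real"
 assumes "f : borel_measurable (lebesgue_on Om)"
 shows "EX g. g : BM & (AE x in mX. f x = g x)"
proof -
 have "(%x. indicator Om x *\<^sub>R f x) : borel_measurable (completion lborel)"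
  using assms by (simp add: borel_measurable_restrict_space_iff)
 from completion_ex_borel_measurable_real[OF this] obtain g where g: "g : BM" "AE x in lborel. indicator Om x *\<^sub>R f x = g x" by auto
 have "AE x in mX. f x = g x" unfolding AE_mX using g(2) by eventually_elim (auto simp: indicator_def)
 thus ?thesis using g(1) by blast
qed

lemma L2I:
 fixes u :: "real => 'b::euclidean_space"
 assumes "sq_int mX r" "AE x in mX. u x = r x"
 shows "u : L2 Om" "L2_norm Om u = sqrt (sqn mX r)" (is ?A)
proof -
 have r: "r : BM" using sq_intD[OF assms(1)] by simp
 have ae: "AE x in mX. (norm (u x))^2 = (norm (r x))^2" using assms(2) by eventually_elim simp
 have m: "(%x. (norm (r x))^2) : BM" using r by measurable
 show "u : L2 Om" unfolding L2_def using lebesgue_rep(1)[OF r assms(2)] lebesgue_rep(2)[OF m ae] sq_int_integrable[OF assms(1)] by simp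
 show ?A unfolding L2_norm_def using lebesgue_rep(3)[OF m ae] by simp
qed

lemma L2E:
 fixes u :: "real => real"
 assumes "u : L2 Om" obtains r where "sq_int mX r" "AE x in mX. u x = r x"
proof -
 have u: "u : borel_measurable (lebesgue_on Om)" "integrable (lebesgue_on Om) (%x. (norm (u x))^2)" using assms by (auto simp: L2_def)
 obtain r where r: "r : BM" "AE x in mX. u x = r x" using lebesgue_rep_exists[OF u(1)] by blast
 have ae: "AE x in mX. (norm (u x))^2 = (norm (r x))^2" using r(2) by eventually_elim simp
 have "integrable mX (%x. (norm (r x))^2)" using lebesgue_rep(2)[OF _ ae] u(2) r(1) by simp
 hence "sq_int mX r" using r(1) by (simp add: sq_int_def)
 thus ?thesis using r(2) that by blast
qed

lemma locally_integrableI: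
 fixes u :: "real => 'b::euclidean_space"
 assumes "integrable mX r" "AE x in mX. u x = r x" shows "locally_integrable Om u"
 unfolding locally_integrable_def
proof (intro allI impI, elim conjE)
 fix K assume K: "compact K" "K <= Om"
 have r: "r : BM" using borel_measurable_integrable[OF assms(1)] by simp
 have "integrable (lebesgue_on Om) u" using lebesgue_rep(2)[OF r assms(2)] assms(1) by simp
 hence "set_integrable lebesgue Om u" by (simp add: integrable_restrict_space set_integrable_def)
 thus "u absolutely_integrable_on K" by (rule set_integrable_subset) (use K in "auto simp: compact_imp_closed")
qed

lemma integrable_test_mult:
 fixes u :: "real => 'b::euclidean_space"
 assumes u: "locally_integrable Om u" and th: "continuous_on UNIV th" "!!x. x ~: {c..d} ==> th x = 0" and cd: "a < c" "d < b"
 shows "integrable (lebesgue_on Om) (%x. th x *\<^sub>R u x)"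
proof -
 have "compact {c..d}" "{c..d} <= Om" using cd by auto
 hence i: "integrable lebesgue (%x. indicator {c..d} x *\<^sub>R u x)" using u by (simp add: locally_integrable_def set_integrable_def)
 have "bounded (th ` {c..d})" using th(1) by (intro compact_imp_bounded compact_continuous_image) (auto intro: continuous_on_subset)
 then obtain B where B: "!!z. z : th ` {c..d} ==> norm z <= B" unfolding bounded_iff by blast
 have "th : borel_measurable lborel" using borel_measurable_continuous_onI[OF th(1)] by simp
 hence thM: "th : borel_measurable lebesgue" by (rule measurable_completion)
 have iz: "integrable lebesgue (%x. th x *\<^sub>R (indicator {c..d} x *\<^sub>R u x))"
 proof (rule Bochner_integrable_bound[OF integrable_scaleR_right[OF i, of B]])
  show "(%x. th x *\<^sub>R (indicator {c..d} x *\<^sub>R u x)) : borel_measurable lebesgue"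
   by (intro borel_measurable_scaleR thM borel_measurable_integrable[OF i])
  have "norm (th x *\<^sub>R (indicator {c..d} x *\<^sub>R u x)) <= norm (B *\<^sub>R (indicator {c..d} x *\<^sub>R u x))" for x
  proof (cases "x : {c..d}")
   case True
   hence "\<bar>th x\<bar> <= \<bar>B\<bar>" using B[of "th x"] by force
   thus ?thesis using True by (simp add: mult_right_mono)
  qed simp
  thus "AE x in lebesgue. norm (th x *\<^sub>R (indicator {c..d} x *\<^sub>R u x)) <= norm (B *\<^sub>R (indicator {c..d} x *\<^sub>R u x))" by simp
 qed
 have eq: "th x *\<^sub>R (indicator {c..d} x *\<^sub>R u x) = indicator Om x *\<^sub>R (th x *\<^sub>R u x)" for x
  using th(2)[of x] cd by (auto simp: indicator_def)
 show ?thesis using iz unfolding eq by (subst integrable_restrict_space) auto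
qed

lemma test_mult_integrable:
 fixes u :: "real => 'b::euclidean_space"
 assumes "locally_integrable Om u" "test_function Om th"
 shows "integrable (lebesgue_on Om) (%x. th x *\<^sub>R u x)" (is ?A) "integrable (lebesgue_on Om) (%x. deriv th x *\<^sub>R u x)" (is ?B)
proof -
 note t = test_functionD[OF assms(2) ab]
 obtain c d where "a < c" "d < b" "!!x. x ~: {c..d} ==> th x = 0 & deriv th x = 0" using t(4) by blast
 thus ?A ?B using integrable_test_mult[OF assms(1) t(2)] integrable_test_mult[OF assms(1) t(3)] by blast+
qed

text \<open>Local integrability speaks of compact sets only; measurability on the whole interval is
  obtained by exhausting it with compact intervals, and then a Borel representative exists.\<close>

lemma locally_integrableE:
 fixes u :: "real => real"
 assumes "locally_integrable Om u"
 shows "EX r. r : BM & (AE x in mX. u x = r x) & (ALL c d. a < c --> d < b --> integrable mX (%x. indicator {c..d} x * r x))"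
proof -
 define z where "z n x = indicator {a + 1 / real (Suc n)..b - 1 / real (Suc n)} x *\<^sub>R u x" for n x
 have i: "integrable lebesgue (%x. indicator {c..d} x *\<^sub>R u x)" if "a < c" "d < b" for c d
 proof -
  have "compact {c..d}" "{c..d} <= Om" using that by auto
  thus ?thesis using assms by (simp add: locally_integrable_def set_integrable_def)
 qed
 have zm: "z n : borel_measurable lebesgue" for n unfolding z_def using i[of "a + 1 / real (Suc n)" "b - 1 / real (Suc n)"] by simp
 have zl: "(%n. z n x) ---> indicator Om x *\<^sub>R u x" for x
 proof (cases "x : Om")
  case True
  have l: "(%n. a + 1 / real (Suc n)) ---> a + 0" "(%n. b - 1 / real (Suc n)) ---> b - 0"
   by (intro tendsto_intros LIMSEQ_Suc[OF lim_1_over_n])+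
  have "\<forall>\<^sub>F n in sequentially. a + 1 / real (Suc n) < x" "\<forall>\<^sub>F n in sequentially. x < b - 1 / real (Suc n)"
   using order_tendstoD(2)[OF l(1), of x] order_tendstoD(1)[OF l(2), of x] True by auto
  hence "\<forall>\<^sub>F n in sequentially. z n x = indicator Om x *\<^sub>R u x"
   by eventually_elim (use True in "auto simp: z_def")
  thus ?thesis by (rule tendsto_eventually)
 next
  case False
  have "z n x = 0" for n
  proof -
   have "1 / real (Suc n) > 0" by simp
   hence "x ~: {a + 1 / real (Suc n)..b - 1 / real (Suc n)}" using False unfolding greaterThanLessThan_iff atLeastAtMost_iff by linarith
   thus ?thesis by (simp add: z_def)
  qed
  thus ?thesis using False by simp
 qed
 have "(%x. indicator Om x *\<^sub>R u x) : borel_measurable lebesgue" by (rule borel_measurable_LIMSEQ_real[OF zl zm])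
 hence um: "u : borel_measurable (lebesgue_on Om)" by (simp add: borel_measurable_restrict_space_iff)
 obtain r where r: "r : BM" "AE x in mX. u x = r x" using lebesgue_rep_exists[OF um] by blast
 have "integrable mX (%x. indicator {c..d} x * r x)" if cd: "a < c" "d < b" for c d
 proof -
  have eq: "indicator Om x *\<^sub>R (indicator {c..d} x *\<^sub>R u x) = indicator {c..d} x *\<^sub>R u x" for x using cd by (auto simp: indicator_def)
  have "integrable (lebesgue_on Om) (%x. indicator {c..d} x *\<^sub>R u x)"
   by (subst integrable_restrict_space, simp) (use i[OF cd] in "simp only: eq")
  moreover have "AE x in mX. indicator {c..d} x *\<^sub>R u x = indicator {c..d} x * r x" using r(2) by eventually_elim simp
  ultimately show ?thesis using lebesgue_rep(2)[of "%x. indicator {c..d} x * r x" "%x. indicator {c..d} x *\<^sub>R u x"] r(1) by simp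
 qed
 thus ?thesis using r by blast
qed

text \<open>Bells converge to indicators of compactly contained open intervals, over which
  \<open>h\<close> therefore integrates to zero; on each of them vanishing primitives give
  \<open>h = 0\<close>, and such intervals exhaust (a,b).\<close>

lemma fundamental_lemma:
 assumes h: "h : BM" "!!c d. a < c ==> d < b ==> integrable mX (%x. indicator {c..d} x * h x)"
  and 0: "!!c d k. a < c ==> c < d ==> d < b ==> (LX x. bell c d k x * h x) = 0"
 shows "AE x in mX. h x = 0"
proof -
 note [measurable] = h(1)
 have bm [measurable]: "bell c d k : BM" if "a < c" "c < d" "d < b" for c d k
  using test_functionD(2)[OF test_bell[OF that] ab] by (rule borel_measurable_continuous_onI)
 have open0: "(LX x. indicator {c<..<d} x * h x) = 0" if cd: "a < c" "d < b" for c d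
 proof (cases "c < d")
  case True
  have "(%k. LX x. bell c d k x * h x) ---> (LX x. indicator {c<..<d} x * h x)"
  proof (rule integral_dominated_convergence[where w="%x. \<bar>indicator {c..d} x * h x\<bar>"])
   show "integrable mX (%x. \<bar>indicator {c..d} x * h x\<bar>)" by (intro integrable_abs h cd)
   show "AE x in mX. (%k. bell c d k x * h x) ---> indicator {c<..<d} x * h x"
    by (intro AE_I2 tendsto_intros bell_tendsto)
   show "AE x in mX. norm (bell c d k x * h x) <= \<bar>indicator {c..d} x * h x\<bar>" for k
   proof (rule AE_I2)
    fix x show "norm (bell c d k x * h x) <= \<bar>indicator {c..d} x * h x\<bar>"
     using bell_bounds(1,2)[OF True, of k x] bell_bounds(3)[OF True, of x k] by (cases "x : {c<..<d}") (auto simp: abs_mult mult_left_le_one_le)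
   qed
  qed (use bm[OF cd(1) True cd(2)] in auto)
  thus ?thesis using 0[OF cd(1) True cd(2)] by (simp add: LIMSEQ_const_iff)
 qed simp
 have loc: "AE x in mX. indicator {c<..<d} x * h x = 0" if cd: "a < c" "d < b" for c d
 proof (rule integral_interval_unique[OF finite_mX sets_mX])
  have eq: "indicator {c<..<d} x * h x = indicator {c<..<d} x * (indicator {c..d} x * h x)" for x by (auto simp: indicator_def)
  show "integrable mX (%x. indicator {c<..<d} x * h x)" unfolding eq by (rule X.integrable_indicator_mult[OF h(2)[OF cd]]) simp
  fix y
  have "(LX x. indicator {..y} x * (indicator {c<..<d} x * h x)) = (LX x. indicator {c<..<min y d} x * h x)"
   by (rule integral_cong_AE) (use X.AE_neq[of y] in "auto elim!: eventually_mono simp: indicator_def")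
  thus "(LX x. indicator {..y} x * (indicator {c<..<d} x * h x)) = 0" using open0[of c "min y d"] cd by simp
 qed
 have "AE x in mX. ALL n. indicator {a + 1 / real (Suc n)<..<b - 1 / real (Suc n)} x * h x = 0"
  unfolding AE_all_countable by (intro allI loc) auto
 thus ?thesis unfolding AE_mX
 proof eventually_elim
  case (elim x)
  show ?case
  proof
   assume x: "a < x & x < b"
   obtain n where n: "1 / real (Suc n) < min (x - a) (b - x)" using x nat_approx_posE[of "min (x - a) (b - x)"] by auto
   hence "x : {a + 1 / real (Suc n)<..<b - 1 / real (Suc n)}" by auto
   moreover have "indicator {a + 1 / real (Suc n)<..<b - 1 / real (Suc n)} x * h x = 0" using elim x by blast
   ultimately show "h x = 0" by (metis indicator_simps(1) mult_1)
  qed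
 qed
qed

lemma test_integral: assumes "test_function Om th" shows "(LX x. deriv th x) = 0" (is ?A) "a <= x ==> x <= b ==> cumX (deriv th) x = th x"
  "integrable mX (deriv th)" (is ?C) "deriv th : BM" (is ?D) "th : BM" (is ?E) "bdm th" "bdm (deriv th)" (is ?F)
proof -
 note t = test_functionD[OF assms ab]
 obtain c d where cd: "a < c" "d < b" "!!x. x ~: {c..d} ==> th x = 0" using t(4) by blast
 show m: ?D ?E using t(2,3) by (auto intro: borel_measurable_continuous_onI)
 show "bdm th" ?F by (intro bdm_continuous m continuous_on_subset[OF t(2)] continuous_on_subset[OF t(3)]; simp)+
 thus ?C by (intro bdm_integrable)
 have z: "th a = 0" "th b = 0" using cd(3)[of a] cd(3)[of b] cd(1,2) by auto
 have ac: "ac (%x. th (max a (min b x))) (deriv th)"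
  by (rule ac_of_deriv) (auto intro: t(1) continuous_on_subset[OF t(3)] m)
 have cum: "cumX (deriv th) x = th x" if "a <= x" "x <= b" for x
  using acD(2)[OF ac, of x] that z ab by (simp add: max_def min_def split: if_splits)
 thus "a <= x ==> x <= b ==> cumX (deriv th) x = th x" .
 show ?A using cumX_ge_b[OF order_refl m(1)] cum[of b] z ab by simp
qed

lemma ac_test:
 assumes "ac ph v" "test_function Om th" shows "(LX x. deriv th x * ph x) = - (LX x. th x * v x)"
proof -
 note t = test_integral[OF assms(2)]
 have "(LX x. v x * cumX (deriv th) x) = (LX x. th x * v x)"
  by (rule integral_cong_AE) (use t ac_measurable_deriv[OF assms(1)] X.borel_measurable_cum in "auto intro!: AE_mXI")
 thus ?thesis using ac_ibp[OF assms(1) t(3)] t(1) by simp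
qed

lemma test_rep:
 fixes u :: "real => real"
 assumes r: "r : BM" "AE x in mX. u x = r x" and t: "t : BM"
  and i: "integrable (lebesgue_on Om) (%x. t x *\<^sub>R u x)"
 shows "integrable mX (%x. t x * r x)" (is ?A) "(LINT x|lebesgue_on Om. t x *\<^sub>R u x) = (LX x. t x * r x)" (is ?B)
proof -
 have ae: "AE x in mX. t x *\<^sub>R u x = t x * r x" using r(2) by eventually_elim simp
 have m: "(%x. t x * r x) : BM" using t r(1) by measurable
 show ?A using lebesgue_rep(2)[OF m ae] i by simp
 show ?B by (rule lebesgue_rep(3)[OF m ae])
qed

lemma weak_deriv_AE_unique:
 fixes u :: "real => real"
 assumes "has_weak_deriv Om u v1" "has_weak_deriv Om u v2"
 shows "AE x in mX. v1 x = v2 x"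
proof -
 have li: "locally_integrable Om v1" "locally_integrable Om v2" using assms by (auto simp: has_weak_deriv_def)
 obtain r1 where r1: "r1 : BM" "AE x in mX. v1 x = r1 x" "!!c d. a < c ==> d < b ==> integrable mX (%x. indicator {c..d} x * r1 x)"
  using locally_integrableE[OF li(1)] by blast
 obtain r2 where r2: "r2 : BM" "AE x in mX. v2 x = r2 x" "!!c d. a < c ==> d < b ==> integrable mX (%x. indicator {c..d} x * r2 x)"
  using locally_integrableE[OF li(2)] by blast
 have "AE x in mX. r1 x - r2 x = 0"
 proof (rule fundamental_lemma)
  show "(%x. r1 x - r2 x) : BM" using r1(1) r2(1) by simp
  show "integrable mX (%x. indicator {c..d} x * (r1 x - r2 x))" if "a < c" "d < b" for c d
   using Bochner_integrable_diff[OF r1(3)[OF that] r2(3)[OF that]] by (simp add: right_diff_distrib)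
  fix c d k assume cd: "a < c" "c < d" "d < b"
  let ?t = "bell c d k"
  have t: "test_function Om ?t" by (rule test_bell[OF cd])
  note R1 = test_rep[OF r1(1,2) test_integral(5)[OF t] test_mult_integrable(1)[OF li(1) t]]
  note R2 = test_rep[OF r2(1,2) test_integral(5)[OF t] test_mult_integrable(1)[OF li(2) t]]
  have "(LX x. ?t x * r1 x) = (LX x. ?t x * r2 x)"
  proof -
   have "(LINT x|lebesgue_on Om. deriv ?t x *\<^sub>R u x) = - (LINT x|lebesgue_on Om. ?t x *\<^sub>R v1 x)"
    "(LINT x|lebesgue_on Om. deriv ?t x *\<^sub>R u x) = - (LINT x|lebesgue_on Om. ?t x *\<^sub>R v2 x)"
    using assms t unfolding has_weak_deriv_def by blast+
   thus ?thesis unfolding R1(2) R2(2) by linarith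
  qed
  thus "(LX x. ?t x * (r1 x - r2 x)) = 0" using R1(1) R2(1) by (simp add: right_diff_distrib)
 qed
 with r1(2) r2(2) show ?thesis by eventually_elim simp
qed

lemma has_weak_deriv_ac:
 fixes u v' :: "real => real"
 assumes ac: "ac ph v" and u: "AE x in mX. u x = ph x" and v': "AE x in mX. v' x = v x"
 shows "has_weak_deriv Om u v'"
proof -
 have li: "locally_integrable Om u" "locally_integrable Om v'"
  by (rule locally_integrableI[OF sq_int_imp_integrable[OF ac_sq_int[OF ac]] u], rule locally_integrableI[OF ac_integrable[OF ac] v'])
 have "(LINT x|lebesgue_on Om. deriv th x *\<^sub>R u x) = - (LINT x|lebesgue_on Om. th x *\<^sub>R v' x)" if t: "test_function Om th" for th
  unfolding test_rep(2)[OF ac_measurable[OF ac] u test_integral(4)[OF t] test_mult_integrable(2)[OF li(1) t]]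
   test_rep(2)[OF ac_measurable_deriv[OF ac] v' test_integral(5)[OF t] test_mult_integrable(1)[OF li(2) t]]
  by (rule ac_test[OF ac t])
 thus ?thesis using li by (simp add: has_weak_deriv_def)
qed

lemma weak_deriv_AE:
 fixes u :: "real => real"
 assumes "has_weak_deriv Om u v" shows "AE x in mX. weak_deriv Om u x = v x"
 unfolding weak_deriv_def by (rule weak_deriv_AE_unique[OF someI[of "has_weak_deriv Om u", OF assms] assms])

text \<open>The antiderivative is constant on either side of the two supports, and mean zero makes
  the two constants equal; subtracting the value at \<open>a\<close> leaves a test function.\<close>

lemma bells_primitive:
 assumes sh: "sh = (%x. \<alpha> * bell c d k x + be * bell c' d' k' x)" and cd: "a < c" "c < d" "d < b" "a < c'" "c' < d'" "d' < b"
  and 0: "(LX x. sh x) = 0"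
 shows "EX th. test_function Om th & deriv th = sh"
proof -
 have bells: "sh : bells" unfolding sh by (rule bell_in_bells[OF cd(2,5)])
 obtain sh' where sh': "!!x. (sh has_real_derivative sh' x) (at x)" using bells_deriv[OF bells] by blast
 have cont: "continuous_on UNIV sh" using sh' by (meson DERIV_isCont continuous_at_imp_continuous_on)
 have "EX F. ALL x::real. - \<infinity> < ereal x --> ereal x < \<infinity> --> (F has_vector_derivative sh x) (at x)"
  by (rule einterval_antiderivative) (use sh' in "auto intro: DERIV_isCont")
 then obtain F where F: "!!x. (F has_real_derivative sh x) (at x)" by (auto simp: has_real_derivative_iff_has_vector_derivative)
 define th where "th x = F x - F a" for x
 have dth: "(th has_real_derivative sh x) (at x)" for x unfolding th_def using DERIV_diff[OF F DERIV_const] by simp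
 have m: "sh : BM" using cont by (rule borel_measurable_continuous_onI)
 have "ac (%x. F (max a (min b x))) sh" by (rule ac_of_deriv) (auto intro: F continuous_on_subset[OF cont] m)
 from acD(2)[OF this, of b] have Fb: "F b = F a" using 0 cumX_ge_b[OF order_refl m] ab by simp
 define l u where "l = min c c'" and "u = max d d'"
 have lu: "a < l" "u < b" "l < u" using cd by (auto simp: l_def u_def)
 have z: "sh x = 0" if "x ~: {l<..<u}" for x
 proof -
  have "x ~: {c<..<d}" "x ~: {c'<..<d'}" using that by (auto simp: l_def u_def)
  thus ?thesis unfolding sh by (simp add: bell_bounds(3)[OF cd(2)] bell_bounds(3)[OF cd(5)])
 qed
 have dw: "(F has_real_derivative 0) (at x within S)" if "x ~: {l<..<u}" for x S
  using has_field_derivative_at_within[OF F[of x], of S] z[OF that] by simp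
 obtain C1 where C1: "ALL x:{..l}. F x = C1" using has_field_derivative_zero_constant[of "{..l}" F] dw by auto
 obtain C2 where C2: "ALL x:{u..}. F x = C2" using has_field_derivative_zero_constant[of "{u..}" F] dw by auto
 have "th x = 0" if "x ~: {l..u}" for x
 proof (cases "x < l")
  case True thus ?thesis using C1 lu by (simp add: th_def)
 next
  case False
  hence "x : {u..}" "b : {u..}" using that lu by auto
  thus ?thesis using C2 Fb by (simp add: th_def)
 qed
 from test_primitive[OF bells dth this lu(1,2)] show ?thesis by blast
qed

text \<open>The du Bois-Reymond lemma. An arbitrary bell minus the multiple of one fixed bell that
  balances its integral is the derivative of a test function; thus \<open>w\<close> integrates
  against every bell like the constant \<open>ka\<close>, its mean with respect to the fixed
  bell.\<close>

lemma AE_const_of_weak_deriv_zero: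
 assumes w: "integrable mX w" and 0: "!!th. test_function Om th ==> (LX x. deriv th x * w x) = 0"
 shows "EX ka. AE x in mX. w x = ka"
proof -
 obtain c0 where c0: "a < c0" "c0 < b" using dense[OF ab] by blast
 obtain d0 where d0: "c0 < d0" "d0 < b" using dense[OF c0(2)] by blast
 let ?B = "bell c0 d0 0"
 have [measurable]: "w : BM" using borel_measurable_integrable[OF w] by simp
 have bd: "bdm (bell c d k)" if "a < c" "c < d" "d < b" for c d k by (rule test_integral(6)[OF test_bell[OF that]])
 have ib: "integrable mX (bell c d k)" if "a < c" "c < d" "d < b" for c d k by (rule bdm_integrable[OF bd[OF that]])
 have ibw: "integrable mX (%x. bell c d k x * w x)" if cd: "a < c" "c < d" "d < b" for c d k
 proof (rule Bochner_integrable_bound[OF w])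
  have "bell c d k : BM" using bd[OF cd] by (auto simp: bconv_def)
  thus "(%x. bell c d k x * w x) : borel_measurable mX" by simp
  show "AE x in mX. norm (bell c d k x * w x) <= norm (w x)"
   using bell_bounds(1,2)[OF cd(2)] by (intro AE_I2) (simp add: abs_mult mult_left_le_one_le)
 qed
 define I where "I = (LX x. ?B x)"
 have "I > 0"
 proof (rule ccontr)
  assume "~ I > 0"
  moreover have "I >= 0" unfolding I_def by (intro integral_nonneg_AE AE_I2 bell_bounds d0)
  ultimately have "(LX x. ?B x) = 0" by (simp add: I_def)
  hence "AE x in mX. ?B x = 0" using integral_nonneg_eq_0_iff_AE[OF ib[OF c0(1) d0], of 0] bell_bounds(1)[OF d0(1)] by simp
  hence "AE x in lborel. x ~: {c0<..<d0}" unfolding AE_mX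
  proof eventually_elim
   case (elim x)
   thus ?case using bell_bounds(4)[OF d0(1), of x 0] c0 d0 by force
  qed
  hence "{c0<..<d0} : null_sets lborel" by (subst AE_iff_null_sets) auto
  thus False using d0 by (auto simp: null_sets_def)
 qed
 define ka where "ka = (LX x. ?B x * w x) / I"
 have "AE x in mX. w x - ka = 0"
 proof (rule fundamental_lemma)
  show "(%x. w x - ka) : BM" by measurable
  show "integrable mX (%x. indicator {c..d} x * (w x - ka))" for c d using w by (intro X.integrable_indicator_mult) auto
  fix c d k assume cd: "a < c" "c < d" "d < b"
  define s where "s = (LX x. bell c d k x) / I"
  define sh where "sh = (%x. 1 * bell c d k x + (- s) * ?B x)"
  have "(LX x. sh x) = (LX x. bell c d k x) - s * I"
   unfolding sh_def I_def using ib[OF cd, of k] ib[OF c0(1) d0, of 0] by simp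
  hence "(LX x. sh x) = 0" using \<open>I > 0\<close> by (simp add: s_def)
  from bells_primitive[OF sh_def cd c0(1) d0 this] obtain th where "test_function Om th" "deriv th = sh" by blast
  hence "(LX x. sh x * w x) = 0" using 0 by blast
  moreover have "(LX x. sh x * w x) = (LX x. bell c d k x * w x) - s * (LX x. ?B x * w x)"
   unfolding sh_def using ibw[OF cd, of k] ibw[OF c0(1) d0, of 0] by (simp add: left_diff_distrib mult.assoc)
  moreover have "s * (LX x. ?B x * w x) = ka * (LX x. bell c d k x)" by (simp add: s_def ka_def)
  moreover have "(LX x. bell c d k x * (w x - ka)) = (LX x. bell c d k x * w x) - (LX x. bell c d k x) * ka"
   using ibw[OF cd, of k] ib[OF cd, of k] by (simp add: right_diff_distrib)
  ultimately show "(LX x. bell c d k x * (w x - ka)) = 0" by (simp add: mult.commute)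
 qed
 thus ?thesis by (intro exI[of _ ka]) simp
qed

text \<open>Subtracting the primitive of the weak derivative leaves a function with weak derivative
  zero, hence a constant. This converts abstract test functions into the pairs of
  \<open>ac\<close>.\<close>

lemma H1_realE:
 fixes u :: "real => real"
 assumes "u : H1 Om"
 obtains ph v where "ac ph v" "AE x in mX. u x = ph x" "AE x in mX. weak_deriv Om u x = v x"
proof -
 obtain v where u: "u : L2 Om" "v : L2 Om" "has_weak_deriv Om u v" using assms by (auto simp: H1_def)
 obtain r where r: "sq_int mX r" "AE x in mX. u x = r x" using L2E[OF u(1)] by blast
 obtain s where s: "sq_int mX s" "AE x in mX. v x = s x" using L2E[OF u(2)] by blast
 have acs: "ac (cumX s) s" using acI[OF s(1), of "cumX s" 0] by simp
 have li: "locally_integrable Om u" "locally_integrable Om v" using u(3) by (auto simp: has_weak_deriv_def)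
 have ic: "integrable mX (cumX s)" by (rule sq_int_imp_integrable[OF ac_sq_int[OF acs]])
 have "EX ka. AE x in mX. r x - cumX s x = ka"
 proof (rule AE_const_of_weak_deriv_zero)
  show "integrable mX (%x. r x - cumX s x)" using ic sq_int_imp_integrable[OF r(1)] by simp
  fix th assume t: "test_function Om th"
  note R = test_rep[OF sq_meas[OF r(1)] r(2) test_integral(4)[OF t] test_mult_integrable(2)[OF li(1) t]]
  note S = test_rep[OF sq_meas[OF s(1)] s(2) test_integral(5)[OF t] test_mult_integrable(1)[OF li(2) t]]
  have "(LINT x|lebesgue_on Om. deriv th x *\<^sub>R u x) = - (LINT x|lebesgue_on Om. th x *\<^sub>R v x)"
   using u(3) t unfolding has_weak_deriv_def by blast
  hence "(LX x. deriv th x * r x) = - (LX x. th x * s x)" unfolding R(2) S(2) .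
  moreover have "integrable mX (%x. deriv th x * cumX s x)" by (intro bdm_integrable bconv_mult test_integral(7)[OF t] ac_bdm[OF acs])
  ultimately show "(LX x. deriv th x * (r x - cumX s x)) = 0" using ac_test[OF acs t] R(1) by (simp add: right_diff_distrib)
 qed
 then obtain ka where ka: "AE x in mX. r x - cumX s x = ka" by blast
 show ?thesis
 proof (rule that)
  show "ac (%x. ka + cumX s x) s" by (rule acI[OF s(1)]) simp
  show "AE x in mX. u x = ka + cumX s x" using r(2) ka by eventually_elim auto
  show "AE x in mX. weak_deriv Om u x = s x" using weak_deriv_AE[OF u(3)] s(2) by eventually_elim simp
 qed
qed

lemma has_weak_deriv_linear:
 fixes T :: "'b::euclidean_space => 'c::euclidean_space"
 assumes T: "bounded_linear T" and u: "has_weak_deriv Om u v"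
 shows "has_weak_deriv Om (%x. T (u x)) (%x. T (v x))"
proof -
 have li: "locally_integrable Om u" "locally_integrable Om v" using u by (auto simp: has_weak_deriv_def)
 have liT: "locally_integrable Om (%x. T (z x))" if "locally_integrable Om z" for z
  using that absolutely_integrable_linear[where f=z, OF _ T] by (auto simp: locally_integrable_def o_def)
 have "(LINT x|lebesgue_on Om. deriv th x *\<^sub>R T (u x)) = - (LINT x|lebesgue_on Om. th x *\<^sub>R T (v x))" if t: "test_function Om th" for th
 proof -
  have "(LINT x|lebesgue_on Om. deriv th x *\<^sub>R T (u x)) = T (LINT x|lebesgue_on Om. deriv th x *\<^sub>R u x)"
   using integral_bounded_linear[OF T test_mult_integrable(2)[OF li(1) t]] by (simp add: linear_simps(5)[OF T])
  moreover have "(LINT x|lebesgue_on Om. th x *\<^sub>R T (v x)) = T (LINT x|lebesgue_on Om. th x *\<^sub>R v x)"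
   using integral_bounded_linear[OF T test_mult_integrable(1)[OF li(2) t]] by (simp add: linear_simps(5)[OF T])
  ultimately show ?thesis using u t by (simp add: has_weak_deriv_def linear_simps(4)[OF T])
 qed
 thus ?thesis using liT li by (simp add: has_weak_deriv_def)
qed

lemma has_weak_deriv_add:
 fixes u v :: "real => 'b::euclidean_space"
 assumes u: "has_weak_deriv Om u v" and u': "has_weak_deriv Om u' v'"
 shows "has_weak_deriv Om (%x. u x + u' x) (%x. v x + v' x)"
proof -
 have li: "locally_integrable Om u" "locally_integrable Om v" "locally_integrable Om u'" "locally_integrable Om v'"
  using u u' by (auto simp: has_weak_deriv_def)
 have "locally_integrable Om (%x. u x + u' x)" "locally_integrable Om (%x. v x + v' x)"
  using li by (auto simp: locally_integrable_def intro!: set_integral_add)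
 moreover have "(LINT x|lebesgue_on Om. deriv th x *\<^sub>R (u x + u' x)) = - (LINT x|lebesgue_on Om. th x *\<^sub>R (v x + v' x))" if t: "test_function Om th" for th
  using test_mult_integrable[OF li(1) t] test_mult_integrable[OF li(2) t] test_mult_integrable[OF li(3) t] test_mult_integrable[OF li(4) t]
   u u' t by (simp add: scaleR_add_right has_weak_deriv_def)
 ultimately show ?thesis by (simp add: has_weak_deriv_def)
qed

lemma has_weak_deriv_pair:
 assumes u: "has_weak_deriv Om u (v :: real => real)" and u': "has_weak_deriv Om u' (v' :: real => real)"
 shows "has_weak_deriv Om (%x. (u x, u' x)) (%x. (v x, v' x))"
proof -
 have "bounded_linear (%x::real. (x, 0::real))" "bounded_linear (%x::real. (0::real, x))"
  by (intro bounded_linear_Pair bounded_linear_ident bounded_linear_zero)+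
 from has_weak_deriv_add[OF has_weak_deriv_linear[OF this(1) u] has_weak_deriv_linear[OF this(2) u']] show ?thesis by simp
qed

lemma sq_int_pair:
 fixes ph sh :: "real => real"
 assumes "sq_int mX ph" "sq_int mX sh"
 shows "sq_int mX (%x. (ph x, sh x))" (is ?A) "sqn mX (%x. (ph x, sh x)) = sqn mX ph + sqn mX sh" (is ?B)
proof -
 have n: "(norm (ph x, sh x))^2 = (norm (ph x))^2 + (norm (sh x))^2" for x by (simp add: norm_Pair)
 show ?A ?B
  unfolding sq_int_def n using sq_int_integrable[OF assms(1)] sq_int_integrable[OF assms(2)] sq_meas[OF assms(1)] sq_meas[OF assms(2)] by auto
qed

lemma H1_pairI:
 assumes ac: "ac ph v" "ac sh w" and U: "AE x in mX. U x = (ph x, sh x)"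
 shows "U : H1 Om" "AE x in mX. weak_deriv Om U x = (v x, w x)" (is ?A) "H1_norm Om U = sqrt (sqn mX ph + sqn mX sh + sqn mX v + sqn mX w)" (is ?B)
proof -
 have "has_weak_deriv Om (%x. (fst (U x), snd (U x))) (%x. (v x, w x))"
  by (intro has_weak_deriv_pair has_weak_deriv_ac[OF ac(1)] has_weak_deriv_ac[OF ac(2)]) (use U in "auto elim: eventually_mono")
 hence h: "has_weak_deriv Om U (%x. (v x, w x))" by simp
 note s = sq_int_pair[OF ac_sq_int[OF ac(1)] ac_sq_int[OF ac(2)]] and s' = sq_int_pair[OF acD(1)[OF ac(1)] acD(1)[OF ac(2)]]
 show "U : H1 Om" unfolding H1_def using L2I(1)[OF s(1) U] L2I(1)[OF s'(1), of "%x. (v x, w x)"] h by auto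
 have W: "has_weak_deriv Om U (weak_deriv Om U)" unfolding weak_deriv_def by (rule someI[of "has_weak_deriv Om U", OF h])
 have "AE x in mX. fst (weak_deriv Om U x) = v x" "AE x in mX. snd (weak_deriv Om U x) = w x"
  using weak_deriv_AE_unique[OF has_weak_deriv_linear[OF bounded_linear_fst W] has_weak_deriv_linear[OF bounded_linear_fst h]]
   weak_deriv_AE_unique[OF has_weak_deriv_linear[OF bounded_linear_snd W] has_weak_deriv_linear[OF bounded_linear_snd h]] by simp_all
 thus wd: ?A by eventually_elim (simp add: prod_eq_iff)
 show ?B unfolding H1_norm_def L2I(2)[OF s(1) U] L2I(2)[OF s'(1) wd] s(2) s'(2)
  by (simp add: add_nonneg_nonneg add.assoc)
qed

lemma H1_pairE:
 fixes U :: "real => real * real"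
 assumes "U : H1 Om"
 obtains ph v sh w where "ac ph v" "ac sh w" "AE x in mX. U x = (ph x, sh x)"
proof -
 obtain V where U: "U : L2 Om" "V : L2 Om" "has_weak_deriv Om U V" using assms by (auto simp: H1_def)
 have L2f: "(%x. fst (Z x)) : L2 Om" (is ?S) "(%x. snd (Z x)) : L2 Om" (is ?T) if Z: "Z : L2 Om" for Z :: "real => real * real"
 proof -
  have m: "Z : borel_measurable (lebesgue_on Om)" "integrable (lebesgue_on Om) (%x. (norm (Z x))^2)" using Z by (auto simp: L2_def)
  have n: "(norm (Z x))^2 = (fst (Z x))^2 + (snd (Z x))^2" for x by (cases "Z x") (simp add: norm_Pair)
  have mf: "(%x. fst (Z x)) : borel_measurable (lebesgue_on Om)" "(%x. snd (Z x)) : borel_measurable (lebesgue_on Om)"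
   using measurable_compose[OF m(1) borel_measurable_continuous_onI[of fst]] measurable_compose[OF m(1) borel_measurable_continuous_onI[of snd]]
   by (simp_all add: continuous_on_fst continuous_on_snd)
  have "integrable (lebesgue_on Om) (%x. (fst (Z x))^2)" "integrable (lebesgue_on Om) (%x. (snd (Z x))^2)"
   by (rule Bochner_integrable_bound[OF m(2)]; use mf n in simp)+
  thus ?S ?T using mf by (simp_all add: L2_def)
 qed
 have "(%x. fst (U x)) : H1 Om" "(%x. snd (U x)) : H1 Om"
  unfolding H1_def using L2f[OF U(1)] L2f[OF U(2)] has_weak_deriv_linear[OF bounded_linear_fst U(3)] has_weak_deriv_linear[OF bounded_linear_snd U(3)] by blast+
 note h = this
 obtain ph v where f: "ac ph v" "AE x in mX. fst (U x) = ph x" by (rule H1_realE[OF h(1)])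
 obtain sh w where g: "ac sh w" "AE x in mX. snd (U x) = sh x" by (rule H1_realE[OF h(2)])
 have "AE x in mX. U x = (ph x, sh x)" using f(2) g(2) by eventually_elim (simp add: prod_eq_iff)
 thus ?thesis by (rule that[OF f(1) g(1)])
qed

end

section \<open>Functionals and Bochner spaces\<close>

text \<open>An averaged approximation depends on time only through the list of its finitely many
  step indices. On a bounded time interval it is therefore a simple function with values in a
  function space, as strong measurability requires.\<close>

lemma simple_function_map:
 assumes "!!n. n < m ==> simple_function M (p n)" shows "simple_function M (%t. map (%n. p n t) [0..<m])"
 using assms
proof (induct m)
 case (Suc m)
 have "simple_function M (%t. (map (%n. p n t) [0..<m], p m t))" using Suc by (intro simple_function_Pair) auto
 from simple_function_compose[OF this, of "%(l, x). l @ [x]"] show ?case by (simp add: o_def)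
qed simp

lemma simple_function_kk: "simple_function (lebesgue_on {0<..<T}) (kk N)"
 unfolding simple_function_def
proof
 have "kk N ` space (lebesgue_on {0<..<T}) <= {..kk N T}" by (auto intro: kk_mono)
 thus "finite (kk N ` space (lebesgue_on {0<..<T}))" by (rule finite_subset) simp
 show "ALL k:kk N ` space (lebesgue_on {0<..<T}). kk N -` {k} \<inter> space (lebesgue_on {0<..<T}) : sets (lebesgue_on {0<..<T})"
 proof
  fix k
  have "kk N : measurable lborel (count_space UNIV)" by simp
  hence "kk N : measurable (lebesgue_on {0<..<T}) (count_space UNIV)" by (intro measurable_restrict_space1 measurable_completion)
  from measurable_sets[OF this, of "{k}"] show "kk N -` {k} \<inter> space (lebesgue_on {0<..<T}) : sets (lebesgue_on {0<..<T})" by simp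
 qed
qed

lemma time_AE: "AE t in mE. P t ==> AE t in lebesgue_on {0<..<T}. P t"
 unfolding AE_mE by (subst lebesgue_on_AE_mes, simp, subst AE_mes, simp) (auto elim: eventually_mono)

lemma time_integrable:
 fixes h :: "real => real"
 assumes h: "integrable mE h" shows "integrable (lebesgue_on {0<..<T}) h"
proof -
 have [measurable]: "h : BM" using borel_measurable_integrable[OF h] by simp
 have "integrable mE (%t. wt T t * h t)"
  by (rule Bochner_integrable_bound[OF integrable_mult_right[OF h, of "exp T"]])
    (use wt_nonneg wt_le in "auto simp: abs_mult intro!: mult_right_mono AE_I2")
 hence "integrable lborel (%t. indicator {0<..T} t * h t)" by (simp add: integrable_mE wt_dens)
 from integrable_mult_indicator[OF _ this, of "{0<..<T}"] have i: "integrable lborel (%t. indicator {0<..<T} t *\<^sub>R (indicator {0<..T} t * h t))" by simp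
 have eq: "indicator {0<..<T} t *\<^sub>R (indicator {0<..T} t * h t) = indicator {0<..<T} t *\<^sub>R h t" for t by (auto simp: indicator_def)
 have "integrable lborel (%t. indicator {0<..<T} t *\<^sub>R h t)" using i unfolding eq .
 thus ?thesis by (subst lebesgue_on_mes(2)) (auto simp: integrable_mes)
qed

context interval
begin

abbreviation "H1p \<equiv> H1 Om :: (real => real * real) set"

lemma H1_norm_nonneg: "H1_norm Om u >= 0" by (simp add: H1_norm_def)

lemma zero_in_H1: "(%x. 0) : H1p" "H1_norm Om (%x. 0 :: real * real) = 0"
 using H1_pairI[OF ac_const[of 0] ac_const[of 0], of "%x. 0"] by (simp_all add: zero_prod_def)

lemma dual_norm_le:
 assumes "!!ph. ph : H1p ==> \<bar>l ph\<bar> <= C * H1_norm Om ph" "C >= 0" shows "H1_dual_norm Om l <= C"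
 unfolding H1_dual_norm_def
proof (rule cSUP_least)
 show "{ph : H1p. H1_norm Om ph <= 1} ~= {}" using zero_in_H1 by (intro ex_in_conv[THEN iffD1] exI[of _ "%x. 0"]) simp
 fix ph assume "ph : {ph : H1p. H1_norm Om ph <= 1}"
 hence "\<bar>l ph\<bar> <= C * H1_norm Om ph" "H1_norm Om ph <= 1" using assms by auto
 thus "\<bar>l ph\<bar> <= C" using mult_left_mono[of "H1_norm Om ph" 1 C] assms(2) by linarith
qed

lemma dual_norm_upper:
 assumes l: "l : H1_dual Om" and ph: "ph : H1p" "H1_norm Om ph <= 1" shows "\<bar>l ph\<bar> <= H1_dual_norm Om l"
proof -
 obtain C where C: "ALL ph:H1p. \<bar>l ph\<bar> <= C * H1_norm Om ph" using l unfolding H1_dual_def by blast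
 have "bdd_above ((%ph. \<bar>l ph\<bar>) ` {ph : H1p. H1_norm Om ph <= 1})"
 proof (rule bdd_aboveI2)
  fix ph assume p: "ph : {ph : H1p. H1_norm Om ph <= 1}"
  have "\<bar>l ph\<bar> <= \<bar>C\<bar> * H1_norm Om ph" using C p mult_right_mono[OF abs_ge_self[of C] H1_norm_nonneg[of ph]] by auto
  thus "\<bar>l ph\<bar> <= \<bar>C\<bar>" using p mult_left_mono[of "H1_norm Om ph" 1 "\<bar>C\<bar>"] by auto
 qed
 thus ?thesis unfolding H1_dual_norm_def using ph by (intro cSUP_upper) auto
qed

lemma dual_norm_nonneg: "l : H1_dual Om ==> H1_dual_norm Om (l :: (real => real * real) => real) >= 0"
 using dual_norm_upper[of l, OF _ zero_in_H1(1)] zero_in_H1(2) by (smt (verit))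

lemma dual_norm_triangle:
 assumes "m : H1_dual Om" "d : H1_dual Om" "!!ph. ph : H1p ==> \<bar>l ph\<bar> <= \<bar>m ph\<bar> + \<bar>d ph\<bar>"
 shows "H1_dual_norm Om l <= H1_dual_norm Om m + H1_dual_norm Om d" unfolding H1_dual_norm_def[of _ l]
proof (rule cSUP_least)
 show "{ph : H1p. H1_norm Om ph <= 1} ~= {}" using zero_in_H1 by (intro ex_in_conv[THEN iffD1] exI[of _ "%x. 0"]) simp
 fix ph assume "ph : {ph : H1p. H1_norm Om ph <= 1}"
 thus "\<bar>l ph\<bar> <= H1_dual_norm Om m + H1_dual_norm Om d"
  using assms(3)[of ph] dual_norm_upper[OF assms(1), of ph] dual_norm_upper[OF assms(2), of ph] by auto
qed

text \<open>Functionals on H1 given by a pair of L2 densities, one acting on the function and one on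
  its derivative. The embedded solution has the second density zero, its time derivative the first;
  both are estimated together.\<close>

definition lam :: "(real => real * real) => (real => real * real) => (real => real * real) => real" where
 "lam A B ph = (LINT x|lebesgue_on Om. A x \<bullet> ph x) + (LINT x|lebesgue_on Om. B x \<bullet> weak_deriv Om ph x)"

lemma L2_embed_lam: "L2_embed Om A = lam A (%x. 0)"
 by (simp add: L2_embed_def lam_def fun_eq_iff)

lemma lam_eq:
 assumes A: "sq_int mX A'" "AE x in mX. A x = A' x" and B: "sq_int mX B'" "AE x in mX. B x = B' x"
  and ph: "ac ph1 v1" "ac ph2 v2" "AE x in mX. ph x = (ph1 x, ph2 x)"
 shows "lam A B ph = (LX x. A' x \<bullet> (ph1 x, ph2 x)) + (LX x. B' x \<bullet> (v1 x, v2 x))"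
proof -
 have m: "A' : BM" "B' : BM" using sq_intD[OF A(1)] sq_intD[OF B(1)] by simp_all
 note [measurable] = m ac_measurable[OF ph(1)] ac_measurable[OF ph(2)] ac_measurable_deriv[OF ph(1)] ac_measurable_deriv[OF ph(2)]
 have 1: "AE x in mX. A x \<bullet> ph x = A' x \<bullet> (ph1 x, ph2 x)" using A(2) ph(3) by eventually_elim simp
 have 2: "AE x in mX. B x \<bullet> weak_deriv Om ph x = B' x \<bullet> (v1 x, v2 x)" using B(2) H1_pairI(2)[OF ph] by eventually_elim simp
 have 3: "(%x. A' x \<bullet> (ph1 x, ph2 x)) : BM" "(%x. B' x \<bullet> (v1 x, v2 x)) : BM" by measurable
 show ?thesis unfolding lam_def lebesgue_rep(3)[OF 3(1) 1] lebesgue_rep(3)[OF 3(2) 2] ..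
qed

lemma lam_bound:
 assumes A: "sq_int mX A'" "AE x in mX. A x = A' x" and B: "sq_int mX B'" "AE x in mX. B x = B' x" and ph: "ph : H1p"
 shows "\<bar>lam A B ph\<bar> <= (sqrt (sqn mX A') + sqrt (sqn mX B')) * H1_norm Om ph"
proof -
 obtain ph1 v1 ph2 v2 where p: "ac ph1 v1" "ac ph2 v2" "AE x in mX. ph x = (ph1 x, ph2 x)" by (rule H1_pairE[OF ph])
 note s = sq_int_pair[OF ac_sq_int[OF p(1)] ac_sq_int[OF p(2)]] and s' = sq_int_pair[OF acD(1)[OF p(1)] acD(1)[OF p(2)]]
 have n: "sqrt (sqn mX (%x. (ph1 x, ph2 x))) <= H1_norm Om ph" "sqrt (sqn mX (%x. (v1 x, v2 x))) <= H1_norm Om ph"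
  unfolding H1_pairI(3)[OF p] s(2) s'(2) by (intro real_sqrt_le_mono; simp add: add_nonneg_nonneg)+
 have "\<bar>lam A B ph\<bar> <= sqrt (sqn mX A') * sqrt (sqn mX (%x. (ph1 x, ph2 x))) + sqrt (sqn mX B') * sqrt (sqn mX (%x. (v1 x, v2 x)))"
  unfolding lam_eq[OF A B p] by (rule order_trans[OF abs_triangle_ineq add_mono[OF CS_inner[OF A(1) s(1)] CS_inner[OF B(1) s'(1)]]])
 also have "... <= sqrt (sqn mX A') * H1_norm Om ph + sqrt (sqn mX B') * H1_norm Om ph"
  by (intro add_mono mult_left_mono n real_sqrt_ge_zero sqn_nonneg)
 finally show ?thesis by (simp add: distrib_right)
qed

lemma lam_dual:
 assumes A: "sq_int mX A'" "AE x in mX. A x = A' x" and B: "sq_int mX B'" "AE x in mX. B x = B' x"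
 shows "lam A B : H1_dual Om" (is ?A) "H1_dual_norm Om (lam A B) <= sqrt (sqn mX A') + sqrt (sqn mX B')" (is ?B)
proof -
 show ?B by (rule dual_norm_le[OF lam_bound[OF A B]]) auto
 have add: "lam A B (%x. ph x + sh x) = lam A B ph + lam A B sh" if H: "ph : H1p" "sh : H1p" for ph sh
 proof -
  obtain ph1 v1 ph2 v2 where p: "ac ph1 v1" "ac ph2 v2" "AE x in mX. ph x = (ph1 x, ph2 x)" by (rule H1_pairE[OF H(1)])
  obtain sh1 w1 sh2 w2 where q: "ac sh1 w1" "ac sh2 w2" "AE x in mX. sh x = (sh1 x, sh2 x)" by (rule H1_pairE[OF H(2)])
  have ae: "AE x in mX. ph x + sh x = (ph1 x + sh1 x, ph2 x + sh2 x)" using p(3) q(3) by eventually_elim simp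
  have add: "(x + y, z + w) = (x, z) + (y, w)" for x y z w :: real by simp
  show ?thesis
   unfolding lam_eq[OF A B ac_add[OF p(1) q(1)] ac_add[OF p(2) q(2)] ae] lam_eq[OF A B p] lam_eq[OF A B q] add inner_add_right
   using sq_int_inner[OF A(1) sq_int_pair(1)[OF ac_sq_int[OF p(1)] ac_sq_int[OF p(2)]]] sq_int_inner[OF B(1) sq_int_pair(1)[OF acD(1)[OF p(1)] acD(1)[OF p(2)]]]
    sq_int_inner[OF A(1) sq_int_pair(1)[OF ac_sq_int[OF q(1)] ac_sq_int[OF q(2)]]] sq_int_inner[OF B(1) sq_int_pair(1)[OF acD(1)[OF q(1)] acD(1)[OF q(2)]]]
   by simp
 qed
 have scale: "lam A B (%x. c *\<^sub>R ph x) = c * lam A B ph" if H: "ph : H1p" for ph c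
 proof -
  obtain ph1 v1 ph2 v2 where p: "ac ph1 v1" "ac ph2 v2" "AE x in mX. ph x = (ph1 x, ph2 x)" by (rule H1_pairE[OF H])
  have ae: "AE x in mX. c *\<^sub>R ph x = (c * ph1 x, c * ph2 x)" using p(3) by eventually_elim simp
  have sc: "(c * x, c * y) = c *\<^sub>R (x, y)" for x y :: real by simp
  show ?thesis
   unfolding lam_eq[OF A B ac_cmult[OF p(1)] ac_cmult[OF p(2)] ae] lam_eq[OF A B p] sc inner_scaleR_right by (simp add: distrib_left)
 qed
 show ?A unfolding H1_dual_def using add scale lam_bound[OF A B] by blast
qed

lemma lam_diff:
 assumes A: "sq_int mX A'" "AE x in mX. A x = A' x" and B: "sq_int mX B'" "AE x in mX. B x = B' x"
  and C: "sq_int mX C'" "AE x in mX. C x = C' x" and D: "sq_int mX D'" "AE x in mX. D x = D' x"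
 shows "H1_dual_norm Om (%ph. lam A B ph - lam C D ph) <= sqrt (sqn mX (%x. A' x - C' x)) + sqrt (sqn mX (%x. B' x - D' x))" (is ?A)
  "H1_dual_norm Om (lam A B) <= H1_dual_norm Om (lam C D) + (sqrt (sqn mX (%x. A' x - C' x)) + sqrt (sqn mX (%x. B' x - D' x)))" (is ?B)
  "0 <= H1_dual_norm Om (%ph. lam A B ph - lam C D ph)"
proof -
 have AC: "sq_int mX (%x. A' x - C' x)" "AE x in mX. A' x - C' x = A' x - C' x" by (intro sq_int_diff A C) simp
 have BD: "sq_int mX (%x. B' x - D' x)" "AE x in mX. B' x - D' x = B' x - D' x" by (intro sq_int_diff B D) simp
 let ?d = "lam (%x. A' x - C' x) (%x. B' x - D' x)"
 have eq: "lam A B ph - lam C D ph = ?d ph" if H: "ph : H1p" for ph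
 proof -
  obtain ph1 v1 ph2 v2 where p: "ac ph1 v1" "ac ph2 v2" "AE x in mX. ph x = (ph1 x, ph2 x)" by (rule H1_pairE[OF H])
  note s = sq_int_pair(1)[OF ac_sq_int[OF p(1)] ac_sq_int[OF p(2)]] and s' = sq_int_pair(1)[OF acD(1)[OF p(1)] acD(1)[OF p(2)]]
  show ?thesis unfolding lam_eq[OF A B p] lam_eq[OF C D p] lam_eq[OF AC BD p] inner_diff_left
   using sq_int_inner[OF A(1) s] sq_int_inner[OF C(1) s] sq_int_inner[OF B(1) s'] sq_int_inner[OF D(1) s'] by simp
 qed
 show ?A by (rule dual_norm_le) (use eq lam_bound[OF AC BD] in auto)
 have "H1_dual_norm Om (lam A B) <= H1_dual_norm Om (lam C D) + H1_dual_norm Om ?d"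
  by (rule dual_norm_triangle[OF lam_dual(1)[OF C D] lam_dual(1)[OF AC BD]]) (use eq in "fastforce")
 thus ?B using lam_dual(2)[OF AC BD] by linarith
 have "H1_dual_norm Om (%ph. lam A B ph - lam C D ph) = H1_dual_norm Om ?d"
  unfolding H1_dual_norm_def by (rule SUP_cong) (use eq in auto)
 thus "0 <= H1_dual_norm Om (%ph. lam A B ph - lam C D ph)" using dual_norm_nonneg[OF lam_dual(1)[OF AC BD]] by simp
qed

text \<open>L2 convergence of the densities implies convergence in the dual norm. The dominating
  function \<open>h\<close> supplies square integrability in time.\<close>

lemma L2_H1_dual_I:
 assumes simple: "!!k. simple_function (lebesgue_on {0<..<T}) (%t. lam (A k t) (B k t))"
  and s: "!!k t. 0 < t ==> t < T ==> sq_int mX (A k t)" "!!k t. 0 < t ==> t < T ==> sq_int mX (B k t)"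
  and lim: "AE t in lebesgue_on {0<..<T}. sq_int mX (A' t) & sq_int mX (B' t) &
   (%k. sqn mX (%x. A k t x - A' t x)) ---> 0 & (%k. sqn mX (%x. B k t x - B' t x)) ---> 0 & 2 * (sqn mX (A' t) + sqn mX (B' t)) <= h t"
  and h: "integrable (lebesgue_on {0<..<T}) h"
 shows "(%t. lam (A' t) (B' t)) : L2_H1_dual T Om"
proof -
 let ?M = "lebesgue_on {0<..<T}" and ?N = "H1_dual_norm Om :: ((real => real * real) => real) => real"
 have r: "AE x in mX. z x = z x" for z :: "real => real * real" by simp
 have ae_space: "AE t in ?M. 0 < t & t < T" using AE_space[of ?M] by (auto elim: eventually_mono)
 have key: "AE t in ?M. lam (A' t) (B' t) : H1_dual Om & (%k. ?N (%ph. lam (A k t) (B k t) ph - lam (A' t) (B' t) ph)) ---> 0 &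
   (%k. ?N (lam (A k t) (B k t))) ---> ?N (lam (A' t) (B' t)) & (?N (lam (A' t) (B' t)))^2 <= h t"
  using lim ae_space
 proof eventually_elim
  case (elim t)
  hence t: "0 < t" "t < T" and s': "sq_int mX (A' t)" "sq_int mX (B' t)"
   and l: "(%k. sqn mX (%x. A k t x - A' t x)) ---> 0" "(%k. sqn mX (%x. B k t x - B' t x)) ---> 0" and ht: "2 * (sqn mX (A' t) + sqn mX (B' t)) <= h t" by auto
  define e where "e k = sqrt (sqn mX (%x. A k t x - A' t x)) + sqrt (sqn mX (%x. B k t x - B' t x))" for k
  have "e ---> sqrt 0 + sqrt 0" unfolding e_def by (intro tendsto_intros l)
  hence e0: "e ---> 0" by simp
  have d: "lam (A' t) (B' t) : H1_dual Om" by (rule lam_dual(1)[OF s'(1) r s'(2) r])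
  have D: "?N (%ph. lam (A k t) (B k t) ph - lam (A' t) (B' t) ph) <= e k" "?N (lam (A k t) (B k t)) <= ?N (lam (A' t) (B' t)) + e k" for k
   unfolding e_def by (rule lam_diff[OF s(1)[OF t] r s(2)[OF t] r s'(1) r s'(2) r])+
  have D3: "?N (lam (A' t) (B' t)) <= ?N (lam (A k t) (B k t)) + e k" for k
   using lam_diff(2)[OF s'(1) r s'(2) r s(1)[OF t, of k] r s(2)[OF t, of k] r] unfolding e_def by (simp add: norm_minus_commute)
  have n0: "0 <= ?N (%ph. lam (A k t) (B k t) ph - lam (A' t) (B' t) ph)" for k
   by (rule lam_diff(3)[OF s(1)[OF t] r s(2)[OF t] r s'(1) r s'(2) r])
  have 1: "(%k. ?N (%ph. lam (A k t) (B k t) ph - lam (A' t) (B' t) ph)) ---> 0"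
   by (rule tendsto_sandwich[OF _ _ tendsto_const e0]) (use n0 D(1) in simp_all)
  have b: "norm (?N (lam (A k t) (B k t)) - ?N (lam (A' t) (B' t))) <= e k" for k
   using D(2)[of k] D3[of k] by (simp add: abs_le_iff)
  have 2: "(%k. ?N (lam (A k t) (B k t))) ---> ?N (lam (A' t) (B' t))"
   by (rule LIM_zero_cancel, rule Lim_null_comparison[OF _ e0]) (use b in simp)
  have "(?N (lam (A' t) (B' t)))^2 <= (sqrt (sqn mX (A' t)) + sqrt (sqn mX (B' t)))^2"
   by (intro power_mono lam_dual(2)[OF s'(1) r s'(2) r] dual_norm_nonneg d)
  also have "... <= 2 * (sqn mX (A' t) + sqn mX (B' t))"
   using sum_squares_bound[of "sqrt (sqn mX (A' t))" "sqrt (sqn mX (B' t))"] by (simp add: power2_sum)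
  finally show ?case using d 1 2 ht by auto
 qed
 \<comment> \<open>The dual norm is a supremum over an uncountable set, so its measurability in
   \<open>t\<close> is obtained as that of an almost everywhere limit of simple functions.\<close>
 have m: "(%t. ?N (lam (A' t) (B' t))) : borel_measurable ?M"
 proof (rule borel_measurable_lebesgue_on_AE)
  have "(%t. ?N (lam (A k t) (B k t))) : borel_measurable ?M" for k
   using simple_function_compose[OF simple[of k], of ?N] by (intro borel_measurable_simple_function) (simp add: o_def)
  hence "(%t. lim (%k. ?N (lam (A k t) (B k t)))) : borel_measurable ?M" by (rule borel_measurable_lim_metric)
  thus "(%t. indicator {0<..<T} t *\<^sub>R lim (%k. ?N (lam (A k t) (B k t)))) : borel_measurable lebesgue"
   by (simp add: borel_measurable_restrict_space_iff)
  show "AE t in ?M. ?N (lam (A' t) (B' t)) = indicator {0<..<T} t *\<^sub>R lim (%k. ?N (lam (A k t) (B k t)))"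
   using key ae_space by eventually_elim (auto dest: limI)
 qed simp
 have "integrable ?M (%t. (?N (lam (A' t) (B' t)))^2)"
 proof (rule Bochner_integrable_bound[OF h])
  show "(%t. (?N (lam (A' t) (B' t)))^2) : borel_measurable ?M" using m by (rule borel_measurable_power)
  show "AE t in ?M. norm ((?N (lam (A' t) (B' t)))^2) <= norm (h t)" using key by eventually_elim auto
 qed
 moreover have "lam (A k t) (B k t) : H1_dual Om" if "t : space ?M" for k t
  using that by (intro lam_dual(1)[OF s(1) r s(2) r]) auto
 ultimately show ?thesis unfolding L2_H1_dual_def L2_Bochner_def strongly_measurable_def using simple key
  by (intro CollectI conjI exI[of _ "%k t. lam (A k t) (B k t)"]) (auto elim!: eventually_mono)
qed

end

lemma time_lint:
 fixes q Z :: "real => real"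
 assumes q: "q : BM" and ae: "AE s in mE. Z s = q s"
 shows "(LINT s|lebesgue_on {0..t}. Z s) = (LINT s|mE. wt t s * q s)"
proof -
 have ae': "AE s in lebesgue_on {0..t}. Z s = q s"
  using ae unfolding AE_mE by (subst lebesgue_on_AE_mes, simp, subst AE_mes, simp) (auto elim: eventually_mono)
 have ql: "q : borel_measurable lebesgue" using measurable_completion[of q lborel borel] q by simp
 have "(LINT s|lebesgue_on {0..t}. Z s) = (LINT s|lebesgue_on {0..t}. q s)"
  by (rule integral_cong_AE[OF borel_measurable_lebesgue_on_AE[OF _ ql ae'] _ ae']) (use lebesgue_on_mes(4)[OF _ q] in auto)
 also have "... = (LINT s|lborel. indicator {0..t} s *\<^sub>R q s)" using q by (simp add: lebesgue_on_mes(1) integral_mes)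
 also have "... = (LINT s|lborel. indicator {0<..t} s * q s)"
  by (rule integral_cong_AE) (use q AE_lborel_singleton[of 0] in "auto elim!: eventually_mono simp: indicator_def")
 also have "... = (LINT s|mE. wt t s * q s)" by (rule integral_wt[OF q, symmetric])
 finally show ?thesis .
qed

section \<open>The limit in the function spaces of the statement\<close>

context muskat_limit
begin

definition "cf k t x = (SUM n<K k. c k n * uf (rr n) t x)"
definition "cg k t x = (SUM n<K k. c k n * ug (rr n) t x)"
definition "cv k t x = (SUM n<K k. c k n * uv (rr n) t x)"
definition "cw' k t x = (SUM n<K k. c k n * uw (rr n) t x)"
definition "cJ k t x = (SUM n<K k. c k n * uJ (rr n) t x)"
definition "cH k t x = (SUM n<K k. c k n * uH (rr n) t x)"

lemmas fg = admissibleD[OF fg_admissible]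

lemma comb_ac: "t > 0 ==> ac (cf k t) (cv k t)" "t > 0 ==> ac (cg k t) (cw' k t)"
 unfolding cf_def[abs_def] cg_def[abs_def] cv_def[abs_def] cw'_def[abs_def] by (intro ac_sum ac_cmult u_ac; assumption)+

lemma comb_sq: "sq_int mX (cJ k t)" "sq_int mX (cH k t)"
 unfolding cJ_def[abs_def] cH_def[abs_def] uJ_def uH_def by (intro sq_int_sum sq_int_mult sq_JH tau_pos)+

lemma comb_bound: "\<bar>cf k t x\<bar> <= Kb" "\<bar>cg k t x\<bar> <= Kb"
 using conv_weights_bound[OF cw, of k "%n. uf (rr n) t x" 0 Kb] conv_weights_bound[OF cw, of k "%n. ug (rr n) t x" 0 Kb] u_abs
 by (simp_all add: cf_def cg_def)

lemma comb_meas: "cf k t : BM" "cg k t : BM"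
 unfolding cf_def[abs_def] cg_def[abs_def] using u_meas1 by measurable

lemma good_comb:
 assumes "good t"
 shows "ac (f t) (%x. V (t, x))" (is ?A) "ac (g t) (%x. W (t, x))" (is ?B)
  "(%k. sqn mX (%x. cf k t x - f t x)) ---> 0" (is ?C) "(%k. sqn mX (%x. cg k t x - g t x)) ---> 0" (is ?D)
  "(%k. sqn mX (%x. cv k t x - V (t, x))) ---> 0" (is ?E) "(%k. sqn mX (%x. cw' k t x - W (t, x))) ---> 0" (is ?F)
proof -
 note l = good_limits[OF assms, folded good_fg[OF assms]]
 show ?A ?B by (rule l)+
 show ?C ?D
  by (rule bconv_sqn, rule bconvI[OF comb_meas(1) fg(1) comb_bound(1)], use l(2) in "simp add: cf_def")
    (rule bconv_sqn, rule bconvI[OF comb_meas(2) fg(2) comb_bound(2)], use l(5) in "simp add: cg_def")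
 show ?E ?F using assms by (simp_all add: good_def cv_def cw'_def)
qed

lemma simple_comb:
 assumes "!!t. S t = \<G> (map (%n. kk (rr n) t) [0..<m])" shows "simple_function (lebesgue_on {0<..<T}) S"
proof -
 have "S = \<G> \<circ> (%t. map (%n. kk (rr n) t) [0..<m])" using assms by auto
 thus ?thesis using simple_function_compose[OF simple_function_map[OF simple_function_kk]] by simp
qed

lemma slice_sqn_integrable:
 fixes Z :: "real * real => real"
 assumes "sq_int Q Z" shows "integrable mE (%t. sqn mX (%x. Z (t, x)))"
 using PQ.integrable_fst'[OF sq_int_integrable[OF assms, unfolded Q_def]] by simp

theorem solution_L2_H1: "(%t x. (f t x, g t x)) : L2_H1 T Om"
proof -
 let ?M = "lebesgue_on {0<..<T}"
 have r: "AE x in mX. z x = z x" for z :: "real => real * real" by simp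
 have simple: "simple_function ?M (%t x. (cf k t x, cg k t x))" for k
  by (rule simple_comb[where m="K k" and \<G>="%l x. (SUM n<K k. c k n * fk (tau (rr n)) (l ! n) x, SUM n<K k. c k n * gk (tau (rr n)) (l ! n) x)"])
    (simp add: cf_def cg_def uf_def ug_def cong: sum.cong_simp)
 have mem: "(%x. (cf k t x, cg k t x)) : H1p" if "t > 0" for k t
  by (rule H1_pairI(1)[OF comb_ac(1)[OF that] comb_ac(2)[OF that] r])
 have gAE: "AE t in ?M. good t" by (rule time_AE[OF good_AE])
 have w: "AE t in ?M. (%x. (f t x, g t x)) : H1p & (%k. H1_norm Om (%x. (cf k t x, cg k t x) - (f t x, g t x))) ---> 0"
  using gAE
 proof eventually_elim
  case (elim t)
  note gd = good_comb[OF elim]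
  have t: "t > 0" using elim by (simp add: good_def)
  have e: "H1_norm Om (%x. (cf k t x, cg k t x) - (f t x, g t x)) = sqrt (sqn mX (%x. cf k t x - f t x) + sqn mX (%x. cg k t x - g t x)
    + sqn mX (%x. cv k t x - V (t, x)) + sqn mX (%x. cw' k t x - W (t, x)))" for k
   by (rule H1_pairI(3)[OF ac_diff[OF comb_ac(1)[OF t] gd(1)] ac_diff[OF comb_ac(2)[OF t] gd(2)]]) simp
  have "(%k. H1_norm Om (%x. (cf k t x, cg k t x) - (f t x, g t x))) ---> sqrt (0 + 0 + 0 + 0)"
   unfolding e by (intro tendsto_intros gd)
  thus ?case using H1_pairI(1)[OF gd(1,2) r] by simp
 qed
 \<comment> \<open>A Borel version of the squared norm: \<open>fl\<close> and \<open>gl\<close> are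
   jointly measurable, and \<open>f\<close> and \<open>g\<close> agree with them at good
   times.\<close>
 define h where "h t = sqn mX (%x. fl t x) + sqn mX (%x. gl t x) + sqn mX (%x. V (t, x)) + sqn mX (%x. W (t, x))" for t
 have [measurable]: "(un fl) : BM2" "(un gl) : BM2"
  "V : BM2" "W : BM2" using l_measurable sq_intD[OF sV] sq_intD[OF sW] by simp_all
 have sqm: "(%t. sqn mX (%x. z t x)) : BM" if "(un z) : BM2" for z :: "real => real => real"
 proof (rule X.borel_measurable_lebesgue_integral)
  have "(%p. (norm (z (fst p) (snd p)))^2) : BM2" using that by measurable
  thus "(%(t, x). (norm (z t x))^2) : borel_measurable (borel \<Otimes>\<^sub>M mX)" by (simp add: case_prod_beta')
 qed
 have hm: "h : BM" unfolding h_def by (intro borel_measurable_add sqm) simp_all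
 have hl: "h : borel_measurable lebesgue" using measurable_completion[of h lborel borel] hm by simp
 have hN: "AE t in ?M. (H1_norm Om (%x. (f t x, g t x)))^2 = h t" using gAE
 proof eventually_elim
  case (elim t)
  have "(H1_norm Om (%x. (f t x, g t x)))^2 = sqn mX (f t) + sqn mX (g t) + sqn mX (%x. V (t, x)) + sqn mX (%x. W (t, x))"
   unfolding H1_pairI(3)[OF good_comb(1,2)[OF elim] r] by (simp add: add_nonneg_nonneg)
  thus ?case by (simp add: h_def good_fg[OF elim])
 qed
 define B where "B t = 2 * (Kb^2 * (b - a)) + sqn mX (%x. V (t, x)) + sqn mX (%x. W (t, x))" for t
 have "integrable mE B" unfolding B_def by (intro Bochner_integrable_add slice_sqn_integrable sV sW) simp
 hence Bi: "integrable ?M B" by (rule time_integrable)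
 have "integrable ?M (%t. (H1_norm Om (%x. (f t x, g t x)))^2)"
 proof (rule Bochner_integrable_bound[OF Bi])
  show "(%t. (H1_norm Om (%x. (f t x, g t x)))^2) : borel_measurable ?M" by (rule borel_measurable_lebesgue_on_AE[OF _ hl hN]) simp
  show "AE t in ?M. norm ((H1_norm Om (%x. (f t x, g t x)))^2) <= norm (B t)" using hN gAE
  proof eventually_elim
   case (elim t)
   have "h t <= B t" unfolding h_def B_def using sqn_bounded[OF fg(1) fg(10), of t] sqn_bounded[OF fg(2) fg(11), of t] good_fg[OF elim(2)] by simp
   thus ?case unfolding elim(1) using zero_le_power2[of "H1_norm Om (%x. (f t x, g t x))"] elim(1) by simp
  qed
 qed
 thus ?thesis unfolding L2_H1_def L2_Bochner_def strongly_measurable_def using simple mem w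
  by (intro CollectI conjI exI[of _ "%k t x. (cf k t x, cg k t x)"]) auto
qed

lemma embed_L2_H1_dual: "(%t. L2_embed Om (%x. (f t x, g t x))) : L2_H1_dual T Om"
 unfolding L2_embed_lam
proof (rule L2_H1_dual_I[where A="%k t x. (cf k t x, cg k t x)" and B="%k t x. 0" and h="%t. 4 * (Kb^2 * (b - a))"])
 show "simple_function (lebesgue_on {0<..<T}) (%t. lam (%x. (cf k t x, cg k t x)) (%x. 0))" for k
  by (rule simple_comb[where m="K k" and \<G>="%l. lam (%x. (SUM n<K k. c k n * fk (tau (rr n)) (l ! n) x, SUM n<K k. c k n * gk (tau (rr n)) (l ! n) x)) (%x. 0)"])
    (simp add: cf_def cg_def uf_def ug_def cong: sum.cong_simp)
 have sfg: "sq_int mX (f t)" "sq_int mX (g t)" for t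
  by (rule sq_int_bounded[OF fg(1) fg(10)], rule sq_int_bounded[OF fg(2) fg(11)])
 have sc: "sq_int mX (cf k t)" "sq_int mX (cg k t)" for k t
  by (rule sq_int_bounded[OF comb_meas(1) comb_bound(1)], rule sq_int_bounded[OF comb_meas(2) comb_bound(2)])
 show "sq_int mX (%x. (cf k t x, cg k t x))" for k t by (rule sq_int_pair(1)[OF sc])
 show "integrable (lebesgue_on {0<..<T}) (%t. 4 * (Kb^2 * (b - a)))" by (rule time_integrable) simp
 show "AE t in lebesgue_on {0<..<T}. sq_int mX (%x. (f t x, g t x)) & sq_int mX (%x. 0 :: real * real) &
   (%k. sqn mX (%x. (cf k t x, cg k t x) - (f t x, g t x))) ---> 0 & (%k. sqn mX (%x. 0 - 0 :: real * real)) ---> 0 &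
   2 * (sqn mX (%x. (f t x, g t x)) + sqn mX (%x. 0 :: real * real)) <= 4 * (Kb^2 * (b - a))"
  using time_AE[OF good_AE]
 proof eventually_elim
  case (elim t)
  note gd = good_comb[OF elim]
  have "sqn mX (%x. (cf k t x, cg k t x) - (f t x, g t x)) = sqn mX (%x. cf k t x - f t x) + sqn mX (%x. cg k t x - g t x)" for k
   using sq_int_pair(2)[OF sq_int_diff[OF sc(1) sfg(1)] sq_int_diff[OF sc(2) sfg(2)]] by simp
  hence l: "(%k. sqn mX (%x. (cf k t x, cg k t x) - (f t x, g t x))) ---> 0" using tendsto_add[OF gd(3,4)] by simp
  have dbl: "2 * (A + C) <= 4 * B" if "A <= 2 * B" "C = 0" for A B C :: real using that by simp
  have "sqn mX (%x. (f t x, g t x)) <= 2 * (Kb^2 * (b - a))"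
   using sq_int_pair(2)[OF sfg, of t t] sqn_bounded[OF fg(1) fg(10), of t] sqn_bounded[OF fg(2) fg(11), of t] by simp
  hence "2 * (sqn mX (%x. (f t x, g t x)) + sqn mX (%x. 0 :: real * real)) <= 4 * (Kb^2 * (b - a))" by (rule dbl) simp
  with l show ?case using sq_int_pair(1)[OF sfg, of t t] by (intro conjI; (assumption | simp))
 qed
qed simp_all

text \<open>The candidate for the time derivative: minus the fluxes acting on the derivative of the
  test function. Its approximations are the averaged fluxes.\<close>

lemma flux_L2_H1_dual: "(%t. lam (%x. 0) (%x. (- J (t, x), - H (t, x)))) : L2_H1_dual T Om"
proof (rule L2_H1_dual_I[where A="%k t x. 0" and B="%k t x. (- cJ k t x, - cH k t x)" and h="%t. 2 * (sqn mX (%x. J (t, x)) + sqn mX (%x. H (t, x)))"])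
 show "simple_function (lebesgue_on {0<..<T}) (%t. lam (%x. 0) (%x. (- cJ k t x, - cH k t x)))" for k
  by (rule simple_comb[where m="K k" and \<G>="%l. lam (%x. 0) (%x. (- (SUM n<K k. c k n * Jk (tau (rr n)) (l ! n) x), - (SUM n<K k. c k n * Hk (tau (rr n)) (l ! n) x)))"])
    (simp add: cJ_def cH_def uJ_def uH_def cong: sum.cong_simp)
 have sc: "sq_int mX (%x. - cJ k t x)" "sq_int mX (%x. - cH k t x)" for k t by (intro sq_int_uminus comb_sq)+
 show "sq_int mX (%x. (- cJ k t x, - cH k t x))" for k t by (rule sq_int_pair(1)[OF sc])
 show "integrable (lebesgue_on {0<..<T}) (%t. 2 * (sqn mX (%x. J (t, x)) + sqn mX (%x. H (t, x))))"
  by (intro time_integrable integrable_mult_right Bochner_integrable_add slice_sqn_integrable sJ sH)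
 show "AE t in lebesgue_on {0<..<T}. sq_int mX (%x. 0 :: real * real) & sq_int mX (%x. (- J (t, x), - H (t, x))) &
   (%k. sqn mX (%x. 0 - 0 :: real * real)) ---> 0 & (%k. sqn mX (%x. (- cJ k t x, - cH k t x) - (- J (t, x), - H (t, x)))) ---> 0 &
   2 * (sqn mX (%x. 0 :: real * real) + sqn mX (%x. (- J (t, x), - H (t, x)))) <= 2 * (sqn mX (%x. J (t, x)) + sqn mX (%x. H (t, x)))"
  using time_AE[OF slices] time_AE[OF sq_int_Q_AE[OF sJ]] time_AE[OF sq_int_Q_AE[OF sH]]
 proof eventually_elim
  case (elim t)
  have s: "sq_int mX (%x. - J (t, x))" "sq_int mX (%x. - H (t, x))" by (intro sq_int_uminus elim)+
  have "sqn mX (%x. (- cJ k t x, - cH k t x) - (- J (t, x), - H (t, x))) = sqn mX (%x. cJ k t x - J (t, x)) + sqn mX (%x. cH k t x - H (t, x))" for k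
   using sq_int_pair(2)[OF sq_int_diff[OF sc(1) s(1)] sq_int_diff[OF sc(2) s(2)], of k t k t] by (simp add: power2_commute)
  moreover have "(%k. sqn mX (%x. cJ k t x - J (t, x)) + sqn mX (%x. cH k t x - H (t, x))) ---> 0 + 0"
   unfolding cJ_def cH_def by (rule tendsto_add) (use elim(1) in blast)+
  ultimately show ?case using sq_int_pair[OF s] by simp
 qed
qed simp_all

lemma fg_flux:
 assumes t: "t >= 0" and h: "sq_int mX h"
 shows "(LX x. (cumX (f t) x - cumX F0 x) * h x) = (LINT p|Q. wt t (fst p) * h (snd p) * J p)"
  "(LX x. (cumX (g t) x - cumX G0 x) * h x) = (LINT p|Q. wt t (fst p) * h (snd p) * H p)"
 unfolding fg(6,7) by (rule U_flux[OF t h])+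

definition "qJ h s = (LX x. h x * J (s, x))"
definition "qH h s = (LX x. h x * H (s, x))"

lemma q_measurable: assumes "sq_int mX h" shows "qJ h : BM" (is ?A) "qH h : BM" (is ?B)
proof -
 have [measurable]: "h : BM" "J : borel_measurable (borel \<Otimes>\<^sub>M mX)" "H : borel_measurable (borel \<Otimes>\<^sub>M mX)"
  using sq_meas[OF assms] sq_intD[OF sJ] sq_intD[OF sH] by simp_all
 show ?A ?B unfolding qJ_def[abs_def] qH_def[abs_def] by measurable
qed

lemma q_integral:
 assumes "sq_int mX h"
 shows "(LINT p|Q. wt t (fst p) * h (snd p) * J p) = (LINT s|mE. wt t s * qJ h s)" (is ?A) "(LINT p|Q. wt t (fst p) * h (snd p) * H p) = (LINT s|mE. wt t s * qH h s)" (is ?B)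
proof -
 have e: "(LX x. wt t s * h x * Z (s, x)) = wt t s * (LX x. h x * Z (s, x))" for s and Z :: "real * real => real"
  by (simp add: mult.assoc)
 show ?A using integral_Q[OF sq_int_times[OF sq_int_Q_wt_snd[OF assms, of t] sJ]] by (simp add: e qJ_def)
 show ?B using integral_Q[OF sq_int_times[OF sq_int_Q_wt_snd[OF assms, of t] sH]] by (simp add: e qH_def)
qed

text \<open>The integrated flux identity, integrated by parts once more in \<open>x\<close>; equal
  masses remove the boundary term. It holds at every \<open>t >= 0\<close>, since it involves the
  values at \<open>t\<close> only through their primitives.\<close>

lemma fg_identity:
 assumes t: "t >= 0" and ac: "ac ph v"
 shows "(LX x. (f t x - F0 x) * ph x) = - (LINT s|mE. wt t s * qJ v s)" (is ?A) "(LX x. (g t x - G0 x) * ph x) = - (LINT s|mE. wt t s * qH v s)" (is ?B)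
proof -
 have i: "integrable mX (f t)" "integrable mX (g t)" "integrable mX F0" "integrable mX G0"
  by (intro bdm_integrable fg bdm0)+
 have c: "cumX (%x. f t x - F0 x) x = cumX (f t) x - cumX F0 x" "cumX (%x. g t x - G0 x) x = cumX (g t) x - cumX G0 x" for x
  using i by (simp_all add: X.cum_diff)
 have m: "(LX x. f t x - F0 x) = 0" "(LX x. g t x - G0 x) = 0"
  using i admissible_mass[OF fg_admissible, of t] by simp_all
 show ?A
  using ac_ibp[OF ac Bochner_integrable_diff[OF i(1,3)]] fg_flux(1)[OF t acD(1)[OF ac]] q_integral(1)[OF acD(1)[OF ac], of t]
  by (simp add: c m mult.commute)
 show ?B
  using ac_ibp[OF ac Bochner_integrable_diff[OF i(2,4)]] fg_flux(2)[OF t acD(1)[OF ac]] q_integral(2)[OF acD(1)[OF ac], of t]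
  by (simp add: c m mult.commute)
qed

lemma weak_deriv_combination:
 assumes "good s" shows "AE x in mX. weak_deriv Om (%y. \<alpha> * f s y + be * g s y) x = \<alpha> * V (s, x) + be * W (s, x)"
proof -
 have ac: "ac (%y. \<alpha> * f s y + be * g s y) (%x. \<alpha> * V (s, x) + be * W (s, x))" by (intro ac_add ac_cmult good_comb assms)
 show ?thesis by (rule weak_deriv_AE[OF has_weak_deriv_ac[OF ac]]) simp_all
qed

theorem weak_formulation:
 assumes ph: "ph : H1 Om" and t: "t >= 0" and F: "AE x in mX. F x = F0 x" "AE x in mX. G x = G0 x"
 shows "(LINT x|lebesgue_on Om. (f t x - F x) * ph x) +
    (LINT s|lebesgue_on {0..t}. LINT x|lebesgue_on Om.
     f s x * weak_deriv Om (%y. (1 + R) * f s y + R * g s y) x * weak_deriv Om ph x) = 0" (is ?A)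
  "(LINT x|lebesgue_on Om. (g t x - G x) * ph x) +
    mu * R * (LINT s|lebesgue_on {0..t}. LINT x|lebesgue_on Om.
     g s x * weak_deriv Om (%y. f s y + g s y) x * weak_deriv Om ph x) = 0" (is ?B)
proof -
 obtain sh v where p: "ac sh v" "AE x in mX. ph x = sh x" "AE x in mX. weak_deriv Om ph x = v x" by (rule H1_realE[OF ph])
 have v: "sq_int mX v" by (rule acD(1)[OF p(1)])
 note [measurable] = ac_measurable[OF p(1)] sq_meas[OF v] fg(1)[of t] fg(2)[of t]
 have first: "(LINT x|lebesgue_on Om. (f t x - F x) * ph x) = (LX x. (f t x - F0 x) * sh x)"
  "(LINT x|lebesgue_on Om. (g t x - G x) * ph x) = (LX x. (g t x - G0 x) * sh x)"
  by (rule lebesgue_rep(3), measurable, use p(2) F(1) in eventually_elim, simp)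
    (rule lebesgue_rep(3), measurable, use p(2) F(2) in eventually_elim, simp)
 have in1: "AE s in mE. (LINT x|lebesgue_on Om. f s x * weak_deriv Om (%y. (1 + R) * f s y + R * g s y) x * weak_deriv Om ph x) = qJ v s"
  using good_AE flux_limit(1) sq_int_Q_AE[OF sJ]
 proof eventually_elim
  case (elim s)
  have [measurable]: "(%x. J (s, x)) : BM" using sq_meas[OF elim(3)] .
  show ?case unfolding qJ_def
  proof (rule lebesgue_rep(3))
   show "(%x. v x * J (s, x)) : BM" by measurable
   show "AE x in mX. f s x * weak_deriv Om (%y. (1 + R) * f s y + R * g s y) x * weak_deriv Om ph x = v x * J (s, x)"
    using elim(2) weak_deriv_combination[OF elim(1), of "1 + R" R] p(3) by eventually_elim (simp add: good_fg[OF elim(1)])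
  qed
 qed
 have in2: "AE s in mE. (LINT x|lebesgue_on Om. g s x * weak_deriv Om (%y. f s y + g s y) x * weak_deriv Om ph x) = 1 / (mu * R) * qH v s"
  using good_AE flux_limit(2) sq_int_Q_AE[OF sH]
 proof eventually_elim
  case (elim s)
  have [measurable]: "(%x. H (s, x)) : BM" using sq_meas[OF elim(3)] .
  have "(LINT x|lebesgue_on Om. g s x * weak_deriv Om (%y. f s y + g s y) x * weak_deriv Om ph x) = (LX x. 1 / (mu * R) * (v x * H (s, x)))"
  proof (rule lebesgue_rep(3))
   show "(%x. 1 / (mu * R) * (v x * H (s, x))) : BM" by measurable
   show "AE x in mX. g s x * weak_deriv Om (%y. f s y + g s y) x * weak_deriv Om ph x = 1 / (mu * R) * (v x * H (s, x))"
    using elim(2) weak_deriv_combination[OF elim(1), of 1 1] p(3)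
   proof eventually_elim
    case (elim x)
    have "mu * R ~= 0" using R mu by simp
    thus ?case using elim good_fg[OF \<open>good s\<close>] by simp
   qed
  qed
  thus ?case by (simp add: qH_def)
 qed
 note o1 = time_lint[OF q_measurable(1)[OF v] in1, of t]
 have qm: "(%s. 1 / (mu * R) * qH v s) : BM" using q_measurable(2)[OF v] by simp
 note o2 = time_lint[OF qm in2, of t]
 show ?A unfolding first o1 fg_identity(1)[OF t p(1)] by simp
 have "(LINT s|mE. wt t s * (1 / (mu * R) * qH v s)) = 1 / (mu * R) * (LINT s|mE. wt t s * qH v s)"
  by (simp only: mult.left_commute[of "wt t _"] integral_mult_right_zero)
 thus ?B unfolding first o2 fg_identity(2)[OF t p(1)] using R mu by simp
qed

lemma rep_Phi1:
 assumes m: "z1 : BM" "z2 : BM" and F: "AE x in mX. F x = z1 x" "AE x in mX. G x = z2 x"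
 shows "(LINT x|lebesgue_on Om. Phi1 mu (F x, G x)) = ent mu z1 z2" (is ?A)
  "(LINT x|lebesgue_on Om. Phi R mu n (F x, G x)) = (LX x. Phi R mu n (z1 x, z2 x))" (is ?B)
proof -
 note [measurable] = m
 show ?A
 proof (rule lebesgue_rep(3))
  show "(%x. Phi1 mu (z1 x, z2 x)) : BM" unfolding Phi1_def by measurable
  show "AE x in mX. Phi1 mu (F x, G x) = Phi1 mu (z1 x, z2 x)" using F by eventually_elim simp
 qed
 show ?B
 proof (rule lebesgue_rep(3))
  show "(%x. Phi R mu n (z1 x, z2 x)) : BM" unfolding Phi_def by measurable
  show "AE x in mX. Phi R mu n (F x, G x) = Phi R mu n (z1 x, z2 x)" using F by eventually_elim simp
 qed
qed

theorem energy_inequality: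
 assumes t: "t >= 0" and F: "AE x in mX. F x = F0 x" "AE x in mX. G x = G0 x"
 shows "(LINT x|lebesgue_on Om. Phi1 mu (f t x, g t x)) +
    (LINT s|lebesgue_on {0..t}. LINT x|lebesgue_on Om.
     \<bar>weak_deriv Om (f s) x\<bar>^2 + R * \<bar>weak_deriv Om (%y. f s y + g s y) x\<bar>^2)
    <= (LINT x|lebesgue_on Om. Phi1 mu (F x, G x))"
proof -
 define d where "d s = (LX x. (V (s, x))^2 + R * (V (s, x) + W (s, x))^2)" for s
 have [measurable]: "V : borel_measurable (borel \<Otimes>\<^sub>M mX)" "W : borel_measurable (borel \<Otimes>\<^sub>M mX)" using sq_intD[OF sV] sq_intD[OF sW] by simp_all
 have dm: "d : BM" unfolding d_def by measurable
 have in1: "AE s in mE. (LINT x|lebesgue_on Om. \<bar>weak_deriv Om (f s) x\<bar>^2 + R * \<bar>weak_deriv Om (%y. f s y + g s y) x\<bar>^2) = d s"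
  using good_AE sq_int_Q_AE[OF sV] sq_int_Q_AE[OF sW]
 proof eventually_elim
  case (elim s)
  have [measurable]: "(%x. V (s, x)) : BM" "(%x. W (s, x)) : BM" using sq_meas[OF elim(2)] sq_meas[OF elim(3)] .
  show ?case unfolding d_def
  proof (rule lebesgue_rep(3))
   show "(%x. (V (s, x))^2 + R * (V (s, x) + W (s, x))^2) : BM" by measurable
   show "AE x in mX. \<bar>weak_deriv Om (f s) x\<bar>^2 + R * \<bar>weak_deriv Om (%y. f s y + g s y) x\<bar>^2 = (V (s, x))^2 + R * (V (s, x) + W (s, x))^2"
    using weak_deriv_combination[OF elim(1), of 1 0] weak_deriv_combination[OF elim(1), of 1 1] by eventually_elim simp
  qed
 qed
 have "Dl t = (LINT s|mE. wt t s * d s)"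
 proof -
  have "integrable Q (%p. (V p)^2 + R * (V p + W p)^2)"
   using sq_int_integrable[OF sV] sq_int_integrable[OF sq_int_add[OF sV sW]] by simp
  from integral_Q[OF integrable_wt_Q[OF this, of t]] show ?thesis by (simp add: Dl_def d_def)
 qed
 thus ?thesis
  unfolding time_lint[OF dm in1] rep_Phi1(1)[OF F0m G0m F] rep_Phi1(1)[OF fg(1,2)[of t] AE_I2 AE_I2, OF refl refl]
  using admissible_energy[OF fg_admissible t] by (simp add: C0_def)
qed

theorem L2_continuity: "L2_continuous_on {0..} Om (%t x. (f t x, g t x))"
proof -
 have sfg: "sq_int mX (f t)" "sq_int mX (g t)" for t
  by (rule sq_int_bounded[OF fg(1) fg(10)], rule sq_int_bounded[OF fg(2) fg(11)])
 have GE: "AE t in mE. t : {t. good t}" using good_AE by simp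
 have mod: "sqn mX (%x. f s x - f p x) <= 78 * \<bar>acc V J p - acc V J s\<bar>" (is ?S) "sqn mX (%x. g s x - g p x) <= 78 * \<bar>acc W H p - acc W H s\<bar>" (is ?T)
  if sp: "0 <= s" "0 <= p" for s p
 proof -
  have u0: "cumX F0 : BM" "cumX G0 : BM" by measurable
  have b0: "\<bar>cumX F0 x\<bar> <= K0 * (b - a)" "\<bar>cumX G0 x\<bar> <= K0 * (b - a)" for x
   by (rule cumX_bounded, use F0n F0_le in simp_all) (rule cumX_bounded, use G0n F0_le in simp_all)
  show ?S
   by (rule L2_modulus[OF fg(1) fg(10) admissible_mass(1)[OF fg_admissible] _ sV sJ GE _ u0(1) b0(1) fg_flux(1) sp])
     (use U_time_continuous(1) good_comb(1) in "simp_all add: fg(6)")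
  show ?T
   by (rule L2_modulus[OF fg(2) fg(11) admissible_mass(2)[OF fg_admissible] _ sW sH GE _ u0(2) b0(2) fg_flux(2) sp])
     (use U_time_continuous(2) good_comb(2) in "simp_all add: fg(7)")
 qed
 show ?thesis unfolding L2_continuous_on_def
 proof (intro ballI conjI)
  fix t :: real assume t: "t : {0..}"
  show "(%x. (f t x, g t x)) : L2 Om" by (rule L2I(1)[OF sq_int_pair(1)[OF sfg(1)[of t] sfg(2)[of t]]]) simp
  have n: "L2_norm Om (%x. (f s x, g s x) - (f t x, g t x)) = sqrt (sqn mX (%x. f s x - f t x) + sqn mX (%x. g s x - g t x))" for s
   using L2I(2)[OF sq_int_pair(1)[OF sq_int_diff[OF sfg(1) sfg(1)] sq_int_diff[OF sfg(2) sfg(2)]], of "%x. (f s x, g s x) - (f t x, g t x)" s t s t]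
    sq_int_pair(2)[OF sq_int_diff[OF sfg(1) sfg(1)] sq_int_diff[OF sfg(2) sfg(2)], of s t s t] by simp
  define e where "e s = sqrt (78 * \<bar>acc V J t - acc V J s\<bar> + 78 * \<bar>acc W H t - acc W H s\<bar>)" for s
  have "(e \<longlongrightarrow> sqrt (78 * \<bar>acc V J t - acc V J t\<bar> + 78 * \<bar>acc W H t - acc W H t\<bar>)) (at t within {0..})"
   unfolding e_def by (intro tendsto_intros acc_continuous sV sW sJ sH)
  hence e0: "(e \<longlongrightarrow> 0) (at t within {0..})" by simp
  show "((%s. L2_norm Om (%x. (f s x, g s x) - (f t x, g t x))) \<longlongrightarrow> 0) (at t within {0..})"
  proof (rule Lim_null_comparison[OF _ e0])
   show "\<forall>\<^sub>F s in at t within {0..}. norm (L2_norm Om (%x. (f s x, g s x) - (f t x, g t x))) <= e s"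
    unfolding eventually_at_filter
   proof (rule always_eventually, intro allI impI)
    fix s :: real assume "s : {0..}"
    hence "sqn mX (%x. f s x - f t x) + sqn mX (%x. g s x - g t x) <= 78 * \<bar>acc V J t - acc V J s\<bar> + 78 * \<bar>acc W H t - acc W H s\<bar>"
     using mod[of s t] t by (intro add_mono) auto
    thus "norm (L2_norm Om (%x. (f s x, g s x) - (f t x, g t x))) <= e s"
     unfolding n e_def by (simp add: add_nonneg_nonneg)
   qed
  qed
 qed
qed

lemma sq_int_time:
 fixes Z :: "real * real => real"
 assumes Z: "sq_int Q Z" and h: "sq_int mX h"
 shows "sq_int (mes {0<..<T}) (%s. LX x. h x * Z (s, x))"
proof -
 have [measurable]: "h : BM" "Z : borel_measurable (borel \<Otimes>\<^sub>M mX)" using sq_meas[OF h] sq_intD[OF Z] by simp_all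
 define q where "q s = (LX x. h x * Z (s, x))" for s
 have qm: "q : BM" unfolding q_def by measurable
 have "integrable mE (%s. (norm (q s))^2)"
 proof (rule Bochner_integrable_bound[OF integrable_mult_right[OF slice_sqn_integrable[OF Z], of "sqn mX h"]])
  show "(%s. (norm (q s))^2) : borel_measurable mE" using qm by simp
  show "AE s in mE. norm ((norm (q s))^2) <= norm (sqn mX h * sqn mX (%x. Z (s, x)))" using sq_int_Q_AE[OF Z]
  proof eventually_elim
   case (elim s)
   have "\<bar>q s\<bar> <= sqrt (sqn mX h) * sqrt (sqn mX (%x. Z (s, x)))" unfolding q_def using CS_inner[OF h elim] by simp
   from power_mono[OF this, of 2] have "(q s)^2 <= sqn mX h * sqn mX (%x. Z (s, x))" by (simp add: power_mult_distrib)
   thus ?case using abs_ge_self[of "sqn mX h * sqn mX (%x. Z (s, x))"] by simp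
  qed
 qed
 hence "integrable (lebesgue_on {0<..<T}) (%s. (norm (q s))^2)" by (rule time_integrable)
 hence "integrable (mes {0<..<T}) (%s. (norm (q s))^2)" using qm by (subst (asm) lebesgue_on_mes(2)) auto
 thus ?thesis using qm by (simp add: sq_int_def q_def)
qed

text \<open>Time is treated as another bounded interval. For a fixed test function in
  \<open>x\<close> the pairing with the solution is a constant minus the primitive in time of the
  tested flux, hence absolutely continuous in the sense of \<open>ac\<close>, and the rule for weak
  derivatives proved in \<open>x\<close> applies to it.\<close>

theorem solution_W12_H1_dual:
 assumes T: "T > 0" shows "(%t. L2_embed Om (%x. (f t x, g t x))) : W12_H1_dual T Om"
proof -
 interpret T: interval 0 T by unfold_locales (rule T)
 have r: "AE x in mX. z x = z x" for z :: "real => real * real" by simp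
 have sfg: "sq_int mX (%x. (f t x, g t x))" for t
  by (rule sq_int_pair(1)[OF sq_int_bounded[OF fg(1) fg(10)] sq_int_bounded[OF fg(2) fg(11)]])
 have ibp: "(LINT t|lebesgue_on {0<..<T}. deriv th t * L2_embed Om (%x. (f t x, g t x)) ph) =
    - (LINT t|lebesgue_on {0<..<T}. th t * lam (%x. 0) (%x. (- J (t, x), - H (t, x))) ph)"
  if th: "test_function {0<..<T} th" and ph: "ph : H1p" for th ph
 proof -
  obtain ph1 v1 ph2 v2 where p: "ac ph1 v1" "ac ph2 v2" "AE x in mX. ph x = (ph1 x, ph2 x)" by (rule H1_pairE[OF ph])
  note v = acD(1)[OF p(1)] acD(1)[OF p(2)] and sph = ac_sq_int[OF p(1)] ac_sq_int[OF p(2)]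
  define q where "q s = qJ v1 s + qH v2 s" for s
  have qm: "q : BM" unfolding q_def[abs_def] by (intro borel_measurable_add q_measurable v)
  have sq: "sq_int T.mX q" "sq_int T.mX (qJ v1)" "sq_int T.mX (qH v2)"
  proof -
   show 1: "sq_int T.mX (qJ v1)" "sq_int T.mX (qH v2)" unfolding T.mX_def qJ_def[abs_def] qH_def[abs_def] by (intro sq_int_time sJ sH v)+
   show "sq_int T.mX q" unfolding q_def[abs_def] by (intro sq_int_add 1)
  qed
  define c0 where "c0 = (LX x. F0 x * ph1 x) + (LX x. G0 x * ph2 x)"
  have u: "L2_embed Om (%x. (f t x, g t x)) ph = c0 - T.cumX q t" if t: "0 < t" "t < T" for t
  proof -
   have cq: "T.cumX z t = (LINT s|mE. wt t s * z s)" if z: "z : BM" for z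
   proof -
    have "T.cumX z t = (LINT s|lborel. indicator {0<..<T} s * (indicator {..t} s * z s))"
     unfolding cum_def T.mX_def using z by (subst integral_mes) auto
    also have "... = (LINT s|lborel. indicator {0<..t} s * z s)"
     by (intro Bochner_integral_cong refl) (use t in "auto simp: indicator_def")
    finally show ?thesis by (simp add: integral_wt[OF z])
   qed
   have b: "bdm F0" "bdm G0" "bdm (f t)" "bdm (g t)" "bdm ph1" "bdm ph2" by (intro bdm0 fg ac_bdm[OF p(1)] ac_bdm[OF p(2)])+
   have i: "integrable mX (%x. F0 x * ph1 x)" "integrable mX (%x. G0 x * ph2 x)" "integrable mX (%x. f t x * ph1 x)" "integrable mX (%x. g t x * ph2 x)"
    by (intro bdm_integrable bconv_mult b)+
   have "L2_embed Om (%x. (f t x, g t x)) ph = (LX x. f t x * ph1 x + g t x * ph2 x)"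
    unfolding L2_embed_lam lam_eq[OF sfg r sq_int_zero r p] by simp
   also have "... = (LX x. f t x * ph1 x) + (LX x. g t x * ph2 x)" using i by simp
   also have "(LX x. f t x * ph1 x) = (LX x. F0 x * ph1 x) - T.cumX (qJ v1) t"
    using fg_identity(1)[OF _ p(1), of t] i t by (simp add: left_diff_distrib cq[OF q_measurable(1)[OF v(1)]])
   also have "(LX x. g t x * ph2 x) = (LX x. G0 x * ph2 x) - T.cumX (qH v2) t"
    using fg_identity(2)[OF _ p(2), of t] i t by (simp add: left_diff_distrib cq[OF q_measurable(2)[OF v(2)]])
   also have "((LX x. F0 x * ph1 x) - T.cumX (qJ v1) t) + ((LX x. G0 x * ph2 x) - T.cumX (qH v2) t) = c0 - T.cumX q t"
    unfolding q_def[abs_def] T.X.cum_add[OF T.sq_int_imp_integrable[OF sq(2)] T.sq_int_imp_integrable[OF sq(3)]] c0_def by simp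
   finally show ?thesis .
  qed
  have "AE t in lborel. t >= 0 --> lam (%x. 0) (%x. (- J (t, x), - H (t, x))) ph = - q t"
   unfolding AE_mE[symmetric] using sq_int_Q_AE[OF sJ] sq_int_Q_AE[OF sH]
  proof eventually_elim
   case (elim t)
   have "lam (%x. 0) (%x. (- J (t, x), - H (t, x))) ph = (LX x. - (J (t, x) * v1 x) - H (t, x) * v2 x)"
    unfolding lam_eq[OF sq_int_zero r sq_int_pair(1)[OF sq_int_uminus[OF elim(1)] sq_int_uminus[OF elim(2)]] r p] by simp
   also have "... = - q t" unfolding q_def qJ_def qH_def
    using sq_int_times[OF elim(1) v(1)] sq_int_times[OF elim(2) v(2)] by (simp add: mult.commute)
   finally show ?case .
  qed
  hence v': "AE t in T.mX. lam (%x. 0) (%x. (- J (t, x), - H (t, x))) ph = - q t" unfolding T.AE_mX by eventually_elim auto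
  have "T.ac (%t. c0 - T.cumX q t) (%t. - q t)"
   using T.acI[OF sq_int_uminus[OF sq(1)], of "%t. c0 - T.cumX q t" c0] T.X.cum_mult[of "-1" q] by simp
  from T.has_weak_deriv_ac[OF this T.AE_mXI[OF u] v'] th show ?thesis by (simp add: has_weak_deriv_def)
 qed
 show ?thesis unfolding W12_H1_dual_def
  by (intro CollectI conjI embed_L2_H1_dual bexI[OF _ flux_L2_H1_dual] allI impI ballI ibp)
qed

text \<open>Joint measurability is the point: the exceptional times form a null set whose product
  with the line is null in the plane, and off it the pair coincides with the Borel functions
  \<open>fl\<close> and \<open>gl\<close>. The bounds hold everywhere by admissibility.\<close>

theorem solution_Linf_pos: "(%(t, x). (f t x, g t x)) : Linf_pos (lebesgue_on ({0<..<T} \<times> Om))"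
proof -
 let ?S = "{0<..<T} \<times> Om" and ?u = "%(t, x). (f t x, g t x)"
 have S: "?S : sets lebesgue" by (intro sets_completionI_sets) (simp add: open_Times)
 have lm: "(%p. (fl (fst p) (snd p), gl (fst p) (snd p))) : borel_measurable lborel"
  using borel_measurable_Pair[OF l_measurable] by (simp add: borel_prod)
 obtain N where N: "{t : space mE. ~ good t} <= N" "emeasure mE N = 0" "N : sets mE" using good_AE by (rule AE_E)
 have "AE t in mE. t ~: N" using N by (intro AE_not_in null_setsI) auto
 hence "AE t in lborel. t >= 0 --> t ~: N" by (simp add: AE_mE)
 hence "AE t in lborel. t ~: N \<inter> {0..}" by eventually_elim auto
 hence "N \<inter> {0..} : null_sets lborel" using N(3) by (subst AE_iff_null_sets) auto
 hence "(N \<inter> {0..}) \<times> (UNIV :: real set) : null_sets (lborel \<Otimes>\<^sub>M lborel)"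
  by (intro null_setsI) (auto simp: lborel.emeasure_pair_measure_Times null_sets_def)
 hence "AE p in (lborel :: (real * real) measure). p ~: (N \<inter> {0..}) \<times> UNIV" unfolding lborel_prod by (rule AE_not_in)
 hence "AE p in lebesgue. p ~: (N \<inter> {0..}) \<times> (UNIV :: real set)" by (rule AE_completion)
 hence "AE p in lebesgue. p : ?S --> ?u p = (fl (fst p) (snd p), gl (fst p) (snd p))"
 proof eventually_elim
  case (elim p)
  thus ?case using N(1) good_fg[of "fst p"] by (auto simp: case_prod_beta')
 qed
 hence "AE p in lebesgue_on ?S. ?u p = (fl (fst p) (snd p), gl (fst p) (snd p))" using S by (simp add: AE_restrict_space_iff)
 hence m: "?u : borel_measurable (lebesgue_on ?S)" by (rule borel_measurable_lebesgue_on_AE[OF S measurable_completion[OF lm]])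
 have "esssup (lebesgue_on ?S) (%p. ereal (norm (?u p))) <= ereal (2 * Kb)"
 proof (rule esssup_I)
  show "(%p. ereal (norm (?u p))) : borel_measurable (lebesgue_on ?S)" using m by measurable
  have "norm (f t x, g t x) <= 2 * Kb" for t x using norm_Pair_le[of "f t x" "g t x"] fg(10)[of t x] fg(11)[of t x] by simp
  thus "AE p in lebesgue_on ?S. ereal (norm (?u p)) <= ereal (2 * Kb)" by (intro AE_I2) auto
 qed
 hence "Linf_norm (lebesgue_on ?S) ?u < \<infinity>" unfolding Linf_norm_def by (rule le_less_trans) simp
 moreover have "AE p in lebesgue_on ?S. ALL e:Basis. 0 <= ?u p \<bullet> e" using fg(3,4) by (intro AE_I2) (auto simp: Basis_prod_def)
 ultimately show ?thesis using m by (simp add: Linf_pos_def Linf_def)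
qed

end

text \<open>The data are replaced by Borel functions satisfying the sign and the bound everywhere.
  \<open>K0\<close> is the essential supremum of f_in + g_in itself, so that the bound
  \<open>Kb\<close> of the scheme is precisely the right-hand side of (l3).\<close>

lemma bounded_representatives:
 fixes f g :: "real => real"
 assumes ab: "a < b" and fg: "(%x. (f x, g x)) : Linf_pos (lebesgue_on {a<..<b})"
 obtains K0 F0 G0 where "Linf_norm (lebesgue_on {a<..<b}) (%x. f x + g x) = ereal K0"
  "F0 : BM" "G0 : BM" "!!x. F0 x >= 0" "!!x. G0 x >= 0" "!!x. F0 x + G0 x <= K0"
  "AE x in interval.mX a b. f x = F0 x" "AE x in interval.mX a b. g x = G0 x"
proof -
 interpret interval a b by unfold_locales (rule ab)
 let ?M = "lebesgue_on Om"
 have pm: "(%x. (f x, g x)) : borel_measurable ?M" and fin: "Linf_norm ?M (%x. (f x, g x)) < \<infinity>"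
  and pos: "AE x in ?M. ALL e:Basis. 0 <= (f x, g x) \<bullet> e" using fg by (auto simp: Linf_pos_def Linf_def)
 have nn: "AE x in ?M. 0 <= f x & 0 <= g x" using pos by eventually_elim (auto simp: Basis_prod_def)
 have m: "f : borel_measurable ?M" "g : borel_measurable ?M"
  using measurable_compose[OF pm borel_measurable_continuous_onI[of fst]] measurable_compose[OF pm borel_measurable_continuous_onI[of snd]]
  by (simp_all add: continuous_on_fst continuous_on_snd)
 have sm: "(%x. ereal (norm (f x + g x))) : borel_measurable ?M" using m by measurable
 define E where "E = Linf_norm ?M (%x. f x + g x)"
 have E_AE: "AE x in ?M. ereal (norm (f x + g x)) <= E" unfolding E_def Linf_norm_def by (rule esssup_AE)
 obtain B where B: "Linf_norm ?M (%x. (f x, g x)) < ereal B" using fin less_PInf_Ex_of_nat by auto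
 have "E <= ereal (2 * B)" unfolding E_def Linf_norm_def
 proof (rule esssup_I[OF sm])
  have "AE x in ?M. ereal (norm (f x, g x)) <= Linf_norm ?M (%x. (f x, g x))" unfolding Linf_norm_def by (rule esssup_AE)
  thus "AE x in ?M. ereal (norm (f x + g x)) <= ereal (2 * B)"
  proof eventually_elim
   case (elim x)
   hence "ereal (norm (f x, g x)) < ereal B" using B by (rule le_less_trans)
   hence "norm (f x, g x) < B" by simp
   thus ?case using norm_fst_le[of "f x" "g x"] norm_snd_le[of "g x" "f x"] norm_triangle_ineq[of "f x" "g x"] by simp
  qed
 qed
 \<comment> \<open>A negative essential supremum of a non-negative function would force the interval
   to be null; this excludes the value minus infinity, so \<open>E\<close> is a real number.\<close>
 moreover have "E >= 0"
 proof (rule ccontr)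
  assume "\<not> E >= 0"
  have "AE x in ?M. False" using E_AE
  proof eventually_elim
   case (elim x)
   have "0 <= ereal (norm (f x + g x))" by simp
   thus ?case using elim \<open>\<not> E >= 0\<close> order_trans by blast
  qed
  hence "AE x in mX. False" by (simp only: AE_Om)
  hence "AE x in lborel. x \<notin> Om" unfolding AE_mX by eventually_elim auto
  hence "Om : null_sets lborel" by (subst AE_iff_null_sets) auto
  thus False using ab by (auto simp: null_sets_def)
 qed
 ultimately obtain K0 where K0: "E = ereal K0" by (cases E) auto
 have K0n: "K0 >= 0" using \<open>E >= 0\<close> K0 by simp
 obtain f1 g1 where r: "f1 : BM" "AE x in mX. f x = f1 x" "g1 : BM" "AE x in mX. g x = g1 x"
  using lebesgue_rep_exists[OF m(1)] lebesgue_rep_exists[OF m(2)] by blast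
 define F0 where "F0 x = max 0 (min (f1 x) K0)" for x
 define G0 where "G0 x = max 0 (min (g1 x) (K0 - F0 x))" for x
 have "AE x in mX. f x = F0 x & g x = G0 x"
  using r(2,4) nn[unfolded AE_Om] E_AE[unfolded AE_Om K0] by eventually_elim (auto simp: F0_def G0_def)
 hence ae: "AE x in mX. f x = F0 x" "AE x in mX. g x = G0 x" by (auto elim: eventually_mono)
 have F0m: "F0 : BM" unfolding F0_def[abs_def] using r(1) by measurable
 have G0m: "G0 : BM" unfolding G0_def[abs_def] using r(3) F0m by measurable
 show ?thesis by (rule that[OF K0[unfolded E_def] F0m G0m _ _ _ ae]) (use K0n in "auto simp: F0_def G0_def")
qed

theorem theorem1p2:
  fixes a b R \<mu> :: real and \<Omega> :: "real set" and f_in g_in :: "real \<Rightarrow> real"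
  assumes "a < b" and "\<Omega> = {a<..<b}"
    and "R > 0" and "\<mu> > 0"
    and "(\<lambda>x. (f_in x, g_in x)) \<in> Linf_pos (lebesgue_on \<Omega>)"
  shows "\<exists>f g :: real \<Rightarrow> real \<Rightarrow> real.
    \<comment> \<open>(p1), together with the choice of the time-continuous representative\<close>
    (\<forall>T>0.
       (\<lambda>(t, x). (f t x, g t x)) \<in> Linf_pos (lebesgue_on ({0<..<T} \<times> \<Omega>)) \<and>
       (\<lambda>t x. (f t x, g t x)) \<in> L2_H1 T \<Omega> \<and>
       (\<lambda>t. L2_embed \<Omega> (\<lambda>x. (f t x, g t x))) \<in> W12_H1_dual T \<Omega>) \<and>
    L2_continuous_on {0..} \<Omega> (\<lambda>t x. (f t x, g t x)) \<and>
    \<comment> \<open>(p2)\<close>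
    (\<forall>\<phi>\<in>H1 \<Omega>. \<forall>t\<ge>0.
       (LINT x|lebesgue_on \<Omega>. (f t x - f_in x) * \<phi> x) +
       (LINT s|lebesgue_on {0..t}. LINT x|lebesgue_on \<Omega>.
          f s x * weak_deriv \<Omega> (\<lambda>y. (1 + R) * f s y + R * g s y) x * weak_deriv \<Omega> \<phi> x) = 0 \<and>
       (LINT x|lebesgue_on \<Omega>. (g t x - g_in x) * \<phi> x) +
       \<mu> * R * (LINT s|lebesgue_on {0..t}. LINT x|lebesgue_on \<Omega>.
          g s x * weak_deriv \<Omega> (\<lambda>y. f s y + g s y) x * weak_deriv \<Omega> \<phi> x) = 0) \<and>
    \<comment> \<open>(l1)\<close>
    (\<forall>t\<ge>0.
       (LINT x|lebesgue_on \<Omega>. Phi1 \<mu> (f t x, g t x)) +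
       (LINT s|lebesgue_on {0..t}. LINT x|lebesgue_on \<Omega>.
          \<bar>weak_deriv \<Omega> (f s) x\<bar>\<^sup>2 + R * \<bar>weak_deriv \<Omega> (\<lambda>y. f s y + g s y) x\<bar>\<^sup>2)
       \<le> (LINT x|lebesgue_on \<Omega>. Phi1 \<mu> (f_in x, g_in x))) \<and>
    \<comment> \<open>(l2)\<close>
    (\<forall>n\<ge>2.
       (\<forall>j\<le>n. acoef R \<mu> j n > 0) \<and>
       convex_on {X. 0 \<le> fst X \<and> 0 \<le> snd X} (Phi R \<mu> n) \<and>
       (\<forall>t\<ge>0. (LINT x|lebesgue_on \<Omega>. Phi R \<mu> n (f t x, g t x))
               \<le> (LINT x|lebesgue_on \<Omega>. Phi R \<mu> n (f_in x, g_in x)))) \<and>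
    \<comment> \<open>(l3)\<close>
    (\<forall>t\<ge>0. Linf_norm (lebesgue_on \<Omega>) (\<lambda>x. f t x + g t x)
             \<le> ereal ((1 + R) / R) * Linf_norm (lebesgue_on \<Omega>) (\<lambda>x. f_in x + g_in x))"
proof -
 note ab = assms(1) and Om = assms(2) and R = assms(3) and mu = assms(4)
 obtain K0 F0 G0 where K0: "Linf_norm (lebesgue_on {a<..<b}) (%x. f_in x + g_in x) = ereal K0"
  and F0: "F0 : BM" "G0 : BM" "!!x. F0 x >= 0" "!!x. G0 x >= 0" "!!x. F0 x + G0 x <= K0"
   "AE x in interval.mX a b. f_in x = F0 x" "AE x in interval.mX a b. g_in x = G0 x"
  by (rule bounded_representatives[OF ab assms(5)[unfolded Om]]) (rule that, assumption+)
 interpret muskat a b R \<mu> K0 F0 G0 by (unfold_locales; fact ab R mu F0)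
 obtain c K V W J H where "limit_data c K V W J H" using limit_data_exists by blast
 then interpret muskat_limit a b R \<mu> K0 F0 G0 c K V W J H by unfold_locales
 have sup: "Linf_norm (lebesgue_on \<Omega>) (%x. f t x + g t x) <= ereal ((1 + R) / R) * Linf_norm (lebesgue_on \<Omega>) (%x. f_in x + g_in x)" for t
 proof -
  have "(%x. f t x + g t x) : borel_measurable (lebesgue_on Om)"
   by (rule lebesgue_rep(1)[of "%x. f t x + g t x"]) (use fg(1,2)[of t] in simp_all)
  hence "(%x. ereal (norm (f t x + g t x))) : borel_measurable (lebesgue_on Om)" by measurable
  hence "esssup (lebesgue_on Om) (%x. ereal (norm (f t x + g t x))) <= ereal Kb"
   by (rule esssup_I) (use fg(3-5)[of t] in "simp add: add_nonneg_nonneg")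
  thus ?thesis unfolding Om K0 unfolding Linf_norm_def by (simp add: Kb_def)
 qed
 have l2: "(ALL j<=n. acoef R \<mu> j n > 0) & convex_on {X. 0 <= fst X & 0 <= snd X} (Phi R \<mu> n) &
    (ALL t>=0. (LINT x|lebesgue_on \<Omega>. Phi R \<mu> n (f t x, g t x)) <= (LINT x|lebesgue_on \<Omega>. Phi R \<mu> n (f_in x, g_in x)))" if n: "n >= 2" for n
 proof -
  obtain m where m: "n = Suc (Suc m)" using n by (metis Suc_le_D numeral_2_eq_2 Suc_le_mono)
  have "(LINT x|lebesgue_on \<Omega>. Phi R \<mu> n (f t x, g t x)) <= (LINT x|lebesgue_on \<Omega>. Phi R \<mu> n (f_in x, g_in x))" for t
   unfolding Om rep_Phi1(2)[OF F0m G0m F0(6,7)] rep_Phi1(2)[OF fg(1,2)[of t] AE_I2 AE_I2, OF refl refl]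
   by (rule admissible_Phi[OF fg_admissible n])
  thus ?thesis using acoef_pos[OF R mu n] Phi_convex[OF R mu m] by blast
 qed
 show ?thesis
 proof (rule exI[of _ f], rule exI[of _ g], unfold Om, intro conjI allI impI ballI)
  show "(%(t, x). (f t x, g t x)) : Linf_pos (lebesgue_on ({0<..<T} \<times> Om))" for T by (rule solution_Linf_pos)
  show "(%t x. (f t x, g t x)) : L2_H1 T Om" for T by (rule solution_L2_H1)
  show "(%t. L2_embed Om (%x. (f t x, g t x))) : W12_H1_dual T Om" if "T > 0" for T by (rule solution_W12_H1_dual[OF that])
  show "L2_continuous_on {0..} Om (%t x. (f t x, g t x))" by (rule L2_continuity)
 next
  fix \<phi> :: "real => real" and t :: real assume "\<phi> : H1 Om" "0 <= t"
  note w = weak_formulation[OF this F0(6,7)]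
  show "(LINT x|lebesgue_on Om. (f t x - f_in x) * \<phi> x) +
    (LINT s|lebesgue_on {0..t}. LINT x|lebesgue_on Om.
     f s x * weak_deriv Om (%y. (1 + R) * f s y + R * g s y) x * weak_deriv Om \<phi> x) = 0" by (rule w)
  show "(LINT x|lebesgue_on Om. (g t x - g_in x) * \<phi> x) +
    \<mu> * R * (LINT s|lebesgue_on {0..t}. LINT x|lebesgue_on Om.
     g s x * weak_deriv Om (%y. f s y + g s y) x * weak_deriv Om \<phi> x) = 0" by (rule w)
 next
  fix t :: real assume "0 <= t"
  from energy_inequality[OF this F0(6,7)] show "(LINT x|lebesgue_on Om. Phi1 \<mu> (f t x, g t x)) +
    (LINT s|lebesgue_on {0..t}. LINT x|lebesgue_on Om.
     \<bar>weak_deriv Om (f s) x\<bar>^2 + R * \<bar>weak_deriv Om (%y. f s y + g s y) x\<bar>^2)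
    <= (LINT x|lebesgue_on Om. Phi1 \<mu> (f_in x, g_in x))" .
 next
  fix n :: nat assume n: "2 <= n"
  show "acoef R \<mu> j n > 0" if "j <= n" for j using l2[OF n] that by blast
  show "convex_on {X. 0 <= fst X & 0 <= snd X} (Phi R \<mu> n)" using l2[OF n] by blast
  show "(LINT x|lebesgue_on Om. Phi R \<mu> n (f t x, g t x)) <= (LINT x|lebesgue_on Om. Phi R \<mu> n (f_in x, g_in x))" if "0 <= t" for t
   using l2[OF n, unfolded Om] that by blast
 next
  show "Linf_norm (lebesgue_on Om) (%x. f t x + g t x) <= ereal ((1 + R) / R) * Linf_norm (lebesgue_on Om) (%x. f_in x + g_in x)" for t
   using sup[of t] unfolding Om .
 qed
qed

end
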